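(* The exact functor $\mathrm{Ind}_{Y_{r,n}^{d}}^{Y_{r,n+1}^{d}}$ is both left and right adjoint to $\mathrm{Res}_{Y_{r,n}^{d}}^{Y_{r,n+1}^{d}}$. Moreover, it commutes with the $\tau$-duality in the sense that there is a natural isomorphism of $Y_{r,n+1}^d$-modules $$\mathrm{Ind}_{Y_{r,n}^{d}}^{Y_{r,n+1}^{d}}(M^{\tau})\cong \bigl(\mathrm{Ind}_{Y_{r,n}^{d}}^{Y_{r,n+1}^{d}}M\bigr)^{\tau}$$ for all $Y_{r,n}^{d}$-modules $M$ that are finite dimensional (i.e. free of finite rank over $\mathcal{R}$).
   Context: Let $r,d\geq 1$ be integers, $\zeta=e^{2\pi i/r}$, let $q,v_1,\ldots,v_d$ be indeterminates and $\mathcal{R}=\mathbb{Z}[\tfrac1r,\zeta][q^{\pm1},v_1^{\pm1},\ldots,v_d^{\pm1}]$. For $n\ge1$, $\mathfrak{S}_n$ acts on $\{1,\ldots,n\}$ on the right and $s_i=(i,i+1)$. The affine Yokonuma-Hecke algebra $\widehat{Y}_{r,n}$ is the associative $\mathcal{R}$-algebra generated by $t_1,\ldots,t_n,g_1,\ldots,g_{n-1},X_1^{\pm1}$ with relations: $g_ig_j=g_jg_i$ if $|i-j|\ge2$; $g_ig_{i+1}g_i=g_{i+1}g_ig_{i+1}$; $t_it_j=t_jt_i$; $g_it_j=t_{js_i}g_i$; $t_i^r=1$; $g_i^2=1+(q-q^{-1})e_ig_i$, where $e_i=\frac1r\sum_{s=0}^{r-1}t_i^st_{i+1}^{-s}$;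 $X_1X_1^{-1}=X_1^{-1}X_1=1$; $g_1X_1g_1X_1=X_1g_1X_1g_1$; $g_iX_1=X_1g_i$ for $i\ge2$; $t_jX_1=X_1t_j$ for all $j$. Put $X_{i+1}=g_iX_ig_i$. The cyclotomic Yokonuma-Hecke algebra is $Y_{r,n}^d=\widehat{Y}_{r,n}/\mathcal{J}_d$, where $\mathcal{J}_d$ is the two-sided ideal generated by $(X_1-v_1)\cdots(X_1-v_d)$. $Y_{r,n}^d$ is identified with the subalgebra of $Y_{r,n+1}^d$ generated by the generators of the same names. Modules are left modules; $\mathrm{Ind}_{Y_{r,n}^{d}}^{Y_{r,n+1}^{d}}M=Y_{r,n+1}^d\otimes_{Y_{r,n}^d}M$ and $\mathrm{Res}_{Y_{r,n}^{d}}^{Y_{r,n+1}^{d}}$ is restriction. Let $\tau$ be the $\mathcal{R}$-linear anti-automorphism of $Y_{r,n}^d$ fixing each $g_i$, $X_j$, $t_j$. For a finite dimensional $Y_{r,n}^d$-module $M$, $M^\tau$ denotes the dual $M^*=\mathrm{Hom}_{\mathcal{R}}(M,\mathcal{R})$ with the left action $(yf)(m)=f(\tau(y)m)$. *)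

theory Defs
  imports
    "HOL-Algebra.Algebraic_Closure_Type"
    "HOL-Algebra.Free_Abelian_Groups"
    "HOL-Algebra.Generated_Rings"
    "HOL-Combinatorics.Transposition"
begin

section \<open>Left modules over a not necessarily commutative ring\<close>

text \<open>
  The locale \<^locale>\<open>module\<close> of the library asks for a commutative ring of scalars; the following
  is the same locale over an arbitrary ring, on the same records. The fields \<^const>\<open>monoid.mult\<close> and
  \<^const>\<open>monoid.one\<close> that a module record inherits from rings carry no information.
\<close>

locale left_module = R?: ring R + M?: abelian_group M
  for R :: "('a, 'p) ring_scheme" (structure)
    and M :: "('a, 'm, 'q) module_scheme" (structure) +
  assumes smult_closed:
      "\<lbrakk>a \<in> carrier R; x \<in> carrier M\<rbrakk> \<Longrightarrow> a \<odot>\<^bsub>M\<^esub> x \<in> carrier M"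
    and smult_l_distr:
      "\<lbrakk>a \<in> carrier R; b \<in> carrier R; x \<in> carrier M\<rbrakk> \<Longrightarrow>
       (a \<oplus> b) \<odot>\<^bsub>M\<^esub> x = a \<odot>\<^bsub>M\<^esub> x \<oplus>\<^bsub>M\<^esub> b \<odot>\<^bsub>M\<^esub> x"
    and smult_r_distr:
      "\<lbrakk>a \<in> carrier R; x \<in> carrier M; y \<in> carrier M\<rbrakk> \<Longrightarrow>
       a \<odot>\<^bsub>M\<^esub> (x \<oplus>\<^bsub>M\<^esub> y) = a \<odot>\<^bsub>M\<^esub> x \<oplus>\<^bsub>M\<^esub> a \<odot>\<^bsub>M\<^esub> y"
    and smult_assoc:
      "\<lbrakk>a \<in> carrier R; b \<in> carrier R; x \<in> carrier M\<rbrakk> \<Longrightarrow>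
       (a \<otimes> b) \<odot>\<^bsub>M\<^esub> x = a \<odot>\<^bsub>M\<^esub> (b \<odot>\<^bsub>M\<^esub> x)"
    and smult_one:
      "x \<in> carrier M \<Longrightarrow> \<one> \<odot>\<^bsub>M\<^esub> x = x"

text \<open>
  Homomorphisms are extensional functions (undefined outside the carrier), so that equality of
  homomorphisms is equality of functions.
\<close>

definition lmod_hom :: "'a ring \<Rightarrow> ('a, 'm) module \<Rightarrow> ('a, 'n) module \<Rightarrow> ('m \<Rightarrow> 'n) set" where
  "lmod_hom R M N = {f \<in> carrier M \<rightarrow>\<^sub>E carrier N.
     (\<forall>x\<in>carrier M. \<forall>y\<in>carrier M. f (x \<oplus>\<^bsub>M\<^esub> y) = f x \<oplus>\<^bsub>N\<^esub> f y) \<and>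
     (\<forall>a\<in>carrier R. \<forall>x\<in>carrier M. f (a \<odot>\<^bsub>M\<^esub> x) = a \<odot>\<^bsub>N\<^esub> f x)}"

definition lmod_iso :: "'a ring \<Rightarrow> ('a, 'm) module \<Rightarrow> ('a, 'n) module \<Rightarrow> ('m \<Rightarrow> 'n) set" where
  "lmod_iso R M N = {f \<in> lmod_hom R M N. bij_betw f (carrier M) (carrier N)}"

definition lmod_id :: "('a, 'm) module \<Rightarrow> 'm \<Rightarrow> 'm" where
  "lmod_id M = (\<lambda>x\<in>carrier M. x)"

definition lmod_hom_add ::
  "('a, 'm) module \<Rightarrow> ('a, 'n) module \<Rightarrow> ('m \<Rightarrow> 'n) \<Rightarrow> ('m \<Rightarrow> 'n) \<Rightarrow> 'm \<Rightarrow> 'n" where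
  "lmod_hom_add M N f g = (\<lambda>x\<in>carrier M. f x \<oplus>\<^bsub>N\<^esub> g x)"

definition short_exact :: "'a ring \<Rightarrow> ('a, 'l) module \<Rightarrow> ('l \<Rightarrow> 'm) \<Rightarrow> ('a, 'm) module \<Rightarrow>
    ('m \<Rightarrow> 'n) \<Rightarrow> ('a, 'n) module \<Rightarrow> bool" where
  "short_exact R L f M g N \<longleftrightarrow>
     f \<in> lmod_hom R L M \<and> g \<in> lmod_hom R M N \<and>
     inj_on f (carrier L) \<and>
     f ` carrier L = {x \<in> carrier M. g x = \<zero>\<^bsub>N\<^esub>} \<and>
     g ` carrier M = carrier N"

definition regular_module :: "'a ring \<Rightarrow> ('a, 'a) module" where
  "regular_module R = \<lparr>carrier = carrier R, monoid.mult = monoid.mult R, monoid.one = monoid.one R,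
     ring.zero = ring.zero R, ring.add = ring.add R, module.smult = monoid.mult R\<rparr>"

definition restrict_scalars :: "('a \<Rightarrow> 'b) \<Rightarrow> ('b, 'm) module \<Rightarrow> ('a, 'm) module" where
  "restrict_scalars \<phi> M = \<lparr>carrier = carrier M, monoid.mult = monoid.mult M, monoid.one = monoid.one M,
     ring.zero = ring.zero M, ring.add = ring.add M, module.smult = (\<lambda>a x. \<phi> a \<odot>\<^bsub>M\<^esub> x)\<rparr>"

definition free_of_finite_rank :: "'a ring \<Rightarrow> ('a, 'm) module \<Rightarrow> bool" where
  "free_of_finite_rank R M \<longleftrightarrow> (\<exists>B. finite B \<and> B \<subseteq> carrier M \<and>
     (\<forall>x\<in>carrier M. \<exists>!c. c \<in> B \<rightarrow>\<^sub>E carrier R \<and> x = (\<Oplus>\<^bsub>M\<^esub>b\<in>B. c b \<odot>\<^bsub>M\<^esub> b)))"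


subsection \<open>Extension of scalars\<close>

text \<open>
  For a ring homomorphism \<open>\<phi>: A \<rightarrow> B\<close> and a left \<open>A\<close>-module \<open>M\<close>, the tensor product
  \<open>B \<otimes>\<^sub>A M\<close> is the quotient of the free abelian group on \<open>B \<times> M\<close> by the subgroup generated by
  the usual relations, where \<open>B\<close> is a right \<open>A\<close>-module by \<open>b \<cdot> a = b \<otimes> \<phi> a\<close>.
  The library writes free abelian groups multiplicatively, although the group operation is
  the addition of the type \<open>'a \<Rightarrow>\<^sub>0 int\<close>.
\<close>

definition tensor_free :: "'b ring \<Rightarrow> ('a, 'm) module \<Rightarrow> ('b \<times> 'm \<Rightarrow>\<^sub>0 int) monoid" where
  "tensor_free B M = free_Abelian_group (carrier B \<times> carrier M)"

inductive_set tensor_relations ::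
  "'a ring \<Rightarrow> 'b ring \<Rightarrow> ('a \<Rightarrow> 'b) \<Rightarrow> ('a, 'm) module \<Rightarrow> ('b \<times> 'm \<Rightarrow>\<^sub>0 int) set"
  for A B \<phi> M where
  add_left: "\<lbrakk>b \<in> carrier B; b' \<in> carrier B; m \<in> carrier M\<rbrakk> \<Longrightarrow>
     frag_of (b \<oplus>\<^bsub>B\<^esub> b', m) - frag_of (b, m) - frag_of (b', m) \<in> tensor_relations A B \<phi> M"
| add_right: "\<lbrakk>b \<in> carrier B; m \<in> carrier M; m' \<in> carrier M\<rbrakk> \<Longrightarrow>
     frag_of (b, m \<oplus>\<^bsub>M\<^esub> m') - frag_of (b, m) - frag_of (b, m') \<in> tensor_relations A B \<phi> M"
| balanced: "\<lbrakk>b \<in> carrier B; a \<in> carrier A; m \<in> carrier M\<rbrakk> \<Longrightarrow>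
     frag_of (b \<otimes>\<^bsub>B\<^esub> \<phi> a, m) - frag_of (b, a \<odot>\<^bsub>M\<^esub> m) \<in> tensor_relations A B \<phi> M"

definition tensor_subgroup ::
  "'a ring \<Rightarrow> 'b ring \<Rightarrow> ('a \<Rightarrow> 'b) \<Rightarrow> ('a, 'm) module \<Rightarrow> ('b \<times> 'm \<Rightarrow>\<^sub>0 int) set" where
  "tensor_subgroup A B \<phi> M = generate (tensor_free B M) (tensor_relations A B \<phi> M)"

definition tensor_group ::
  "'a ring \<Rightarrow> 'b ring \<Rightarrow> ('a \<Rightarrow> 'b) \<Rightarrow> ('a, 'm) module \<Rightarrow> ('b \<times> 'm \<Rightarrow>\<^sub>0 int) set monoid" where
  "tensor_group A B \<phi> M = tensor_free B M Mod tensor_subgroup A B \<phi> M"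

text \<open>
  The scalar action is \<open>b \<cdot> (b' \<otimes> m) = b b' \<otimes> m\<close> and the map induced by \<open>f\<close> is
  \<open>b \<otimes> m \<mapsto> b \<otimes> f m\<close>. In both cases a coset is sent to the coset of the images of its
  elements under the additive extension of the map on pure tensors.
\<close>

definition ext_scalars ::
  "'a ring \<Rightarrow> 'b ring \<Rightarrow> ('a \<Rightarrow> 'b) \<Rightarrow> ('a, 'm) module \<Rightarrow> ('b, ('b \<times> 'm \<Rightarrow>\<^sub>0 int) set) module"
where
  "ext_scalars A B \<phi> M = \<lparr>carrier = carrier (tensor_group A B \<phi> M),
     monoid.mult = undefined, monoid.one = undefined,
     ring.zero = monoid.one (tensor_group A B \<phi> M), ring.add = monoid.mult (tensor_group A B \<phi> M),
     module.smult = (\<lambda>b C. tensor_subgroup A B \<phi> M <#>\<^bsub>tensor_free B M\<^esub>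
        (frag_extend (\<lambda>(b', m). frag_of (b \<otimes>\<^bsub>B\<^esub> b', m)) ` C))\<rparr>"

definition ext_scalars_map :: "'a ring \<Rightarrow> 'b ring \<Rightarrow> ('a \<Rightarrow> 'b) \<Rightarrow>
    ('a, 'm) module \<Rightarrow> ('a, 'n) module \<Rightarrow> ('m \<Rightarrow> 'n) \<Rightarrow>
    ('b \<times> 'm \<Rightarrow>\<^sub>0 int) set \<Rightarrow> ('b \<times> 'n \<Rightarrow>\<^sub>0 int) set" where
  "ext_scalars_map A B \<phi> M N f = (\<lambda>C\<in>carrier (ext_scalars A B \<phi> M).
     tensor_subgroup A B \<phi> N <#>\<^bsub>tensor_free B N\<^esub>
       (frag_extend (\<lambda>(b, m). frag_of (b, f m)) ` C))"


subsection \<open>Duality along an anti-automorphism\<close>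

text \<open>
  Here \<open>\<phi>: R \<rightarrow> A\<close> is the structure map of an \<open>R\<close>-algebra \<open>A\<close> and \<open>\<tau>\<close> an anti-automorphism
  of \<open>A\<close>; the dual is \<open>Hom\<^sub>R(M, R)\<close> with the action \<open>(a f)(m) = f (\<tau>(a) m)\<close>.
\<close>

definition twisted_dual ::
  "'r ring \<Rightarrow> ('r \<Rightarrow> 'a) \<Rightarrow> ('a \<Rightarrow> 'a) \<Rightarrow> ('a, 'm) module \<Rightarrow> ('a, 'm \<Rightarrow> 'r) module" where
  "twisted_dual R \<phi> \<tau> M = \<lparr>
     carrier = lmod_hom R (restrict_scalars \<phi> M) (regular_module R),
     monoid.mult = undefined, monoid.one = undefined,
     ring.zero = (\<lambda>m\<in>carrier M. \<zero>\<^bsub>R\<^esub>),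
     ring.add = (\<lambda>f g. \<lambda>m\<in>carrier M. f m \<oplus>\<^bsub>R\<^esub> g m),
     module.smult = (\<lambda>a f. \<lambda>m\<in>carrier M. f (\<tau> a \<odot>\<^bsub>M\<^esub> m))\<rparr>"

definition twisted_dual_map :: "'r ring \<Rightarrow> ('r \<Rightarrow> 'a) \<Rightarrow> ('a \<Rightarrow> 'a) \<Rightarrow>
    ('a, 'm) module \<Rightarrow> ('a, 'n) module \<Rightarrow> ('m \<Rightarrow> 'n) \<Rightarrow> ('n \<Rightarrow> 'r) \<Rightarrow> 'm \<Rightarrow> 'r" where
  "twisted_dual_map R \<phi> \<tau> M N f =
     (\<lambda>h\<in>carrier (twisted_dual R \<phi> \<tau> N). compose (carrier M) h f)"


subsection \<open>Functors and adjunctions between module categories\<close>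

text \<open>
  A functor is given by its action \<open>F\<close> on modules with elements of type \<open>'m\<close> and its action
  \<open>Fm M N\<close> on the homomorphisms from \<open>M\<close> to \<open>N\<close>.
\<close>

definition lmod_functor :: "'a ring \<Rightarrow> 'b ring \<Rightarrow> (('a, 'm) module \<Rightarrow> ('b, 'k) module) \<Rightarrow>
    (('a, 'm) module \<Rightarrow> ('a, 'm) module \<Rightarrow> ('m \<Rightarrow> 'm) \<Rightarrow> 'k \<Rightarrow> 'k) \<Rightarrow> bool" where
  "lmod_functor A B F Fm \<longleftrightarrow>
     (\<forall>M. left_module A M \<longrightarrow> left_module B (F M)) \<and>
     (\<forall>M N f. left_module A M \<and> left_module A N \<and> f \<in> lmod_hom A M N \<longrightarrow>
        Fm M N f \<in> lmod_hom B (F M) (F N)) \<and>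
     (\<forall>M. left_module A M \<longrightarrow> Fm M M (lmod_id M) = lmod_id (F M)) \<and>
     (\<forall>L M N f g. left_module A L \<and> left_module A M \<and> left_module A N \<and>
        f \<in> lmod_hom A L M \<and> g \<in> lmod_hom A M N \<longrightarrow>
        Fm L N (compose (carrier L) g f) = compose (carrier (F L)) (Fm M N g) (Fm L M f))"

definition exact_lmod_functor :: "'a ring \<Rightarrow> 'b ring \<Rightarrow> (('a, 'm) module \<Rightarrow> ('b, 'k) module) \<Rightarrow>
    (('a, 'm) module \<Rightarrow> ('a, 'm) module \<Rightarrow> ('m \<Rightarrow> 'm) \<Rightarrow> 'k \<Rightarrow> 'k) \<Rightarrow> bool" where
  "exact_lmod_functor A B F Fm \<longleftrightarrow>
     lmod_functor A B F Fm \<and>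
     (\<forall>M N f g. left_module A M \<and> left_module A N \<and> f \<in> lmod_hom A M N \<and> g \<in> lmod_hom A M N \<longrightarrow>
        Fm M N (lmod_hom_add M N f g) = lmod_hom_add (F M) (F N) (Fm M N f) (Fm M N g)) \<and>
     (\<forall>L M N f g. left_module A L \<and> left_module A M \<and> left_module A N \<and>
        short_exact A L f M g N \<longrightarrow>
        short_exact B (F L) (Fm L M f) (F M) (Fm M N g) (F N))"

text \<open>
  \<open>F\<close> is left adjoint to \<open>G\<close>: there are bijections \<open>Hom\<^sub>B(F M, N) \<rightarrow> Hom\<^sub>A(M, G N)\<close>, natural
  in \<open>M\<close> and \<open>N\<close>. The element types \<open>'k\<close> and \<open>'l\<close> of the values of \<open>F\<close> and \<open>G\<close> may differ
  from \<open>'n\<close> and \<open>'m\<close>, which is why units and counits are not used.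
\<close>

definition adjoint_lmod_functors :: "'a ring \<Rightarrow> 'b ring \<Rightarrow>
    (('a, 'm) module \<Rightarrow> ('b, 'k) module) \<Rightarrow>
    (('a, 'm) module \<Rightarrow> ('a, 'm) module \<Rightarrow> ('m \<Rightarrow> 'm) \<Rightarrow> 'k \<Rightarrow> 'k) \<Rightarrow>
    (('b, 'n) module \<Rightarrow> ('a, 'l) module) \<Rightarrow>
    (('b, 'n) module \<Rightarrow> ('b, 'n) module \<Rightarrow> ('n \<Rightarrow> 'n) \<Rightarrow> 'l \<Rightarrow> 'l) \<Rightarrow> bool" where
  "adjoint_lmod_functors A B F Fm G Gm \<longleftrightarrow>
     lmod_functor A B F Fm \<and> lmod_functor B A G Gm \<and>
     (\<exists>\<Phi>.
       (\<forall>M N. left_module A M \<and> left_module B N \<longrightarrow>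
          bij_betw (\<Phi> M N) (lmod_hom B (F M) N) (lmod_hom A M (G N))) \<and>
       (\<forall>M M' N N' f g h.
          left_module A M \<and> left_module A M' \<and> left_module B N \<and> left_module B N' \<and>
          f \<in> lmod_hom A M' M \<and> g \<in> lmod_hom B N N' \<and> h \<in> lmod_hom B (F M) N \<longrightarrow>
          \<Phi> M' N' (compose (carrier (F M')) g (compose (carrier (F M')) h (Fm M' M f))) =
          compose (carrier M') (Gm N N' g) (compose (carrier M') (\<Phi> M N h) f)))"


section \<open>The ground ring\<close>

text \<open>
  The monoid algebra of \<open>'a :: monoid_add\<close> over a ring \<open>'b\<close> is the type \<open>'a \<Rightarrow>\<^sub>0 'b\<close> with the
  convolution product. Laurent polynomials are the monoid algebra of the exponent vectors; the
  restriction to coefficients in \<open>\<int>[1/r, \<zeta>]\<close> and to the variables \<open>q, v\<^sub>1, \<dots>, v\<^sub>d\<close> is a condition on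
  the carrier.
\<close>

datatype laurent_var = Q | V nat

type_synonym laurent = "(laurent_var \<Rightarrow>\<^sub>0 int) \<Rightarrow>\<^sub>0 complex"

definition laurent_power :: "laurent_var \<Rightarrow> int \<Rightarrow> laurent" where
  "laurent_power x k = Poly_Mapping.single (Poly_Mapping.single x k) 1"

definition laurent_const :: "complex \<Rightarrow> laurent" where
  "laurent_const c = Poly_Mapping.single 0 c"

definition coeff_ring :: "nat \<Rightarrow> complex set" where
  "coeff_ring r =
     generate_ring ring_of_type_algebra {1 / of_nat r, exp (2 * of_real pi * \<i> / of_nat r)}"

definition ground_ring :: "nat \<Rightarrow> nat \<Rightarrow> laurent ring" where
  "ground_ring r d = ring_of_type_algebra \<lparr>carrier :=
     {p. \<forall>m\<in>Poly_Mapping.keys p. Poly_Mapping.lookup p m \<in> coeff_ring r \<and>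
           Poly_Mapping.keys m \<subseteq> insert Q (V ` {1..d})}\<rparr>"


section \<open>Free algebras\<close>

datatype 'g word = Word (letters: "'g list")

instantiation word :: (type) monoid_add
begin

definition zero_word :: "'a word" where "0 = Word []"

definition plus_word :: "'a word \<Rightarrow> 'a word \<Rightarrow> 'a word" where
  "v + w = Word (letters v @ letters w)"

instance
  by standard (auto simp: zero_word_def plus_word_def)

end

text \<open>
  The generator \<open>X1\<close> stands for \<open>X\<^sub>1\<close> and \<open>X1inv\<close> for its inverse.
\<close>

datatype yh_gen = T nat | G nat | X1 | X1inv

type_synonym yh_free = "yh_gen word \<Rightarrow>\<^sub>0 laurent"

definition yh_gens :: "nat \<Rightarrow> yh_gen set" where
  "yh_gens n = T ` {1..n} \<union> G ` {1..<n} \<union> {X1, X1inv}"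

definition free_algebra :: "nat \<Rightarrow> nat \<Rightarrow> nat \<Rightarrow> yh_free ring" where
  "free_algebra r d n = ring_of_type_algebra \<lparr>carrier :=
     {p. \<forall>w\<in>Poly_Mapping.keys p. Poly_Mapping.lookup p w \<in> carrier (ground_ring r d) \<and>
           set (letters w) \<subseteq> yh_gens n}\<rparr>"

definition fgen :: "yh_gen \<Rightarrow> yh_free" where
  "fgen x = Poly_Mapping.single (Word [x]) 1"

definition fscalar :: "laurent \<Rightarrow> yh_free" where
  "fscalar c = Poly_Mapping.single 0 c"

definition frev :: "yh_free \<Rightarrow> yh_free" where
  "frev = Poly_Mapping.map_key (\<lambda>w. Word (rev (letters w)))"

lemma lookup_frev: "Poly_Mapping.lookup (frev p) w = Poly_Mapping.lookup p (Word (rev (letters w)))"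
proof -
  have "inj (\<lambda>w. Word (rev (letters w)))"
    by (rule injI) (metis rev_is_rev_conv word.collapse word.inject)
  then show ?thesis
    unfolding frev_def by (simp add: Poly_Mapping.map_key.rep_eq[OF \<open>inj _\<close>])
qed


section \<open>Yokonuma--Hecke algebras\<close>

text \<open>
  \<open>e\<^sub>i = 1/r \<Sum>\<^sub>s t\<^sub>i\<^sup>s t\<^sub>i\<^sub>+\<^sub>1\<^sup>-\<^sup>s\<close>. Since \<open>t\<^sub>i\<^sub>+\<^sub>1\<^sup>r = 1\<close> is imposed, the inverse
  power of \<open>t\<^sub>i\<^sub>+\<^sub>1\<close> is written as its power with exponent \<open>r - s\<close>, which is not truncated as \<open>s < r\<close>.
\<close>

definition e_elt :: "nat \<Rightarrow> nat \<Rightarrow> yh_free" where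
  "e_elt r i = fscalar (laurent_const (1 / of_nat r)) *
     (\<Sum>s<r. fgen (T i) ^ s * fgen (T (Suc i)) ^ (r - s))"

text \<open>A relation \<open>u = v\<close> is recorded as the element \<open>u - v\<close>.\<close>

inductive_set yh_relations :: "nat \<Rightarrow> nat \<Rightarrow> yh_free set" for r n where
  braid_far: "\<lbrakk>1 \<le> i; i < n; 1 \<le> j; j < n; i + 2 \<le> j \<or> j + 2 \<le> i\<rbrakk> \<Longrightarrow>
     fgen (G i) * fgen (G j) - fgen (G j) * fgen (G i) \<in> yh_relations r n"
| braid: "\<lbrakk>1 \<le> i; Suc i < n\<rbrakk> \<Longrightarrow>
     fgen (G i) * fgen (G (Suc i)) * fgen (G i)
     - fgen (G (Suc i)) * fgen (G i) * fgen (G (Suc i)) \<in> yh_relations r n"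
| t_comm: "\<lbrakk>1 \<le> i; i \<le> n; 1 \<le> j; j \<le> n\<rbrakk> \<Longrightarrow>
     fgen (T i) * fgen (T j) - fgen (T j) * fgen (T i) \<in> yh_relations r n"
| g_t: "\<lbrakk>1 \<le> i; i < n; 1 \<le> j; j \<le> n\<rbrakk> \<Longrightarrow>
     fgen (G i) * fgen (T j) - fgen (T (transpose i (Suc i) j)) * fgen (G i) \<in> yh_relations r n"
| t_order: "\<lbrakk>1 \<le> j; j \<le> n\<rbrakk> \<Longrightarrow> fgen (T j) ^ r - 1 \<in> yh_relations r n"
| quadratic: "\<lbrakk>1 \<le> i; i < n\<rbrakk> \<Longrightarrow>
     fgen (G i) ^ 2
     - (1 + fscalar (laurent_power Q 1 - laurent_power Q (-1)) * e_elt r i * fgen (G i))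
     \<in> yh_relations r n"
| X1_X1inv: "fgen X1 * fgen X1inv - 1 \<in> yh_relations r n"
| X1inv_X1: "fgen X1inv * fgen X1 - 1 \<in> yh_relations r n"
| X1_braid: "1 < n \<Longrightarrow>
     fgen (G 1) * fgen X1 * fgen (G 1) * fgen X1 - fgen X1 * fgen (G 1) * fgen X1 * fgen (G 1)
     \<in> yh_relations r n"
| g_X1: "\<lbrakk>2 \<le> i; i < n\<rbrakk> \<Longrightarrow> fgen (G i) * fgen X1 - fgen X1 * fgen (G i) \<in> yh_relations r n"
| t_X1: "\<lbrakk>1 \<le> j; j \<le> n\<rbrakk> \<Longrightarrow> fgen (T j) * fgen X1 - fgen X1 * fgen (T j) \<in> yh_relations r n"

definition affine_ideal :: "nat \<Rightarrow> nat \<Rightarrow> nat \<Rightarrow> yh_free set" where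
  "affine_ideal r d n = genideal (free_algebra r d n) (yh_relations r n)"

definition affine_YH :: "nat \<Rightarrow> nat \<Rightarrow> nat \<Rightarrow> yh_free set ring" where
  "affine_YH r d n = free_algebra r d n Quot affine_ideal r d n"

definition affine_class :: "nat \<Rightarrow> nat \<Rightarrow> nat \<Rightarrow> yh_free \<Rightarrow> yh_free set" where
  "affine_class r d n p = affine_ideal r d n +>\<^bsub>free_algebra r d n\<^esub> p"

definition cyclotomic_poly :: "nat \<Rightarrow> yh_free" where
  "cyclotomic_poly d = prod_list (map (\<lambda>i. fgen X1 - fscalar (laurent_power (V i) 1)) [1..<Suc d])"

definition cyclotomic_ideal :: "nat \<Rightarrow> nat \<Rightarrow> nat \<Rightarrow> yh_free set set" where
  "cyclotomic_ideal r d n =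
     genideal (affine_YH r d n) {affine_class r d n (cyclotomic_poly d)}"

type_synonym yh_elt = "yh_free set set"

definition cyclotomic_YH :: "nat \<Rightarrow> nat \<Rightarrow> nat \<Rightarrow> yh_elt ring" where
  "cyclotomic_YH r d n = affine_YH r d n Quot cyclotomic_ideal r d n"

definition YH_class :: "nat \<Rightarrow> nat \<Rightarrow> nat \<Rightarrow> yh_free \<Rightarrow> yh_elt" where
  "YH_class r d n p = cyclotomic_ideal r d n +>\<^bsub>affine_YH r d n\<^esub> affine_class r d n p"

definition YH_scalar :: "nat \<Rightarrow> nat \<Rightarrow> nat \<Rightarrow> laurent \<Rightarrow> yh_elt" where
  "YH_scalar r d n c = YH_class r d n (fscalar c)"

text \<open>
  The additive map induced by \<open>f\<close> on cosets, with values in the cosets of the ideal \<open>I\<close> of \<open>R\<close>: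
  for a coset \<open>C\<close> of \<open>x\<close> it yields the coset of \<open>f x\<close>, as soon as \<open>f\<close> sends the ideal of the
  source into \<open>I\<close>.
\<close>

definition quot_map :: "'b ring \<Rightarrow> 'b set \<Rightarrow> ('a \<Rightarrow> 'b) \<Rightarrow> 'a set \<Rightarrow> 'b set" where
  "quot_map R I f C = I <+>\<^bsub>R\<^esub> (f ` C)"

text \<open>
  The inclusion of the algebra for \<open>n\<close> into the one for \<open>n + 1\<close>, sending every generator to the
  generator of the same name.
\<close>

definition YH_incl :: "nat \<Rightarrow> nat \<Rightarrow> nat \<Rightarrow> yh_elt \<Rightarrow> yh_elt" where
  "YH_incl r d n =
     quot_map (affine_YH r d (Suc n)) (cyclotomic_ideal r d (Suc n))
       (quot_map (free_algebra r d (Suc n)) (affine_ideal r d (Suc n)) (\<lambda>p. p))"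

text \<open>
  The anti-automorphism fixing all generators: it is induced by the reversal of words. It then
  also fixes the elements \<open>X\<^sub>i\<^sub>+\<^sub>1 = g\<^sub>i X\<^sub>i g\<^sub>i\<close>.
\<close>

definition YH_tau :: "nat \<Rightarrow> nat \<Rightarrow> nat \<Rightarrow> yh_elt \<Rightarrow> yh_elt" where
  "YH_tau r d n =
     quot_map (affine_YH r d n) (cyclotomic_ideal r d n)
       (quot_map (free_algebra r d n) (affine_ideal r d n) frev)"


subsection \<open>Induction, restriction and duality\<close>

definition Ind :: "nat \<Rightarrow> nat \<Rightarrow> nat \<Rightarrow> (yh_elt, 'm) module \<Rightarrow>
    (yh_elt, (yh_elt \<times> 'm \<Rightarrow>\<^sub>0 int) set) module" where
  "Ind r d n = ext_scalars (cyclotomic_YH r d n) (cyclotomic_YH r d (Suc n)) (YH_incl r d n)"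

definition Ind_map :: "nat \<Rightarrow> nat \<Rightarrow> nat \<Rightarrow> (yh_elt, 'm) module \<Rightarrow> (yh_elt, 'n) module \<Rightarrow>
    ('m \<Rightarrow> 'n) \<Rightarrow> (yh_elt \<times> 'm \<Rightarrow>\<^sub>0 int) set \<Rightarrow> (yh_elt \<times> 'n \<Rightarrow>\<^sub>0 int) set" where
  "Ind_map r d n =
     ext_scalars_map (cyclotomic_YH r d n) (cyclotomic_YH r d (Suc n)) (YH_incl r d n)"

definition Res :: "nat \<Rightarrow> nat \<Rightarrow> nat \<Rightarrow> (yh_elt, 'm) module \<Rightarrow> (yh_elt, 'm) module" where
  "Res r d n = restrict_scalars (YH_incl r d n)"

definition Res_map :: "(yh_elt, 'm) module \<Rightarrow> (yh_elt, 'n) module \<Rightarrow> ('m \<Rightarrow> 'n) \<Rightarrow> 'm \<Rightarrow> 'n" where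
  "Res_map M N f = f"

definition finite_dimensional :: "nat \<Rightarrow> nat \<Rightarrow> nat \<Rightarrow> (yh_elt, 'm) module \<Rightarrow> bool" where
  "finite_dimensional r d n M \<longleftrightarrow>
     free_of_finite_rank (ground_ring r d) (restrict_scalars (YH_scalar r d n) M)"

definition tau_dual :: "nat \<Rightarrow> nat \<Rightarrow> nat \<Rightarrow> (yh_elt, 'm) module \<Rightarrow> (yh_elt, 'm \<Rightarrow> laurent) module"
where
  "tau_dual r d n = twisted_dual (ground_ring r d) (YH_scalar r d n) (YH_tau r d n)"

definition tau_dual_map :: "nat \<Rightarrow> nat \<Rightarrow> nat \<Rightarrow> (yh_elt, 'm) module \<Rightarrow> (yh_elt, 'n) module \<Rightarrow>
    ('m \<Rightarrow> 'n) \<Rightarrow> ('n \<Rightarrow> laurent) \<Rightarrow> 'm \<Rightarrow> laurent" where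
  "tau_dual_map r d n = twisted_dual_map (ground_ring r d) (YH_scalar r d n) (YH_tau r d n)"

end

theory Submission
  imports Defs
begin

text \<open>
  Write \<open>A\<close> for the algebra with parameter \<open>n\<close> and \<open>B\<close> for the one with parameter \<open>n + 1\<close>. The
  reason for all assertions is that \<open>A \<rightarrow> B\<close> is a Frobenius extension: there are an additive map
  \<open>\<theta> : B \<rightarrow> A\<close>, linear over \<open>A\<close> on both sides, and finitely many \<open>b\<^sub>i, c\<^sub>i \<in> B\<close> such that
  \<open>x = \<Sum> b\<^sub>i \<theta>(c\<^sub>i x) = \<Sum> \<theta>(x b\<^sub>i) c\<^sub>i\<close> for all \<open>x \<in> B\<close>. The rest is formal. Let
  \<open>\<epsilon> : B \<otimes> M \<rightarrow> M\<close> send \<open>b \<otimes> m\<close> to \<open>\<theta>(b) m\<close>. Then \<open>y = \<Sum> b\<^sub>i \<otimes> \<epsilon>(c\<^sub>i y)\<close>, so that elements of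
  \<open>B \<otimes> M\<close> are tested and constructed by their images under \<open>\<epsilon>\<close>. This makes \<open>B \<otimes> -\<close> exact
  (\<open>ext_exact\<close>) and yields the right adjunction, where \<open>h : N \<rightarrow> M\<close> corresponds to
  \<open>x \<mapsto> \<Sum> b\<^sub>i \<otimes> h(c\<^sub>i x)\<close> (\<open>ext_right_adjoint\<close>); the left adjunction holds for every ring extension.
  The comparison of induction and duality sends \<open>b \<otimes> f\<close> to the form \<open>t \<mapsto> f(\<epsilon>(\<tau>(b) t))\<close>, and its
  inverse sends \<open>g\<close> to \<open>\<Sum> \<tau>(c\<^sub>i) \<otimes> g(b\<^sub>i \<otimes> -)\<close> (\<open>dual_comparison_iso\<close>).

  To construct \<open>\<theta>\<close>, let \<open>X = X\<^sub>n\<^sub>+\<^sub>1\<close> and \<open>u\<^sub>j = g\<^sub>n\<^sup>-\<^sup>1 \<dots> g\<^sub>j\<^sup>-\<^sup>1\<close> for \<open>1 \<le> j \<le> n + 1\<close>. The elements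
  \<open>X\<^sup>k t\<^sub>n\<^sub>+\<^sub>1\<^sup>l u\<^sub>j\<close> with \<open>k < d\<close> and \<open>l < r\<close> form a basis of \<open>B\<close> over \<open>A\<close>, and \<open>\<theta>\<close> is the
  coefficient of \<open>X\<^sup>d\<^sup>-\<^sup>1\<close>. Independence is the difficult half of the basis theorem, and it is obtained
  together with \<open>\<theta>\<close>. A left \<open>A\<close>-linear \<open>f : B \<rightarrow> A\<close> for which \<open>f(t\<^sub>n\<^sub>+\<^sub>1 y) = \<zeta>\<^sup>m f(y)\<close> is determined
  by the array of the values \<open>f(X\<^sup>k u\<^sub>j)\<close>, and the right translate of \<open>f\<close> by a generator has an
  array that is given by explicit formulas. These formulas define operators on all
  arrays of elements of \<open>A\<close>, and the operators satisfy the relations of the affine algebra, without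
  any knowledge of \<open>B\<close>. Arrays that are killed by the translates of the cyclotomic polynomial are
  determined by their values in degrees \<open>k < d\<close>, which can be prescribed. Evaluation of a suitable
  array at 1 gives a map on \<open>B\<close>, and the average of these maps over the \<open>r\<close>-th roots of unity
  \<open>\<zeta>\<^sup>m\<close> is \<open>\<theta>\<close>; its values are computed in \<open>functional_basis\<close>.

  The dual bases come from two computations in \<open>B\<close>: the elements \<open>X\<^sup>k t\<^sub>n\<^sub>+\<^sub>1\<^sup>l u\<^sub>j\<close> span \<open>B\<close>
  (\<open>spanning\<close>), and the matrix of the values of \<open>\<theta>\<close> at their products with
  \<open>g\<^sub>j \<dots> g\<^sub>n X\<^sup>d\<^sup>-\<^sup>1\<^sup>-\<^sup>k t\<^sub>n\<^sub>+\<^sub>1\<^sup>r\<^sup>-\<^sup>l\<close> is unitriangular (\<open>gram\<close>). This gives the second of the two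
  expansions, and the first follows from it by means of \<open>\<theta>\<tau> = \<tau>\<theta>\<close>.
\<close>

section \<open>Extension of scalars\<close>

definition tensor_pure :: "'a ring \<Rightarrow> 'b ring \<Rightarrow> ('a \<Rightarrow> 'b) \<Rightarrow> ('a, 'm) module \<Rightarrow> 'b \<Rightarrow> 'm \<Rightarrow>
    ('b \<times> 'm \<Rightarrow>\<^sub>0 int) set" where
  "tensor_pure A B \<phi> M b m = (\<lambda>h. h + frag_of (b, m)) ` tensor_subgroup A B \<phi> M"

locale tensor_data = left_module A M + B: ring B
  for A :: "'a ring" and M :: "('a, 'm) module" and B :: "'b ring" and \<phi> :: "'a \<Rightarrow> 'b" +
  assumes hom: "\<phi> \<in> ring_hom A B"
begin

abbreviation H where "H \<equiv> tensor_subgroup A B \<phi> M"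
abbreviation F where "F \<equiv> tensor_free B M"
abbreviation TM where "TM \<equiv> ext_scalars A B \<phi> M"

lemma phi_closed: "a \<in> carrier A ==> \<phi> a \<in> carrier B"
  using hom by (rule ring_hom_closed)

lemma carrier_free: "x \<in> carrier F \<longleftrightarrow> Poly_Mapping.keys x \<subseteq> carrier B \<times> carrier M"
  by (simp add: tensor_free_def)

lemma mult_free: "x \<otimes>\<^bsub>F\<^esub> y = x + y"
  by (simp add: tensor_free_def)

lemma free_comm_group: "comm_group F"
  unfolding tensor_free_def by (rule abelian_free_Abelian_group)

lemma frag_of_free: "b \<in> carrier B ==> m \<in> carrier M ==> frag_of (b, m) \<in> carrier F"
  by (simp add: carrier_free)

lemma free_diff: "x \<in> carrier F ==> y \<in> carrier F ==> x - y \<in> carrier F"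
  unfolding carrier_free using keys_diff[of x y] by blast

lemma relations_free: "tensor_relations A B \<phi> M \<subseteq> carrier F"
proof
  fix x assume "x \<in> tensor_relations A B \<phi> M"
  then show "x \<in> carrier F"
    by cases (auto intro!: free_diff frag_of_free phi_closed smult_closed)
qed

lemma subgroup: "subgroup H F"
  unfolding tensor_subgroup_def
  by (rule group.generate_is_subgroup[OF comm_group.axioms(2)[OF free_comm_group] relations_free])

lemma relations_H: "x \<in> tensor_relations A B \<phi> M ==> x \<in> H"
  unfolding tensor_subgroup_def by (rule generate.incl)

lemma H_zero: "0 \<in> H"
  using subgroup.one_closed[OF subgroup] by (simp add: tensor_free_def)

lemma H_add: "x \<in> H ==> y \<in> H ==> x + y \<in> H"
  using subgroup.m_closed[OF subgroup, of x y] by (simp add: mult_free)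

lemma H_free: "x \<in> H ==> x \<in> carrier F"
  using subgroup.subset[OF subgroup] by blast

lemma H_minus: "x \<in> H ==> - x \<in> H"
  using subgroup.m_inv_closed[OF subgroup, of x] H_free[of x]
  by (simp add: tensor_free_def)

definition coset where "coset p = (\<lambda>h. h + p) ` H"

lemma coset_eq_iff: "coset p = coset p' \<longleftrightarrow> p - p' \<in> H"
proof
  assume "coset p = coset p'"
  moreover have "0 + p \<in> coset p" unfolding coset_def by (rule imageI) (rule H_zero)
  ultimately show "p - p' \<in> H" by (auto simp: coset_def)
next
  assume d: "p - p' \<in> H"
  have "h + p \<in> coset p'" if "h \<in> H" for h
    unfolding coset_def by (rule image_eqI[of _ _ "h + (p - p')"]) (use that d H_add in auto)
  moreover have "h + p' \<in> coset p" if "h \<in> H" for h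
    unfolding coset_def
    by (rule image_eqI[of _ _ "h + - (p - p')"])
      (simp, rule H_add[OF that H_minus[OF d]])
  ultimately show "coset p = coset p'" by (auto simp: coset_def)
qed

lemma carrier_ext: "carrier TM = coset ` carrier F"
  by (auto simp: ext_scalars_def tensor_group_def FactGroup_def RCOSETS_def r_coset_def mult_free coset_def)

lemma add_coset: "coset p \<oplus>\<^bsub>TM\<^esub> coset p' = coset (p + p')"
proof -
  have "coset p \<oplus>\<^bsub>TM\<^esub> coset p' = {x + y |x y. x \<in> coset p \<and> y \<in> coset p'}"
    by (auto simp: ext_scalars_def tensor_group_def FactGroup_def set_mult_def mult_free)
  also have "\<dots> = coset (p + p')"
  proof
    show "{x + y |x y. x \<in> coset p \<and> y \<in> coset p'} \<subseteq> coset (p + p')"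
    proof clarify
      fix x y assume "x \<in> coset p" "y \<in> coset p'"
      then obtain h h' where h: "h \<in> H" "h' \<in> H" "x = h + p" "y = h' + p'" by (auto simp: coset_def)
      show "x + y \<in> coset (p + p')"
        unfolding coset_def
        by (rule image_eqI[of _ _ "h + h'"]) (simp_all add: h H_add)
    qed
    show "coset (p + p') \<subseteq> {x + y |x y. x \<in> coset p \<and> y \<in> coset p'}"
    proof
      fix z assume "z \<in> coset (p + p')"
      then obtain h where "h \<in> H" "z = (h + p) + (0 + p')" by (auto simp: coset_def)
      then show "z \<in> {x + y |x y. x \<in> coset p \<and> y \<in> coset p'}"
        using H_zero unfolding coset_def by blast
    qed
  qed
  finally show ?thesis .
qed

lemma zero_ext: "\<zero>\<^bsub>TM\<^esub> = coset 0"
  by (simp add: ext_scalars_def tensor_group_def FactGroup_def coset_def)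

lemma abelian_group_ext: "abelian_group TM"
proof (rule abelian_groupI)
  fix x y z
  assume "x \<in> carrier TM" "y \<in> carrier TM" "z \<in> carrier TM"
  then obtain p p' p'' where p: "x = coset p" "y = coset p'" "z = coset p''"
    "p \<in> carrier F" "p' \<in> carrier F" "p'' \<in> carrier F"
    by (auto simp: carrier_ext)
  show "x \<oplus>\<^bsub>TM\<^esub> y \<oplus>\<^bsub>TM\<^esub> z = x \<oplus>\<^bsub>TM\<^esub> (y \<oplus>\<^bsub>TM\<^esub> z)"
    by (simp add: p add_coset add.assoc)
next
  fix x y
  assume "x \<in> carrier TM" "y \<in> carrier TM"
  then obtain p p' where p: "x = coset p" "y = coset p'" "p \<in> carrier F" "p' \<in> carrier F"
    by (auto simp: carrier_ext)
  have "p + p' \<in> carrier F" using free_diff[OF p(3) free_diff[OF free_diff[OF p(3) p(3)] p(4)]] by simp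
  then show "x \<oplus>\<^bsub>TM\<^esub> y \<in> carrier TM"
    by (auto simp: p add_coset carrier_ext)
  show "x \<oplus>\<^bsub>TM\<^esub> y = y \<oplus>\<^bsub>TM\<^esub> x"
    by (simp add: p add_coset add.commute)
next
  show "\<zero>\<^bsub>TM\<^esub> \<in> carrier TM" by (auto simp: zero_ext carrier_ext carrier_free)
  fix x assume "x \<in> carrier TM"
  then obtain p where p: "x = coset p" "p \<in> carrier F" by (auto simp: carrier_ext)
  show "\<zero>\<^bsub>TM\<^esub> \<oplus>\<^bsub>TM\<^esub> x = x" by (simp add: p zero_ext add_coset)
  have "- p \<in> carrier F" using p by (simp add: carrier_free)
  then show "\<exists>y\<in>carrier TM. y \<oplus>\<^bsub>TM\<^esub> x = \<zero>\<^bsub>TM\<^esub>"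
    by (intro bexI[of _ "coset (- p)"]) (auto simp: p zero_ext add_coset carrier_ext)
qed

sublocale T: abelian_group TM by (rule abelian_group_ext)

abbreviation pure (infix "\<otimes>\<^sub>p" 70) where "b \<otimes>\<^sub>p m \<equiv> tensor_pure A B \<phi> M b m"

lemma pure_def: "b \<otimes>\<^sub>p m = coset (frag_of (b, m))"
  by (simp add: tensor_pure_def coset_def)

lemma pure_closed: "b \<in> carrier B ==> m \<in> carrier M ==> b \<otimes>\<^sub>p m \<in> carrier TM"
  unfolding pure_def carrier_ext by (intro imageI frag_of_free)

lemma pure_add_left: "b \<in> carrier B ==> b' \<in> carrier B ==> m \<in> carrier M ==>
   (b \<oplus>\<^bsub>B\<^esub> b') \<otimes>\<^sub>p m = b \<otimes>\<^sub>p m \<oplus>\<^bsub>TM\<^esub> b' \<otimes>\<^sub>p m"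
  unfolding pure_def add_coset coset_eq_iff
  using relations_H[OF tensor_relations.add_left] by (simp add: algebra_simps)

lemma pure_add_right: "b \<in> carrier B ==> m' \<in> carrier M ==> m \<in> carrier M ==>
   b \<otimes>\<^sub>p (m \<oplus>\<^bsub>M\<^esub> m') = b \<otimes>\<^sub>p m \<oplus>\<^bsub>TM\<^esub> b \<otimes>\<^sub>p m'"
  unfolding pure_def add_coset coset_eq_iff
  using relations_H[OF tensor_relations.add_right] by (simp add: algebra_simps)

lemma pure_balanced: "b \<in> carrier B ==> a \<in> carrier A ==> m \<in> carrier M ==>
   (b \<otimes>\<^bsub>B\<^esub> \<phi> a) \<otimes>\<^sub>p m = b \<otimes>\<^sub>p (a \<odot>\<^bsub>M\<^esub> m)"
  unfolding pure_def coset_eq_iff using relations_H[OF tensor_relations.balanced] by simp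

lemma pure_zero_left: "m \<in> carrier M ==> \<zero>\<^bsub>B\<^esub> \<otimes>\<^sub>p m = \<zero>\<^bsub>TM\<^esub>"
  by (rule T.add.r_cancel_one'[THEN iffD1, of "\<zero>\<^bsub>B\<^esub> \<otimes>\<^sub>p m"])
    (simp_all add: pure_closed pure_add_left[symmetric])

text \<open>
  Only sums have to be treated, since \<open>- (b \<otimes> m) = (- b) \<otimes> m\<close> is again a pure tensor.
\<close>

lemma tensor_induct [consumes 1, case_names pure add]:
  assumes x: "x \<in> carrier TM"
    and pure: "\<And>b m. b \<in> carrier B ==> m \<in> carrier M ==> P (b \<otimes>\<^sub>p m)"
    and add: "\<And>x y. x \<in> carrier TM ==> y \<in> carrier TM ==> P x ==> P y ==> P (x \<oplus>\<^bsub>TM\<^esub> y)"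
  shows "P x"
proof -
  have "\<exists>p. p \<in> carrier F \<and> x = coset p" using x unfolding carrier_ext by blast
  then obtain p where p: "p \<in> carrier F \<and> x = coset p" ..
  have z: "P \<zero>\<^bsub>TM\<^esub>" using pure[OF B.zero_closed M.zero_closed] unfolding pure_zero_left[OF M.zero_closed] .
  have c: "coset u \<in> carrier TM" "coset (- u) \<in> carrier TM"
    if "Poly_Mapping.keys u \<subseteq> carrier B \<times> carrier M" for u
    unfolding carrier_ext using that by (intro imageI, simp add: carrier_free)+
  have "P (coset p) \<and> P (coset (- p))"
  proof (rule free_Abelian_group_induct[of p "carrier B \<times> carrier M" "\<lambda>p. P (coset p) \<and> P (coset (- p))"])
    show "Poly_Mapping.keys p \<subseteq> carrier B \<times> carrier M" using p by (simp add: carrier_free)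
    show "P (coset 0) \<and> P (coset (- 0))" using z by (simp add: zero_ext)
  next
    fix x y :: "'b \<times> 'm \<Rightarrow>\<^sub>0 int"
    assume xy: "Poly_Mapping.keys x \<subseteq> carrier B \<times> carrier M" "Poly_Mapping.keys y \<subseteq> carrier B \<times> carrier M"
      "P (coset x) \<and> P (coset (- x))" "P (coset y) \<and> P (coset (- y))"
    have "coset (x - y) = coset x \<oplus>\<^bsub>TM\<^esub> coset (- y)" "coset (- (x - y)) = coset (- x) \<oplus>\<^bsub>TM\<^esub> coset y"
      by (simp_all add: add_coset algebra_simps)
    then show "P (coset (x - y)) \<and> P (coset (- (x - y)))"
      using xy by (simp add: add c del: minus_diff_eq)
  next
    fix a assume "a \<in> carrier B \<times> carrier M"
    then obtain b m where a: "a = (b, m)" "b \<in> carrier B" "m \<in> carrier M" by auto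
    have "(\<ominus>\<^bsub>B\<^esub> b) \<otimes>\<^sub>p m \<oplus>\<^bsub>TM\<^esub> b \<otimes>\<^sub>p m = \<zero>\<^bsub>TM\<^esub>"
      using a pure_add_left[of "\<ominus>\<^bsub>B\<^esub> b" b m] by (simp add: B.l_neg pure_zero_left)
    moreover have "coset (- frag_of a) \<oplus>\<^bsub>TM\<^esub> b \<otimes>\<^sub>p m = \<zero>\<^bsub>TM\<^esub>"
      by (simp add: pure_def add_coset zero_ext a)
    moreover have "coset (- frag_of a) \<in> carrier TM" using a by (intro c) simp
    ultimately have "coset (- frag_of a) = (\<ominus>\<^bsub>B\<^esub> b) \<otimes>\<^sub>p m"
      using a by (metis T.add.right_cancel pure_closed B.a_inv_closed)
    then show "P (coset (frag_of a)) \<and> P (coset (- frag_of a))"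
      using pure a by (auto simp: pure_def[symmetric])
  qed
  then show ?thesis using p by (simp add: carrier_free)
qed

text \<open>
  A balanced biadditive map kills the relations. So the homomorphism which it induces on the free
  abelian group factors through the quotient.
\<close>

lemma tensor_lift:
  fixes N :: "('c, 'n, 'z) module_scheme"
  assumes N: "abelian_group N"
    and cl: "\<And>b m. b \<in> carrier B ==> m \<in> carrier M ==> f b m \<in> carrier N"
    and addl: "\<And>b b' m. b \<in> carrier B ==> b' \<in> carrier B ==> m \<in> carrier M ==>
       f (b \<oplus>\<^bsub>B\<^esub> b') m = f b m \<oplus>\<^bsub>N\<^esub> f b' m"
    and addr: "\<And>b m m'. b \<in> carrier B ==> m \<in> carrier M ==> m' \<in> carrier M ==>
       f b (m \<oplus>\<^bsub>M\<^esub> m') = f b m \<oplus>\<^bsub>N\<^esub> f b m'"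
    and bal: "\<And>b a m. b \<in> carrier B ==> a \<in> carrier A ==> m \<in> carrier M ==>
       f (b \<otimes>\<^bsub>B\<^esub> \<phi> a) m = f b (a \<odot>\<^bsub>M\<^esub> m)"
  shows "\<exists>h \<in> carrier TM \<rightarrow>\<^sub>E carrier N.
     (\<forall>x\<in>carrier TM. \<forall>y\<in>carrier TM. h (x \<oplus>\<^bsub>TM\<^esub> y) = h x \<oplus>\<^bsub>N\<^esub> h y) \<and>
     (\<forall>b\<in>carrier B. \<forall>m\<in>carrier M. h (b \<otimes>\<^sub>p m) = f b m)"
proof -
  interpret N: abelian_group N by (rule N)
  have "(\<lambda>(b, m). f b m) ` (carrier B \<times> carrier M) \<subseteq> carrier (add_monoid N)"
    using cl by auto
  then obtain h where h: "h \<in> hom F (add_monoid N)"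
    and hf: "\<And>x. x \<in> carrier B \<times> carrier M ==> h (frag_of x) = (case x of (b, m) \<Rightarrow> f b m)"
    unfolding tensor_free_def
    by (rule comm_group.free_Abelian_group_universal[OF N.a_comm_group]) iprover
  have h_add: "h (x + y) = h x \<oplus>\<^bsub>N\<^esub> h y" if "x \<in> carrier F" "y \<in> carrier F" for x y
    using hom_mult[OF h that] by (simp add: mult_free)
  have h_cl: "h x \<in> carrier N" if "x \<in> carrier F" for x
    using h that by (auto simp: Group.hom_def)
  interpret gh: group_hom F "add_monoid N" h
    using h by (simp add: group_hom_def group_hom_axioms_def N.a_group
        comm_group.axioms(2)[OF free_comm_group])
  have h_diff: "h (x - y) = h x \<ominus>\<^bsub>N\<^esub> h y" if x: "x \<in> carrier F" "y \<in> carrier F" for x y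
  proof -
    have "h x = h (x - y) \<oplus>\<^bsub>N\<^esub> h y" using h_add[of "x - y" y] free_diff x by simp
    then show ?thesis using h_cl[OF free_diff[OF x]] h_cl[OF x(1)] h_cl[OF x(2)]
      by (simp add: N.minus_eq N.a_assoc N.r_neg)
  qed
  have "tensor_relations A B \<phi> M \<subseteq> Coset.kernel F (add_monoid N) h"
  proof
    fix x assume x: "x \<in> tensor_relations A B \<phi> M"
    have *: "(u \<oplus>\<^bsub>N\<^esub> v) \<ominus>\<^bsub>N\<^esub> u \<ominus>\<^bsub>N\<^esub> v = \<zero>\<^bsub>N\<^esub>" if "u \<in> carrier N" "v \<in> carrier N" for u v
    proof -
      have "u \<oplus>\<^bsub>N\<^esub> v \<ominus>\<^bsub>N\<^esub> u = v"
        unfolding N.a_comm[OF that] using that by (simp add: N.minus_eq N.a_assoc N.r_neg)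
      then show ?thesis using that by (simp add: N.minus_eq N.r_neg)
    qed
    from x have "h x = \<zero>\<^bsub>N\<^esub>"
    proof cases
      case (add_left b b' m)
      then show ?thesis by (simp add: h_diff free_diff frag_of_free hf addl * cl)
    next
      case (add_right b m m')
      then show ?thesis by (simp add: h_diff free_diff frag_of_free hf addr * cl)
    next
      case (balanced b a m)
      then show ?thesis
        by (simp add: h_diff free_diff frag_of_free phi_closed smult_closed hf bal cl N.minus_eq N.r_neg)
    qed
    then show "x \<in> Coset.kernel F (add_monoid N) h"
      using x relations_free by (auto simp: Coset.kernel_def)
  qed
  then have "H \<subseteq> Coset.kernel F (add_monoid N) h"
    unfolding tensor_subgroup_def
    by (rule group.generate_subgroup_incl[OF comm_group.axioms(2)[OF free_comm_group] _ gh.subgroup_kernel])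
  then have hH: "h x = \<zero>\<^bsub>N\<^esub>" if "x \<in> H" for x using that by (auto simp: Coset.kernel_def)
  define g where "g = (\<lambda>C\<in>carrier TM. h (SOME p. p \<in> carrier F \<and> C = coset p))"
  have g: "g (coset p) = h p" if p: "p \<in> carrier F" for p
  proof -
    define p' where "p' = (SOME p'. p' \<in> carrier F \<and> coset p = coset p')"
    have p': "p' \<in> carrier F \<and> coset p = coset p'"
      unfolding p'_def by (rule someI[of _ p]) (use p in simp)
    have "p - p' \<in> H" using p' by (simp add: coset_eq_iff)
    then have "h (p - p') = \<zero>\<^bsub>N\<^esub>" by (rule hH)
    then have "h p = h p'" using p' h_cl h_add[of "p - p'" p'] free_diff[OF p, of p'] by simp
    then show ?thesis using p by (simp add: g_def p'_def carrier_ext)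
  qed
  show ?thesis
  proof (intro bexI[of _ g] conjI ballI)
    fix x y assume "x \<in> carrier TM" "y \<in> carrier TM"
    then obtain p p' where p: "p \<in> carrier F" "p' \<in> carrier F" "x = coset p" "y = coset p'"
      by (auto simp: carrier_ext)
    then show "g (x \<oplus>\<^bsub>TM\<^esub> y) = g x \<oplus>\<^bsub>N\<^esub> g y"
      using monoid.m_closed[OF group.is_monoid[OF comm_group.axioms(2)[OF free_comm_group]], of p p']
      by (simp add: add_coset g h_add mult_free)
  next
    fix b m assume "b \<in> carrier B" "m \<in> carrier M"
    then show "g (b \<otimes>\<^sub>p m) = f b m" by (simp add: pure_def g frag_of_free hf)
  next
    show "g \<in> carrier TM \<rightarrow>\<^sub>E carrier N"
      using g h_cl by (auto simp: carrier_ext g_def)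
  qed
qed

text \<open>
  Both maps on tensor products that are used below, the scalar action and the map induced by a
  homomorphism, send the coset of \<open>p\<close> to the coset of the image of \<open>p\<close> as soon as the images of the
  relations vanish.
\<close>

lemma image_coset:
  assumes N: "tensor_data A N B \<phi>"
    and rel: "\<And>x. x \<in> tensor_relations A B \<phi> M ==> frag_extend g x \<in> tensor_subgroup A B \<phi> N"
  shows "tensor_subgroup A B \<phi> N <#>\<^bsub>tensor_free B N\<^esub> (frag_extend g ` coset p)
     = (\<lambda>h. h + frag_extend g p) ` tensor_subgroup A B \<phi> N"
proof -
  interpret N: tensor_data A N B \<phi> by (rule N)
  have HH: "frag_extend g x \<in> N.H" if "x \<in> H" for x
    using that unfolding tensor_subgroup_def
  proof (induction rule: generate.induct)
    case one
    then show ?case using N.H_zero by (simp add: tensor_free_def tensor_subgroup_def)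
  next
    case (incl h)
    then show ?case using rel by (simp add: tensor_subgroup_def)
  next
    case (inv h)
    then have "inv\<^bsub>F\<^esub> h = - h" using relations_free by (auto simp: tensor_free_def carrier_free)
    then show ?case using N.H_minus[OF rel[OF inv]] by (simp add: frag_extend_minus tensor_subgroup_def)
  next
    case (eng h1 h2)
    then show ?case
      using N.H_add by (simp add: mult_free frag_extend_add tensor_subgroup_def)
  qed
  show ?thesis
  proof
    show "N.H <#>\<^bsub>N.F\<^esub> (frag_extend g ` coset p) \<subseteq> (\<lambda>h. h + frag_extend g p) ` N.H"
    proof
      fix z assume "z \<in> N.H <#>\<^bsub>N.F\<^esub> (frag_extend g ` coset p)"
      then obtain h h' where h: "h \<in> N.H" "h' \<in> H" "z = h + frag_extend g (h' + p)"
        unfolding set_mult_def coset_def N.mult_free by blast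
      then show "z \<in> (\<lambda>h. h + frag_extend g p) ` N.H"
        by (intro image_eqI[of _ _ "h + frag_extend g h'"]) (simp_all add: frag_extend_add N.H_add HH)
    qed
    show "(\<lambda>h. h + frag_extend g p) ` N.H \<subseteq> N.H <#>\<^bsub>N.F\<^esub> (frag_extend g ` coset p)"
    proof
      fix z assume "z \<in> (\<lambda>h. h + frag_extend g p) ` N.H"
      then obtain h where "h \<in> N.H" "z = h + frag_extend g (0 + p)" by auto
      then show "z \<in> N.H <#>\<^bsub>N.F\<^esub> (frag_extend g ` coset p)"
        using H_zero unfolding set_mult_def coset_def N.mult_free by blast
    qed
  qed
qed

lemma smult_coset:
  assumes b: "b \<in> carrier B"
  shows "b \<odot>\<^bsub>TM\<^esub> coset p = coset (frag_extend (\<lambda>(b', m). frag_of (b \<otimes>\<^bsub>B\<^esub> b', m)) p)"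
proof -
  have "frag_extend (\<lambda>(b', m). frag_of (b \<otimes>\<^bsub>B\<^esub> b', m)) x \<in> H"
    if "x \<in> tensor_relations A B \<phi> M" for x
    using that
  proof cases
    case (add_left b1 b' m)
    then show ?thesis
      using relations_H[OF tensor_relations.add_left[of "b \<otimes>\<^bsub>B\<^esub> b1" B "b \<otimes>\<^bsub>B\<^esub> b'" m]] b
      by (simp add: frag_extend_diff B.r_distr)
  next
    case (add_right b1 m m')
    then show ?thesis
      using relations_H[OF tensor_relations.add_right[of "b \<otimes>\<^bsub>B\<^esub> b1" B m]] b
      by (simp add: frag_extend_diff)
  next
    case (balanced b1 a m)
    then show ?thesis
      using relations_H[OF tensor_relations.balanced[of "b \<otimes>\<^bsub>B\<^esub> b1" B a A m]] b
      by (simp add: frag_extend_diff B.m_assoc phi_closed)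
  qed
  from image_coset[OF tensor_data_axioms this, of p] show ?thesis
    by (simp add: ext_scalars_def coset_def)
qed

lemma smult_pure:
  "b \<in> carrier B ==> b \<odot>\<^bsub>TM\<^esub> (b' \<otimes>\<^sub>p m) = (b \<otimes>\<^bsub>B\<^esub> b') \<otimes>\<^sub>p m"
  by (simp add: pure_def smult_coset)

lemma carrier_obtain: "x \<in> carrier TM ==> (\<And>p. p \<in> carrier F ==> x = coset p ==> thesis) ==> thesis"
  unfolding carrier_ext by blast

lemma smult_add:
  assumes "b \<in> carrier B" "x \<in> carrier TM" "y \<in> carrier TM"
  shows "b \<odot>\<^bsub>TM\<^esub> (x \<oplus>\<^bsub>TM\<^esub> y) = b \<odot>\<^bsub>TM\<^esub> x \<oplus>\<^bsub>TM\<^esub> b \<odot>\<^bsub>TM\<^esub> y"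
  by (rule carrier_obtain[OF assms(2)], rule carrier_obtain[OF assms(3)])
    (simp add: smult_coset assms add_coset frag_extend_add)

lemma smult_carrier:
  assumes "b \<in> carrier B" "x \<in> carrier TM"
  shows "b \<odot>\<^bsub>TM\<^esub> x \<in> carrier TM"
  using assms(2)
  by (induction x rule: tensor_induct) (simp_all add: assms(1) smult_pure pure_closed smult_add)

lemma left_module_ext: "left_module B TM"
proof (intro left_module.intro left_module_axioms.intro B.ring_axioms T.abelian_group_axioms)
  fix a b x assume ab: "a \<in> carrier B" "b \<in> carrier B" and x: "x \<in> carrier TM"
  show "(a \<oplus>\<^bsub>B\<^esub> b) \<odot>\<^bsub>TM\<^esub> x = a \<odot>\<^bsub>TM\<^esub> x \<oplus>\<^bsub>TM\<^esub> b \<odot>\<^bsub>TM\<^esub> x"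
    using x
    by (induction x rule: tensor_induct)
      (simp_all add: ab smult_pure B.l_distr pure_add_left smult_add smult_carrier T.a_ac)
  show "(a \<otimes>\<^bsub>B\<^esub> b) \<odot>\<^bsub>TM\<^esub> x = a \<odot>\<^bsub>TM\<^esub> (b \<odot>\<^bsub>TM\<^esub> x)"
    using x
    by (induction x rule: tensor_induct) (simp_all add: ab smult_pure B.m_assoc smult_add smult_carrier)
next
  fix x assume x: "x \<in> carrier TM"
  then show "\<one>\<^bsub>B\<^esub> \<odot>\<^bsub>TM\<^esub> x = x"
    by (induction x rule: tensor_induct) (simp_all add: smult_pure smult_add)
qed (simp_all add: smult_carrier smult_add)

lemma additive_eqI:
  assumes x: "x \<in> carrier TM"
    and f: "\<And>x y. x \<in> carrier TM ==> y \<in> carrier TM ==> f (x \<oplus>\<^bsub>TM\<^esub> y) = add' (f x) (f y)"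
    and g: "\<And>x y. x \<in> carrier TM ==> y \<in> carrier TM ==> g (x \<oplus>\<^bsub>TM\<^esub> y) = add' (g x) (g y)"
    and eq: "\<And>b m. b \<in> carrier B ==> m \<in> carrier M ==> f (b \<otimes>\<^sub>p m) = g (b \<otimes>\<^sub>p m)"
  shows "f x = g x"
  using x by (induction x rule: tensor_induct) (simp_all add: f g eq)

end

lemma ext_scalars_map_hom:
  fixes A :: "'a ring" and B :: "'b ring" and M :: "('a, 'm) module" and N :: "('a, 'n) module"
  assumes "tensor_data A M B \<phi>" "tensor_data A N B \<phi>" and f: "f \<in> lmod_hom A M N"
  shows "ext_scalars_map A B \<phi> M N f \<in> lmod_hom B (ext_scalars A B \<phi> M) (ext_scalars A B \<phi> N)"
    and "\<And>b m. b \<in> carrier B ==> m \<in> carrier M ==>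
      ext_scalars_map A B \<phi> M N f (tensor_pure A B \<phi> M b m) = tensor_pure A B \<phi> N b (f m)"
proof -
  interpret M: tensor_data A M B \<phi> by fact
  interpret N: tensor_data A N B \<phi> by fact
  define E where "E = frag_extend (\<lambda>(b, m). frag_of (b :: 'b, f (m :: 'm)))"
  have fcl: "f m \<in> carrier N" if "m \<in> carrier M" for m using f that by (auto simp: lmod_hom_def)
  have fadd: "f (m \<oplus>\<^bsub>M\<^esub> m') = f m \<oplus>\<^bsub>N\<^esub> f m'" if "m \<in> carrier M" "m' \<in> carrier M" for m m'
    using f that by (auto simp: lmod_hom_def)
  have fs: "f (a \<odot>\<^bsub>M\<^esub> m) = a \<odot>\<^bsub>N\<^esub> f m" if "m \<in> carrier M" "a \<in> carrier A" for m a
    using f that by (auto simp: lmod_hom_def)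
  have "E x \<in> N.H" if "x \<in> tensor_relations A B \<phi> M" for x
    using that
  proof cases
    case (add_left b1 b' m)
    then show ?thesis
      using N.relations_H[OF tensor_relations.add_left[of "b1" B "b'" "f m"]]
      by (simp add: E_def frag_extend_diff fcl)
  next
    case (add_right b1 m m')
    then show ?thesis
      using N.relations_H[OF tensor_relations.add_right[of "b1" B "f m" _ "f m'"]]
      by (simp add: E_def frag_extend_diff fadd fcl)
  next
    case (balanced b1 a m)
    then show ?thesis
      using N.relations_H[OF tensor_relations.balanced[of "b1" B a A "f m"]]
      by (simp add: E_def frag_extend_diff fs fcl)
  qed
  then have map: "ext_scalars_map A B \<phi> M N f (M.coset p) = N.coset (E p)" if "p \<in> carrier M.F" for p
    using M.image_coset[OF N.tensor_data_axioms, of "\<lambda>(b, m). frag_of (b, f m)" p] that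
    by (simp add: E_def ext_scalars_map_def N.coset_def M.carrier_ext)
  show pure: "ext_scalars_map A B \<phi> M N f (M.pure b m) = N.pure b (f m)"
    if "b \<in> carrier B" "m \<in> carrier M" for b m
    using that by (simp add: M.pure_def N.pure_def map M.frag_of_free E_def)
  have add: "ext_scalars_map A B \<phi> M N f (x \<oplus>\<^bsub>M.TM\<^esub> y) =
      ext_scalars_map A B \<phi> M N f x \<oplus>\<^bsub>N.TM\<^esub> ext_scalars_map A B \<phi> M N f y"
    if x: "x \<in> carrier M.TM" and y: "y \<in> carrier M.TM" for x y
  proof (rule M.carrier_obtain[OF x], rule M.carrier_obtain[OF y])
    fix p p' assume p: "p \<in> carrier M.F" "x = M.coset p" "p' \<in> carrier M.F" "y = M.coset p'"
    have "p + p' \<in> carrier M.F" using p keys_add[of p p'] by (auto simp: M.carrier_free)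
    then show ?thesis using p by (simp add: M.add_coset N.add_coset map E_def frag_extend_add)
  qed
  have cl: "ext_scalars_map A B \<phi> M N f x \<in> carrier N.TM" if "x \<in> carrier M.TM" for x
    using that by (induction x rule: M.tensor_induct) (simp_all add: pure add N.pure_closed fcl)
  have sm: "ext_scalars_map A B \<phi> M N f (b \<odot>\<^bsub>M.TM\<^esub> x) = b \<odot>\<^bsub>N.TM\<^esub> ext_scalars_map A B \<phi> M N f x"
    if "x \<in> carrier M.TM" "b \<in> carrier B" for x b
    using that(1)
    by (induction x rule: M.tensor_induct)
      (simp_all add: pure add N.pure_closed fcl that(2) M.smult_pure N.smult_pure M.smult_add N.smult_add cl M.smult_carrier)
  have ext: "ext_scalars_map A B \<phi> M N f \<in> extensional (carrier M.TM)"
    by (simp add: ext_scalars_map_def)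
  show "ext_scalars_map A B \<phi> M N f \<in> lmod_hom B M.TM N.TM"
    unfolding lmod_hom_def by (simp add: PiE_def Pi_def cl sm add ext)
qed

section \<open>Frobenius extensions\<close>

lemma additive_zero:
  assumes "abelian_group S" "abelian_group S'" and "f \<in> carrier S \<rightarrow> carrier S'"
    and "\<And>x y. x \<in> carrier S ==> y \<in> carrier S ==> f (x \<oplus>\<^bsub>S\<^esub> y) = f x \<oplus>\<^bsub>S'\<^esub> f y"
  shows "f \<zero>\<^bsub>S\<^esub> = \<zero>\<^bsub>S'\<^esub>"
proof -
  interpret S: abelian_group S by fact
  interpret S': abelian_group S' by fact
  have "f \<zero>\<^bsub>S\<^esub> \<in> carrier S'" by (rule funcset_mem[OF assms(3) S.zero_closed])
  then show ?thesis
    using S'.add.r_cancel_one'[of "f \<zero>\<^bsub>S\<^esub>" "f \<zero>\<^bsub>S\<^esub>"] assms(4)[of "\<zero>\<^bsub>S\<^esub>" "\<zero>\<^bsub>S\<^esub>"] by simp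
qed

lemma additive_finsum:
  assumes "abelian_group S" "abelian_group S'" and "f \<in> carrier S \<rightarrow> carrier S'"
    and "\<And>x y. x \<in> carrier S ==> y \<in> carrier S ==> f (x \<oplus>\<^bsub>S\<^esub> y) = f x \<oplus>\<^bsub>S'\<^esub> f y"
    and "finite I" "\<And>i. i \<in> I ==> x i \<in> carrier S"
  shows "f (\<Oplus>\<^bsub>S\<^esub>i\<in>I. x i) = (\<Oplus>\<^bsub>S'\<^esub>i\<in>I. f (x i))"
proof -
  interpret S: abelian_group S by fact
  interpret S': abelian_group S' by fact
  have f: "\<And>x. x \<in> carrier S ==> f x \<in> carrier S'" using assms(3) by auto
  show ?thesis
    using assms(5,6)
  proof (induction I rule: finite_induct)
    case empty
    then show ?case using additive_zero[OF assms(1-4)] by simp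
  next
    case (insert i I)
    have x: "x \<in> insert i I \<rightarrow> carrier S" using insert.prems by auto
    have "f (\<Oplus>\<^bsub>S\<^esub>i\<in>insert i I. x i) = f (x i \<oplus>\<^bsub>S\<^esub> (\<Oplus>\<^bsub>S\<^esub>i\<in>I. x i))"
      using insert.hyps x by (subst S.finsum_insert) auto
    also have "\<dots> = f (x i) \<oplus>\<^bsub>S'\<^esub> f (\<Oplus>\<^bsub>S\<^esub>i\<in>I. x i)"
      using x by (intro assms(4) S.finsum_closed) auto
    also have "\<dots> = f (x i) \<oplus>\<^bsub>S'\<^esub> (\<Oplus>\<^bsub>S'\<^esub>i\<in>I. f (x i))"
      using insert by simp
    also have "\<dots> = (\<Oplus>\<^bsub>S'\<^esub>i\<in>insert i I. f (x i))"
      using insert.hyps x by (subst S'.finsum_insert) (auto intro!: f)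
    finally show ?case .
  qed
qed

lemma lmod_homD:
  assumes "f \<in> lmod_hom R M N"
  shows "x \<in> carrier M ==> f x \<in> carrier N"
    and "x \<in> carrier M ==> y \<in> carrier M ==> f (x \<oplus>\<^bsub>M\<^esub> y) = f x \<oplus>\<^bsub>N\<^esub> f y"
    and "a \<in> carrier R ==> x \<in> carrier M ==> f (a \<odot>\<^bsub>M\<^esub> x) = a \<odot>\<^bsub>N\<^esub> f x"
    and "f \<in> extensional (carrier M)"
    and "f \<in> carrier M \<rightarrow> carrier N"
  using assms by (auto simp: lmod_hom_def PiE_def)

lemma lmod_homI:
  assumes "\<And>x. x \<in> carrier M ==> f x \<in> carrier N"
    and "\<And>x y. x \<in> carrier M ==> y \<in> carrier M ==> f (x \<oplus>\<^bsub>M\<^esub> y) = f x \<oplus>\<^bsub>N\<^esub> f y"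
    and "\<And>a x. a \<in> carrier R ==> x \<in> carrier M ==> f (a \<odot>\<^bsub>M\<^esub> x) = a \<odot>\<^bsub>N\<^esub> f x"
    and "f \<in> extensional (carrier M)"
  shows "f \<in> lmod_hom R M N"
  using assms by (auto simp: lmod_hom_def PiE_def)

lemma left_module_restrict_scalars:
  assumes "ring A" "left_module B M" "\<phi> \<in> ring_hom A B"
  shows "left_module A (restrict_scalars \<phi> M)"
proof -
  interpret A: ring A by fact
  interpret left_module B M by fact
  have ab: "abelian_group (restrict_scalars \<phi> M)"
    by (rule abelian_groupI)
      (auto simp: restrict_scalars_def M.a_ac intro!: bexI[of _ "\<ominus>\<^bsub>M\<^esub> _"] M.l_neg)
  show ?thesis
    by (intro left_module.intro left_module_axioms.intro A.ring_axioms ab)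
      (simp_all add: restrict_scalars_def ring_hom_closed[OF assms(3)] ring_hom_add[OF assms(3)]
        ring_hom_mult[OF assms(3)] ring_hom_one[OF assms(3)] smult_closed smult_l_distr smult_r_distr
        smult_assoc smult_one)
qed

lemma restrict_scalars_sel [simp]:
  "carrier (restrict_scalars \<phi> M) = carrier M"
  "ring.add (restrict_scalars \<phi> M) = ring.add M"
  "ring.zero (restrict_scalars \<phi> M) = ring.zero M"
  "module.smult (restrict_scalars \<phi> M) a x = \<phi> a \<odot>\<^bsub>M\<^esub> x"
  by (simp_all add: restrict_scalars_def)

lemma lmod_id_apply: "x \<in> carrier M ==> lmod_id M x = x"
  by (simp add: lmod_id_def)

lemma lmod_hom_add_apply: "x \<in> carrier M ==> lmod_hom_add M N f g x = f x \<oplus>\<^bsub>N\<^esub> g x"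
  by (simp add: lmod_hom_add_def)

locale ring_extension = A: ring A + B: ring B
  for A :: "'a ring" and B :: "'b ring" and \<phi> :: "'a \<Rightarrow> 'b" +
  assumes hom: "\<phi> \<in> ring_hom A B"
begin

lemma tensor_data: "left_module A M ==> tensor_data A M B \<phi>"
  by (intro tensor_data.intro tensor_data_axioms.intro B.ring_axioms hom)

lemma ext_functor: "lmod_functor A B (ext_scalars A B \<phi>) (ext_scalars_map A B \<phi>)"
  unfolding lmod_functor_def
proof (intro conjI allI impI, goal_cases)
  case (1 M)
  then show ?case by (rule tensor_data.left_module_ext[OF tensor_data])
next
  case (2 M N f)
  then show ?case by (auto intro: ext_scalars_map_hom tensor_data)
next
  case (3 M)
  then interpret M: tensor_data A M B \<phi> by (rule tensor_data)
  have id: "lmod_id M \<in> lmod_hom A M M"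
    by (rule lmod_homI) (auto simp: lmod_id_def M.smult_closed)
  note e = ext_scalars_map_hom[OF M.tensor_data_axioms M.tensor_data_axioms id]
  show ?case
  proof (rule extensionalityI[OF lmod_homD(4)[OF e(1)]])
    show "lmod_id M.TM \<in> extensional (carrier M.TM)" by (simp add: lmod_id_def)
    fix x assume x: "x \<in> carrier M.TM"
    then show "ext_scalars_map A B \<phi> M M (lmod_id M) x = lmod_id M.TM x"
      by (rule M.additive_eqI[where add' = "ring.add M.TM"])
        (simp_all add: lmod_id_apply M.pure_closed lmod_homD(2)[OF e(1)] e(2))
  qed
next
  case (4 L M N f g)
  then interpret L: tensor_data A L B \<phi> by (intro tensor_data) simp
  from 4 interpret M: tensor_data A M B \<phi> by (intro tensor_data) simp
  from 4 interpret N: tensor_data A N B \<phi> by (intro tensor_data) simp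
  have f: "f \<in> lmod_hom A L M" and g: "g \<in> lmod_hom A M N" using 4 by auto
  have gf: "compose (carrier L) g f \<in> lmod_hom A L N"
    by (rule lmod_homI) (auto simp: compose_def lmod_homD[OF f] lmod_homD[OF g] L.smult_closed)
  note ef = ext_scalars_map_hom[OF L.tensor_data_axioms M.tensor_data_axioms f]
  note eg = ext_scalars_map_hom[OF M.tensor_data_axioms N.tensor_data_axioms g]
  note egf = ext_scalars_map_hom[OF L.tensor_data_axioms N.tensor_data_axioms gf]
  show ?case
  proof (rule extensionalityI[OF lmod_homD(4)[OF egf(1)]])
    fix x assume x: "x \<in> carrier L.TM"
    then show "ext_scalars_map A B \<phi> L N (compose (carrier L) g f) x =
      compose (carrier L.TM) (ext_scalars_map A B \<phi> M N g) (ext_scalars_map A B \<phi> L M f) x"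
      by (rule L.additive_eqI[where add' = "ring.add N.TM"])
        (simp_all add: compose_eq L.pure_closed lmod_homD[OF egf(1)] lmod_homD[OF ef(1)] lmod_homD[OF eg(1)]
          ef(2) eg(2) egf(2) lmod_homD[OF f])
  qed simp
qed

lemma ext_additive:
  assumes "left_module A M" "left_module A N" and f: "f \<in> lmod_hom A M N" and g: "g \<in> lmod_hom A M N"
  shows "ext_scalars_map A B \<phi> M N (lmod_hom_add M N f g) =
    lmod_hom_add (ext_scalars A B \<phi> M) (ext_scalars A B \<phi> N)
      (ext_scalars_map A B \<phi> M N f) (ext_scalars_map A B \<phi> M N g)"
proof -
  interpret M: tensor_data A M B \<phi> by (rule tensor_data) fact
  interpret N: tensor_data A N B \<phi> by (rule tensor_data) fact
  have fg: "lmod_hom_add M N f g \<in> lmod_hom A M N"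
    by (rule lmod_homI)
      (auto simp: lmod_hom_add_def lmod_homD[OF f] lmod_homD[OF g] M.smult_closed N.smult_r_distr N.M.a_ac)
  note ef = ext_scalars_map_hom[OF M.tensor_data_axioms N.tensor_data_axioms f]
  note eg = ext_scalars_map_hom[OF M.tensor_data_axioms N.tensor_data_axioms g]
  note efg = ext_scalars_map_hom[OF M.tensor_data_axioms N.tensor_data_axioms fg]
  show ?thesis
  proof (rule extensionalityI[OF lmod_homD(4)[OF efg(1)]])
    fix x assume x: "x \<in> carrier M.TM"
    then show "ext_scalars_map A B \<phi> M N (lmod_hom_add M N f g) x =
      lmod_hom_add M.TM N.TM (ext_scalars_map A B \<phi> M N f) (ext_scalars_map A B \<phi> M N g) x"
      by (rule M.additive_eqI[where add' = "ring.add N.TM"])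
        (simp_all add: M.pure_closed lmod_homD[OF efg(1)] lmod_homD[OF ef(1)] lmod_homD[OF eg(1)]
          ef(2) eg(2) efg(2) lmod_homD[OF f] lmod_homD[OF g] lmod_hom_add_apply N.T.a_ac N.pure_add_right)
  qed (simp add: lmod_hom_add_def)
qed

lemma res_functor: "lmod_functor B A (restrict_scalars \<phi>) (\<lambda>_ _ f. f)"
  unfolding lmod_functor_def
  by (auto intro: left_module_restrict_scalars A.ring_axioms hom
      simp: lmod_hom_def lmod_id_def ring_hom_closed[OF hom])

end

text \<open>
  The map \<open>\<theta>\<close> is the Frobenius homomorphism, and the families \<open>b\<close> and \<open>c\<close> are dual bases. This is
  the element-wise form of a Frobenius extension: it expresses that \<open>B\<close> is finitely generated and
  projective over \<open>A\<close> and isomorphic to its own dual as a bimodule.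
\<close>

locale frobenius_extension = ring_extension A B \<phi>
  for A :: "'a ring" and B :: "'b ring" and \<phi> :: "'a \<Rightarrow> 'b" +
  fixes \<theta> :: "'b \<Rightarrow> 'a" and I :: "'i set" and b c :: "'i \<Rightarrow> 'b"
  assumes theta_closed: "x \<in> carrier B ==> \<theta> x \<in> carrier A"
    and theta_add: "x \<in> carrier B ==> y \<in> carrier B ==> \<theta> (x \<oplus>\<^bsub>B\<^esub> y) = \<theta> x \<oplus>\<^bsub>A\<^esub> \<theta> y"
    and theta_left: "a \<in> carrier A ==> x \<in> carrier B ==> \<theta> (\<phi> a \<otimes>\<^bsub>B\<^esub> x) = a \<otimes>\<^bsub>A\<^esub> \<theta> x"
    and theta_right: "a \<in> carrier A ==> x \<in> carrier B ==> \<theta> (x \<otimes>\<^bsub>B\<^esub> \<phi> a) = \<theta> x \<otimes>\<^bsub>A\<^esub> a"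
    and finite_index: "finite I"
    and dual_closed: "i \<in> I ==> b i \<in> carrier B" "i \<in> I ==> c i \<in> carrier B"
    and dual_left: "x \<in> carrier B ==> (\<Oplus>\<^bsub>B\<^esub>i\<in>I. b i \<otimes>\<^bsub>B\<^esub> \<phi> (\<theta> (c i \<otimes>\<^bsub>B\<^esub> x))) = x"
    and dual_right: "x \<in> carrier B ==> (\<Oplus>\<^bsub>B\<^esub>i\<in>I. \<phi> (\<theta> (x \<otimes>\<^bsub>B\<^esub> b i)) \<otimes>\<^bsub>B\<^esub> c i) = x"
begin

abbreviation Ex :: "('a, 'm) module \<Rightarrow> ('b, ('b \<times> 'm \<Rightarrow>\<^sub>0 int) set) module"
  where "Ex \<equiv> ext_scalars A B \<phi>"

lemma phi_closed: "a \<in> carrier A ==> \<phi> a \<in> carrier B"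
  using hom by (rule ring_hom_closed)

lemma counit_exists:
  assumes "left_module A M"
  shows "\<exists>h. (\<forall>x\<in>carrier (Ex M). h x \<in> carrier M) \<and>
     (\<forall>x\<in>carrier (Ex M). \<forall>y\<in>carrier (Ex M). h (x \<oplus>\<^bsub>Ex M\<^esub> y) = h x \<oplus>\<^bsub>M\<^esub> h y) \<and>
     (\<forall>b\<in>carrier B. \<forall>m\<in>carrier M. h (tensor_pure A B \<phi> M b m) = \<theta> b \<odot>\<^bsub>M\<^esub> m)"
proof -
  interpret M: tensor_data A M B \<phi> by (rule tensor_data) fact
  obtain h where "h \<in> carrier (Ex M) \<rightarrow>\<^sub>E carrier M"
     "\<forall>x\<in>carrier (Ex M). \<forall>y\<in>carrier (Ex M). h (x \<oplus>\<^bsub>Ex M\<^esub> y) = h x \<oplus>\<^bsub>M\<^esub> h y"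
     "\<forall>b\<in>carrier B. \<forall>m\<in>carrier M. h (tensor_pure A B \<phi> M b m) = \<theta> b \<odot>\<^bsub>M\<^esub> m"
    using M.tensor_lift[OF M.M.abelian_group_axioms, of "\<lambda>b m. \<theta> b \<odot>\<^bsub>M\<^esub> m"]
    by (auto simp: theta_closed theta_add theta_right M.smult_closed M.smult_l_distr M.smult_r_distr M.smult_assoc)
  then show ?thesis by (intro exI[of _ h]) (auto simp: PiE_def)
qed

text \<open>
  An additive map on the tensor product can only be named through its values on pure tensors,
  hence the choice operator.
\<close>

definition counit :: "('a, 'm) module \<Rightarrow> ('b \<times> 'm \<Rightarrow>\<^sub>0 int) set \<Rightarrow> 'm" where
  "counit M = (SOME h. (\<forall>x\<in>carrier (Ex M). h x \<in> carrier M) \<and>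
     (\<forall>x\<in>carrier (Ex M). \<forall>y\<in>carrier (Ex M). h (x \<oplus>\<^bsub>Ex M\<^esub> y) = h x \<oplus>\<^bsub>M\<^esub> h y) \<and>
     (\<forall>b\<in>carrier B. \<forall>m\<in>carrier M. h (tensor_pure A B \<phi> M b m) = \<theta> b \<odot>\<^bsub>M\<^esub> m))"

lemma counit:
  assumes "left_module A M"
  shows "x \<in> carrier (Ex M) ==> counit M x \<in> carrier M"
    and "x \<in> carrier (Ex M) ==> y \<in> carrier (Ex M) ==>
      counit M (x \<oplus>\<^bsub>Ex M\<^esub> y) = counit M x \<oplus>\<^bsub>M\<^esub> counit M y"
    and "z \<in> carrier B ==> m \<in> carrier M ==> counit M (tensor_pure A B \<phi> M z m) = \<theta> z \<odot>\<^bsub>M\<^esub> m"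
  using someI_ex[OF counit_exists[OF assms], folded counit_def] by blast+

lemma counit_smult:
  assumes M: "left_module A M" and a: "a \<in> carrier A" and x: "x \<in> carrier (Ex M)"
  shows "counit M (\<phi> a \<odot>\<^bsub>Ex M\<^esub> x) = a \<odot>\<^bsub>M\<^esub> counit M x"
proof -
  interpret M: tensor_data A M B \<phi> by (rule tensor_data) fact
  show ?thesis using x
    by (rule M.additive_eqI[where add' = "ring.add M"])
      (simp_all add: a M.smult_add counit[OF M] M.smult_carrier phi_closed M.smult_r_distr M.smult_pure
        theta_left theta_closed M.smult_assoc)
qed

text \<open>
  Both sides are additive, and for a pure tensor the sum can be moved into its first factor, where
  it is the expansion \<open>dual_left\<close>.
\<close>

lemma expand_pure:
  assumes M: "left_module A M" and x: "x \<in> carrier (Ex M)"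
  shows "(\<Oplus>\<^bsub>Ex M\<^esub>i\<in>I. tensor_pure A B \<phi> M (b i) (counit M (c i \<odot>\<^bsub>Ex M\<^esub> x))) = x"
proof -
  interpret M: tensor_data A M B \<phi> by (rule tensor_data) fact
  show ?thesis using x
  proof (rule M.additive_eqI[where add' = "ring.add M.TM"])
    fix x y assume xy: "x \<in> carrier M.TM" "y \<in> carrier M.TM"
    have "(\<Oplus>\<^bsub>M.TM\<^esub>i\<in>I. M.pure (b i) (counit M (c i \<odot>\<^bsub>M.TM\<^esub> (x \<oplus>\<^bsub>M.TM\<^esub> y)))) =
      (\<Oplus>\<^bsub>M.TM\<^esub>i\<in>I. M.pure (b i) (counit M (c i \<odot>\<^bsub>M.TM\<^esub> x)) \<oplus>\<^bsub>M.TM\<^esub> M.pure (b i) (counit M (c i \<odot>\<^bsub>M.TM\<^esub> y)))"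
      by (rule M.T.finsum_cong')
        (simp_all add: Pi_def M.pure_closed counit[OF M] M.smult_carrier dual_closed xy M.smult_add M.pure_add_right)
    also have "\<dots> = (\<Oplus>\<^bsub>M.TM\<^esub>i\<in>I. M.pure (b i) (counit M (c i \<odot>\<^bsub>M.TM\<^esub> x))) \<oplus>\<^bsub>M.TM\<^esub>
      (\<Oplus>\<^bsub>M.TM\<^esub>i\<in>I. M.pure (b i) (counit M (c i \<odot>\<^bsub>M.TM\<^esub> y)))"
      by (rule M.T.finsum_addf) (simp_all add: Pi_def M.pure_closed counit[OF M] M.smult_carrier dual_closed xy)
    finally show "(\<Oplus>\<^bsub>M.TM\<^esub>i\<in>I. M.pure (b i) (counit M (c i \<odot>\<^bsub>M.TM\<^esub> (x \<oplus>\<^bsub>M.TM\<^esub> y)))) =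
      (\<Oplus>\<^bsub>M.TM\<^esub>i\<in>I. M.pure (b i) (counit M (c i \<odot>\<^bsub>M.TM\<^esub> x))) \<oplus>\<^bsub>M.TM\<^esub>
      (\<Oplus>\<^bsub>M.TM\<^esub>i\<in>I. M.pure (b i) (counit M (c i \<odot>\<^bsub>M.TM\<^esub> y)))" .
  next
    fix y m assume ym: "y \<in> carrier B" "m \<in> carrier M"
    have "(\<Oplus>\<^bsub>M.TM\<^esub>i\<in>I. M.pure (b i) (counit M (c i \<odot>\<^bsub>M.TM\<^esub> M.pure y m)))
       = (\<Oplus>\<^bsub>M.TM\<^esub>i\<in>I. M.pure (b i \<otimes>\<^bsub>B\<^esub> \<phi> (\<theta> (c i \<otimes>\<^bsub>B\<^esub> y))) m)"
      by (rule M.T.finsum_cong')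
        (simp_all add: Pi_def M.pure_closed counit[OF M] dual_closed ym M.smult_pure M.pure_balanced theta_closed phi_closed M.smult_closed)
    also have "\<dots> = M.pure (\<Oplus>\<^bsub>B\<^esub>i\<in>I. b i \<otimes>\<^bsub>B\<^esub> \<phi> (\<theta> (c i \<otimes>\<^bsub>B\<^esub> y))) m"
      by (rule additive_finsum[OF B.abelian_group_axioms M.T.abelian_group_axioms, where f = "\<lambda>z. M.pure z m", symmetric])
        (simp_all add: M.pure_closed M.pure_add_left ym finite_index dual_closed theta_closed phi_closed)
    finally show "(\<Oplus>\<^bsub>M.TM\<^esub>i\<in>I. M.pure (b i) (counit M (c i \<odot>\<^bsub>M.TM\<^esub> M.pure y m))) = M.pure y m"
      by (simp add: dual_left ym)
  qed (rule refl)
qed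

text \<open>
  The expansion \<open>expand_pure\<close> recovers an element from these values.
\<close>

lemma counit_eqI:
  assumes M: "left_module A M" and xy: "x \<in> carrier (Ex M)" "y \<in> carrier (Ex M)"
    and eq: "\<And>z. z \<in> carrier B ==> counit M (z \<odot>\<^bsub>Ex M\<^esub> x) = counit M (z \<odot>\<^bsub>Ex M\<^esub> y)"
  shows "x = y"
proof -
  interpret M: tensor_data A M B \<phi> by (rule tensor_data) fact
  have "(\<Oplus>\<^bsub>M.TM\<^esub>i\<in>I. M.pure (b i) (counit M (c i \<odot>\<^bsub>M.TM\<^esub> x))) =
     (\<Oplus>\<^bsub>M.TM\<^esub>i\<in>I. M.pure (b i) (counit M (c i \<odot>\<^bsub>M.TM\<^esub> y)))"
    by (rule M.T.finsum_cong') (simp_all add: eq dual_closed Pi_def M.pure_closed counit[OF M] M.smult_carrier xy)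
  then show ?thesis by (simp add: expand_pure M xy)
qed

lemma counit_natural:
  assumes L: "left_module A L" and M: "left_module A M" and f: "f \<in> lmod_hom A L M"
    and x: "x \<in> carrier (Ex L)"
  shows "counit M (ext_scalars_map A B \<phi> L M f x) = f (counit L x)"
proof -
  interpret L: tensor_data A L B \<phi> by (rule tensor_data) fact
  interpret M: tensor_data A M B \<phi> by (rule tensor_data) fact
  note ef = ext_scalars_map_hom[OF L.tensor_data_axioms M.tensor_data_axioms f]
  show ?thesis using x
    by (rule L.additive_eqI[where add' = "ring.add M"])
      (simp_all add: lmod_homD[OF ef(1)] counit[OF L] counit[OF M] lmod_homD[OF f] L.pure_closed ef(2) theta_closed)
qed

text \<open>
  Exactness on the left is the part that uses the Frobenius structure. By naturality of the counit,
  injectivity can be tested on the given module, by \<open>counit_eqI\<close>; and an element of the kernel has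
  its values under the counit in the kernel of the given map, so that it is the image of a sum
  \<open>\<Sum> b\<^sub>i \<otimes> l\<^sub>i\<close> by \<open>expand_pure\<close>.
\<close>

lemma ext_exact: "exact_lmod_functor A B Ex (ext_scalars_map A B \<phi>)"
  unfolding exact_lmod_functor_def
proof (intro conjI allI impI ext_functor)
  fix M N :: "('a, 'm) module" and f g
  assume "left_module A M \<and> left_module A N \<and> f \<in> lmod_hom A M N \<and> g \<in> lmod_hom A M N"
  then show "ext_scalars_map A B \<phi> M N (lmod_hom_add M N f g) =
      lmod_hom_add (Ex M) (Ex N) (ext_scalars_map A B \<phi> M N f) (ext_scalars_map A B \<phi> M N g)"
    by (intro ext_additive) auto
next
  fix L M N :: "('a, 'm) module" and f g
  assume "left_module A L \<and> left_module A M \<and> left_module A N \<and> short_exact A L f M g N"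
  then have L: "left_module A L" and M: "left_module A M" and N: "left_module A N"
    and f: "f \<in> lmod_hom A L M" and g: "g \<in> lmod_hom A M N"
    and inj: "inj_on f (carrier L)" and im: "f ` carrier L = {x \<in> carrier M. g x = \<zero>\<^bsub>N\<^esub>}"
    and surj: "g ` carrier M = carrier N"
    by (auto simp: short_exact_def)
  interpret L: tensor_data A L B \<phi> by (rule tensor_data) fact
  interpret M: tensor_data A M B \<phi> by (rule tensor_data) fact
  interpret N: tensor_data A N B \<phi> by (rule tensor_data) fact
  note ef = ext_scalars_map_hom[OF L.tensor_data_axioms M.tensor_data_axioms f]
  note eg = ext_scalars_map_hom[OF M.tensor_data_axioms N.tensor_data_axioms g]
  let ?f = "ext_scalars_map A B \<phi> L M f" and ?g = "ext_scalars_map A B \<phi> M N g"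
  note cf = counit_natural[OF L M f] and cg = counit_natural[OF M N g]
  show "short_exact B L.TM ?f M.TM ?g N.TM"
    unfolding short_exact_def
  proof (intro conjI ef eg)
    show "inj_on ?f (carrier L.TM)"
    proof (rule inj_onI)
      fix x y assume xy: "x \<in> carrier L.TM" "y \<in> carrier L.TM" "?f x = ?f y"
      show "x = y"
      proof (rule counit_eqI[OF L xy(1,2)])
        fix z assume z: "z \<in> carrier B"
        have "f (counit L (z \<odot>\<^bsub>L.TM\<^esub> x)) = f (counit L (z \<odot>\<^bsub>L.TM\<^esub> y))"
          using z xy by (simp add: cf[symmetric] L.smult_carrier lmod_homD[OF ef(1)])
        then show "counit L (z \<odot>\<^bsub>L.TM\<^esub> x) = counit L (z \<odot>\<^bsub>L.TM\<^esub> y)"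
          using inj z xy by (simp add: inj_on_eq_iff counit[OF L] L.smult_carrier)
      qed
    qed
  next
    have N0: "z \<in> carrier B ==> z \<odot>\<^bsub>N.TM\<^esub> \<zero>\<^bsub>N.TM\<^esub> = \<zero>\<^bsub>N.TM\<^esub>" for z
      by (rule additive_zero[OF N.T.abelian_group_axioms N.T.abelian_group_axioms])
        (simp_all add: N.smult_carrier N.smult_add)
    have cN0: "counit N \<zero>\<^bsub>N.TM\<^esub> = \<zero>\<^bsub>N\<^esub>"
      by (rule additive_zero[OF N.T.abelian_group_axioms N.M.abelian_group_axioms])
        (simp_all add: counit[OF N])
    show "?f ` carrier L.TM = {x \<in> carrier M.TM. ?g x = \<zero>\<^bsub>N.TM\<^esub>}"
    proof (intro equalityI subsetI)
      fix y assume "y \<in> ?f ` carrier L.TM"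
      then obtain x where x: "x \<in> carrier L.TM" "y = ?f x" by auto
      have "?g (?f x) = \<zero>\<^bsub>N.TM\<^esub>"
      proof (rule counit_eqI[OF N])
        fix z assume z: "z \<in> carrier B"
        have "z \<odot>\<^bsub>N.TM\<^esub> ?g (?f x) = ?g (?f (z \<odot>\<^bsub>L.TM\<^esub> x))"
          using z x by (simp add: lmod_homD[OF ef(1)] lmod_homD[OF eg(1)])
        then have "counit N (z \<odot>\<^bsub>N.TM\<^esub> ?g (?f x)) = g (f (counit L (z \<odot>\<^bsub>L.TM\<^esub> x)))"
          using z x by (simp add: cf cg L.smult_carrier lmod_homD(1)[OF ef(1)])
        also have "\<dots> = \<zero>\<^bsub>N\<^esub>" using im z x counit(1)[OF L] L.smult_carrier by blast
        finally show "counit N (z \<odot>\<^bsub>N.TM\<^esub> ?g (?f x)) = counit N (z \<odot>\<^bsub>N.TM\<^esub> \<zero>\<^bsub>N.TM\<^esub>)"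
          using z by (simp add: N0 cN0)
      qed (simp_all add: x lmod_homD[OF ef(1)] lmod_homD[OF eg(1)])
      then show "y \<in> {x \<in> carrier M.TM. ?g x = \<zero>\<^bsub>N.TM\<^esub>}" using x by (simp add: lmod_homD[OF ef(1)])
    next
      fix y assume "y \<in> {x \<in> carrier M.TM. ?g x = \<zero>\<^bsub>N.TM\<^esub>}"
      then have y: "y \<in> carrier M.TM" "?g y = \<zero>\<^bsub>N.TM\<^esub>" by auto
      have "\<exists>l. l \<in> carrier L \<and> f l = counit M (c i \<odot>\<^bsub>M.TM\<^esub> y)" if "i \<in> I" for i
      proof -
        have "g (counit M (c i \<odot>\<^bsub>M.TM\<^esub> y)) = \<zero>\<^bsub>N\<^esub>"
          using that y by (simp add: cg[symmetric] M.smult_carrier dual_closed lmod_homD[OF eg(1)] N0 cN0)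
        then have "counit M (c i \<odot>\<^bsub>M.TM\<^esub> y) \<in> f ` carrier L"
          using im that y by (simp add: counit[OF M] M.smult_carrier dual_closed)
        then show ?thesis by auto
      qed
      then obtain l where l: "\<And>i. i \<in> I ==> l i \<in> carrier L \<and> f (l i) = counit M (c i \<odot>\<^bsub>M.TM\<^esub> y)" by metis
      have "?f (\<Oplus>\<^bsub>L.TM\<^esub>i\<in>I. L.pure (b i) (l i)) = (\<Oplus>\<^bsub>M.TM\<^esub>i\<in>I. ?f (L.pure (b i) (l i)))"
        by (rule additive_finsum[OF L.T.abelian_group_axioms M.T.abelian_group_axioms])
          (simp_all add: lmod_homD[OF ef(1)] finite_index L.pure_closed dual_closed l)
      also have "\<dots> = (\<Oplus>\<^bsub>M.TM\<^esub>i\<in>I. M.pure (b i) (counit M (c i \<odot>\<^bsub>M.TM\<^esub> y)))"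
        by (rule M.T.finsum_cong') (simp_all add: ef(2) dual_closed l Pi_def M.pure_closed counit[OF M] M.smult_carrier y)
      also have "\<dots> = y" by (rule expand_pure[OF M y(1)])
      finally show "y \<in> ?f ` carrier L.TM"
        by (intro image_eqI[of _ _ "\<Oplus>\<^bsub>L.TM\<^esub>i\<in>I. L.pure (b i) (l i)"])
          (auto intro!: L.T.finsum_closed simp: L.pure_closed dual_closed l)
    qed
  next
    show "?g ` carrier M.TM = carrier N.TM"
    proof (intro equalityI subsetI)
      fix y assume "y \<in> ?g ` carrier M.TM"
      then show "y \<in> carrier N.TM" by (auto simp: lmod_homD[OF eg(1)])
    next
      fix y assume "y \<in> carrier N.TM"
      then show "y \<in> ?g ` carrier M.TM"
      proof (induction y rule: N.tensor_induct)
        case (pure z n)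
        then obtain m where "m \<in> carrier M" "n = g m" using surj by blast
        then show ?case using pure by (intro image_eqI[of _ _ "M.pure z m"]) (simp_all add: eg(2) M.pure_closed)
      next
        case (add x y)
        then obtain x' y' where "x' \<in> carrier M.TM" "x = ?g x'" "y' \<in> carrier M.TM" "y = ?g y'" by blast
        then show ?case by (intro image_eqI[of _ _ "x' \<oplus>\<^bsub>M.TM\<^esub> y'"]) (simp_all add: lmod_homD[OF eg(1)])
      qed
    qed
  qed
qed

end

section \<open>The two adjunctions\<close>

context ring_extension
begin

text \<open>
  A linear map on \<open>B \<otimes> M\<close> corresponds to its restriction to \<open>1 \<otimes> M\<close>.
\<close>

lemma ext_left_adjoint:
  "adjoint_lmod_functors A B (ext_scalars A B \<phi> :: ('a, 'm) module \<Rightarrow> _) (ext_scalars_map A B \<phi>)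
     (restrict_scalars \<phi> :: ('b, 'n) module \<Rightarrow> _) (\<lambda>_ _ f. f)"
  unfolding adjoint_lmod_functors_def
proof (intro conjI ext_functor res_functor exI[of _ "\<lambda>M N h. \<lambda>m\<in>carrier M. h (tensor_pure A B \<phi> M \<one>\<^bsub>B\<^esub> m)"]
    allI impI)
  fix M :: "('a, 'm) module" and N :: "('b, 'n) module"
  assume "left_module A M \<and> left_module B N"
  then interpret M: tensor_data A M B \<phi> + N: left_module B N by (auto intro: tensor_data)
  let ?\<Phi> = "\<lambda>h. \<lambda>m\<in>carrier M. h (tensor_pure A B \<phi> M \<one>\<^bsub>B\<^esub> m)"
  have scale: "h (M.pure b m) = b \<odot>\<^bsub>N\<^esub> h (M.pure \<one>\<^bsub>B\<^esub> m)"
    if "h \<in> lmod_hom B M.TM N" "b \<in> carrier B" "m \<in> carrier M" for h b m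
    using that by (simp add: lmod_homD(3)[OF that(1), symmetric] M.pure_closed M.smult_pure)
  show "bij_betw ?\<Phi> (lmod_hom B M.TM N) (lmod_hom A M (restrict_scalars \<phi> N))"
  proof (rule bij_betw_imageI)
    show "inj_on ?\<Phi> (lmod_hom B M.TM N)"
    proof (rule inj_onI)
      fix h h' assume h: "h \<in> lmod_hom B M.TM N" "h' \<in> lmod_hom B M.TM N" "?\<Phi> h = ?\<Phi> h'"
      show "h = h'"
      proof (rule extensionalityI[OF lmod_homD(4)[OF h(1)] lmod_homD(4)[OF h(2)]])
        fix x assume "x \<in> carrier M.TM"
        then show "h x = h' x"
        proof (rule M.additive_eqI[where add' = "ring.add N"])
          fix b m assume bm: "b \<in> carrier B" "m \<in> carrier M"
          then have "h (M.pure \<one>\<^bsub>B\<^esub> m) = h' (M.pure \<one>\<^bsub>B\<^esub> m)" using fun_cong[OF h(3), of m] by simp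
          then show "h (M.pure b m) = h' (M.pure b m)" by (simp only: scale[OF h(1) bm] scale[OF h(2) bm])
        qed (simp_all add: lmod_homD[OF h(1)] lmod_homD[OF h(2)])
      qed
    qed
    show "?\<Phi> ` lmod_hom B M.TM N = lmod_hom A M (restrict_scalars \<phi> N)"
    proof (intro equalityI subsetI)
      fix f assume "f \<in> ?\<Phi> ` lmod_hom B M.TM N"
      then obtain h where h: "h \<in> lmod_hom B M.TM N" and f: "f = ?\<Phi> h" by auto
      show "f \<in> lmod_hom A M (restrict_scalars \<phi> N)"
      proof (rule lmod_homI)
        fix a m assume am: "a \<in> carrier A" "m \<in> carrier M"
        have "h (M.pure \<one>\<^bsub>B\<^esub> (a \<odot>\<^bsub>M\<^esub> m)) = h (M.pure (\<phi> a) m)"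
          using am M.pure_balanced[of "\<one>\<^bsub>B\<^esub>" a m] by (simp add: M.phi_closed)
        then show "f (a \<odot>\<^bsub>M\<^esub> m) = a \<odot>\<^bsub>restrict_scalars \<phi> N\<^esub> f m"
          using am scale[OF h M.phi_closed[OF am(1)] am(2)] by (simp add: f M.smult_closed)
      qed (auto simp: f lmod_homD[OF h] M.pure_closed M.pure_add_right)
    next
      fix f assume f: "f \<in> lmod_hom A M (restrict_scalars \<phi> N)"
      have cl: "f m \<in> carrier N" if "m \<in> carrier M" for m
        using lmod_homD(1)[OF f that] by simp
      have "\<exists>h\<in>carrier M.TM \<rightarrow>\<^sub>E carrier N.
         (\<forall>x\<in>carrier M.TM. \<forall>y\<in>carrier M.TM. h (x \<oplus>\<^bsub>M.TM\<^esub> y) = h x \<oplus>\<^bsub>N\<^esub> h y) \<and>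
         (\<forall>b\<in>carrier B. \<forall>m\<in>carrier M. h (M.pure b m) = b \<odot>\<^bsub>N\<^esub> f m)"
        by (rule M.tensor_lift[OF N.M.abelian_group_axioms])
          (simp_all add: cl N.smult_closed N.smult_l_distr N.smult_r_distr lmod_homD(2,3)[OF f] N.smult_assoc
            M.phi_closed)
      then obtain h where h: "h \<in> carrier M.TM \<rightarrow>\<^sub>E carrier N"
         "\<forall>x\<in>carrier M.TM. \<forall>y\<in>carrier M.TM. h (x \<oplus>\<^bsub>M.TM\<^esub> y) = h x \<oplus>\<^bsub>N\<^esub> h y"
         "\<forall>b\<in>carrier B. \<forall>m\<in>carrier M. h (M.pure b m) = b \<odot>\<^bsub>N\<^esub> f m" by blast
      have "h \<in> lmod_hom B M.TM N"
      proof (rule lmod_homI)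
        fix a x assume a: "a \<in> carrier B" and x: "x \<in> carrier M.TM"
        have hcl: "h x \<in> carrier N" if "x \<in> carrier M.TM" for x using h(1) that by (auto simp: PiE_def)
        show "h (a \<odot>\<^bsub>M.TM\<^esub> x) = a \<odot>\<^bsub>N\<^esub> h x"
          using x by (rule M.additive_eqI[where add' = "ring.add N"])
            (simp_all add: a h(2,3) hcl M.smult_add M.smult_carrier N.smult_r_distr M.smult_pure N.smult_assoc cl)
      qed (use h in \<open>auto simp: PiE_def\<close>)
      moreover have "f = ?\<Phi> h"
        by (rule extensionalityI[OF lmod_homD(4)[OF f]]) (simp_all add: h cl N.smult_one)
      ultimately show "f \<in> ?\<Phi> ` lmod_hom B M.TM N" by blast
    qed
  qed
next
  fix M M' :: "('a, 'm) module" and N N' :: "('b, 'n) module" and f g h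
  assume A: "left_module A M \<and> left_module A M' \<and> left_module B N \<and> left_module B N' \<and>
    f \<in> lmod_hom A M' M \<and> g \<in> lmod_hom B N N' \<and> h \<in> lmod_hom B (ext_scalars A B \<phi> M) N"
  then interpret M: tensor_data A M B \<phi> + M': tensor_data A M' B \<phi> by (auto intro: tensor_data)
  have f: "f \<in> lmod_hom A M' M" using A by simp
  note ef = ext_scalars_map_hom[OF M'.tensor_data_axioms M.tensor_data_axioms f]
  show "(\<lambda>m\<in>carrier M'. compose (carrier M'.TM) g (compose (carrier M'.TM) h
           (ext_scalars_map A B \<phi> M' M f)) (M'.pure \<one>\<^bsub>B\<^esub> m)) =
       compose (carrier M') g (compose (carrier M') (\<lambda>m\<in>carrier M. h (M.pure \<one>\<^bsub>B\<^esub> m)) f)"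
    by (rule extensionalityI[of _ "carrier M'"])
      (simp_all add: compose_eq M'.pure_closed ef(2) lmod_homD[OF f])
qed

end

context frobenius_extension
begin

definition coind :: "('b, 'n) module \<Rightarrow> ('a, 'm) module \<Rightarrow> ('n \<Rightarrow> 'm) \<Rightarrow> 'n \<Rightarrow> ('b \<times> 'm \<Rightarrow>\<^sub>0 int) set" where
  "coind N M h = (\<lambda>x\<in>carrier N. \<Oplus>\<^bsub>Ex M\<^esub>i\<in>I. tensor_pure A B \<phi> M (b i) (h (c i \<odot>\<^bsub>N\<^esub> x)))"

text \<open>
  Linearity over \<open>B\<close> cannot be read off from the sum that defines \<open>coind\<close>. By \<open>counit_eqI\<close> it is
  enough to compare the values under the counit, and there \<open>dual_right\<close> collapses the sum: the
  element \<open>coind N M h x\<close>, multiplied by \<open>z\<close>, is sent to \<open>h (z x)\<close>.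
\<close>

lemma coind:
  assumes N: "left_module B N" and M: "left_module A M" and h: "h \<in> lmod_hom A (restrict_scalars \<phi> N) M"
  shows "coind N M h \<in> lmod_hom B N (Ex M)"
    and "x \<in> carrier N ==> counit M (coind N M h x) = h x"
proof -
  interpret M: tensor_data A M B \<phi> by (rule tensor_data) fact
  interpret N: left_module B N by fact
  have hcl: "h x \<in> carrier M" if "x \<in> carrier N" for x using lmod_homD(1)[OF h] that by simp
  have hadd: "h (x \<oplus>\<^bsub>N\<^esub> y) = h x \<oplus>\<^bsub>M\<^esub> h y" if "x \<in> carrier N" "y \<in> carrier N" for x y
    using lmod_homD(2)[OF h] that by simp
  have hs: "h (\<phi> a \<odot>\<^bsub>N\<^esub> x) = a \<odot>\<^bsub>M\<^esub> h x" if "a \<in> carrier A" "x \<in> carrier N" for a x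
    using lmod_homD(3)[OF h] that by simp
  have cl: "coind N M h x \<in> carrier M.TM" if "x \<in> carrier N" for x
    using that by (auto simp: coind_def intro!: M.T.finsum_closed M.pure_closed hcl N.smult_closed dual_closed)
  have key: "counit M (z \<odot>\<^bsub>M.TM\<^esub> coind N M h x) = h (z \<odot>\<^bsub>N\<^esub> x)" if z: "z \<in> carrier B" and x: "x \<in> carrier N" for z x
  proof -
    have "counit M (z \<odot>\<^bsub>M.TM\<^esub> coind N M h x) =
      (\<Oplus>\<^bsub>M\<^esub>i\<in>I. counit M (z \<odot>\<^bsub>M.TM\<^esub> M.pure (b i) (h (c i \<odot>\<^bsub>N\<^esub> x))))"
      unfolding coind_def using x
      by (simp, intro additive_finsum[OF M.T.abelian_group_axioms M.M.abelian_group_axioms, where f = "\<lambda>y. counit M (z \<odot>\<^bsub>M.TM\<^esub> y)"])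
        (simp_all add: z M.smult_carrier M.smult_add counit[OF M] finite_index M.pure_closed hcl N.smult_closed dual_closed)
    also have "\<dots> = (\<Oplus>\<^bsub>M\<^esub>i\<in>I. h ((\<phi> (\<theta> (z \<otimes>\<^bsub>B\<^esub> b i)) \<otimes>\<^bsub>B\<^esub> c i) \<odot>\<^bsub>N\<^esub> x))"
      by (rule M.M.finsum_cong')
        (simp_all add: Pi_def z x dual_closed theta_closed phi_closed counit[OF M] M.smult_pure hcl
          N.smult_closed N.smult_assoc hs M.smult_closed)
    also have "\<dots> = h ((\<Oplus>\<^bsub>B\<^esub>i\<in>I. \<phi> (\<theta> (z \<otimes>\<^bsub>B\<^esub> b i)) \<otimes>\<^bsub>B\<^esub> c i) \<odot>\<^bsub>N\<^esub> x)"
      by (rule additive_finsum[OF B.abelian_group_axioms M.M.abelian_group_axioms, where f = "\<lambda>y. h (y \<odot>\<^bsub>N\<^esub> x)", symmetric])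
        (simp_all add: x hcl N.smult_closed N.smult_l_distr hadd finite_index z dual_closed theta_closed phi_closed)
    finally show ?thesis by (simp add: dual_right z)
  qed
  show "coind N M h \<in> lmod_hom B N M.TM"
  proof (rule lmod_homI)
    fix x y assume xy: "x \<in> carrier N" "y \<in> carrier N"
    show "coind N M h (x \<oplus>\<^bsub>N\<^esub> y) = coind N M h x \<oplus>\<^bsub>M.TM\<^esub> coind N M h y"
      by (rule counit_eqI[OF M])
        (simp_all add: xy cl key M.smult_add counit(2)[OF M] M.smult_carrier N.smult_r_distr hadd N.smult_closed)
  next
    fix a x assume ax: "a \<in> carrier B" "x \<in> carrier N"
    interpret T: left_module B M.TM by (rule M.left_module_ext)
    show "coind N M h (a \<odot>\<^bsub>N\<^esub> x) = a \<odot>\<^bsub>M.TM\<^esub> coind N M h x"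
      by (rule counit_eqI[OF M])
        (simp_all add: ax cl key M.smult_carrier N.smult_closed T.smult_assoc[symmetric] N.smult_assoc[symmetric])
  next
    show "coind N M h \<in> extensional (carrier N)" by (simp add: coind_def)
  qed (rule cl)
  show "counit M (coind N M h x) = h x" if x: "x \<in> carrier N"
  proof -
    interpret T: left_module B M.TM by (rule M.left_module_ext)
    show ?thesis using key[of "\<one>\<^bsub>B\<^esub>" x] x by (simp add: T.smult_one cl N.smult_one)
  qed
qed

text \<open>
  The inverse of \<open>coind\<close> is composition with the counit.
\<close>

lemma ext_right_adjoint:
  "adjoint_lmod_functors B A (restrict_scalars \<phi> :: ('b, 'n) module \<Rightarrow> _) (\<lambda>_ _ f. f)
     (Ex :: ('a, 'm) module \<Rightarrow> _) (ext_scalars_map A B \<phi>)"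
  unfolding adjoint_lmod_functors_def
proof (intro conjI ext_functor res_functor exI[of _ coind] allI impI)
  fix N :: "('b, 'n) module" and M :: "('a, 'm) module"
  assume "left_module B N \<and> left_module A M"
  then have N: "left_module B N" and M: "left_module A M" by auto
  interpret M: tensor_data A M B \<phi> by (rule tensor_data) fact
  interpret N: left_module B N by fact
  show "bij_betw (coind N M) (lmod_hom A (restrict_scalars \<phi> N) M) (lmod_hom B N (Ex M))"
  proof (rule bij_betwI[where g = "\<lambda>k. compose (carrier N) (counit M) k"])
    show "coind N M \<in> lmod_hom A (restrict_scalars \<phi> N) M \<rightarrow> lmod_hom B N (Ex M)"
      using coind(1)[OF N M] by auto
    show "(\<lambda>k. compose (carrier N) (counit M) k) \<in> lmod_hom B N (Ex M) \<rightarrow> lmod_hom A (restrict_scalars \<phi> N) M"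
    proof
      fix k assume k: "k \<in> lmod_hom B N (Ex M)"
      show "compose (carrier N) (counit M) k \<in> lmod_hom A (restrict_scalars \<phi> N) M"
        by (rule lmod_homI)
          (simp_all add: compose_eq lmod_homD[OF k] counit[OF M] counit_smult[OF M] phi_closed N.smult_closed)
    qed
    show "compose (carrier N) (counit M) (coind N M h) = h" if h: "h \<in> lmod_hom A (restrict_scalars \<phi> N) M" for h
      using lmod_homD(4)[OF h]
      by (intro extensionalityI[of _ "carrier N"]) (simp_all add: compose_eq coind(2)[OF N M h])
    show "coind N M (compose (carrier N) (counit M) k) = k" if k: "k \<in> lmod_hom B N (Ex M)" for k
    proof (rule extensionalityI[of _ "carrier N"])
      fix x assume x: "x \<in> carrier N"
      have "coind N M (compose (carrier N) (counit M) k) x =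
        (\<Oplus>\<^bsub>Ex M\<^esub>i\<in>I. tensor_pure A B \<phi> M (b i) (counit M (c i \<odot>\<^bsub>Ex M\<^esub> k x)))"
        unfolding coind_def using x
        by (simp, intro M.T.finsum_cong')
          (simp_all add: Pi_def compose_eq N.smult_closed dual_closed M.pure_closed counit[OF M] M.smult_carrier lmod_homD[OF k])
      then show "coind N M (compose (carrier N) (counit M) k) x = k x"
        using x by (simp add: expand_pure[OF M] lmod_homD[OF k])
    qed (simp_all add: coind_def lmod_homD(4)[OF k])
  qed
next
  fix N N' :: "('b, 'n) module" and M M' :: "('a, 'm) module" and f g h
  assume A: "left_module B N \<and> left_module B N' \<and> left_module A M \<and> left_module A M' \<and>
    f \<in> lmod_hom B N' N \<and> g \<in> lmod_hom A M M' \<and> h \<in> lmod_hom A (restrict_scalars \<phi> N) M"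
  then interpret M: tensor_data A M B \<phi> + M': tensor_data A M' B \<phi> + N: left_module B N + N': left_module B N'
    by (auto intro: tensor_data)
  have f: "f \<in> lmod_hom B N' N" and g: "g \<in> lmod_hom A M M'" and h: "h \<in> lmod_hom A (restrict_scalars \<phi> N) M"
    using A by auto
  have hcl: "h x \<in> carrier M" if "x \<in> carrier N" for x using lmod_homD(1)[OF h] that by simp
  note eg = ext_scalars_map_hom[OF M.tensor_data_axioms M'.tensor_data_axioms g]
  show "coind N' M' (compose (carrier (restrict_scalars \<phi> N')) g (compose (carrier (restrict_scalars \<phi> N')) h f)) =
    compose (carrier N') (ext_scalars_map A B \<phi> M M' g) (compose (carrier N') (coind N M h) f)"
  proof (rule extensionalityI[of _ "carrier N'"])
    fix x assume x: "x \<in> carrier N'"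
    have "ext_scalars_map A B \<phi> M M' g (\<Oplus>\<^bsub>M.TM\<^esub>i\<in>I. M.pure (b i) (h (c i \<odot>\<^bsub>N\<^esub> f x))) =
      (\<Oplus>\<^bsub>M'.TM\<^esub>i\<in>I. ext_scalars_map A B \<phi> M M' g (M.pure (b i) (h (c i \<odot>\<^bsub>N\<^esub> f x))))"
      by (rule additive_finsum[OF M.T.abelian_group_axioms M'.T.abelian_group_axioms])
        (simp_all add: lmod_homD[OF eg(1)] finite_index M.pure_closed dual_closed hcl N.smult_closed lmod_homD[OF f] x)
    also have "\<dots> = (\<Oplus>\<^bsub>M'.TM\<^esub>i\<in>I. M'.pure (b i) (g (h (f (c i \<odot>\<^bsub>N'\<^esub> x)))))"
      by (rule M'.T.finsum_cong')
        (simp_all add: Pi_def eg(2) dual_closed hcl N.smult_closed lmod_homD[OF f] x M'.pure_closed lmod_homD[OF g])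
    finally show "coind N' M' (compose (carrier (restrict_scalars \<phi> N')) g (compose (carrier (restrict_scalars \<phi> N')) h f)) x =
      compose (carrier N') (ext_scalars_map A B \<phi> M M' g) (compose (carrier N') (coind N M h) f) x"
      using x
      by (simp add: compose_eq coind_def lmod_homD[OF f])
        (rule M'.T.finsum_cong', simp_all add: Pi_def compose_eq N'.smult_closed dual_closed M'.pure_closed
          lmod_homD(1,3)[OF f] lmod_homD(1)[OF g] hcl N.smult_closed)
  qed (simp_all add: coind_def)
qed

end

section \<open>Duality over a Frobenius extension\<close>

lemma regular_module_sel [simp]:
  "carrier (regular_module R) = carrier R"
  "ring.add (regular_module R) = ring.add R"
  "ring.zero (regular_module R) = ring.zero R"
  "module.smult (regular_module R) = monoid.mult R"
  by (simp_all add: regular_module_def)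

locale algebra_involution = A: ring A + R: cring R
  for A :: "'a ring" and R :: "'r ring" and \<sigma> :: "'r \<Rightarrow> 'a" and \<tau> :: "'a \<Rightarrow> 'a" +
  assumes sigma_hom: "\<sigma> \<in> ring_hom R A"
    and sigma_central: "s \<in> carrier R ==> x \<in> carrier A ==> \<sigma> s \<otimes>\<^bsub>A\<^esub> x = x \<otimes>\<^bsub>A\<^esub> \<sigma> s"
    and tau_closed: "x \<in> carrier A ==> \<tau> x \<in> carrier A"
    and tau_add: "x \<in> carrier A ==> y \<in> carrier A ==> \<tau> (x \<oplus>\<^bsub>A\<^esub> y) = \<tau> x \<oplus>\<^bsub>A\<^esub> \<tau> y"
    and tau_mult: "x \<in> carrier A ==> y \<in> carrier A ==> \<tau> (x \<otimes>\<^bsub>A\<^esub> y) = \<tau> y \<otimes>\<^bsub>A\<^esub> \<tau> x"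
    and tau_one: "\<tau> \<one>\<^bsub>A\<^esub> = \<one>\<^bsub>A\<^esub>"
    and tau_tau: "x \<in> carrier A ==> \<tau> (\<tau> x) = x"
begin

lemma sigma_closed: "s \<in> carrier R ==> \<sigma> s \<in> carrier A"
  using sigma_hom by (rule ring_hom_closed)

abbreviation Du where "Du \<equiv> twisted_dual R \<sigma> \<tau>"

lemma dual_sel:
  "ring.zero (Du M) = (\<lambda>m\<in>carrier M. \<zero>\<^bsub>R\<^esub>)"
  "f \<oplus>\<^bsub>Du M\<^esub> g = (\<lambda>m\<in>carrier M. f m \<oplus>\<^bsub>R\<^esub> g m)"
  "a \<odot>\<^bsub>Du M\<^esub> f = (\<lambda>m\<in>carrier M. f (\<tau> a \<odot>\<^bsub>M\<^esub> m))"
  by (simp_all add: twisted_dual_def)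

lemma dualD:
  assumes "f \<in> carrier (Du M)"
  shows "x \<in> carrier M ==> f x \<in> carrier R"
    and "x \<in> carrier M ==> y \<in> carrier M ==> f (x \<oplus>\<^bsub>M\<^esub> y) = f x \<oplus>\<^bsub>R\<^esub> f y"
    and "s \<in> carrier R ==> x \<in> carrier M ==> f (\<sigma> s \<odot>\<^bsub>M\<^esub> x) = s \<otimes>\<^bsub>R\<^esub> f x"
    and "f \<in> extensional (carrier M)"
    and "f \<in> carrier M \<rightarrow> carrier R"
proof -
  have "f \<in> lmod_hom R (restrict_scalars \<sigma> M) (regular_module R)"
    using assms by (simp add: twisted_dual_def)
  from lmod_homD[OF this] show
    "x \<in> carrier M ==> f x \<in> carrier R"
    "x \<in> carrier M ==> y \<in> carrier M ==> f (x \<oplus>\<^bsub>M\<^esub> y) = f x \<oplus>\<^bsub>R\<^esub> f y"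
    "s \<in> carrier R ==> x \<in> carrier M ==> f (\<sigma> s \<odot>\<^bsub>M\<^esub> x) = s \<otimes>\<^bsub>R\<^esub> f x"
    "f \<in> extensional (carrier M)"
    "f \<in> carrier M \<rightarrow> carrier R" by simp_all
qed

lemma dualI:
  assumes "\<And>x. x \<in> carrier M ==> f x \<in> carrier R"
    and "\<And>x y. x \<in> carrier M ==> y \<in> carrier M ==> f (x \<oplus>\<^bsub>M\<^esub> y) = f x \<oplus>\<^bsub>R\<^esub> f y"
    and "\<And>s x. s \<in> carrier R ==> x \<in> carrier M ==> f (\<sigma> s \<odot>\<^bsub>M\<^esub> x) = s \<otimes>\<^bsub>R\<^esub> f x"
    and "f \<in> extensional (carrier M)"
  shows "f \<in> carrier (Du M)"
proof -
  have "f \<in> lmod_hom R (restrict_scalars \<sigma> M) (regular_module R)"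
    by (rule lmod_homI) (simp_all add: assms)
  then show ?thesis by (simp add: twisted_dual_def)
qed

lemma dual_eqI:
  assumes "f \<in> carrier (Du M)" "g \<in> carrier (Du M)" "\<And>x. x \<in> carrier M ==> f x = g x"
  shows "f = g"
  by (rule extensionalityI[OF dualD(4)[OF assms(1)] dualD(4)[OF assms(2)] assms(3)])

lemma left_module_dual:
  assumes "left_module A M"
  shows "left_module A (Du M)"
proof -
  interpret M: left_module A M by fact
  have add: "f \<oplus>\<^bsub>Du M\<^esub> g \<in> carrier (Du M)" if "f \<in> carrier (Du M)" "g \<in> carrier (Du M)" for f g
    by (rule dualI)
      (simp_all add: dual_sel dualD[OF that(1)] dualD[OF that(2)] R.a_ac R.r_distr M.smult_closed sigma_closed)
  have smult: "a \<odot>\<^bsub>Du M\<^esub> f \<in> carrier (Du M)" if a: "a \<in> carrier A" and f: "f \<in> carrier (Du M)" for a f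
  proof (rule dualI)
    fix s x assume sx: "s \<in> carrier R" "x \<in> carrier M"
    have "\<tau> a \<odot>\<^bsub>M\<^esub> (\<sigma> s \<odot>\<^bsub>M\<^esub> x) = \<sigma> s \<odot>\<^bsub>M\<^esub> (\<tau> a \<odot>\<^bsub>M\<^esub> x)"
      using sx a by (simp add: M.smult_assoc[symmetric] tau_closed sigma_closed sigma_central)
    then show "(a \<odot>\<^bsub>Du M\<^esub> f) (\<sigma> s \<odot>\<^bsub>M\<^esub> x) = s \<otimes>\<^bsub>R\<^esub> (a \<odot>\<^bsub>Du M\<^esub> f) x"
      using sx a by (simp add: dual_sel M.smult_closed sigma_closed tau_closed dualD[OF f])
  qed (simp_all add: dual_sel dualD[OF f] a tau_closed M.smult_closed M.smult_r_distr)
  have ab: "abelian_group (Du M)"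
  proof (rule abelian_groupI)
    show "\<zero>\<^bsub>Du M\<^esub> \<in> carrier (Du M)"
      by (rule dualI) (simp_all add: dual_sel M.smult_closed sigma_closed)
  next
    fix f g h assume f: "f \<in> carrier (Du M)" and g: "g \<in> carrier (Du M)" and h: "h \<in> carrier (Du M)"
    show "f \<oplus>\<^bsub>Du M\<^esub> g \<oplus>\<^bsub>Du M\<^esub> h = f \<oplus>\<^bsub>Du M\<^esub> (g \<oplus>\<^bsub>Du M\<^esub> h)"
      by (rule dual_eqI[where M = M]) (simp_all add: add f g h, simp add: dual_sel dualD[OF f] dualD[OF g] dualD[OF h] R.a_assoc)
  next
    fix f g assume f: "f \<in> carrier (Du M)" and g: "g \<in> carrier (Du M)"
    show "f \<oplus>\<^bsub>Du M\<^esub> g = g \<oplus>\<^bsub>Du M\<^esub> f"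
      by (rule dual_eqI[where M = M]) (simp_all add: add f g, simp add: dual_sel dualD[OF f] dualD[OF g] R.a_comm)
  next
    fix f assume f: "f \<in> carrier (Du M)"
    have z: "\<zero>\<^bsub>Du M\<^esub> \<in> carrier (Du M)"
      by (rule dualI) (simp_all add: dual_sel M.smult_closed sigma_closed)
    show "\<zero>\<^bsub>Du M\<^esub> \<oplus>\<^bsub>Du M\<^esub> f = f"
      by (rule dual_eqI[where M = M]) (simp_all add: add f z, simp add: dual_sel dualD[OF f])
    have n: "(\<lambda>m\<in>carrier M. \<ominus>\<^bsub>R\<^esub> f m) \<in> carrier (Du M)"
      by (rule dualI) (simp_all add: dualD[OF f] R.minus_add R.r_minus M.smult_closed sigma_closed)
    have "(\<lambda>m\<in>carrier M. \<ominus>\<^bsub>R\<^esub> f m) \<oplus>\<^bsub>Du M\<^esub> f = \<zero>\<^bsub>Du M\<^esub>"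
      by (rule dual_eqI[where M = M]) (simp_all add: add f z n, simp add: dual_sel dualD[OF f] R.l_neg)
    with n show "\<exists>g\<in>carrier (Du M). g \<oplus>\<^bsub>Du M\<^esub> f = \<zero>\<^bsub>Du M\<^esub>" by blast
  qed (rule add)
  show ?thesis
  proof (intro left_module.intro left_module_axioms.intro A.ring_axioms ab smult)
    fix a b f assume ab: "a \<in> carrier A" "b \<in> carrier A" and f: "f \<in> carrier (Du M)"
    show "(a \<oplus>\<^bsub>A\<^esub> b) \<odot>\<^bsub>Du M\<^esub> f = a \<odot>\<^bsub>Du M\<^esub> f \<oplus>\<^bsub>Du M\<^esub> b \<odot>\<^bsub>Du M\<^esub> f"
      by (rule dual_eqI[where M = M])
        (simp_all add: add smult ab f, simp add: dual_sel ab tau_closed tau_add M.smult_closed M.smult_l_distr dualD[OF f])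
    show "(a \<otimes>\<^bsub>A\<^esub> b) \<odot>\<^bsub>Du M\<^esub> f = a \<odot>\<^bsub>Du M\<^esub> (b \<odot>\<^bsub>Du M\<^esub> f)"
      by (rule dual_eqI[where M = M])
        (simp_all add: smult ab f, simp add: dual_sel ab tau_closed tau_mult M.smult_closed M.smult_assoc)
  next
    fix a f g assume a: "a \<in> carrier A" and f: "f \<in> carrier (Du M)" and g: "g \<in> carrier (Du M)"
    show "a \<odot>\<^bsub>Du M\<^esub> (f \<oplus>\<^bsub>Du M\<^esub> g) = a \<odot>\<^bsub>Du M\<^esub> f \<oplus>\<^bsub>Du M\<^esub> a \<odot>\<^bsub>Du M\<^esub> g"
      by (rule dual_eqI[where M = M]) (simp_all add: add smult a f g, simp add: dual_sel a tau_closed M.smult_closed)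
  next
    fix f assume f: "f \<in> carrier (Du M)"
    show "\<one>\<^bsub>A\<^esub> \<odot>\<^bsub>Du M\<^esub> f = f"
      by (rule dual_eqI[where M = M]) (simp_all add: smult f, simp add: dual_sel tau_one M.smult_one)
  qed auto
qed

lemma dual_map_hom:
  assumes "left_module A M" "left_module A N" and f: "f \<in> lmod_hom A M N"
  shows "twisted_dual_map R \<sigma> \<tau> M N f \<in> lmod_hom A (Du N) (Du M)"
proof -
  interpret M: left_module A M by fact
  interpret N: left_module A N by fact
  have cl: "compose (carrier M) h f \<in> carrier (Du M)" if h: "h \<in> carrier (Du N)" for h
    by (rule dualI)
      (simp_all add: compose_eq dualD[OF h] lmod_homD[OF f] M.smult_closed sigma_closed)
  interpret DM: left_module A "Du M" by (rule left_module_dual) fact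
  interpret DN: left_module A "Du N" by (rule left_module_dual) fact
  show ?thesis
  proof (rule lmod_homI)
    fix h h' assume h: "h \<in> carrier (Du N)" "h' \<in> carrier (Du N)"
    show "twisted_dual_map R \<sigma> \<tau> M N f (h \<oplus>\<^bsub>Du N\<^esub> h') =
      twisted_dual_map R \<sigma> \<tau> M N f h \<oplus>\<^bsub>Du M\<^esub> twisted_dual_map R \<sigma> \<tau> M N f h'"
      using h DN.M.a_closed[OF h]
      by (intro dual_eqI[where M = M])
        (simp_all add: twisted_dual_map_def cl, simp add: dual_sel compose_eq lmod_homD[OF f])
  next
    fix a h assume h: "a \<in> carrier A" "h \<in> carrier (Du N)"
    show "twisted_dual_map R \<sigma> \<tau> M N f (a \<odot>\<^bsub>Du N\<^esub> h) = a \<odot>\<^bsub>Du M\<^esub> twisted_dual_map R \<sigma> \<tau> M N f h"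
      using h DN.smult_closed[OF h]
      by (intro dual_eqI[where M = M])
        (simp_all add: twisted_dual_map_def cl DM.smult_closed,
          simp add: dual_sel compose_eq lmod_homD[OF f] tau_closed M.smult_closed)
  qed (simp_all add: twisted_dual_map_def cl)
qed

end

locale frobenius_duality =
  frobenius_extension A B \<phi> \<theta> I b c + DA: algebra_involution A R \<sigma> \<tau> + DB: algebra_involution B R \<sigma>' \<tau>'
  for A :: "'a ring" and B :: "'b ring" and \<phi> and \<theta> and I :: "'i set" and b c
    and R :: "'r ring" and \<sigma> \<tau> \<sigma>' \<tau>' +
  assumes phi_sigma: "s \<in> carrier R ==> \<phi> (\<sigma> s) = \<sigma>' s"
    and tau_phi: "a \<in> carrier A ==> \<tau>' (\<phi> a) = \<phi> (\<tau> a)"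
begin

text \<open>
  The value of the comparison map at the pure tensor of \<open>y\<close> and \<open>f\<close>. It is balanced since \<open>\<tau>\<close> turns
  the right multiplication of \<open>y\<close> by \<open>\<phi> a\<close> into a left multiplication, which the counit carries to
  \<open>f\<close>.
\<close>

definition dual_pairing where
  "dual_pairing M y f = (\<lambda>t\<in>carrier (Ex M). f (counit M (\<tau>' y \<odot>\<^bsub>Ex M\<^esub> t)))"

lemma dual_pairing:
  assumes M: "left_module A M" and y: "y \<in> carrier B" and f: "f \<in> carrier (DA.Du M)"
  shows "dual_pairing M y f \<in> carrier (DB.Du (Ex M))"
proof -
  interpret M: tensor_data A M B \<phi> by (rule tensor_data) fact
  interpret T: left_module B M.TM by (rule M.left_module_ext)
  show ?thesis
  proof (rule DB.dualI)
    fix s x assume sx: "s \<in> carrier R" "x \<in> carrier M.TM"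
    have "\<tau>' y \<odot>\<^bsub>M.TM\<^esub> (\<sigma>' s \<odot>\<^bsub>M.TM\<^esub> x) = \<phi> (\<sigma> s) \<odot>\<^bsub>M.TM\<^esub> (\<tau>' y \<odot>\<^bsub>M.TM\<^esub> x)"
      using sx y by (simp add: T.smult_assoc[symmetric] DB.tau_closed DB.sigma_closed DB.sigma_central phi_sigma)
    then show "dual_pairing M y f (\<sigma>' s \<odot>\<^bsub>M.TM\<^esub> x) = s \<otimes>\<^bsub>R\<^esub> dual_pairing M y f x"
      using sx y by (simp add: dual_pairing_def T.smult_closed DB.sigma_closed DB.tau_closed DA.sigma_closed
          counit_smult[OF M] counit[OF M] DA.dualD[OF f])
  qed (simp_all add: dual_pairing_def y DB.tau_closed T.smult_closed T.smult_r_distr counit[OF M] DA.dualD[OF f])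
qed

lemma dual_comparison_exists:
  assumes M: "left_module A M"
  shows "\<exists>h \<in> carrier (Ex (DA.Du M)) \<rightarrow>\<^sub>E carrier (DB.Du (Ex M)).
     (\<forall>x\<in>carrier (Ex (DA.Du M)). \<forall>y\<in>carrier (Ex (DA.Du M)). h (x \<oplus>\<^bsub>Ex (DA.Du M)\<^esub> y) = h x \<oplus>\<^bsub>DB.Du (Ex M)\<^esub> h y) \<and>
     (\<forall>y\<in>carrier B. \<forall>f\<in>carrier (DA.Du M). h (tensor_pure A B \<phi> (DA.Du M) y f) = dual_pairing M y f)"
proof -
  interpret M: tensor_data A M B \<phi> by (rule tensor_data) fact
  interpret T: left_module B M.TM by (rule M.left_module_ext)
  interpret D: tensor_data A "DA.Du M" B \<phi> by (rule tensor_data) (rule DA.left_module_dual, fact)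
  interpret DT: left_module B "DB.Du M.TM" by (rule DB.left_module_dual, rule M.left_module_ext)
  show ?thesis
  proof (rule D.tensor_lift[OF DT.M.abelian_group_axioms])
    show "dual_pairing M y f \<in> carrier (DB.Du (Ex M))" if "y \<in> carrier B" "f \<in> carrier (DA.Du M)" for y f
      by (rule dual_pairing[OF M that])
    show "dual_pairing M (y \<oplus>\<^bsub>B\<^esub> y') f = dual_pairing M y f \<oplus>\<^bsub>DB.Du (Ex M)\<^esub> dual_pairing M y' f"
      if "y \<in> carrier B" "y' \<in> carrier B" "f \<in> carrier (DA.Du M)" for y y' f
      using that
      by (intro DB.dual_eqI[where M = "Ex M"] dual_pairing[OF M] DT.M.a_closed)
        (simp_all add: DB.dual_sel dual_pairing_def DB.tau_add DB.tau_closed T.smult_l_distr T.smult_closed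
          counit[OF M] DA.dualD[OF that(3)])
    show "dual_pairing M y (f \<oplus>\<^bsub>DA.Du M\<^esub> g) = dual_pairing M y f \<oplus>\<^bsub>DB.Du (Ex M)\<^esub> dual_pairing M y g"
      if "y \<in> carrier B" "f \<in> carrier (DA.Du M)" "g \<in> carrier (DA.Du M)" for y f g
      using that
      by (intro DB.dual_eqI[where M = "Ex M"] dual_pairing[OF M] DT.M.a_closed D.M.a_closed)
        (simp_all add: DB.dual_sel DA.dual_sel dual_pairing_def DB.tau_closed T.smult_closed counit[OF M])
    show "dual_pairing M (y \<otimes>\<^bsub>B\<^esub> \<phi> a) f = dual_pairing M y (a \<odot>\<^bsub>DA.Du M\<^esub> f)"
      if "y \<in> carrier B" "a \<in> carrier A" "f \<in> carrier (DA.Du M)" for y a f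
      using that
      by (intro DB.dual_eqI[where M = "Ex M"] dual_pairing[OF M] D.smult_closed B.m_closed phi_closed)
        (simp_all add: DA.dual_sel dual_pairing_def DB.tau_closed T.smult_closed counit[OF M] DB.tau_mult tau_phi
          phi_closed T.smult_assoc DA.tau_closed counit_smult[OF M])
  qed
qed

definition dual_comparison where
  "dual_comparison M = (SOME h. h \<in> carrier (Ex (DA.Du M)) \<rightarrow>\<^sub>E carrier (DB.Du (Ex M)) \<and>
     (\<forall>x\<in>carrier (Ex (DA.Du M)). \<forall>y\<in>carrier (Ex (DA.Du M)). h (x \<oplus>\<^bsub>Ex (DA.Du M)\<^esub> y) = h x \<oplus>\<^bsub>DB.Du (Ex M)\<^esub> h y) \<and>
     (\<forall>y\<in>carrier B. \<forall>f\<in>carrier (DA.Du M). h (tensor_pure A B \<phi> (DA.Du M) y f) = dual_pairing M y f))"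

lemma dual_comparison:
  assumes M: "left_module A M"
  shows "x \<in> carrier (Ex (DA.Du M)) ==> dual_comparison M x \<in> carrier (DB.Du (Ex M))"
    and "x \<in> carrier (Ex (DA.Du M)) ==> y \<in> carrier (Ex (DA.Du M)) ==> dual_comparison M (x \<oplus>\<^bsub>Ex (DA.Du M)\<^esub> y) =
      dual_comparison M x \<oplus>\<^bsub>DB.Du (Ex M)\<^esub> dual_comparison M y"
    and "z \<in> carrier B ==> f \<in> carrier (DA.Du M) ==> t \<in> carrier (Ex M) ==>
      dual_comparison M (tensor_pure A B \<phi> (DA.Du M) z f) t = f (counit M (\<tau>' z \<odot>\<^bsub>Ex M\<^esub> t))"
    and "dual_comparison M \<in> extensional (carrier (Ex (DA.Du M)))"
  using someI_ex[OF dual_comparison_exists[OF M, unfolded Bex_def], folded dual_comparison_def]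
  by (auto simp: PiE_def Pi_def dual_pairing_def)

lemma dual_comparison_hom:
  assumes M: "left_module A M"
  shows "dual_comparison M \<in> lmod_hom B (Ex (DA.Du M)) (DB.Du (Ex M))"
proof -
  interpret M: tensor_data A M B \<phi> by (rule tensor_data) fact
  interpret T: left_module B M.TM by (rule M.left_module_ext)
  interpret D: tensor_data A "DA.Du M" B \<phi> by (rule tensor_data) (rule DA.left_module_dual, fact)
  interpret DT: left_module B "DB.Du M.TM" by (rule DB.left_module_dual, rule M.left_module_ext)
  show ?thesis
  proof (rule lmod_homI)
    fix a x assume a: "a \<in> carrier B" and x: "x \<in> carrier D.TM"
    show "dual_comparison M (a \<odot>\<^bsub>D.TM\<^esub> x) = a \<odot>\<^bsub>DB.Du M.TM\<^esub> dual_comparison M x"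
      using x
    proof (rule D.additive_eqI[where add' = "ring.add (DB.Du M.TM)"])
      fix z f assume zf: "z \<in> carrier B" "f \<in> carrier (DA.Du M)"
      show "dual_comparison M (a \<odot>\<^bsub>D.TM\<^esub> D.pure z f) = a \<odot>\<^bsub>DB.Du M.TM\<^esub> dual_comparison M (D.pure z f)"
        using zf a
        by (intro DB.dual_eqI[where M = M.TM])
          (simp_all add: D.smult_pure D.pure_closed dual_comparison[OF M] DT.smult_closed,
            simp add: DB.dual_sel T.smult_closed DB.tau_closed dual_comparison[OF M] DB.tau_mult T.smult_assoc)
    qed (simp_all add: a D.smult_add dual_comparison[OF M] D.smult_carrier DT.smult_r_distr)
  qed (simp_all add: dual_comparison[OF M])
qed

text \<open>
  The inverse of the comparison map sends \<open>g\<close> to the sum of the tensors of \<open>\<tau>' (c i)\<close> and these forms.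
\<close>

definition dual_component where
  "dual_component M g i = (\<lambda>m\<in>carrier M. g (tensor_pure A B \<phi> M (b i) m))"

lemma dual_component_apply: "m \<in> carrier M ==> dual_component M g i m = g (tensor_pure A B \<phi> M (b i) m)"
  by (simp add: dual_component_def)

lemma dual_component:
  assumes M: "left_module A M" and g: "g \<in> carrier (DB.Du (Ex M))" and i: "i \<in> I"
  shows "dual_component M g i \<in> carrier (DA.Du M)"
proof -
  interpret M: tensor_data A M B \<phi> by (rule tensor_data) fact
  show ?thesis
  proof (rule DA.dualI)
    fix s m assume sm: "s \<in> carrier R" "m \<in> carrier M"
    have "M.pure (b i) (\<sigma> s \<odot>\<^bsub>M\<^esub> m) = \<sigma>' s \<odot>\<^bsub>M.TM\<^esub> M.pure (b i) m"
      using sm i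
      by (simp add: M.pure_balanced[symmetric] dual_closed DA.sigma_closed phi_sigma M.smult_pure DB.sigma_closed
          DB.sigma_central)
    then show "dual_component M g i (\<sigma> s \<odot>\<^bsub>M\<^esub> m) = s \<otimes>\<^bsub>R\<^esub> dual_component M g i m"
      using sm i by (simp add: dual_component_def M.smult_closed DA.sigma_closed DB.dualD[OF g] M.pure_closed dual_closed)
  qed (simp_all add: dual_component_def i DB.dualD[OF g] M.pure_closed dual_closed M.pure_add_right)
qed

text \<open>
  On the pure tensor of \<open>y\<close> and \<open>f\<close> the forms \<open>dual_component\<close> are multiples of \<open>f\<close>. Moved to the
  other factor, the multiples form the expansion \<open>dual_right\<close> of \<open>\<tau>' y\<close>.
\<close>

lemma dual_comparison_left_inverse:
  assumes M: "left_module A M" and x: "x \<in> carrier (Ex (DA.Du M))"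
  shows "(\<Oplus>\<^bsub>Ex (DA.Du M)\<^esub>i\<in>I. tensor_pure A B \<phi> (DA.Du M) (\<tau>' (c i)) (dual_component M (dual_comparison M x) i)) = x"
proof -
  interpret M: tensor_data A M B \<phi> by (rule tensor_data) fact
  interpret T: left_module B M.TM by (rule M.left_module_ext)
  interpret D: tensor_data A "DA.Du M" B \<phi> by (rule tensor_data) (rule DA.left_module_dual, fact)
  interpret DT: left_module B "DB.Du M.TM" by (rule DB.left_module_dual, rule M.left_module_ext)
  note cl = D.pure_closed DB.tau_closed dual_closed dual_component[OF M] dual_comparison[OF M]
  show ?thesis using x
  proof (rule D.additive_eqI[where add' = "ring.add D.TM"])
    fix x y assume xy: "x \<in> carrier D.TM" "y \<in> carrier D.TM"
    have "dual_component M (dual_comparison M (x \<oplus>\<^bsub>D.TM\<^esub> y)) i =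
        dual_component M (dual_comparison M x) i \<oplus>\<^bsub>DA.Du M\<^esub> dual_component M (dual_comparison M y) i" if "i \<in> I" for i
      using that xy
      by (intro DA.dual_eqI[where M = M])
        (simp_all add: cl, simp add: DA.dual_sel DB.dual_sel dual_component_def dual_comparison(2)[OF M] M.pure_closed dual_closed)
    then have "(\<Oplus>\<^bsub>D.TM\<^esub>i\<in>I. D.pure (\<tau>' (c i)) (dual_component M (dual_comparison M (x \<oplus>\<^bsub>D.TM\<^esub> y)) i)) =
      (\<Oplus>\<^bsub>D.TM\<^esub>i\<in>I. D.pure (\<tau>' (c i)) (dual_component M (dual_comparison M x) i) \<oplus>\<^bsub>D.TM\<^esub>
         D.pure (\<tau>' (c i)) (dual_component M (dual_comparison M y) i))"
      using xy by (intro D.T.finsum_cong') (simp_all add: Pi_def D.pure_closed DB.tau_closed dual_closed dual_component[OF M]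
          dual_comparison(1)[OF M] D.pure_add_right)
    also have "\<dots> = (\<Oplus>\<^bsub>D.TM\<^esub>i\<in>I. D.pure (\<tau>' (c i)) (dual_component M (dual_comparison M x) i)) \<oplus>\<^bsub>D.TM\<^esub>
        (\<Oplus>\<^bsub>D.TM\<^esub>i\<in>I. D.pure (\<tau>' (c i)) (dual_component M (dual_comparison M y) i))"
      using xy by (intro D.T.finsum_addf) (simp_all add: Pi_def cl)
    finally show "(\<Oplus>\<^bsub>D.TM\<^esub>i\<in>I. D.pure (\<tau>' (c i)) (dual_component M (dual_comparison M (x \<oplus>\<^bsub>D.TM\<^esub> y)) i)) =
        (\<Oplus>\<^bsub>D.TM\<^esub>i\<in>I. D.pure (\<tau>' (c i)) (dual_component M (dual_comparison M x) i)) \<oplus>\<^bsub>D.TM\<^esub>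
        (\<Oplus>\<^bsub>D.TM\<^esub>i\<in>I. D.pure (\<tau>' (c i)) (dual_component M (dual_comparison M y) i))" .
  next
    fix y f assume y: "y \<in> carrier B" and f: "f \<in> carrier (DA.Du M)"
    have "dual_component M (dual_comparison M (D.pure y f)) i = \<tau> (\<theta> (\<tau>' y \<otimes>\<^bsub>B\<^esub> b i)) \<odot>\<^bsub>DA.Du M\<^esub> f" if i: "i \<in> I" for i
      using i y f
      by (intro DA.dual_eqI[where M = M])
        (simp_all add: cl D.smult_closed DA.tau_closed theta_closed,
          simp add: DA.dual_sel dual_component_def dual_comparison(3)[OF M] M.pure_closed dual_closed
            M.smult_pure DB.tau_closed counit[OF M] DA.tau_tau theta_closed)
    then have "(\<Oplus>\<^bsub>D.TM\<^esub>i\<in>I. D.pure (\<tau>' (c i)) (dual_component M (dual_comparison M (D.pure y f)) i)) =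
      (\<Oplus>\<^bsub>D.TM\<^esub>i\<in>I. D.pure (\<tau>' (\<phi> (\<theta> (\<tau>' y \<otimes>\<^bsub>B\<^esub> b i)) \<otimes>\<^bsub>B\<^esub> c i)) f)"
      using y f
      by (intro D.T.finsum_cong')
        (simp_all add: Pi_def D.pure_closed DB.tau_closed dual_closed theta_closed phi_closed DB.tau_mult tau_phi D.pure_balanced DA.tau_closed D.smult_closed)
    also have "\<dots> = D.pure (\<tau>' (\<Oplus>\<^bsub>B\<^esub>i\<in>I. \<phi> (\<theta> (\<tau>' y \<otimes>\<^bsub>B\<^esub> b i)) \<otimes>\<^bsub>B\<^esub> c i)) f"
      by (rule additive_finsum[OF B.abelian_group_axioms D.T.abelian_group_axioms, where f = "\<lambda>z. D.pure (\<tau>' z) f", symmetric])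
        (simp_all add: D.pure_closed f DB.tau_closed DB.tau_add D.pure_add_left finite_index y dual_closed theta_closed phi_closed)
    finally show "(\<Oplus>\<^bsub>D.TM\<^esub>i\<in>I. D.pure (\<tau>' (c i)) (dual_component M (dual_comparison M (D.pure y f)) i)) = D.pure y f"
      by (simp add: dual_right y DB.tau_closed DB.tau_tau)
  qed (rule refl)
qed

text \<open>
  Evaluation at \<open>t\<close> turns the sum into \<open>g\<close> applied to the expansion \<open>expand_pure\<close> of \<open>t\<close>.
\<close>

lemma dual_comparison_right_inverse:
  assumes M: "left_module A M" and g: "g \<in> carrier (DB.Du (Ex M))"
  shows "dual_comparison M (\<Oplus>\<^bsub>Ex (DA.Du M)\<^esub>i\<in>I. tensor_pure A B \<phi> (DA.Du M) (\<tau>' (c i)) (dual_component M g i)) = g"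
proof -
  interpret M: tensor_data A M B \<phi> by (rule tensor_data) fact
  interpret T: left_module B M.TM by (rule M.left_module_ext)
  interpret D: tensor_data A "DA.Du M" B \<phi> by (rule tensor_data) (rule DA.left_module_dual, fact)
  interpret DT: left_module B "DB.Du M.TM" by (rule DB.left_module_dual, rule M.left_module_ext)
  let ?x = "\<Oplus>\<^bsub>D.TM\<^esub>i\<in>I. D.pure (\<tau>' (c i)) (dual_component M g i)"
  have x: "?x \<in> carrier D.TM"
    by (rule D.T.finsum_closed) (simp add: Pi_def D.pure_closed DB.tau_closed dual_closed dual_component[OF M g])
  show ?thesis
  proof (rule DB.dual_eqI[OF dual_comparison(1)[OF M x] g])
    fix t assume t: "t \<in> carrier M.TM"
    have "dual_comparison M ?x t = (\<Oplus>\<^bsub>R\<^esub>i\<in>I. dual_comparison M (D.pure (\<tau>' (c i)) (dual_component M g i)) t)"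
      by (rule additive_finsum[OF D.T.abelian_group_axioms DA.R.abelian_group_axioms, where f = "\<lambda>x. dual_comparison M x t"])
        (simp_all add: finite_index D.pure_closed DB.tau_closed dual_closed dual_component[OF M g]
          dual_comparison[OF M] DB.dualD[OF dual_comparison(1)[OF M]] t DB.dual_sel)
    also have "\<dots> = (\<Oplus>\<^bsub>R\<^esub>i\<in>I. g (M.pure (b i) (counit M (c i \<odot>\<^bsub>M.TM\<^esub> t))))"
      by (rule DA.R.finsum_cong')
        (simp_all add: Pi_def dual_comparison(3)[OF M] DB.tau_closed dual_closed dual_component[OF M g] t DB.tau_tau
          dual_component_apply counit[OF M] T.smult_closed DB.dualD[OF g] M.pure_closed)
    also have "\<dots> = g (\<Oplus>\<^bsub>M.TM\<^esub>i\<in>I. M.pure (b i) (counit M (c i \<odot>\<^bsub>M.TM\<^esub> t)))"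
      by (rule additive_finsum[OF M.T.abelian_group_axioms DA.R.abelian_group_axioms, where f = g, symmetric])
        (simp_all add: DB.dualD[OF g] finite_index M.pure_closed dual_closed counit[OF M] T.smult_closed t)
    finally show "dual_comparison M ?x t = g t" by (simp add: expand_pure[OF M t])
  qed
qed

theorem dual_comparison_iso:
  assumes M: "left_module A M"
  shows "dual_comparison M \<in> lmod_iso B (Ex (DA.Du M)) (DB.Du (Ex M))"
proof -
  interpret D: tensor_data A "DA.Du M" B \<phi> by (rule tensor_data) (rule DA.left_module_dual, fact)
  have "bij_betw (dual_comparison M) (carrier D.TM) (carrier (DB.Du (Ex M)))"
  proof (rule bij_betwI[where g = "\<lambda>g. \<Oplus>\<^bsub>D.TM\<^esub>i\<in>I. D.pure (\<tau>' (c i)) (dual_component M g i)"])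
    show "dual_comparison M \<in> carrier D.TM \<rightarrow> carrier (DB.Du (Ex M))"
      by (simp add: dual_comparison[OF M])
    show "(\<lambda>g. \<Oplus>\<^bsub>D.TM\<^esub>i\<in>I. D.pure (\<tau>' (c i)) (dual_component M g i)) \<in> carrier (DB.Du (Ex M)) \<rightarrow> carrier D.TM"
      by (auto intro!: D.T.finsum_closed D.pure_closed DB.tau_closed dual_closed dual_component[OF M])
  qed (simp_all add: dual_comparison_left_inverse[OF M] dual_comparison_right_inverse[OF M])
  then show ?thesis by (simp add: lmod_iso_def dual_comparison_hom[OF M])
qed

theorem dual_comparison_natural:
  assumes M: "left_module A M" and N: "left_module A N" and f: "f \<in> lmod_hom A M N"
  shows "compose (carrier (Ex (DA.Du N))) (dual_comparison M)
      (ext_scalars_map A B \<phi> (DA.Du N) (DA.Du M) (twisted_dual_map R \<sigma> \<tau> M N f)) =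
    compose (carrier (Ex (DA.Du N)))
      (twisted_dual_map R \<sigma>' \<tau>' (Ex M) (Ex N) (ext_scalars_map A B \<phi> M N f)) (dual_comparison N)"
proof -
  interpret M: tensor_data A M B \<phi> by (rule tensor_data) fact
  interpret N: tensor_data A N B \<phi> by (rule tensor_data) fact
  interpret TM: left_module B M.TM by (rule M.left_module_ext)
  interpret DM: tensor_data A "DA.Du M" B \<phi> by (rule tensor_data) (rule DA.left_module_dual, fact)
  interpret DN: tensor_data A "DA.Du N" B \<phi> by (rule tensor_data) (rule DA.left_module_dual, fact)
  let ?d = "twisted_dual_map R \<sigma> \<tau> M N f"
  let ?f = "ext_scalars_map A B \<phi> M N f"
  have d: "?d \<in> lmod_hom A (DA.Du N) (DA.Du M)" by (rule DA.dual_map_hom[OF M N f])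
  note ef = ext_scalars_map_hom[OF M.tensor_data_axioms N.tensor_data_axioms f]
  note ed = ext_scalars_map_hom[OF DN.tensor_data_axioms DM.tensor_data_axioms d]
  have td: "twisted_dual_map R \<sigma>' \<tau>' M.TM N.TM ?f \<in> lmod_hom B (DB.Du N.TM) (DB.Du M.TM)"
    by (rule DB.dual_map_hom[OF M.left_module_ext N.left_module_ext ef(1)])
  show ?thesis
  proof (rule extensionalityI[of _ "carrier DN.TM"])
    fix x assume "x \<in> carrier DN.TM"
    then show "compose (carrier DN.TM) (dual_comparison M) (ext_scalars_map A B \<phi> (DA.Du N) (DA.Du M) ?d) x =
      compose (carrier DN.TM) (twisted_dual_map R \<sigma>' \<tau>' M.TM N.TM ?f) (dual_comparison N) x"
    proof (rule DN.additive_eqI[where add' = "ring.add (DB.Du M.TM)"])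
      fix y g assume y: "y \<in> carrier B" and g: "g \<in> carrier (DA.Du N)"
      have dg: "?d g = compose (carrier M) g f" using g by (simp add: twisted_dual_map_def)
      have dg': "compose (carrier M) g f \<in> carrier (DA.Du M)" using lmod_homD(1)[OF d g] by (simp add: dg)
      show "compose (carrier DN.TM) (dual_comparison M) (ext_scalars_map A B \<phi> (DA.Du N) (DA.Du M) ?d) (DN.pure y g) =
        compose (carrier DN.TM) (twisted_dual_map R \<sigma>' \<tau>' M.TM N.TM ?f) (dual_comparison N) (DN.pure y g)"
      proof (rule DB.dual_eqI[where M = M.TM])
        show "compose (carrier DN.TM) (dual_comparison M) (ext_scalars_map A B \<phi> (DA.Du N) (DA.Du M) ?d) (DN.pure y g)
          \<in> carrier (DB.Du M.TM)"
          using y g by (simp add: compose_eq DN.pure_closed dual_comparison[OF M] lmod_homD(1)[OF ed(1)])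
        show "compose (carrier DN.TM) (twisted_dual_map R \<sigma>' \<tau>' M.TM N.TM ?f) (dual_comparison N) (DN.pure y g)
          \<in> carrier (DB.Du M.TM)"
          using y g by (simp add: compose_eq DN.pure_closed dual_comparison[OF N] lmod_homD(1)[OF td])
        fix t assume t: "t \<in> carrier M.TM"
        have "dual_comparison N (DN.pure y g) (?f t) = g (counit N (?f (\<tau>' y \<odot>\<^bsub>M.TM\<^esub> t)))"
          using y g t by (simp add: dual_comparison(3)[OF N] lmod_homD[OF ef(1)] DB.tau_closed)
        also have "\<dots> = g (f (counit M (\<tau>' y \<odot>\<^bsub>M.TM\<^esub> t)))"
          using y t by (simp add: counit_natural[OF M N f] TM.smult_closed DB.tau_closed)
        finally show "compose (carrier DN.TM) (dual_comparison M) (ext_scalars_map A B \<phi> (DA.Du N) (DA.Du M) ?d) (DN.pure y g) t =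
          compose (carrier DN.TM) (twisted_dual_map R \<sigma>' \<tau>' M.TM N.TM ?f) (dual_comparison N) (DN.pure y g) t"
          using y g t
          by (simp add: compose_eq DN.pure_closed ed(2) dg dg' dual_comparison[OF M] dual_comparison(1)[OF N]
              twisted_dual_map_def[of R \<sigma>' \<tau>'] counit[OF M] TM.smult_closed DB.tau_closed)
      qed
    qed (simp_all add: compose_eq lmod_homD[OF ed(1)] lmod_homD[OF td] dual_comparison[OF M] dual_comparison[OF N])
  qed simp_all
qed

end

section \<open>The ground ring and the free algebras\<close>

text \<open>
  The ground ring and the free algebra are both of this form: coefficients in a subring, exponents in
  a submonoid.
\<close>

definition monoid_subalgebra :: "'b set \<Rightarrow> 'a set \<Rightarrow> ('a::monoid_add \<Rightarrow>\<^sub>0 'b::ring_1) set" where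
  "monoid_subalgebra K W = {p. \<forall>w\<in>Poly_Mapping.keys p. Poly_Mapping.lookup p w \<in> K \<and> w \<in> W}"

locale subalgebra_data =
  fixes K :: "'b::ring_1 set" and W :: "'a::monoid_add set"
  assumes K: "0 \<in> K" "1 \<in> K" "\<And>x y. x \<in> K ==> y \<in> K ==> x + y \<in> K" "\<And>x. x \<in> K ==> - x \<in> K"
      "\<And>x y. x \<in> K ==> y \<in> K ==> x * y \<in> K"
    and W: "0 \<in> W" "\<And>v w. v \<in> W ==> w \<in> W ==> v + w \<in> W"
begin

abbreviation S where "S \<equiv> monoid_subalgebra K W"

lemma mem_iff: "p \<in> S \<longleftrightarrow> (\<forall>w. Poly_Mapping.lookup p w \<in> K) \<and> (\<forall>w. Poly_Mapping.lookup p w \<noteq> 0 \<longrightarrow> w \<in> W)"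
  using K(1) by (force simp: monoid_subalgebra_def in_keys_iff)

lemma mem_single: "w \<in> W ==> c \<in> K ==> Poly_Mapping.single w c \<in> S"
  using K(1) by (auto simp: mem_iff lookup_single when_def)

lemma mem_add: "p \<in> S ==> q \<in> S ==> p + q \<in> S"
  using K(3) unfolding mem_iff lookup_add by (metis add_0_left)

lemma mem_uminus: "p \<in> S ==> - p \<in> S"
  using K(4) unfolding mem_iff by simp

lemma mem_zero: "0 \<in> S"
  using K(1) by (simp add: mem_iff)

lemma mem_one: "1 \<in> S"
  using mem_single[OF W(1) K(2)] by simp

lemma mem_induct [consumes 1, case_names zero single add]:
  assumes "p \<in> S" and "P 0" and s: "\<And>w c. w \<in> W ==> c \<in> K ==> P (Poly_Mapping.single w c)"
    and a: "\<And>p q. p \<in> S ==> q \<in> S ==> P p ==> P q ==> P (p + q)"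
  shows "P p"
  using assms(1)
proof (induction p rule: update_induct)
  case const
  show ?case by fact
next
  case (update f w c)
  have eq: "Poly_Mapping.update w c f = f + Poly_Mapping.single w c"
    using update(1) by (intro poly_mapping_eqI) (auto simp: lookup_update lookup_add lookup_single when_def in_keys_iff)
  have "Poly_Mapping.lookup (Poly_Mapping.update w c f) v \<in> K"
    "Poly_Mapping.lookup (Poly_Mapping.update w c f) v \<noteq> 0 \<longrightarrow> v \<in> W" for v
    using update.prems by (auto simp: mem_iff)
  note * = this[of w] this
  have f: "f \<in> S"
    unfolding mem_iff
  proof (intro conjI allI impI)
    fix v
    show "Poly_Mapping.lookup f v \<in> K"
      using *(3)[of v] K(1) update(1) by (cases "v = w") (auto simp: lookup_update in_keys_iff)
    show "v \<in> W" if "Poly_Mapping.lookup f v \<noteq> 0"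
      using *(4)[of v] that update(1) by (cases "v = w") (auto simp: lookup_update in_keys_iff)
  qed
  have "w \<in> W" "c \<in> K" using * update(2) by (auto simp: lookup_update)
  then show ?case unfolding eq using f update.IH by (intro a s mem_single) auto
qed

lemma mem_mult: "p \<in> S ==> q \<in> S ==> p * q \<in> S"
proof (induction p rule: mem_induct)
  case zero
  then show ?case by (simp add: mem_zero)
next
  case (single w c)
  from single(3) show ?case
    by (induction q rule: mem_induct)
      (simp_all add: mem_zero mult_single mem_single K(5) W(2) single(1,2) distrib_left mem_add)
next
  case (add p p')
  then show ?case by (simp add: distrib_right mem_add)
qed

lemma ring_subalgebra: "ring (ring_of_type_algebra\<lparr>carrier := S\<rparr>)"
proof (rule ringI)
  show "abelian_group (ring_of_type_algebra\<lparr>carrier := S\<rparr>)"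
    by (rule abelian_groupI)
      (auto simp: ring_of_type_algebra_def mem_zero mem_add algebra_simps intro!: bexI[of _ "- _"] mem_uminus)
  show "Group.monoid (ring_of_type_algebra\<lparr>carrier := S\<rparr>)"
    by (rule monoidI) (auto simp: ring_of_type_algebra_def mem_one mem_mult algebra_simps)
qed (auto simp: ring_of_type_algebra_def algebra_simps)

end

lemma ring_of_type_algebra_sel [simp]:
  "x \<oplus>\<^bsub>ring_of_type_algebra\<lparr>carrier := S\<rparr>\<^esub> y = x + y"
  "x \<otimes>\<^bsub>ring_of_type_algebra\<lparr>carrier := S\<rparr>\<^esub> y = x * y"
  "\<zero>\<^bsub>ring_of_type_algebra\<lparr>carrier := S\<rparr>\<^esub> = 0"
  "\<one>\<^bsub>ring_of_type_algebra\<lparr>carrier := S\<rparr>\<^esub> = 1"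
  "carrier (ring_of_type_algebra\<lparr>carrier := S\<rparr>) = S"
  by (simp_all add: ring_of_type_algebra_def)

lemma coeff_ring:
  "0 \<in> coeff_ring r" "1 \<in> coeff_ring r"
  "x \<in> coeff_ring r ==> y \<in> coeff_ring r ==> x + y \<in> coeff_ring r"
  "x \<in> coeff_ring r ==> - x \<in> coeff_ring r"
  "x \<in> coeff_ring r ==> y \<in> coeff_ring r ==> x * y \<in> coeff_ring r"
  "1 / of_nat r \<in> coeff_ring r" "exp (2 * of_real pi * \<i> / of_nat r) \<in> coeff_ring r"
proof -
  interpret C: ring "ring_of_type_algebra :: complex ring" by (rule ring_from_type_algebra)
  interpret subring "coeff_ring r" "ring_of_type_algebra :: complex ring"
    unfolding coeff_ring_def by (rule C.generate_ring_is_subring) (simp add: ring_of_type_algebra_def)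
  have neg: "\<ominus>\<^bsub>ring_of_type_algebra\<^esub> x = - x" for x :: complex
    by (rule C.minus_equality) (simp_all add: ring_of_type_algebra_def)
  show "0 \<in> coeff_ring r" "1 \<in> coeff_ring r"
    "x \<in> coeff_ring r ==> y \<in> coeff_ring r ==> x + y \<in> coeff_ring r"
    "x \<in> coeff_ring r ==> - x \<in> coeff_ring r"
    "x \<in> coeff_ring r ==> y \<in> coeff_ring r ==> x * y \<in> coeff_ring r"
    using subringE[OF subring_axioms] neg by (simp_all add: ring_of_type_algebra_def)
  show "1 / of_nat r \<in> coeff_ring r" "exp (2 * of_real pi * \<i> / of_nat r) \<in> coeff_ring r"
    unfolding coeff_ring_def by (rule generate_ring.incl, simp)+
qed

lemma carrier_ground:
  "carrier (ground_ring r d) = monoid_subalgebra (coeff_ring r) {m. Poly_Mapping.keys m \<subseteq> insert Q (V ` {1..d})}"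
  by (simp add: ground_ring_def monoid_subalgebra_def)

interpretation ground: subalgebra_data "coeff_ring r" "{m :: laurent_var \<Rightarrow>\<^sub>0 int. Poly_Mapping.keys m \<subseteq> insert Q (V ` {1..d})}"
  rewrites "monoid_subalgebra (coeff_ring r) {m :: laurent_var \<Rightarrow>\<^sub>0 int. Poly_Mapping.keys m \<subseteq> insert Q (V ` {1..d})} = carrier (ground_ring r d)"
  for r d
proof -
  show "subalgebra_data (coeff_ring r) {m :: laurent_var \<Rightarrow>\<^sub>0 int. Poly_Mapping.keys m \<subseteq> insert Q (V ` {1..d})}"
    by (standard) (use coeff_ring in \<open>auto dest: subsetD[OF keys_add]\<close>)
qed (simp add: carrier_ground)

lemma carrier_free:
  "carrier (free_algebra r d n) = monoid_subalgebra (carrier (ground_ring r d)) {w. set (letters w) \<subseteq> yh_gens n}"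
  by (simp add: free_algebra_def monoid_subalgebra_def)

interpretation free: subalgebra_data "carrier (ground_ring r d)" "{w. set (letters w) \<subseteq> yh_gens n}"
  rewrites "monoid_subalgebra (carrier (ground_ring r d)) {w. set (letters w) \<subseteq> yh_gens n} = carrier (free_algebra r d n)"
  for r d n
proof -
  show "subalgebra_data (carrier (ground_ring r d)) {w. set (letters w) \<subseteq> yh_gens n}"
    by standard (use ground.mem_zero ground.mem_one ground.mem_add ground.mem_uminus ground.mem_mult in
      \<open>auto simp: zero_word_def plus_word_def\<close>)
qed (simp add: carrier_free)

lemma free_sel [simp]:
  "x \<oplus>\<^bsub>free_algebra r d n\<^esub> y = x + y"
  "x \<otimes>\<^bsub>free_algebra r d n\<^esub> y = x * y"
  "\<zero>\<^bsub>free_algebra r d n\<^esub> = 0"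
  "\<one>\<^bsub>free_algebra r d n\<^esub> = 1"
  by (simp_all add: free_algebra_def ring_of_type_algebra_def)

lemma ring_free: "ring (free_algebra r d n)"
  using free.ring_subalgebra[of r d n] by (simp add: free_algebra_def)

lemma ground_sel [simp]:
  "x \<oplus>\<^bsub>ground_ring r d\<^esub> y = x + y"
  "x \<otimes>\<^bsub>ground_ring r d\<^esub> y = x * y"
  "\<zero>\<^bsub>ground_ring r d\<^esub> = 0"
  "\<one>\<^bsub>ground_ring r d\<^esub> = 1"
  by (simp_all add: ground_ring_def ring_of_type_algebra_def)

lemma cring_ground: "cring (ground_ring r d)"
proof -
  interpret ring "ground_ring r d"
    using ground.ring_subalgebra[of r d] by (simp add: ground_ring_def)
  show ?thesis by unfold_locales (simp add: mult.commute)
qed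

lemma free_minus: "x \<in> carrier (free_algebra r d n) ==> \<ominus>\<^bsub>free_algebra r d n\<^esub> x = - x"
  by (rule abelian_group.minus_equality[OF ring.is_abelian_group[OF ring_free]]) (auto intro: free.mem_uminus)

lemma free_diff: "x \<in> carrier (free_algebra r d n) ==> y \<in> carrier (free_algebra r d n) ==> x - y \<in> carrier (free_algebra r d n)"
  using free.mem_add[OF _ free.mem_uminus, of x r d n y] by simp

lemma fscalar_mem: "c \<in> carrier (ground_ring r d) ==> fscalar c \<in> carrier (free_algebra r d n)"
  unfolding fscalar_def by (rule free.mem_single) (simp_all add: zero_word_def)

lemma fgen_mem: "x \<in> yh_gens n ==> fgen x \<in> carrier (free_algebra r d n)"
  unfolding fgen_def by (rule free.mem_single) (simp_all add: ground.mem_one)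

lemma free_power: "p \<in> carrier (free_algebra r d n) ==> p ^ k \<in> carrier (free_algebra r d n)"
  by (induction k) (simp_all add: free.mem_one free.mem_mult)

lemma free_sum: "(\<And>i. i \<in> A ==> f i \<in> carrier (free_algebra r d n)) ==> sum f A \<in> carrier (free_algebra r d n)"
  by (induction A rule: infinite_finite_induct) (simp_all add: free.mem_zero free.mem_add)

lemma free_prod_list: "(\<And>p. p \<in> set ps ==> p \<in> carrier (free_algebra r d n)) ==> prod_list ps \<in> carrier (free_algebra r d n)"
  by (induction ps) (simp_all add: free.mem_one free.mem_mult)

lemma fscalar_simps:
  "fscalar (a + b) = fscalar a + fscalar b" "fscalar (a * b) = fscalar a * fscalar b"
  "fscalar 1 = 1" "fscalar 0 = 0" "fscalar (- a) = - fscalar a" "fscalar (a - b) = fscalar a - fscalar b"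
  by (simp_all add: fscalar_def single_add mult_single single_uminus single_diff)

lemma fscalar_central: "fscalar c * p = p * fscalar c"
proof -
  interpret U: subalgebra_data "UNIV :: laurent set" "UNIV :: yh_gen word set" by standard auto
  have "p \<in> U.S" by (simp add: monoid_subalgebra_def)
  then show ?thesis
    by (induction p rule: U.mem_induct) (simp_all add: fscalar_def mult_single mult.commute algebra_simps)
qed

lemma single_Cons: "Poly_Mapping.single (Word (x # xs)) c = fgen x * Poly_Mapping.single (Word xs) c"
  by (simp add: fgen_def mult_single plus_word_def)

lemma free_induct [consumes 1, case_names scalar gen add mult]:
  assumes p: "p \<in> carrier (free_algebra r d n)"
    and scalar: "\<And>c. c \<in> carrier (ground_ring r d) ==> P (fscalar c)"
    and gen: "\<And>x. x \<in> yh_gens n ==> P (fgen x)"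
    and add: "\<And>p q. p \<in> carrier (free_algebra r d n) ==> q \<in> carrier (free_algebra r d n) ==> P p ==> P q ==> P (p + q)"
    and mult: "\<And>p q. p \<in> carrier (free_algebra r d n) ==> q \<in> carrier (free_algebra r d n) ==> P p ==> P q ==> P (p * q)"
  shows "P p"
  using p
proof (induction p rule: free.mem_induct)
  case zero
  then show ?case using scalar[OF ground.mem_zero] by (simp add: fscalar_simps)
next
  case (single w c)
  have "set xs \<subseteq> yh_gens n ==> P (Poly_Mapping.single (Word xs) c)" for xs
  proof (induction xs)
    case Nil
    then show ?case using scalar[OF single(2)] by (simp add: fscalar_def zero_word_def)
  next
    case (Cons x xs)
    then show ?case
      unfolding single_Cons using single(2) by (intro mult gen fgen_mem free.mem_single) auto
  qed
  from this[of "letters w"] single show ?case by simp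
next
  case (add p q)
  then show ?case by (intro assms(4))
qed

lemma laurent_const_mem: "c \<in> coeff_ring r ==> laurent_const c \<in> carrier (ground_ring r d)"
  unfolding laurent_const_def by (rule ground.mem_single) simp_all

lemma laurent_Q_mem: "laurent_power Q k \<in> carrier (ground_ring r d)"
  unfolding laurent_power_def by (rule ground.mem_single) (simp_all add: coeff_ring)

lemma laurent_V_mem: "1 \<le> i ==> i \<le> d ==> laurent_power (V i) k \<in> carrier (ground_ring r d)"
  unfolding laurent_power_def by (rule ground.mem_single) (auto simp: coeff_ring)

lemma laurent_power_mult: "laurent_power x k * laurent_power x l = laurent_power x (k + l)"
  by (simp add: laurent_power_def mult_single single_add)

lemma laurent_power_zero: "laurent_power x 0 = 1"
  by (simp add: laurent_power_def)

lemma laurent_const_mult: "laurent_const a * laurent_const b = laurent_const (a * b)"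
  by (simp add: laurent_const_def mult_single)

section \<open>Embedding rings into a type of class ring\<close>

text \<open>
  A record ring is not a type of class \<open>ring\<close>, but it is a direct factor of the product of all
  rings with elements of type \<open>'a\<close>, and this product is one. Computations with \<open>+\<close> and \<open>*\<close> then apply to the image
  of the record ring, whose unit is an idempotent of the product and not its 1.
\<close>

typedef 'a ring_family = "{x :: 'a ring \<Rightarrow> 'a. \<forall>S. if ring S then x S \<in> carrier S else x S = undefined}"
proof
  show "(\<lambda>S. if ring S then \<zero>\<^bsub>S\<^esub> else undefined) \<in> {x :: 'a ring \<Rightarrow> 'a. \<forall>S. if ring S then x S \<in> carrier S else x S = undefined}"
    by (auto simp: ring.ring_simprules)
qed

lemma ring_family_mem: "ring S ==> Rep_ring_family x S \<in> carrier S"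
  using Rep_ring_family[of x] by auto

lemma ring_family_undefined: "\<not> ring S ==> Rep_ring_family x S = undefined"
  using Rep_ring_family[of x] by auto

lemma ring_family_eqI: "(\<And>S. ring S ==> Rep_ring_family x S = Rep_ring_family y S) ==> x = y"
  by (metis Rep_ring_family_inject ext ring_family_undefined)

definition ring_family :: "('a ring \<Rightarrow> 'a) \<Rightarrow> 'a ring_family" where
  "ring_family x = Abs_ring_family (\<lambda>S. if ring S then x S else undefined)"

lemma Rep_ring_family_build:
  "(\<And>S. ring S ==> x S \<in> carrier S) ==> ring S ==> Rep_ring_family (ring_family x) S = x S"
  unfolding ring_family_def by (subst Abs_ring_family_inverse) auto

instantiation ring_family :: (type) "{ring, monoid_mult}"
begin

definition "0 = ring_family (\<lambda>S. \<zero>\<^bsub>S\<^esub>)"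
definition "1 = ring_family (\<lambda>S. \<one>\<^bsub>S\<^esub>)"
definition "x + y = ring_family (\<lambda>S. Rep_ring_family x S \<oplus>\<^bsub>S\<^esub> Rep_ring_family y S)"
definition "x * y = ring_family (\<lambda>S. Rep_ring_family x S \<otimes>\<^bsub>S\<^esub> Rep_ring_family y S)"
definition "- x = ring_family (\<lambda>S. \<ominus>\<^bsub>S\<^esub> Rep_ring_family x S)"
definition "x - y = ring_family (\<lambda>S. Rep_ring_family x S \<ominus>\<^bsub>S\<^esub> Rep_ring_family y S)"

lemma ring_family_sel:
  assumes "ring S"
  shows "Rep_ring_family 0 S = \<zero>\<^bsub>S\<^esub>" "Rep_ring_family 1 S = \<one>\<^bsub>S\<^esub>"
    "Rep_ring_family (x + y) S = Rep_ring_family x S \<oplus>\<^bsub>S\<^esub> Rep_ring_family y S"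
    "Rep_ring_family (x * y) S = Rep_ring_family x S \<otimes>\<^bsub>S\<^esub> Rep_ring_family y S"
    "Rep_ring_family (- x) S = \<ominus>\<^bsub>S\<^esub> Rep_ring_family x S"
    "Rep_ring_family (x - y) S = Rep_ring_family x S \<ominus>\<^bsub>S\<^esub> Rep_ring_family y S"
  unfolding zero_ring_family_def one_ring_family_def plus_ring_family_def times_ring_family_def
    uminus_ring_family_def minus_ring_family_def
  by (subst Rep_ring_family_build; simp add: ring_family_mem ring.ring_simprules assms)+

instance
proof
  fix a b c :: "'a ring_family"
  note s = ring_family_sel ring_family_mem ring.ring_simprules
  show "a + b + c = a + (b + c)" by (rule ring_family_eqI) (simp add: s)
  show "a + b = b + a" by (rule ring_family_eqI) (simp add: s)
  show "0 + a = a" by (rule ring_family_eqI) (simp add: s)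
  show "- a + a = 0" by (rule ring_family_eqI) (simp add: s)
  show "a - b = a + - b" by (rule ring_family_eqI) (simp add: s)
  show "a * b * c = a * (b * c)" by (rule ring_family_eqI) (simp add: s)
  show "(a + b) * c = a * c + b * c" by (rule ring_family_eqI) (simp add: s)
  show "a * (b + c) = a * b + a * c" by (rule ring_family_eqI) (simp add: s)
  show "1 * a = a" by (rule ring_family_eqI) (simp add: s)
  show "a * 1 = a" by (rule ring_family_eqI) (simp add: s monoid.r_one[OF ring.axioms(2)])
qed

end

text \<open>
  The inclusion of a direct factor, with zero in all other components.
\<close>

definition ring_embed :: "'a ring \<Rightarrow> 'a \<Rightarrow> 'a ring_family" where
  "ring_embed S x = ring_family (\<lambda>S'. if S' = S then x else \<zero>\<^bsub>S'\<^esub>)"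

lemma ring_embed_sel:
  "x \<in> carrier S ==> ring S' ==> Rep_ring_family (ring_embed S x) S' = (if S' = S then x else \<zero>\<^bsub>S'\<^esub>)"
  unfolding ring_embed_def by (subst Rep_ring_family_build) (auto simp: ring.ring_simprules)

lemma ring_embed:
  assumes "ring S" "x \<in> carrier S" "y \<in> carrier S"
  shows "ring_embed S (x \<oplus>\<^bsub>S\<^esub> y) = ring_embed S x + ring_embed S y"
    and "ring_embed S (x \<otimes>\<^bsub>S\<^esub> y) = ring_embed S x * ring_embed S y"
    and "ring_embed S x = ring_embed S y \<longleftrightarrow> x = y"
proof -
  note s = ring_family_sel ring_embed_sel assms ring.ring_simprules
  show "ring_embed S (x \<oplus>\<^bsub>S\<^esub> y) = ring_embed S x + ring_embed S y"
    by (rule ring_family_eqI) (auto simp: s)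
  show "ring_embed S (x \<otimes>\<^bsub>S\<^esub> y) = ring_embed S x * ring_embed S y"
    by (rule ring_family_eqI) (auto simp: s)
  show "ring_embed S x = ring_embed S y \<longleftrightarrow> x = y"
    using ring_embed_sel[OF assms(2,1)] ring_embed_sel[OF assms(3,1)] by metis
qed

section \<open>Universal property of the cyclotomic algebras\<close>

context
  fixes r d n :: nat
begin

abbreviation FA where "FA \<equiv> free_algebra r d n"

lemma fscalar_const_mem: "fscalar (laurent_const (1 / of_nat r)) \<in> carrier FA"
  by (intro fscalar_mem laurent_const_mem coeff_ring)

lemma e_elt_mem: "1 \<le> i ==> Suc i \<le> n ==> e_elt r i \<in> carrier FA"
  unfolding e_elt_def
  by (intro free.mem_mult fscalar_const_mem free_sum free_power fgen_mem) (auto simp: yh_gens_def)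

lemma gens_mem:
  "1 \<le> i ==> i \<le> n ==> T i \<in> yh_gens n" "1 \<le> i ==> i < n ==> G i \<in> yh_gens n" "X1 \<in> yh_gens n" "X1inv \<in> yh_gens n"
  by (auto simp: yh_gens_def)

lemma transpose_range: "1 \<le> i ==> i < n ==> 1 \<le> j ==> j \<le> n ==> 1 \<le> transpose i (Suc i) j \<and> transpose i (Suc i) j \<le> n"
  by (auto simp: transpose_def)

lemma yh_relations_mem: "p \<in> yh_relations r n ==> p \<in> carrier FA"
  by (induction p rule: yh_relations.induct)
    (intro free_diff free.mem_mult free.mem_add free.mem_one free_power fgen_mem gens_mem e_elt_mem
        fscalar_mem ground.mem_add[OF laurent_Q_mem ground.mem_uminus[OF laurent_Q_mem], simplified]
        transpose_range[THEN conjunct1] transpose_range[THEN conjunct2]; simp)+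

lemma cyclotomic_poly_mem: "cyclotomic_poly d \<in> carrier FA"
  unfolding cyclotomic_poly_def
  by (rule free_prod_list) (auto intro!: free_diff fgen_mem gens_mem fscalar_mem laurent_V_mem)

interpretation FA: ring FA by (rule ring_free)

interpretation aff: ideal "affine_ideal r d n" FA
  unfolding affine_ideal_def by (rule FA.genideal_ideal) (use yh_relations_mem in blast)

lemma affine_class_hom: "affine_class r d n \<in> ring_hom FA (affine_YH r d n)"
  using aff.rcos_ring_hom by (simp add: affine_class_def[abs_def] affine_YH_def)

lemma ring_affine: "ring (affine_YH r d n)"
  unfolding affine_YH_def by (rule aff.quotient_is_ring)

lemma affine_class_surj: "carrier (affine_YH r d n) = affine_class r d n ` carrier FA"
  by (auto simp: affine_YH_def FactRing_def A_RCOSETS_def' affine_class_def[abs_def])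

lemma affine_class_eq_zero_iff: "p \<in> carrier FA ==> affine_class r d n p = \<zero>\<^bsub>affine_YH r d n\<^esub> \<longleftrightarrow> p \<in> affine_ideal r d n"
  using aff.a_rcos_const aff.a_rcos_self
  by (auto simp: affine_class_def affine_YH_def FactRing_def)

interpretation aYH: ring "affine_YH r d n" by (rule ring_affine)

interpretation cyc: ideal "cyclotomic_ideal r d n" "affine_YH r d n"
  unfolding cyclotomic_ideal_def
  by (rule aYH.genideal_ideal) (simp add: affine_class_surj cyclotomic_poly_mem)

lemma ring_cyclotomic: "ring (cyclotomic_YH r d n)"
  unfolding cyclotomic_YH_def by (rule cyc.quotient_is_ring)

lemma YH_class_hom: "YH_class r d n \<in> ring_hom FA (cyclotomic_YH r d n)"
proof -
  have "(+>\<^bsub>affine_YH r d n\<^esub>) (cyclotomic_ideal r d n) \<circ> affine_class r d n \<in> ring_hom FA (cyclotomic_YH r d n)"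
    unfolding cyclotomic_YH_def by (rule ring_hom_trans[OF affine_class_hom cyc.rcos_ring_hom])
  then show ?thesis by (simp add: YH_class_def[abs_def] comp_def)
qed

lemma YH_class_surj: "carrier (cyclotomic_YH r d n) = YH_class r d n ` carrier FA"
proof -
  have "carrier (cyclotomic_YH r d n) = (\<lambda>C. cyclotomic_ideal r d n +>\<^bsub>affine_YH r d n\<^esub> C) ` carrier (affine_YH r d n)"
    by (auto simp: cyclotomic_YH_def FactRing_def A_RCOSETS_def')
  then show ?thesis by (simp add: affine_class_surj image_image YH_class_def[abs_def])
qed

lemma YH_class_eq_zero_iff:
  "p \<in> carrier FA ==> YH_class r d n p = \<zero>\<^bsub>cyclotomic_YH r d n\<^esub> \<longleftrightarrow> affine_class r d n p \<in> cyclotomic_ideal r d n"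
  using cyc.a_rcos_const cyc.a_rcos_self[of "affine_class r d n p"] ring_hom_closed[OF affine_class_hom]
  by (auto simp: YH_class_def cyclotomic_YH_def FactRing_def)

lemma affine_class_relation: "p \<in> yh_relations r n ==> affine_class r d n p = \<zero>\<^bsub>affine_YH r d n\<^esub>"
  unfolding affine_class_eq_zero_iff[OF yh_relations_mem] affine_ideal_def
  using FA.genideal_self[of "yh_relations r n"] yh_relations_mem by blast

lemma YH_class_relation: "p \<in> yh_relations r n ==> YH_class r d n p = \<zero>\<^bsub>cyclotomic_YH r d n\<^esub>"
  by (simp add: YH_class_eq_zero_iff yh_relations_mem affine_class_relation cyc.zero_closed)

lemma YH_class_cyclotomic: "YH_class r d n (cyclotomic_poly d) = \<zero>\<^bsub>cyclotomic_YH r d n\<^esub>"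
  unfolding YH_class_eq_zero_iff[OF cyclotomic_poly_mem] cyclotomic_ideal_def
  using aYH.genideal_self'[of "affine_class r d n (cyclotomic_poly d)"]
  by (simp add: affine_class_surj cyclotomic_poly_mem)

lemma affine_class_zero_least:
  assumes J: "ideal J FA" "yh_relations r n \<subseteq> J"
    and p: "p \<in> carrier FA" "affine_class r d n p = \<zero>\<^bsub>affine_YH r d n\<^esub>"
  shows "p \<in> J"
  using FA.genideal_minimal[OF J] p by (auto simp: affine_class_eq_zero_iff affine_ideal_def)

text \<open>
  The algebra is a quotient of a quotient. An ideal that contains the relations of the affine algebra
  has an ideal as image there, and this image contains the second ideal.
\<close>

lemma YH_class_zero_least:
  assumes J: "ideal J FA" "yh_relations r n \<subseteq> J" "cyclotomic_poly d \<in> J"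
    and p: "p \<in> carrier FA" "YH_class r d n p = \<zero>\<^bsub>cyclotomic_YH r d n\<^esub>"
  shows "p \<in> J"
proof -
  interpret J: ideal J FA by fact
  note hom = ring_hom_add[OF affine_class_hom] ring_hom_mult[OF affine_class_hom]
  have Jsub: "x \<in> carrier FA" if "x \<in> J" for x using that J.a_subset by blast
  have "ideal (affine_class r d n ` J) (affine_YH r d n)"
  proof (rule idealI[OF ring_affine])
    show "subgroup (affine_class r d n ` J) (add_monoid (affine_YH r d n))"
    proof (rule aYH.add.subgroupI)
      show "affine_class r d n ` J \<subseteq> carrier (affine_YH r d n)" using Jsub by (auto simp: affine_class_surj)
      show "affine_class r d n ` J \<noteq> {}" using J.zero_closed by auto
    next
      fix a assume "a \<in> affine_class r d n ` J"
      then obtain x where x: "x \<in> J" "a = affine_class r d n x" by auto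
      have "\<ominus>\<^bsub>affine_YH r d n\<^esub> a = affine_class r d n (- x)"
      proof (rule aYH.minus_equality)
        have "affine_class r d n (- x) \<oplus>\<^bsub>affine_YH r d n\<^esub> a = affine_class r d n (- x + x)"
          using x Jsub[OF x(1)] by (simp add: hom[symmetric, simplified] free.mem_uminus)
        then show "affine_class r d n (- x) \<oplus>\<^bsub>affine_YH r d n\<^esub> a = \<zero>\<^bsub>affine_YH r d n\<^esub>"
          using affine_class_eq_zero_iff[of 0] aff.zero_closed by (simp add: free.mem_zero)
      qed (use x Jsub in \<open>auto simp: affine_class_surj free.mem_uminus\<close>)
      moreover have "- x \<in> J" using J.a_inv_closed[OF x(1)] free_minus[OF Jsub[OF x(1)]] by simp
      ultimately show "\<ominus>\<^bsub>affine_YH r d n\<^esub> a \<in> affine_class r d n ` J" by blast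
      fix b assume "b \<in> affine_class r d n ` J"
      then obtain y where y: "y \<in> J" "b = affine_class r d n y" by auto
      have "a \<oplus>\<^bsub>affine_YH r d n\<^esub> b = affine_class r d n (x + y)"
        using x y Jsub by (simp add: hom[symmetric, simplified])
      moreover have "x + y \<in> J" using J.a_closed[OF x(1) y(1)] by simp
      ultimately show "a \<oplus>\<^bsub>affine_YH r d n\<^esub> b \<in> affine_class r d n ` J" by blast
    qed
  next
    fix a z assume a: "a \<in> affine_class r d n ` J" and z: "z \<in> carrier (affine_YH r d n)"
    then obtain x y where x: "x \<in> J" "a = affine_class r d n x" and y: "y \<in> carrier FA" "z = affine_class r d n y"
      by (auto simp: affine_class_surj)
    have "z \<otimes>\<^bsub>affine_YH r d n\<^esub> a = affine_class r d n (y * x)" "a \<otimes>\<^bsub>affine_YH r d n\<^esub> z = affine_class r d n (x * y)"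
      using x y Jsub by (simp_all add: hom[symmetric, simplified])
    moreover have "y * x \<in> J" "x * y \<in> J" using J.I_l_closed[OF x(1) y(1)] J.I_r_closed[OF x(1) y(1)] by simp_all
    ultimately show "z \<otimes>\<^bsub>affine_YH r d n\<^esub> a \<in> affine_class r d n ` J" "a \<otimes>\<^bsub>affine_YH r d n\<^esub> z \<in> affine_class r d n ` J"
      by blast+
  qed
  then have "cyclotomic_ideal r d n \<subseteq> affine_class r d n ` J"
    unfolding cyclotomic_ideal_def using J(3) by (intro aYH.genideal_minimal) auto
  then obtain x where x: "x \<in> J" "affine_class r d n p = affine_class r d n x"
    using p YH_class_eq_zero_iff by auto
  have "p \<in> affine_ideal r d n +>\<^bsub>FA\<^esub> x"
    using aff.a_rcos_self[OF p(1)] x(2) by (simp add: affine_class_def)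
  then obtain h where h: "h \<in> affine_ideal r d n" "p = h + x"
    by (auto simp: a_r_coset_def')
  have "h \<in> J" using FA.genideal_minimal[OF J(1,2)] h by (auto simp: affine_ideal_def)
  then show ?thesis using J.a_closed[OF _ x(1)] h by simp
qed

end

section \<open>Averages over a cyclic group\<close>

text \<open>
  If \<open>\<rho> = 1 / r\<close> and \<open>a\<close>, \<open>b\<close> are commuting elements of order \<open>r\<close>, this is the idempotent \<open>r\<^sup>-\<^sup>1 \<Sum>\<^sub>s (a b\<^sup>-\<^sup>1)\<^sup>s\<close>.
\<close>

definition cyclic_avg :: "'a::{ring,monoid_mult} \<Rightarrow> nat \<Rightarrow> 'a \<Rightarrow> 'a \<Rightarrow> 'a" where
  "cyclic_avg \<rho> r a b = \<rho> * (\<Sum>s<r. a ^ s * b ^ (r - s))"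

lemma power_commute_gen:
  fixes c a :: "'a::monoid_mult"
  assumes "c * a = a' * c" shows "c * a ^ k = a' ^ k * c"
proof (induction k)
  case (Suc k)
  have "c * a ^ Suc k = (c * a) * a ^ k" by (simp add: mult.assoc)
  also have "\<dots> = a' * (c * a ^ k)" by (simp add: assms mult.assoc)
  finally show ?case by (simp add: Suc mult.assoc)
qed simp

lemma cyclic_avg_conj:
  assumes "c * \<rho> = \<rho> * c" "c * a = a' * c" "c * b = b' * c"
  shows "c * cyclic_avg \<rho> r a b = cyclic_avg \<rho> r a' b' * c"
proof -
  have "c * (a ^ s * b ^ (r - s)) = (a' ^ s * b' ^ (r - s)) * c" for s
  proof -
    have "c * (a ^ s * b ^ (r - s)) = (c * a ^ s) * b ^ (r - s)" by (simp add: mult.assoc)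
    also have "\<dots> = a' ^ s * (c * b ^ (r - s))"
      by (simp add: power_commute_gen[OF assms(2)] mult.assoc)
    finally show ?thesis by (simp add: power_commute_gen[OF assms(3)] mult.assoc)
  qed
  then have "c * (\<Sum>s<r. a ^ s * b ^ (r - s)) = (\<Sum>s<r. a' ^ s * b' ^ (r - s)) * c"
    by (simp add: sum_distrib_left sum_distrib_right)
  then show ?thesis unfolding cyclic_avg_def mult.assoc
    by (metis assms(1) mult.assoc)
qed

text \<open>
  The unit is a parameter \<open>u\<close>, because it will be the unit of a direct factor.
\<close>

locale cyclic_pair =
  fixes u \<rho> :: "'a::{ring,monoid_mult}" and r :: nat and a b :: 'a
  assumes comm: "a * b = b * a" and ord: "a ^ r = u" "b ^ r = u"
    and unit: "u * a = a" "u * b = b" and r: "1 \<le> r"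
begin

text \<open>
  Replace \<open>s\<close> by \<open>r - s\<close>; the terms \<open>s = 0\<close> are both equal to \<open>u\<close>.
\<close>

lemma avg_swap: "cyclic_avg \<rho> r a b = cyclic_avg \<rho> r b a"
proof -
  obtain m where m: "r = Suc m" using r by (cases r) auto
  have ba: "b ^ l * a = a * b ^ l" for l
    by (rule power_commute_gen[of a b b l, OF comm, symmetric])
  have ab: "a ^ k * b ^ l = b ^ l * a ^ k" for k l
    by (rule power_commute_gen[of "b ^ l" a a k, OF ba, symmetric])
  have "(\<Sum>s<r. a ^ s * b ^ (r - s)) = u + (\<Sum>s<m. a ^ Suc s * b ^ (m - s))"
    unfolding m sum.lessThan_Suc_shift using ord by (simp add: m)
  also have "(\<Sum>s<m. a ^ Suc s * b ^ (m - s)) = (\<Sum>s<m. a ^ Suc (m - Suc s) * b ^ (m - (m - Suc s)))"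
    by (rule sum.nat_diff_reindex[symmetric])
  also have "\<dots> = (\<Sum>s<m. b ^ Suc s * a ^ (m - s))"
    by (rule sum.cong) (auto simp: Suc_diff_Suc ab simp del: power_Suc)
  also have "u + \<dots> = (\<Sum>s<r. b ^ s * a ^ (r - s))"
    unfolding m sum.lessThan_Suc_shift using ord by (simp add: m)
  finally show ?thesis by (simp add: cyclic_avg_def)
qed

text \<open>
  Multiplication by \<open>a\<close> shifts the index of summation, as does multiplication by \<open>b\<close>.
\<close>

lemma avg_absorb: "cyclic_avg \<rho> r a b * a = cyclic_avg \<rho> r a b * b"
proof -
  obtain m where m: "r = Suc m" using r by (cases r) auto
  have ba: "b ^ k * a = a * b ^ k" for k
    by (rule power_commute_gen[of a b b k, OF comm, symmetric])
  have l: "a ^ s * b ^ (r - s) * a = a ^ Suc s * b ^ (r - s)" for s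
    by (simp add: mult.assoc ba power_Suc2 del: power_Suc)
  have rr: "a ^ s * b ^ (r - s) * b = a ^ s * b ^ (Suc r - s)" if "s < r" for s
    using that by (simp add: mult.assoc power_Suc2[symmetric] Suc_diff_le del: power_Suc)
  have "(\<Sum>s<r. a ^ s * b ^ (r - s)) * a = (\<Sum>s<r. a ^ Suc s * b ^ (r - s))"
    by (simp add: sum_distrib_right l)
  also have "\<dots> = (\<Sum>s<m. a ^ Suc s * b ^ (r - s)) + a ^ r * b"
    by (simp add: m del: power_Suc)
  also have "a ^ r * b = b ^ Suc r"
    using ord unit by (simp add: power_Suc2 del: power_Suc)
  also have "(\<Sum>s<m. a ^ Suc s * b ^ (r - s)) + b ^ Suc r = (\<Sum>s<r. a ^ s * b ^ (Suc r - s))"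
    unfolding m sum.lessThan_Suc_shift by (simp add: add.commute del: power_Suc)
  also have "\<dots> = (\<Sum>s<r. a ^ s * b ^ (r - s)) * b"
    by (simp add: sum_distrib_right rr)
  finally show ?thesis by (simp add: cyclic_avg_def mult.assoc)
qed

lemma avg_absorb_power: "cyclic_avg \<rho> r a b * a ^ k = cyclic_avg \<rho> r a b * b ^ k"
proof (induction k)
  case (Suc k)
  have "cyclic_avg \<rho> r a b * a ^ Suc k = cyclic_avg \<rho> r a b * a ^ k * a" by (simp add: mult.assoc power_Suc2 del: power_Suc)
  also have "\<dots> = cyclic_avg \<rho> r a b * b ^ k * a" by (simp add: Suc)
  also have "\<dots> = cyclic_avg \<rho> r a b * a * b ^ k"
    by (simp add: mult.assoc power_commute_gen[of a b b k, OF comm])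
  finally show ?case by (simp add: avg_absorb mult.assoc)
qed simp

text \<open>
  Left multiplication by the first average identifies \<open>a\<close> with \<open>b\<close>.
\<close>

lemma avg_replace:
  assumes "\<rho> * a = a * \<rho>" "\<rho> * b = b * \<rho>" "c * a = a * c" "c * b = b * c" "c * \<rho> = \<rho> * c"
  shows "cyclic_avg \<rho> r a b * cyclic_avg \<rho> r a c = cyclic_avg \<rho> r a b * cyclic_avg \<rho> r b c"
proof -
  have er: "cyclic_avg \<rho> r a b * \<rho> = \<rho> * cyclic_avg \<rho> r a b"
    using cyclic_avg_conj[of \<rho> \<rho> a a b b r] assms by simp
  have "cyclic_avg \<rho> r a b * (a ^ s * c ^ (r - s)) = cyclic_avg \<rho> r a b * (b ^ s * c ^ (r - s))" for s
    by (simp add: mult.assoc[symmetric] avg_absorb_power)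
  then have "cyclic_avg \<rho> r a b * (\<Sum>s<r. a ^ s * c ^ (r - s)) = cyclic_avg \<rho> r a b * (\<Sum>s<r. b ^ s * c ^ (r - s))"
    by (simp add: sum_distrib_left)
  then have "\<rho> * (cyclic_avg \<rho> r a b * (\<Sum>s<r. a ^ s * c ^ (r - s))) = \<rho> * (cyclic_avg \<rho> r a b * (\<Sum>s<r. b ^ s * c ^ (r - s)))"
    by simp
  then show ?thesis unfolding cyclic_avg_def[of \<rho> r a c] cyclic_avg_def[of \<rho> r b c]
    by (simp add: er mult.assoc[symmetric])
qed

end

section \<open>Elements satisfying the Yokonuma--Hecke relations\<close>

text \<open>
  The map \<open>cl\<close> is a representation of the affine algebra, as a map on the free algebra. Its image
  \<open>A\<close> is a ring with unit \<open>u\<close>.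
\<close>

locale yh_rep =
  fixes r d n :: nat and cl :: "yh_free \<Rightarrow> 'a::{ring,monoid_mult}"
  assumes r: "1 \<le> r"
    and cl_add: "p \<in> carrier (free_algebra r d n) ==> p' \<in> carrier (free_algebra r d n) ==> cl (p + p') = cl p + cl p'"
    and cl_mult: "p \<in> carrier (free_algebra r d n) ==> p' \<in> carrier (free_algebra r d n) ==> cl (p * p') = cl p * cl p'"
    and cl_relation: "p \<in> yh_relations r n ==> cl p = 0"
begin

abbreviation F where "F \<equiv> carrier (free_algebra r d n)"

definition A where "A = cl ` F"
definition u where "u = cl 1"
definition s where "s c = cl (fscalar c)"
definition t where "t i = cl (fgen (T i))"
definition g where "g i = cl (fgen (G i))"
definition x where "x = cl (fgen X1)"
definition xinv where "xinv = cl (fgen X1inv)"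
definition \<rho> where "\<rho> = s (laurent_const (1 / of_nat r))"
definition \<kappa> where "\<kappa> = s (laurent_power Q 1 - laurent_power Q (-1))"
abbreviation e where "e \<equiv> cyclic_avg \<rho> r"

abbreviation R where "R \<equiv> carrier (ground_ring r d)"

lemma T_mem [simp]: "1 \<le> i ==> i \<le> n ==> fgen (T i) \<in> F" by (intro fgen_mem gens_mem)
lemma G_mem [simp]: "1 \<le> i ==> i < n ==> fgen (G i) \<in> F" by (intro fgen_mem gens_mem)
lemma X1_mem [simp]: "fgen X1 \<in> F" by (intro fgen_mem gens_mem)
lemma X1inv_mem [simp]: "fgen X1inv \<in> F" by (intro fgen_mem gens_mem)
lemma scal_mem [simp]: "c \<in> R ==> fscalar c \<in> F" by (rule fscalar_mem)

lemmas F_closed [simp] = free.mem_one free.mem_zero free.mem_add free.mem_uminus free.mem_mult free_diff free_power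

lemma kappa_R: "laurent_power Q 1 - laurent_power Q (-1) \<in> R"
  using ground.mem_add[OF laurent_Q_mem ground.mem_uminus[OF laurent_Q_mem]] by simp

lemma rho_R: "laurent_const (1 / of_nat r) \<in> R"
  by (intro laurent_const_mem coeff_ring)

lemma cl_zero: "cl 0 = 0"
  using cl_add[of 0 0] by simp

lemma cl_diff: "p \<in> F ==> p' \<in> F ==> cl (p - p') = cl p - cl p'"
  using cl_add[of "p - p'" p'] by (simp add: algebra_simps)

lemma cl_uminus: "p \<in> F ==> cl (- p) = - cl p"
  using cl_diff[of 0 p] by (simp add: cl_zero)

lemma cl_sum: "(\<And>i. i \<in> I ==> f i \<in> F) ==> cl (sum f I) = (\<Sum>i\<in>I. cl (f i))"
  by (induction I rule: infinite_finite_induct) (simp_all add: cl_zero cl_add free_sum)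

lemma cl_one: "cl 1 = u" by (simp add: u_def)

lemma A_I: "p \<in> F ==> cl p \<in> A" by (simp add: A_def)

lemma A_closed [simp]:
  "u \<in> A" "0 \<in> A" "a \<in> A ==> b \<in> A ==> a + b \<in> A" "a \<in> A ==> b \<in> A ==> a - b \<in> A" "a \<in> A ==> - a \<in> A"
  "a \<in> A ==> b \<in> A ==> a * b \<in> A"
proof -
  show "u \<in> A" by (simp add: A_I u_def)
  show "0 \<in> A" using A_I[of 0] by (simp add: cl_zero)
  assume "a \<in> A"
  then obtain p where p: "p \<in> F" "a = cl p" by (auto simp: A_def)
  show "- a \<in> A" using A_I[of "- p"] p by (simp add: cl_uminus)
  assume "b \<in> A"
  then obtain p' where p': "p' \<in> F" "b = cl p'" by (auto simp: A_def)
  show "a + b \<in> A" using A_I[of "p + p'"] p p' by (simp add: cl_add)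
  show "a - b \<in> A" using A_I[of "p - p'"] p p' by (simp add: cl_diff)
  show "a * b \<in> A" using A_I[of "p * p'"] p p' by (simp add: cl_mult)
qed

lemma A_sum [simp]: "(\<And>i. i \<in> I ==> f i \<in> A) ==> sum f I \<in> A"
  by (induction I rule: infinite_finite_induct) simp_all

lemma gens_A [simp]:
  "c \<in> R ==> s c \<in> A" "1 \<le> i ==> i \<le> n ==> t i \<in> A" "1 \<le> i ==> i < n ==> g i \<in> A" "x \<in> A" "xinv \<in> A"
  "\<rho> \<in> A" "\<kappa> \<in> A"
  by (simp_all add: A_I s_def t_def g_def x_def xinv_def \<rho>_def \<kappa>_def rho_R kappa_R)

lemma unit [simp]: "a \<in> A ==> u * a = a" "a \<in> A ==> a * u = a"
  using cl_mult[of 1] cl_mult[of _ 1] by (auto simp: A_def u_def)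

lemma central: "c \<in> R ==> a \<in> A ==> s c * a = a * s c"
  by (auto simp: A_def s_def cl_mult[symmetric] fscalar_central)

lemma kappa_central: "a \<in> A ==> \<kappa> * a = a * \<kappa>" and rho_central: "a \<in> A ==> \<rho> * a = a * \<rho>"
  by (simp_all add: \<rho>_def \<kappa>_def central rho_R kappa_R)

lemma s_simps: "c \<in> R ==> c' \<in> R ==> s (c + c') = s c + s c'" "c \<in> R ==> c' \<in> R ==> s (c * c') = s c * s c'"
  "s 1 = u" "s 0 = 0"
  by (simp_all add: s_def fscalar_simps cl_add cl_mult u_def cl_zero)

lemma power_A: "1 \<le> k ==> a \<in> A ==> a ^ k \<in> A"
  by (induction k rule: nat_induct_at_least) simp_all

lemma cl_power: "1 \<le> k ==> p \<in> F ==> cl (p ^ k) = cl p ^ k"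
  by (induction k rule: nat_induct_at_least) (simp_all add: cl_mult)

lemma t_comm: "1 \<le> i ==> i \<le> n ==> 1 \<le> j ==> j \<le> n ==> t i * t j = t j * t i"
  using cl_relation[OF yh_relations.t_comm[of i n j r]] by (simp add: cl_diff cl_mult t_def)

lemma t_order: "1 \<le> i ==> i \<le> n ==> t i ^ r = u"
  using cl_relation[OF yh_relations.t_order[of i n r]] r by (simp add: cl_diff cl_power t_def u_def)

lemma g_far: "1 \<le> i ==> i < n ==> 1 \<le> j ==> j < n ==> i + 2 \<le> j \<or> j + 2 \<le> i ==> g i * g j = g j * g i"
  using cl_relation[OF yh_relations.braid_far[of i n j r]] by (simp add: cl_diff cl_mult g_def)

lemma g_braid: "1 \<le> i ==> Suc i < n ==> g i * (g (Suc i) * g i) = g (Suc i) * (g i * g (Suc i))"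
  using cl_relation[OF yh_relations.braid[of i n r]] by (simp add: cl_diff cl_mult g_def mult.assoc)

lemma g_t: "1 \<le> i ==> i < n ==> 1 \<le> j ==> j \<le> n ==> g i * t j = t (transpose i (Suc i) j) * g i"
  using cl_relation[OF yh_relations.g_t[of i n j r]] transpose_range[of i n j]
  by (simp add: cl_diff cl_mult g_def t_def)

lemma g_t_simps:
  "1 \<le> i ==> i < n ==> g i * t i = t (Suc i) * g i"
  "1 \<le> i ==> i < n ==> g i * t (Suc i) = t i * g i"
  "1 \<le> i ==> i < n ==> 1 \<le> j ==> j \<le> n ==> j \<noteq> i ==> j \<noteq> Suc i ==> g i * t j = t j * g i"
  using g_t[of i i] g_t[of i "Suc i"] g_t[of i j] by (simp_all add: transpose_def)

lemma e_cl: "1 \<le> i ==> Suc i \<le> n ==> cl (e_elt r i) = e (t i) (t (Suc i))"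
proof -
  assume i: "1 \<le> i" "Suc i \<le> n"
  have "cl (fgen (T i) ^ k * fgen (T (Suc i)) ^ (r - k)) = t i ^ k * t (Suc i) ^ (r - k)" if "k < r" for k
    using i that by (cases k) (simp_all add: cl_mult cl_power t_def del: power_Suc)
  then have "cl (\<Sum>k<r. fgen (T i) ^ k * fgen (T (Suc i)) ^ (r - k)) = (\<Sum>k<r. t i ^ k * t (Suc i) ^ (r - k))"
    using i by (subst cl_sum) simp_all
  then show ?thesis
    using i by (simp add: e_elt_def cyclic_avg_def \<rho>_def s_def cl_mult rho_R free_sum)
qed

lemma e_A: "a \<in> A ==> b \<in> A ==> e a b \<in> A"
proof -
  assume ab: "a \<in> A" "b \<in> A"
  have "a ^ k * b ^ (r - k) \<in> A" if "k < r" for k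
    using ab that by (cases k) (simp_all add: power_A del: power_Suc)
  then show ?thesis unfolding cyclic_avg_def by (intro A_closed(6)[OF gens_A(6) A_sum]) auto
qed

lemma g_quadratic: "1 \<le> i ==> i < n ==> g i * g i = u + \<kappa> * (e (t i) (t (Suc i)) * g i)"
proof -
  assume i: "1 \<le> i" "i < n"
  have m: "e_elt r i \<in> F" using i by (intro e_elt_mem) auto
  show ?thesis
    using cl_relation[OF yh_relations.quadratic[OF i]] i m kappa_R
    by (simp add: cl_diff cl_add cl_mult cl_power power2_eq_square g_def u_def \<kappa>_def s_def e_cl[symmetric] mult.assoc)
qed

lemma x_inverse: "x * xinv = u" "xinv * x = u"
  using cl_relation[OF yh_relations.X1_X1inv[of r n]] cl_relation[OF yh_relations.X1inv_X1[of r n]]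
  by (simp_all add: cl_diff cl_mult x_def xinv_def u_def)

lemma x_braid: "1 < n ==> g 1 * (x * (g 1 * x)) = x * (g 1 * (x * g 1))"
  using cl_relation[OF yh_relations.X1_braid[of n r]] by (simp add: cl_diff cl_mult x_def g_def mult.assoc)

lemma g_x: "2 \<le> i ==> i < n ==> g i * x = x * g i"
  using cl_relation[OF yh_relations.g_X1[of i n r]] by (simp add: cl_diff cl_mult x_def g_def)

lemma t_x: "1 \<le> j ==> j \<le> n ==> t j * x = x * t j"
  using cl_relation[OF yh_relations.t_X1[of j n r]] by (simp add: cl_diff cl_mult x_def t_def)

lemma cyclic_pair:
  "a \<in> A ==> b \<in> A ==> a * b = b * a ==> a ^ r = u ==> b ^ r = u ==> cyclic_pair u r a b"
  by unfold_locales (use r in simp_all)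

lemma e_swap: "1 \<le> i ==> i \<le> n ==> 1 \<le> j ==> j \<le> n ==> e (t i) (t j) = e (t j) (t i)"
  by (rule cyclic_pair.avg_swap[OF cyclic_pair]) (simp_all add: t_comm t_order)

lemma g_e_comm: "1 \<le> i ==> i < n ==> g i * e (t i) (t (Suc i)) = e (t i) (t (Suc i)) * g i"
  by (subst e_swap, simp_all, rule cyclic_avg_conj) (simp_all add: rho_central[symmetric] g_t_simps)

end

section \<open>Right translation of functionals\<close>

text \<open>
  The arrays \<open>\<phi> j k\<close> with \<open>1 \<le> j \<le> n + 1\<close> stand for the values \<open>f(X\<^sup>k u\<^sub>j)\<close> of a left \<open>A\<close>-linear
  functional \<open>f\<close> on the algebra for \<open>n + 1\<close>, with \<open>u\<^sub>j = g\<^sub>n\<^sup>-\<^sup>1 \<dots> g\<^sub>j\<^sup>-\<^sup>1\<close> and \<open>X = X\<^sub>n\<^sub>+\<^sub>1\<close>, such that left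
  multiplication by \<open>t\<^sub>n\<^sub>+\<^sub>1\<close> acts on the values as the central element \<open>t0\<close>. A generator \<open>b\<close> acts on
  functionals by \<open>(b f)(y) = f(y b)\<close>, so the operators below record how \<open>u\<^sub>j b\<close> is expressed by
  the elements \<open>X\<^sup>k u\<^sub>i\<close> with coefficients in \<open>A\<close>. Entries at other indices \<open>j\<close> are 0.
\<close>

locale yh_coind = yh_rep r d n cl for r d n and cl :: "yh_free \<Rightarrow> 'a::{ring,monoid_mult}" +
  fixes t0 :: 'a
  assumes n: "1 \<le> n" and t0: "t0 \<in> A" and t0_central: "a \<in> A ==> t0 * a = a * t0" and t0_order: "t0 ^ r = u"
begin

abbreviation e0 where "e0 i \<equiv> e (t i) t0"

lemma t0_pair: "1 \<le> i ==> i \<le> n ==> cyclic_pair u r (t i) t0"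
  by (rule cyclic_pair) (simp_all add: t0 t0_order t_order t0_central[symmetric])

lemma e0_swap: "1 \<le> i ==> i \<le> n ==> e t0 (t i) = e0 i"
  by (rule cyclic_pair.avg_swap[OF t0_pair, symmetric])

lemma e0_A [simp]: "1 \<le> i ==> i \<le> n ==> e0 i \<in> A"
  by (intro e_A t0 gens_A)

lemma ee_A [simp]: "1 \<le> i ==> i < n ==> e (t i) (t (Suc i)) \<in> A"
  by (intro e_A gens_A) auto

lemma e0_absorb: "1 \<le> i ==> i \<le> n ==> e0 i * t i = e0 i * t0"
  by (rule cyclic_pair.avg_absorb[OF t0_pair])

lemma e0_t: "1 \<le> i ==> i \<le> n ==> 1 \<le> j ==> j \<le> n ==> t j * e0 i = e0 i * t j"
  by (rule cyclic_avg_conj) (simp_all add: rho_central t0_central t_comm)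

lemma e0_x: "1 \<le> i ==> i \<le> n ==> x * e0 i = e0 i * x"
  by (rule cyclic_avg_conj) (simp_all add: rho_central t0_central t_x)

lemma g_e0:
  "1 \<le> i ==> i < n ==> g i * e0 i = e0 (Suc i) * g i"
  "1 \<le> i ==> i < n ==> g i * e0 (Suc i) = e0 i * g i"
  "1 \<le> i ==> i < n ==> 1 \<le> j ==> j \<le> n ==> j \<noteq> i ==> j \<noteq> Suc i ==> g i * e0 j = e0 j * g i"
  by (rule cyclic_avg_conj; simp add: rho_central t0_central g_t_simps)+

text \<open>
  The average over \<open>t\<^sub>i\<close> and \<open>t0\<close> absorbs \<open>t\<^sub>i\<close> into \<open>t0\<close>, so the second average can be taken over
  \<open>t0\<close> and \<open>t\<^sub>i\<^sub>+\<^sub>1\<close>.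
\<close>

lemma e0_e0: "1 \<le> i ==> i < n ==> e0 i * e (t i) (t (Suc i)) = e0 (Suc i) * e0 i"
proof -
  assume i: "1 \<le> i" "i < n"
  have "e0 i * e (t i) (t (Suc i)) = e0 i * e t0 (t (Suc i))"
  proof (rule cyclic_pair.avg_replace[OF t0_pair])
    show "\<rho> * t i = t i * \<rho>" "\<rho> * t0 = t0 * \<rho>" "t (Suc i) * \<rho> = \<rho> * t (Suc i)"
      using i t0 by (simp_all add: rho_central)
    show "t (Suc i) * t i = t i * t (Suc i)" using i by (intro t_comm) auto
    show "t (Suc i) * t0 = t0 * t (Suc i)" using i by (simp add: t0_central)
  qed (use i in simp_all)
  also have "\<dots> = e0 i * e0 (Suc i)" using i by (simp add: e0_swap)
  also have "\<dots> = e0 (Suc i) * e0 i"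
    by (rule cyclic_avg_conj) (use i in \<open>simp_all add: rho_central t0_central e0_t[symmetric]\<close>)
  finally show ?thesis .
qed

text \<open>
  Moving \<open>t\<^sub>i\<close> to the left of \<open>u\<^sub>j\<close>, with \<open>t0\<close> in place of \<open>t\<^sub>n\<^sub>+\<^sub>1\<close>.
\<close>

definition tj where "tj i j = (if i < j then t i else if i = j then t0 else t (i - 1))"

lemma tj_A [simp]: "1 \<le> i ==> i \<le> Suc n ==> 1 \<le> j ==> j \<le> Suc n ==> tj i j \<in> A"
  by (auto simp: tj_def t0)

definition Top where "Top i \<phi> = (\<lambda>j k. if 1 \<le> j \<and> j \<le> Suc n then tj i j * \<phi> j k else 0)"

text \<open>
  In order of the cases: \<open>u\<^sub>j g\<^sub>i = g\<^sub>i u\<^sub>j\<close> for \<open>i + 1 < j\<close>; \<open>u\<^sub>i\<^sub>+\<^sub>1 g\<^sub>i = u\<^sub>i + \<kappa> u\<^sub>i\<^sub>+\<^sub>1 e\<^sub>i\<close> by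
  \<open>g\<^sub>i = g\<^sub>i\<^sup>-\<^sup>1 + \<kappa> e\<^sub>i\<close>; \<open>u\<^sub>i g\<^sub>i = u\<^sub>i\<^sub>+\<^sub>1\<close>; and \<open>u\<^sub>j g\<^sub>i = g\<^sub>i\<^sub>-\<^sub>1 u\<^sub>j\<close> for \<open>j < i\<close> by the braid
  relation.
\<close>

definition Gop :: "nat \<Rightarrow> (nat \<Rightarrow> nat \<Rightarrow> 'a) \<Rightarrow> nat \<Rightarrow> nat \<Rightarrow> 'a" where
  "Gop i \<phi> = (\<lambda>j k. if 1 \<le> j \<and> j \<le> Suc n then
     (if Suc i < j then g i * \<phi> j k else if Suc i = j then \<phi> i k + \<kappa> * (e0 i * \<phi> j k)
      else if i = j then \<phi> (Suc j) k else g (i - 1) * \<phi> j k) else 0)"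

definition Eop where "Eop i \<phi> = (\<lambda>j k. if 1 \<le> j \<and> j \<le> Suc n then e (tj i j) (tj (Suc i) j) * \<phi> j k else 0)"

definition gd where "gd m p = prod_list (map g (rev [m..<p]))"

text \<open>
  The coefficients in \<open>g\<^sub>n \<dots> g\<^sub>1 = u\<^sub>1 + \<Sum>\<^sub>i \<alpha>\<^sub>i u\<^sub>i\<close>, where \<open>i\<close> runs from 2 to \<open>n + 1\<close>.
\<close>

definition \<alpha> where "\<alpha> i = \<kappa> * (e0 (i - 1) * gd 1 (i - 1))"

definition tail where "tail = {2..Suc n}"

lemma tail_iff [simp]: "i \<in> tail \<longleftrightarrow> 2 \<le> i \<and> i \<le> Suc n"
  by (auto simp: tail_def)

text \<open>
  For \<open>j \<ge> 2\<close> the element \<open>X\<^sub>1\<close> commutes with \<open>u\<^sub>j\<close>. The remaining entry comes from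
  \<open>g\<^sub>n \<dots> g\<^sub>1 X\<^sub>1 = X u\<^sub>1\<close>, which gives \<open>u\<^sub>1 X\<^sub>1 = X u\<^sub>1 - \<Sum>\<^sub>i \<alpha>\<^sub>i X\<^sub>1 u\<^sub>i\<close>.
\<close>

definition Xop :: "(nat \<Rightarrow> nat \<Rightarrow> 'a) \<Rightarrow> nat \<Rightarrow> nat \<Rightarrow> 'a" where
  "Xop \<phi> = (\<lambda>j k. if j = 1 then \<phi> 1 (Suc k) - (\<Sum>i\<in>tail. \<alpha> i * (x * \<phi> i k))
     else if 2 \<le> j \<and> j \<le> Suc n then x * \<phi> j k else 0)"

definition Sop :: "'a \<Rightarrow> (nat \<Rightarrow> nat \<Rightarrow> 'a) \<Rightarrow> nat \<Rightarrow> nat \<Rightarrow> 'a" where "Sop c \<phi> = (\<lambda>j k. c * \<phi> j k)"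
definition Add :: "(nat \<Rightarrow> nat \<Rightarrow> 'a) \<Rightarrow> (nat \<Rightarrow> nat \<Rightarrow> 'a) \<Rightarrow> nat \<Rightarrow> nat \<Rightarrow> 'a" where "Add \<phi> \<psi> = (\<lambda>j k. \<phi> j k + \<psi> j k)"

definition D where "D = {\<phi>. (\<forall>j k. \<phi> j k \<in> A) \<and> (\<forall>j k. \<not> (1 \<le> j \<and> j \<le> Suc n) \<longrightarrow> \<phi> j k = 0)}"

lemma D_I:
  "(\<And>j k. 1 \<le> j ==> j \<le> Suc n ==> \<phi> j k \<in> A) ==>
   (\<And>j k. \<not> (1 \<le> j \<and> j \<le> Suc n) ==> \<phi> j k = 0) ==> \<phi> \<in> D"
proof -
  assume a: "\<And>j k. 1 \<le> j ==> j \<le> Suc n ==> \<phi> j k \<in> A"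
    and b: "\<And>j k. \<not> (1 \<le> j \<and> j \<le> Suc n) ==> \<phi> j k = 0"
  have "\<phi> j k \<in> A" for j k
  proof (cases "1 \<le> j \<and> j \<le> Suc n")
    case False
    show ?thesis unfolding b[OF False] by simp
  qed (simp add: a)
  then show "\<phi> \<in> D" using b unfolding D_def by blast
qed

lemma D_outside: "\<phi> \<in> D ==> \<not> (1 \<le> j \<and> j \<le> Suc n) ==> \<phi> j k = 0"
  by (simp add: D_def)

lemma D_A [simp]: "\<phi> \<in> D ==> \<phi> j k \<in> A" by (simp add: D_def)

lemma D_eqI:
  "\<phi> \<in> D ==> \<psi> \<in> D ==> (\<And>j k. 1 \<le> j ==> j \<le> Suc n ==> \<phi> j k = \<psi> j k) ==> \<phi> = \<psi>"
proof (intro ext)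
  fix j k
  assume D: "\<phi> \<in> D" "\<psi> \<in> D" and eq: "\<And>j k. 1 \<le> j ==> j \<le> Suc n ==> \<phi> j k = \<psi> j k"
  show "\<phi> j k = \<psi> j k"
  proof (cases "1 \<le> j \<and> j \<le> Suc n")
    case False
    show ?thesis unfolding D_outside[OF D(1) False] D_outside[OF D(2) False] ..
  qed (simp add: eq)
qed

lemma gd_Suc: "m \<le> p ==> gd m (Suc p) = g p * gd m p" "gd m m = 1"
  by (simp_all add: gd_def)

lemma gd_A:
  assumes "a \<in> A" "1 \<le> m"
  shows "p \<le> n ==> gd m p * a \<in> A"
proof (induction p)
  case 0
  then show ?case using assms by (simp add: gd_def)
next
  case (Suc p)
  show ?case
  proof (cases "m \<le> p")
    case True
    then show ?thesis unfolding gd_Suc(1)[OF True] mult.assoc using Suc assms True by (intro A_closed(6)[OF gens_A(3)]) auto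
  next
    case False
    then have "gd m (Suc p) = 1" by (simp add: gd_def)
    then show ?thesis using assms by simp
  qed
qed

lemma alpha_mult_A [simp]: "a \<in> A ==> 2 \<le> i ==> i \<le> Suc n ==> \<alpha> i * a \<in> A"
  unfolding \<alpha>_def mult.assoc by (intro A_closed(6)[OF gens_A(7)] A_closed(6)[OF e0_A] gd_A) auto

lemma Top_D [simp]: "1 \<le> i ==> i \<le> Suc n ==> \<phi> \<in> D ==> Top i \<phi> \<in> D"
  by (rule D_I) (auto simp: Top_def)

lemma Gop_D [simp]: "1 \<le> i ==> i \<le> n ==> \<phi> \<in> D ==> Gop i \<phi> \<in> D"
  by (rule D_I) (auto simp: Gop_def)

lemma Eop_D [simp]: "1 \<le> i ==> i \<le> n ==> \<phi> \<in> D ==> Eop i \<phi> \<in> D"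
  by (rule D_I) (auto simp: Eop_def e_A)

lemma Xop_D [simp]: "\<phi> \<in> D ==> Xop \<phi> \<in> D"
  by (rule D_I) (auto simp: Xop_def intro!: A_closed(4) A_sum)

lemma Sop_D [simp]: "c \<in> A ==> \<phi> \<in> D ==> Sop c \<phi> \<in> D"
  by (rule D_I) (auto simp: Sop_def D_outside)

lemma Add_D [simp]: "\<phi> \<in> D ==> \<psi> \<in> D ==> Add \<phi> \<psi> \<in> D"
  by (rule D_I) (auto simp: Add_def D_outside)

lemma op_Add:
  "Top i (Add \<phi> \<psi>) = Add (Top i \<phi>) (Top i \<psi>)"
  "Gop i (Add \<phi> \<psi>) = Add (Gop i \<phi>) (Gop i \<psi>)"
  "Eop i (Add \<phi> \<psi>) = Add (Eop i \<phi>) (Eop i \<psi>)"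
  "Xop (Add \<phi> \<psi>) = Add (Xop \<phi>) (Xop \<psi>)"
  "Sop c (Add \<phi> \<psi>) = Add (Sop c \<phi>) (Sop c \<psi>)"
proof -
  show "Top i (Add \<phi> \<psi>) = Add (Top i \<phi>) (Top i \<psi>)"
    by (intro ext) (simp add: Top_def Add_def distrib_left)
  show "Gop i (Add \<phi> \<psi>) = Add (Gop i \<phi>) (Gop i \<psi>)"
    by (intro ext) (simp add: Gop_def Add_def distrib_left add.assoc add.left_commute)
  show "Eop i (Add \<phi> \<psi>) = Add (Eop i \<phi>) (Eop i \<psi>)"
    by (intro ext) (simp add: Eop_def Add_def distrib_left)
  show "Xop (Add \<phi> \<psi>) = Add (Xop \<phi>) (Xop \<psi>)"
    by (intro ext) (simp add: Xop_def Add_def distrib_left sum.distrib add_diff_add)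
  show "Sop c (Add \<phi> \<psi>) = Add (Sop c \<phi>) (Sop c \<psi>)"
    by (intro ext) (simp add: Sop_def Add_def distrib_left)
qed

definition central_elt where "central_elt c \<longleftrightarrow> c \<in> A \<and> (\<forall>a\<in>A. c * a = a * c)"

lemma central_elt: "central_elt c ==> a \<in> A ==> c * a = a * c" "central_elt c ==> c \<in> A"
  by (simp_all add: central_elt_def)

lemma central_left: "central_elt c ==> a \<in> A ==> a * (c * b) = c * (a * b)"
  by (simp add: central_elt mult.assoc[symmetric])

lemma central_scalars: "c \<in> R ==> central_elt (s c)" "central_elt \<kappa>" "central_elt \<rho>" "central_elt t0"
  by (simp_all add: central_elt_def central kappa_central rho_central t0 t0_central)

lemma alpha_central: "central_elt c ==> a \<in> A ==> 2 \<le> i ==> i \<le> Suc n ==> \<alpha> i * (c * a) = c * (\<alpha> i * a)"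
proof -
  assume c: "central_elt c" "a \<in> A" "2 \<le> i" "i \<le> Suc n"
  have "\<alpha> i * (c * a) = (\<alpha> i * a) * c" using c by (simp add: central_elt mult.assoc)
  also have "\<dots> = c * (\<alpha> i * a)" using c by (simp add: central_elt(1)[of c])
  finally show ?thesis .
qed

lemma op_Sop:
  assumes c: "central_elt c" and \<phi>: "\<phi> \<in> D"
  shows "1 \<le> i ==> i \<le> Suc n ==> Top i (Sop c \<phi>) = Sop c (Top i \<phi>)"
  "1 \<le> i ==> i \<le> n ==> Gop i (Sop c \<phi>) = Sop c (Gop i \<phi>)"
  "1 \<le> i ==> i \<le> n ==> Eop i (Sop c \<phi>) = Sop c (Eop i \<phi>)"
  "Xop (Sop c \<phi>) = Sop c (Xop \<phi>)"
proof -
  show "1 \<le> i ==> i \<le> Suc n ==> Top i (Sop c \<phi>) = Sop c (Top i \<phi>)"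
    by (intro ext) (auto simp: Top_def Sop_def central_left[OF c])
  show "1 \<le> i ==> i \<le> n ==> Gop i (Sop c \<phi>) = Sop c (Gop i \<phi>)"
    by (intro ext) (auto simp: Gop_def Sop_def central_left[OF c] distrib_left)
  show "1 \<le> i ==> i \<le> n ==> Eop i (Sop c \<phi>) = Sop c (Eop i \<phi>)"
    by (intro ext) (auto simp: Eop_def Sop_def central_left[OF c] e_A)
  show "Xop (Sop c \<phi>) = Sop c (Xop \<phi>)"
    by (intro ext)
      (auto simp: Xop_def Sop_def central_left[OF c] right_diff_distrib sum_distrib_left alpha_central[OF c] \<phi>
        intro!: sum.cong)
qed

lemma Gop_simps:
  "Suc i < j ==> j \<le> Suc n ==> Gop i \<phi> j k = g i * \<phi> j k"
  "i \<le> n ==> Gop i \<phi> (Suc i) k = \<phi> i k + \<kappa> * (e0 i * \<phi> (Suc i) k)"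
  "1 \<le> i ==> i \<le> n ==> Gop i \<phi> i k = \<phi> (Suc i) k"
  "1 \<le> j ==> j < i ==> i \<le> n ==> Gop i \<phi> j k = g (i - 1) * \<phi> j k"
  by (simp_all add: Gop_def)

lemma Top_simps: "1 \<le> j ==> j \<le> Suc n ==> Top i \<phi> j k = tj i j * \<phi> j k"
  by (simp add: Top_def)

lemma Eop_simps: "1 \<le> j ==> j \<le> Suc n ==> Eop i \<phi> j k = e (tj i j) (tj (Suc i) j) * \<phi> j k"
  by (simp add: Eop_def)

lemma Xop_simps: "2 \<le> j ==> j \<le> Suc n ==> Xop \<phi> j k = x * \<phi> j k"
  by (simp add: Xop_def)

lemma kl:
  "1 \<le> i ==> i < n ==> g i * (\<kappa> * b) = \<kappa> * (g i * b)"
  "1 \<le> i ==> i \<le> n ==> e0 i * (\<kappa> * b) = \<kappa> * (e0 i * b)"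
  "1 \<le> i ==> i \<le> Suc n ==> 1 \<le> j ==> j \<le> Suc n ==> tj i j * (\<kappa> * b) = \<kappa> * (tj i j * b)"
  "x * (\<kappa> * b) = \<kappa> * (x * b)"
  by (rule central_left[OF central_scalars(2)]; simp)+

lemma rel_T_comm:
  assumes "1 \<le> i" "i \<le> Suc n" "1 \<le> j" "j \<le> Suc n" "\<phi> \<in> D"
  shows "Top i (Top j \<phi>) = Top j (Top i \<phi>)"
proof (rule D_eqI)
  fix l k assume l: "1 \<le> l" "l \<le> Suc n"
  have "tj i l * tj j l = tj j l * tj i l"
    using assms l by (auto simp: tj_def t0 t0_central t_comm)
  then show "Top i (Top j \<phi>) l k = Top j (Top i \<phi>) l k"
    using l by (simp add: Top_simps mult.assoc[symmetric])
qed (use assms in simp_all)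

lemma Top_power: "1 \<le> j ==> j \<le> Suc n ==> (Top i ^^ m) \<phi> j k = tj i j ^ m * \<phi> j k"
  by (induction m arbitrary: \<phi>) (simp_all add: Top_simps mult.assoc)

lemma tj_order: "1 \<le> i ==> i \<le> Suc n ==> 1 \<le> j ==> j \<le> Suc n ==> tj i j ^ r = u"
  by (auto simp: tj_def t_order t0_order)

lemma rel_G_T:
  assumes i: "1 \<le> i" "i \<le> n" and j: "1 \<le> j" "j \<le> Suc n" and \<phi>: "\<phi> \<in> D"
  shows "Gop i (Top j \<phi>) = Top (transpose i (Suc i) j) (Gop i \<phi>)"
proof (rule D_eqI)
  let ?j = "transpose i (Suc i) j"
  have j': "1 \<le> ?j" "?j \<le> Suc n" using i j by (auto simp: transpose_def)
  show "Gop i (Top j \<phi>) \<in> D" "Top ?j (Gop i \<phi>) \<in> D" using i j j' \<phi> by simp_all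
  fix l k assume l: "1 \<le> l" "l \<le> Suc n"
  consider "Suc i < l" | "l = Suc i" | "l = i" | "l < i" by linarith
  then show "Gop i (Top j \<phi>) l k = Top ?j (Gop i \<phi>) l k"
  proof cases
    case 1
    have "g i * tj j l = tj ?j l * g i"
      using i j l 1 g_t_simps(1)[of i] g_t_simps(2)[of i] g_t_simps(3)[of i j] g_t_simps(3)[of i "j - 1"]
        t0_central[of "g i"]
      by (auto simp: tj_def transpose_def)
    then show ?thesis using 1 l by (simp add: Gop_simps Top_simps mult.assoc[symmetric])
  next
    case 2
    have 1: "tj j i = tj ?j l" using i j 2 by (auto simp: tj_def transpose_def)
    have "e0 i * tj j l = e0 i * tj ?j l"
      using i j 2 e0_absorb[of i] by (auto simp: tj_def transpose_def)
    also have "\<dots> = tj ?j l * e0 i"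
      using i j j' 2 e0_t[of i ?j] e0_t[of i "?j - 1"] t0_central[of "e0 i"] by (auto simp: tj_def)
    finally have "e0 i * (tj j l * \<phi> l k) = tj ?j l * (e0 i * \<phi> l k)" by (simp add: mult.assoc[symmetric])
    then show ?thesis
      using i j j' l 2 1 by (simp add: Gop_simps Top_simps distrib_left kl)
  next
    case 3
    have "tj j (Suc i) = tj ?j i" using i j by (auto simp: tj_def transpose_def)
    then show ?thesis using 3 i by (simp add: Gop_simps Top_simps)
  next
    case 4
    have "g (i - 1) * tj j l = tj ?j l * g (i - 1)"
      using i j l 4 g_t_simps(1)[of "i - 1"] g_t_simps(2)[of "i - 1"] g_t_simps(3)[of "i - 1" j] g_t_simps(3)[of "i - 1" "j - 1"]
        t0_central[of "g (i - 1)"]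
      by (auto simp: tj_def transpose_def)
    then show ?thesis using 4 i l by (simp add: Gop_simps Top_simps mult.assoc[symmetric])
  qed
qed

text \<open>
  The two entries at \<open>i\<close> and \<open>i + 1\<close> are exchanged up to a correction, which reproduces \<open>\<kappa> e\<^sub>i\<close>; at
  all other entries the operator is multiplication by some \<open>g\<^sub>l\<close>, and the relation is the one of \<open>A\<close>.
\<close>

lemma rel_G_quadratic:
  assumes i: "1 \<le> i" "i \<le> n" and \<phi>: "\<phi> \<in> D"
  shows "Gop i (Gop i \<phi>) = Add \<phi> (Sop \<kappa> (Eop i (Gop i \<phi>)))"
proof (rule D_eqI)
  fix l k assume l: "1 \<le> l" "l \<le> Suc n"
  consider "Suc i < l" | "l = Suc i" | "l = i" | "l < i" by linarith
  then show "Gop i (Gop i \<phi>) l k = Add \<phi> (Sop \<kappa> (Eop i (Gop i \<phi>))) l k"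
  proof cases
    case 1
    then show ?thesis using i l \<phi>
      by (simp add: Gop_simps Eop_simps Add_def Sop_def tj_def mult.assoc[symmetric] g_quadratic[unfolded mult.assoc[symmetric]] distrib_right)
  next
    case 2
    then show ?thesis using i by (simp add: Gop_simps Eop_simps Add_def Sop_def tj_def)
  next
    case 3
    then show ?thesis using i by (simp add: Gop_simps Eop_simps Add_def Sop_def tj_def e0_swap)
  next
    case 4
    then show ?thesis using i l \<phi> g_quadratic[of "i - 1"]
      by (auto simp: Gop_simps Eop_simps Add_def Sop_def tj_def mult.assoc[symmetric] distrib_right)
  qed
qed (use i \<phi> in simp_all)

lemma rel_G_far:
  assumes i: "1 \<le> i" "i \<le> n" "1 \<le> j" "j \<le> n" "i + 2 \<le> j" and \<phi>: "\<phi> \<in> D"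
  shows "Gop i (Gop j \<phi>) = Gop j (Gop i \<phi>)"
proof (rule D_eqI)
  fix l k assume l: "1 \<le> l" "l \<le> Suc n"
  consider "Suc j < l" | "l = Suc j" | "l = j" | "Suc i < l" "l < j" | "l = Suc i" | "l = i" | "l < i" by linarith
  then show "Gop i (Gop j \<phi>) l k = Gop j (Gop i \<phi>) l k"
  proof cases
    case 1
    then show ?thesis using i l g_far[of i j] by (simp add: Gop_simps mult.assoc[symmetric])
  next
    case 2
    have "g i * (e0 j * \<phi> l k) = e0 j * (g i * \<phi> l k)"
      using g_e0(3)[of i j] i by (simp add: mult.assoc[symmetric])
    then show ?thesis using i l 2 by (simp add: Gop_simps distrib_left kl)
  next
    case 3
    then show ?thesis using i l by (simp add: Gop_simps)
  next
    case 4
    then show ?thesis using i l g_far[of i "j - 1"] by (simp add: Gop_simps mult.assoc[symmetric])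
  next
    case 5
    have "g (j - 1) * (e0 i * \<phi> l k) = e0 i * (g (j - 1) * \<phi> l k)"
      using g_e0(3)[of "j - 1" i] i by (simp add: mult.assoc[symmetric])
    then show ?thesis using i l 5 by (simp add: Gop_simps distrib_left kl)
  next
    case 6
    then show ?thesis using i l by (simp add: Gop_simps)
  next
    case 7
    have "g (i - 1) * g (j - 1) = g (j - 1) * g (i - 1)" using 7 i l by (intro g_far) arith+
    then show ?thesis using 7 i l by (simp add: Gop_simps mult.assoc[symmetric])
  qed
qed (use i \<phi> in simp_all)

lemma rel_G_braid:
  assumes i: "1 \<le> i" "Suc i \<le> n" and \<phi>: "\<phi> \<in> D"
  shows "Gop i (Gop (Suc i) (Gop i \<phi>)) = Gop (Suc i) (Gop i (Gop (Suc i) \<phi>))"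
proof (rule D_eqI)
  fix l k assume l: "1 \<le> l" "l \<le> Suc n"
  consider "Suc (Suc i) < l" | "l = Suc (Suc i)" | "l = Suc i" | "l = i" | "l < i" by linarith
  then show "Gop i (Gop (Suc i) (Gop i \<phi>)) l k = Gop (Suc i) (Gop i (Gop (Suc i) \<phi>)) l k"
  proof cases
    case 1
    have "g i * (g (Suc i) * (g i * \<phi> l k)) = g (Suc i) * (g i * (g (Suc i) * \<phi> l k))"
      using g_braid[of i] 1 l i by (simp add: mult.assoc[symmetric])
    then show ?thesis using 1 l i by (simp add: Gop_simps)
  next
    case 2
    let ?a = "\<phi> i k" and ?b = "\<phi> (Suc i) k" and ?c = "\<phi> (Suc (Suc i)) k"
    have i': "i < n" using i by simp
    have 1: "g i * (e0 i * ?b) = e0 (Suc i) * (g i * ?b)"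
      using g_e0(1)[of i] i' i by (simp add: mult.assoc[symmetric])
    have "g i * (e0 (Suc i) * (g i * ?c)) = e0 i * ((g i * g i) * ?c)"
      using g_e0(2)[of i] i' i by (simp add: mult.assoc[symmetric])
    also have "(g i * g i) * ?c = ?c + \<kappa> * (e (t i) (t (Suc i)) * (g i * ?c))"
      using g_quadratic[of i] i i' \<phi> by (simp add: mult.assoc distrib_right)
    also have "e0 i * \<dots> = e0 i * ?c + \<kappa> * ((e0 i * e (t i) (t (Suc i))) * (g i * ?c))"
      using i i' by (simp add: distrib_left kl mult.assoc)
    also have "e0 i * e (t i) (t (Suc i)) = e0 (Suc i) * e0 i" by (rule e0_e0[OF i(1) i'])
    finally have 2: "g i * (e0 (Suc i) * (g i * ?c)) = e0 i * ?c + \<kappa> * (e0 (Suc i) * (e0 i * (g i * ?c)))"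
      by (simp add: mult.assoc)
    have 3: "e0 i * (g i * ?c) = g i * (e0 (Suc i) * ?c)"
      using g_e0(2)[of i] i' i by (simp add: mult.assoc[symmetric])
    show ?thesis
      unfolding \<open>l = Suc (Suc i)\<close> using i i' 1 2 3
      by (simp add: Gop_simps distrib_left kl add.assoc)
  next
    case 3
    have "e0 i * (g i * \<phi> (Suc (Suc i)) k) = g i * (e0 (Suc i) * \<phi> (Suc (Suc i)) k)"
      using g_e0(2)[of i] i by (simp add: mult.assoc[symmetric])
    then show ?thesis using i l 3 by (simp add: Gop_simps distrib_left kl)
  next
    case 4
    then show ?thesis using i l by (simp add: Gop_simps)
  next
    case 5
    have "g (i - 1) * (g i * (g (i - 1) * \<phi> l k)) = g i * (g (i - 1) * (g i * \<phi> l k))"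
      using g_braid[of "i - 1"] 5 l i by (simp add: mult.assoc[symmetric])
    then show ?thesis using 5 l i by (simp add: Gop_simps)
  qed
qed (use i \<phi> in simp_all)

end

subsection \<open>Relations involving \<open>X\<^sub>1\<close>\<close>

context yh_coind
begin

lemma fold_Gop_D: "set L \<subseteq> {1..n} ==> \<phi> \<in> D ==> fold Gop L \<phi> \<in> D"
  by (induction L arbitrary: \<phi>) auto

lemma fold_commute:
  assumes "set L \<subseteq> {1..n}" "\<phi> \<in> D"
    and "\<And>l \<psi>. l \<in> set L ==> \<psi> \<in> D ==> f (Gop l \<psi>) = Gop l (f \<psi>)"
  shows "f (fold Gop L \<phi>) = fold Gop L (f \<phi>)"
  using assms
proof (induction L arbitrary: \<phi>)
  case (Cons a L)
  have a: "1 \<le> a" "a \<le> n" using Cons.prems(1) by auto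
  have "f (fold Gop L (Gop a \<phi>)) = fold Gop L (f (Gop a \<phi>))"
    by (rule Cons.IH) (use Cons.prems a in auto)
  then show ?case using Cons.prems by simp
qed simp

lemma gd_cases: "1 \<le> m ==> p \<le> n ==> gd m p = 1 \<or> gd m p \<in> A"
proof -
  assume mp: "1 \<le> m" "p \<le> n"
  have "m \<le> p' ==> p' < n ==> gd m (Suc p') \<in> A" for p'
  proof (induction p' rule: dec_induct)
    case base
    then show ?case using mp by (simp add: gd_Suc)
  next
    case (step k)
    then show ?case using mp by (subst gd_Suc) auto
  qed
  then show ?thesis using mp by (cases p) (auto simp: gd_def)
qed

lemma gd_central: "1 \<le> m ==> p \<le> n ==> central_elt c ==> gd m p * c = c * gd m p"
  using gd_cases[of m p] central_elt(1)[of c "gd m p"] by auto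

lemma alpha_A:
  assumes "2 \<le> i" "i \<le> Suc n"
  shows "\<alpha> i \<in> A"
proof -
  obtain p where p: "i = Suc p" "1 \<le> p" "p \<le> n" using assms by (cases i) auto
  show ?thesis using gd_cases[of 1 p] p by (auto simp: \<alpha>_def)
qed

text \<open>
  This is \<open>g\<^sub>p\<^sub>-\<^sub>1 \<dots> g\<^sub>m = g\<^sub>p\<^sub>-\<^sub>1\<^sup>-\<^sup>1 \<dots> g\<^sub>m\<^sup>-\<^sup>1 + \<dots>\<close>, obtained by replacing the factors \<open>g\<^sub>i\<close> by
  \<open>g\<^sub>i\<^sup>-\<^sup>1 + \<kappa> e\<^sub>i\<close> one after the other.
\<close>

lemma fold_Gop_value:
  assumes "1 \<le> m" "m \<le> p" "p \<le> Suc n"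
  shows "fold Gop [m..<p] \<phi> p k = \<phi> m k + (\<Sum>i\<in>{m<..p}. \<kappa> * (e0 (i - 1) * (gd m (i - 1) * \<phi> i k)))"
  using assms(2,3)
proof (induction p rule: dec_induct)
  case base
  then show ?case by simp
next
  case (step p)
  have pn: "1 \<le> q" "Suc q \<le> n" if "m \<le> q" "q < p" for q using that step.prems assms(1) by auto
  have far: "fold Gop [m..<p] \<phi> (Suc p) k = gd m p * \<phi> (Suc p) k"
  proof -
    have "fold Gop [m..<q] \<phi> (Suc p) k = gd m q * \<phi> (Suc p) k" if "m \<le> q" "q \<le> p" for q
      using that
    proof (induction q rule: dec_induct)
      case (step q)
      then show ?case using pn[of q] \<open>Suc p \<le> Suc n\<close>
        by (simp add: gd_Suc Gop_simps mult.assoc)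
    qed (simp add: gd_Suc)
    then show ?thesis using step by simp
  qed
  have set: "{m<..Suc p} = insert (Suc p) {m<..p}" using step by auto
  show ?case
    using step assms(1) by (simp add: set Gop_simps far add.assoc add.commute add.left_commute)
qed

text \<open>
  Right translation by \<open>g\<^sub>n \<dots> g\<^sub>m\<close>. Its entries at \<open>n + 1\<close> are simpler than those at \<open>m\<close> of
  the array itself, and by \<open>down_eqI\<close> they can be used in their place.
\<close>

definition down where "down m \<phi> = fold Gop [m..<Suc n] \<phi>"

lemma down_D [simp]: "1 \<le> m ==> \<phi> \<in> D ==> down m \<phi> \<in> D"
  unfolding down_def by (rule fold_Gop_D) auto

lemma down_step: "m \<le> n ==> down m \<phi> = down (Suc m) (Gop m \<phi>)"
  by (simp add: down_def upt_conv_Cons del: upt_Suc)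

lemma down_value:
  "1 \<le> m ==> m \<le> Suc n ==>
   down m \<phi> (Suc n) k = \<phi> m k + (\<Sum>i\<in>{m<..Suc n}. \<kappa> * (e0 (i - 1) * (gd m (i - 1) * \<phi> i k)))"
  unfolding down_def by (rule fold_Gop_value) auto

lemma down_eqI:
  assumes "1 \<le> m" "m \<le> Suc n" "\<And>j. m < j ==> j \<le> Suc n ==> \<phi> j k = \<psi> j k"
    and "down m \<phi> (Suc n) k = down m \<psi> (Suc n) k"
  shows "\<phi> m k = \<psi> m k"
proof -
  have "(\<Sum>i\<in>{m<..Suc n}. \<kappa> * (e0 (i - 1) * (gd m (i - 1) * \<phi> i k))) =
      (\<Sum>i\<in>{m<..Suc n}. \<kappa> * (e0 (i - 1) * (gd m (i - 1) * \<psi> i k)))"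
    using assms(3) by (intro sum.cong) auto
  then show ?thesis using assms(4) unfolding down_value[OF assms(1,2)] by simp
qed

text \<open>
  The operator \<open>Xop\<close> was derived from this identity, \<open>g\<^sub>n \<dots> g\<^sub>1 X\<^sub>1 = X u\<^sub>1\<close>.
\<close>

lemma down_Xop: "down 1 (Xop \<phi>) (Suc n) k = \<phi> 1 (Suc k)"
proof -
  have "(\<Sum>i\<in>{1<..Suc n}. \<kappa> * (e0 (i - 1) * (gd 1 (i - 1) * Xop \<phi> i k))) = (\<Sum>i\<in>tail. \<alpha> i * (x * \<phi> i k))"
    by (rule sum.cong) (auto simp: \<alpha>_def mult.assoc Xop_simps)
  then show ?thesis
    using down_value[of 1 "Xop \<phi>" k] by (simp add: Xop_def)
qed

lemma gd_t:
  assumes "1 \<le> i" "i \<le> n"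
  shows "1 \<le> p ==> p \<le> n ==> gd 1 p * t i = t (if i = 1 then p else if i \<le> p then i - 1 else i) * gd 1 p"
proof (induction p rule: dec_induct)
  case base
  then show ?case using assms by (auto simp: gd_Suc)
next
  case (step p)
  let ?j = "if i = 1 then p else if i \<le> p then i - 1 else i"
  have "gd 1 (Suc p) * t i = (g p * t ?j) * gd 1 p"
    using step by (simp add: gd_Suc mult.assoc)
  also have "g p * t ?j = t (if i = 1 then Suc p else if i \<le> Suc p then i - 1 else i) * g p"
    using step assms g_t_simps(1)[of p] g_t_simps(2)[of p] g_t_simps(3)[of p i] g_t_simps(3)[of p "i - 1"]
    by (auto simp: le_Suc_eq)
  finally show ?case using step by (simp add: gd_Suc mult.assoc)
qed

text \<open>
  By \<open>gd_t\<close> the product of the \<open>g\<close> permutes the \<open>t\<^sub>i\<close>. The result can differ from the right side by an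
  exchange of \<open>t\<^sub>l\<^sub>-\<^sub>1\<close> and \<open>t0\<close>, which the average in \<open>\<alpha> l\<close> identifies.
\<close>

lemma alpha_tj:
  assumes l: "2 \<le> l" "l \<le> Suc n" and i: "1 \<le> i" "i \<le> Suc n"
  shows "\<alpha> l * tj i l = tj i 1 * \<alpha> l"
proof -
  define p where "p = l - 1"
  have p: "1 \<le> p" "p \<le> n" "l = Suc p" using l by (auto simp: p_def)
  have \<alpha>: "\<alpha> l = \<kappa> * (e0 p * gd 1 p)" by (simp add: \<alpha>_def p)
  have pull: "\<kappa> * (e0 p * (a * gd 1 p)) = a * \<alpha> l" if "a \<in> A" "e0 p * a = a * e0 p" for a
  proof -
    have "\<kappa> * (e0 p * (a * gd 1 p)) = \<kappa> * ((e0 p * a) * gd 1 p)" by (simp only: mult.assoc)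
    also have "\<dots> = (\<kappa> * a) * (e0 p * gd 1 p)" unfolding that(2) by (simp only: mult.assoc)
    also have "\<dots> = a * \<alpha> l" unfolding \<alpha> kappa_central[OF that(1)] by (simp only: mult.assoc)
    finally show ?thesis .
  qed
  consider "i = 1" | "2 \<le> i" "i \<le> p" | "i = l" | "l < i" using i p by linarith
  then show ?thesis
  proof cases
    case 1
    have "\<alpha> l * t i = \<kappa> * ((e0 p * t p) * gd 1 p)"
      using gd_t[of 1 p] p(1,2) 1 by (simp add: \<alpha> mult.assoc)
    also have "\<dots> = t0 * \<alpha> l"
      using pull[of t0] p t0 t0_central[of "e0 p"] by (simp add: e0_absorb mult.assoc)
    finally show ?thesis using 1 l by (simp add: tj_def)
  next
    case 2
    have "\<alpha> l * t i = \<kappa> * (e0 p * (t (i - 1) * gd 1 p))"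
      using gd_t[of i p] p(1,2) 2 by (simp add: \<alpha> mult.assoc)
    also have "\<dots> = t (i - 1) * \<alpha> l"
      using pull[of "t (i - 1)"] p 2 e0_t[of p "i - 1"] by simp
    finally show ?thesis using 2 p l by (simp add: tj_def)
  next
    case 3
    have "\<alpha> l * t0 = \<kappa> * ((e0 p * t0) * gd 1 p)"
      using gd_central[of 1 p t0] p(1,2) central_scalars(4) by (simp add: \<alpha> mult.assoc)
    also have "\<dots> = \<kappa> * (e0 p * (t p * gd 1 p))" using p by (simp add: e0_absorb[symmetric] mult.assoc)
    also have "\<dots> = t p * \<alpha> l" using pull[of "t p"] p e0_t[of p p] by simp
    finally show ?thesis using 3 p l by (simp add: tj_def)
  next
    case 4
    have "\<alpha> l * t (i - 1) = \<kappa> * (e0 p * (t (i - 1) * gd 1 p))"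
      using gd_t[of "i - 1" p] p(1,2) 4 i \<open>l = Suc p\<close>[symmetric] by (simp add: \<alpha> mult.assoc)
    also have "\<dots> = t (i - 1) * \<alpha> l"
      using pull[of "t (i - 1)"] p 4 i e0_t[of p "i - 1"] by simp
    finally show ?thesis using 4 p l by (simp add: tj_def)
  qed
qed

lemma tj_x: "1 \<le> i ==> i \<le> Suc n ==> 1 \<le> j ==> j \<le> Suc n ==> tj i j * x = x * tj i j"
  by (auto simp: tj_def t0_central t_x)

lemma rel_T_X:
  assumes i: "1 \<le> i" "i \<le> Suc n" and \<phi>: "\<phi> \<in> D"
  shows "Top i (Xop \<phi>) = Xop (Top i \<phi>)"
proof (rule D_eqI)
  fix j k assume j: "1 \<le> j" "j \<le> Suc n"
  show "Top i (Xop \<phi>) j k = Xop (Top i \<phi>) j k"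
  proof (cases "j = 1")
    case True
    have "tj i 1 * (\<alpha> l * (x * \<phi> l k)) = \<alpha> l * (x * Top i \<phi> l k)" if "l \<in> tail" for l
    proof -
      have l: "2 \<le> l" "l \<le> Suc n" using that by auto
      have "tj i 1 * (\<alpha> l * (x * \<phi> l k)) = \<alpha> l * ((tj i l * x) * \<phi> l k)"
        using alpha_tj[OF l i] by (simp add: mult.assoc[symmetric])
      then show ?thesis using tj_x[OF i, of l] l by (simp add: Top_simps mult.assoc)
    qed
    then show ?thesis using True j by (simp add: Top_simps Xop_def right_diff_distrib sum_distrib_left)
  next
    case False
    then have "tj i j * (x * \<phi> j k) = x * (tj i j * \<phi> j k)"
      using tj_x[OF i j] by (simp add: mult.assoc[symmetric])
    then show ?thesis using False j by (simp add: Top_simps Xop_simps)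
  qed
qed (use i \<phi> in simp_all)

lemma rel_E_X:
  assumes i: "1 \<le> i" "i \<le> n" and \<phi>: "\<phi> \<in> D"
  shows "Eop i (Xop \<phi>) = Xop (Eop i \<phi>)"
proof (rule D_eqI)
  fix j k assume j: "1 \<le> j" "j \<le> Suc n"
  have ex: "x * e (tj i l) (tj (Suc i) l) = e (tj i l) (tj (Suc i) l) * x" if "1 \<le> l" "l \<le> Suc n" for l
    by (rule cyclic_avg_conj) (use i that in \<open>simp_all add: rho_central tj_x\<close>)
  show "Eop i (Xop \<phi>) j k = Xop (Eop i \<phi>) j k"
  proof (cases "j = 1")
    case True
    have "e (tj i 1) (tj (Suc i) 1) * (\<alpha> l * (x * \<phi> l k)) = \<alpha> l * (x * Eop i \<phi> l k)" if "l \<in> tail" for l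
    proof -
      have l: "2 \<le> l" "l \<le> Suc n" using that by auto
      have "\<alpha> l * e (tj i l) (tj (Suc i) l) = e (tj i 1) (tj (Suc i) 1) * \<alpha> l"
        by (rule cyclic_avg_conj)
          (use i l alpha_tj[OF l, of i] alpha_tj[OF l, of "Suc i"] alpha_A[OF l] in \<open>simp_all add: rho_central\<close>)
      then have "e (tj i 1) (tj (Suc i) 1) * (\<alpha> l * (x * \<phi> l k)) = \<alpha> l * ((e (tj i l) (tj (Suc i) l) * x) * \<phi> l k)"
        by (simp add: mult.assoc[symmetric])
      also have "(e (tj i l) (tj (Suc i) l) * x) * \<phi> l k = x * Eop i \<phi> l k"
        using ex[of l] l by (simp add: Eop_simps mult.assoc[symmetric])
      finally show ?thesis .
    qed
    then show ?thesis using True j by (simp add: Eop_simps Xop_def right_diff_distrib sum_distrib_left)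
  next
    case False
    then have "e (tj i j) (tj (Suc i) j) * (x * \<phi> j k) = x * (e (tj i j) (tj (Suc i) j) * \<phi> j k)"
      using ex[OF j] by (simp add: mult.assoc[symmetric])
    then show ?thesis using False j by (simp add: Eop_simps Xop_simps)
  qed
qed (use i \<phi> in simp_all)

lemma rel_E_G:
  assumes i: "1 \<le> i" "i \<le> n" and \<phi>: "\<phi> \<in> D"
  shows "Eop i (Gop i \<phi>) = Gop i (Eop i \<phi>)"
proof (rule D_eqI)
  fix l k assume l: "1 \<le> l" "l \<le> Suc n"
  consider "Suc i < l" | "l = Suc i" | "l = i" | "l < i" by linarith
  then show "Eop i (Gop i \<phi>) l k = Gop i (Eop i \<phi>) l k"
  proof cases
    case 1
    then show ?thesis using i l g_e_comm[of i]
      by (simp add: Gop_simps Eop_simps tj_def mult.assoc[symmetric])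
  next
    case 2
    then show ?thesis using i by (simp add: Gop_simps Eop_simps tj_def e0_swap distrib_left kl)
  next
    case 3
    then show ?thesis using i by (simp add: Gop_simps Eop_simps tj_def e0_swap)
  next
    case 4
    have "g (i - 1) * e (t (i - 1)) (t (Suc (i - 1))) = e (t (i - 1)) (t (Suc (i - 1))) * g (i - 1)"
      using 4 i l by (intro g_e_comm) auto
    then have "e (t (i - 1)) (t i) * (g (i - 1) * \<phi> l k) = g (i - 1) * (e (t (i - 1)) (t i) * \<phi> l k)"
      using 4 i by (simp add: mult.assoc[symmetric])
    then show ?thesis using i l 4 by (simp add: Gop_simps Eop_simps tj_def)
  qed
qed (use i \<phi> in simp_all)

lemma Gop_far:
  assumes "1 \<le> i" "i \<le> n" "1 \<le> j" "j \<le> n" "i + 2 \<le> j \<or> j + 2 \<le> i" "\<phi> \<in> D"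
  shows "Gop i (Gop j \<phi>) = Gop j (Gop i \<phi>)"
  using assms rel_G_far[of i j \<phi>] rel_G_far[of j i \<phi>] by auto

lemma down_Gop:
  assumes i: "2 \<le> i" "i \<le> n" and \<phi>: "\<phi> \<in> D"
  shows "down 1 (Gop i \<phi>) = Gop (i - 1) (down 1 \<phi>)"
proof -
  define \<psi> where "\<psi> = fold Gop [1..<i - 1] \<phi>"
  have \<psi>: "\<psi> \<in> D" unfolding \<psi>_def by (rule fold_Gop_D) (use i \<phi> in auto)
  have list: "[1..<Suc n] = [1..<i - 1] @ (i - 1) # i # [Suc i..<Suc n]"
  proof -
    have "[1..<Suc n] = [1..<i - 1] @ [i - 1..<Suc n]"
      using upt_add_eq_append[of 1 "i - 1" "Suc n - (i - 1)"] i by simp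
    also have "[i - 1..<Suc n] = (i - 1) # i # [Suc i..<Suc n]"
      using upt_conv_Cons[of "i - 1" "Suc n"] upt_conv_Cons[of i "Suc n"] i by (simp del: upt_Suc)
    finally show ?thesis .
  qed
  have "down 1 (Gop i \<phi>) = fold Gop [Suc i..<Suc n] (Gop i (Gop (i - 1) (fold Gop [1..<i - 1] (Gop i \<phi>))))"
    unfolding down_def list by simp
  also have "fold Gop [1..<i - 1] (Gop i \<phi>) = Gop i \<psi>"
    unfolding \<psi>_def by (rule fold_commute[symmetric]) (use i \<phi> in \<open>auto intro!: Gop_far\<close>)
  also have "Gop i (Gop (i - 1) (Gop i \<psi>)) = Gop (i - 1) (Gop i (Gop (i - 1) \<psi>))"
    using rel_G_braid[of "i - 1" \<psi>] i \<psi> by simp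
  also have "fold Gop [Suc i..<Suc n] (Gop (i - 1) (Gop i (Gop (i - 1) \<psi>))) =
     Gop (i - 1) (fold Gop [Suc i..<Suc n] (Gop i (Gop (i - 1) \<psi>)))"
    by (rule fold_commute[symmetric]) (use i \<psi> in \<open>auto intro!: Gop_far\<close>)
  also have "fold Gop [Suc i..<Suc n] (Gop i (Gop (i - 1) \<psi>)) = down 1 \<phi>"
    unfolding down_def list \<psi>_def by simp
  finally show ?thesis .
qed

text \<open>
  At \<open>j \<ge> 2\<close> the operator \<open>Xop\<close> is multiplication by \<open>x\<close>. At \<open>j = 1\<close> both sides are compared after
  translation by \<open>g\<^sub>n \<dots> g\<^sub>1\<close>, which turns \<open>g\<^sub>i\<close> into \<open>g\<^sub>i\<^sub>-\<^sub>1\<close> acting from the left.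
\<close>

lemma rel_G_X:
  assumes i: "2 \<le> i" "i \<le> n" and \<phi>: "\<phi> \<in> D"
  shows "Gop i (Xop \<phi>) = Xop (Gop i \<phi>)"
proof (rule D_eqI)
  have i1: "1 \<le> i" using i by simp
  have ge2: "Gop i (Xop \<phi>) j k = Xop (Gop i \<phi>) j k" if j: "2 \<le> j" "j \<le> Suc n" for j k
  proof -
    consider "Suc i < j" | "j = Suc i" | "j = i" | "j < i" by linarith
    then show ?thesis
    proof cases
      case 1
      then show ?thesis using i j g_x[of i] by (simp add: Gop_simps Xop_simps mult.assoc[symmetric])
    next
      case 2
      have "e0 i * (x * \<phi> j k) = x * (e0 i * \<phi> j k)" using e0_x[of i] i by (simp add: mult.assoc[symmetric])
      then show ?thesis using i j 2 by (simp add: Gop_simps Xop_simps distrib_left kl)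
    next
      case 3
      then show ?thesis using i j by (simp add: Gop_simps Xop_simps)
    next
      case 4
      have "g (i - 1) * x = x * g (i - 1)" using 4 i j by (intro g_x) auto
      then show ?thesis using 4 i j by (simp add: Gop_simps Xop_simps mult.assoc[symmetric])
    qed
  qed
  fix j k assume j: "1 \<le> j" "j \<le> Suc n"
  show "Gop i (Xop \<phi>) j k = Xop (Gop i \<phi>) j k"
  proof (cases "j = 1")
    case True
    have "down 1 (Gop i (Xop \<phi>)) (Suc n) k = g (i - 1) * \<phi> 1 (Suc k)"
      unfolding down_Gop[OF i Xop_D[OF \<phi>]] using i Gop_simps(1)[of "i - 1" "Suc n"] by (simp only: down_Xop)
    also have "\<dots> = down 1 (Xop (Gop i \<phi>)) (Suc n) k"
      using i by (simp only: down_Xop) (simp add: Gop_simps)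
    finally have "Gop i (Xop \<phi>) 1 k = Xop (Gop i \<phi>) 1 k"
      by (intro down_eqI[where m = 1 and \<phi> = "Gop i (Xop \<phi>)" and \<psi> = "Xop (Gop i \<phi>)"])
        (use n ge2 in auto)
    then show ?thesis using True by simp
  qed (use j ge2 in auto)
qed (use i \<phi> in simp_all)

lemma Xop_down2: "\<phi> \<in> D ==> Xop (down 2 \<phi>) = down 2 (Xop \<phi>)"
  unfolding down_def by (rule fold_commute[where f = Xop]) (auto intro: rel_G_X[symmetric])

text \<open>
  The two sides agree at \<open>j \<ge> 3\<close> by the relation in \<open>A\<close>, and at \<open>j = 2\<close> because translation by
  \<open>g\<^sub>n \<dots> g\<^sub>2\<close> reduces both to \<open>down_Xop\<close>. The entry at \<open>j = 1\<close> is the entry at 2 of the translate by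
  \<open>g\<^sub>1\<close>, up to a multiple of the entry at 2; and the translate of the right side by \<open>g\<^sub>1\<close> is known at 2,
  as the case \<open>j = 2\<close> applies to the array \<open>Gop 1 \<phi>\<close> as well.
\<close>

lemma rel_X_braid:
  assumes \<phi>: "\<phi> \<in> D"
  shows "Gop 1 (Xop (Gop 1 (Xop \<phi>))) = Xop (Gop 1 (Xop (Gop 1 \<phi>)))"
proof -
  define H E :: "(nat \<Rightarrow> nat \<Rightarrow> 'a) \<Rightarrow> nat \<Rightarrow> nat \<Rightarrow> 'a"
    where "H = Gop 1" and "E = Eop 1"
  have two: "2 = Suc 1" by simp
  have HD: "H \<psi> \<in> D" "E \<psi> \<in> D" if "\<psi> \<in> D" for \<psi>
    unfolding H_def E_def using that n by simp_all
  have H2: "H \<psi> 2 k = \<psi> 1 k + \<kappa> * (e0 1 * \<psi> 2 k)" for \<psi> k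
    unfolding H_def two by (rule Gop_simps(2)[OF n])
  have H1: "H \<psi> 1 k = \<psi> 2 k" for \<psi> k
    unfolding H_def two by (rule Gop_simps(3)[OF order_refl n])
  have H3: "H \<psi> j k = g 1 * \<psi> j k" if "3 \<le> j" "j \<le> Suc n" for \<psi> j k
    unfolding H_def using that by (intro Gop_simps(1)) auto
  have E2: "E \<psi> 2 k = e0 1 * \<psi> 2 k" for \<psi> k
    unfolding E_def using n by (simp add: Eop_simps tj_def)
  have q: "H (H \<psi>) = Add \<psi> (Sop \<kappa> (E (H \<psi>)))" if "\<psi> \<in> D" for \<psi>
    unfolding H_def E_def using that n by (intro rel_G_quadratic) auto
  have Hlin: "H (Add \<psi> \<psi>') = Add (H \<psi>) (H \<psi>')" for \<psi> \<psi>' by (simp add: H_def op_Add)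
  have HS: "H (Sop \<kappa> \<psi>) = Sop \<kappa> (H \<psi>)" if "\<psi> \<in> D" for \<psi>
    unfolding H_def using that n by (intro op_Sop central_scalars) auto
  have XS: "Xop (Sop \<kappa> \<psi>) = Sop \<kappa> (Xop \<psi>)" if "\<psi> \<in> D" for \<psi>
    using that by (intro op_Sop central_scalars) auto
  have EX: "Xop (E \<psi>) = E (Xop \<psi>)" "H (E \<psi>) = E (H \<psi>)" if "\<psi> \<in> D" for \<psi>
    unfolding H_def E_def using that n by (simp_all add: rel_E_X rel_E_G)
  have Z3: "H (Xop (H (Xop \<psi>))) j k = Xop (H (Xop (H \<psi>))) j k" if "3 \<le> j" "j \<le> Suc n" for \<psi> j k
    using that x_braid by (simp add: H3 Xop_simps mult.assoc[symmetric])
  have Z2: "H (Xop (H (Xop \<psi>))) 2 k = Xop (H (Xop (H \<psi>))) 2 k" if \<psi>: "\<psi> \<in> D" for \<psi> k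
  proof (rule down_eqI[where m = 2 and \<phi> = "H (Xop (H (Xop \<psi>)))" and \<psi> = "Xop (H (Xop (H \<psi>)))"])
    have d: "down 2 (H (Xop \<chi>)) (Suc n) k = \<chi> 1 (Suc k)" for \<chi> k
      unfolding H_def two using down_step[OF n, of "Xop \<chi>"] down_Xop[of \<chi> k] by (simp only:)
    have "down 2 (H (Xop (H (Xop \<psi>)))) (Suc n) k = Xop \<psi> 2 (Suc k)"
      by (simp only: d H1)
    also have "\<dots> = x * \<psi> 2 (Suc k)" using n by (simp add: Xop_simps)
    also have "\<dots> = x * down 2 (H (Xop (H \<psi>))) (Suc n) k"
      by (simp only: d H1)
    also have "\<dots> = Xop (down 2 (H (Xop (H \<psi>)))) (Suc n) k"
      using n by (simp add: Xop_simps)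
    also have "\<dots> = down 2 (Xop (H (Xop (H \<psi>)))) (Suc n) k"
      using \<psi> by (simp add: Xop_down2 HD)
    finally show "down 2 (H (Xop (H (Xop \<psi>)))) (Suc n) k = down 2 (Xop (H (Xop (H \<psi>)))) (Suc n) k" .
  qed (use n Z3 in auto)
  have Z1: "H (Xop (H (Xop \<phi>))) 1 k = Xop (H (Xop (H \<phi>))) 1 k" for k
  proof -
    let ?l = "H (Xop (H (Xop \<phi>)))" and ?r = "Xop (H (Xop (H \<phi>)))"
    have "H ?r 2 k = Xop (H (Xop (H (H \<phi>)))) 2 k"
      using Z2[OF HD(1)[OF \<phi>]] .
    also have "Xop (H (Xop (H (H \<phi>)))) = Add (Xop (H (Xop \<phi>))) (Sop \<kappa> (E ?r))"
      using \<phi> by (simp add: q op_Add Hlin HS XS EX HD)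
    also have "Add (Xop (H (Xop \<phi>))) (Sop \<kappa> (E ?r)) 2 k = Add (Xop (H (Xop \<phi>))) (Sop \<kappa> (E ?l)) 2 k"
      unfolding Add_def Sop_def E2 Z2[OF \<phi>] ..
    also have "\<dots> = H ?l 2 k"
      using \<phi> by (simp add: q HD)
    finally have "H ?r 2 k = H ?l 2 k" .
    then show ?thesis using H2[of ?r k] H2[of ?l k] Z2[OF \<phi>, of k] by simp
  qed
  have "H (Xop (H (Xop \<phi>))) = Xop (H (Xop (H \<phi>)))"
  proof (rule D_eqI)
    fix j k assume j: "1 \<le> j" "j \<le> Suc n"
    consider "j = 1" | "j = 2" | "3 \<le> j" using j by linarith
    then show "H (Xop (H (Xop \<phi>))) j k = Xop (H (Xop (H \<phi>))) j k"
      by cases (use Z1 Z2[OF \<phi>] Z3 j in simp_all)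
  qed (simp_all add: HD \<phi>)
  then show ?thesis by (simp only: H_def)
qed

end

section \<open>Functionals on the cyclotomic algebra\<close>

locale yh_cyc_coind = yh_coind r d n cl t0 for r d n and cl :: "yh_free \<Rightarrow> 'a::{ring,monoid_mult}" and t0 +
  assumes d: "1 \<le> d" and cl_cyclotomic: "cl (cyclotomic_poly d) = 0"
begin

definition Zr :: "nat \<Rightarrow> nat \<Rightarrow> 'a" where "Zr = (\<lambda>j k. 0)"

lemma Zr_D [simp]: "Zr \<in> D" by (rule D_I) (simp_all add: Zr_def)

lemma op_Zr [simp]:
  "Top i Zr = Zr" "Gop i Zr = Zr" "Eop i Zr = Zr" "Xop Zr = Zr" "Sop c Zr = Zr" "Add Zr \<phi> = \<phi>" "Add \<phi> Zr = \<phi>"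
  by (auto intro!: ext simp: Zr_def Top_def Gop_def Eop_def Xop_def Sop_def Add_def)

definition Xv where "Xv v \<phi> = Add (Xop \<phi>) (Sop (- v) \<phi>)"
text \<open>
  The product of the operators \<open>X\<^sub>1 - a\<close> over the entries \<open>a\<close> of a list.
\<close>

definition Pop where "Pop L \<phi> = foldr Xv L \<phi>"
definition v where "v i = s (laurent_power (V i) 1)"
definition vs where "vs = map v [1..<Suc d]"

lemma Pop_simps: "Pop [] \<phi> = \<phi>" "Pop (a # L) \<phi> = Xv a (Pop L \<phi>)" "Pop (L @ L') \<phi> = Pop L (Pop L' \<phi>)"
  by (simp_all add: Pop_def)

definition centrals where "centrals L \<longleftrightarrow> (\<forall>a\<in>set L. central_elt a)"

lemma centrals_simps: "centrals []" "centrals (a # L) \<longleftrightarrow> central_elt a \<and> centrals L"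
  by (auto simp: centrals_def)

lemma v_R: "1 \<le> i ==> i \<le> d ==> laurent_power (V i) k \<in> R" by (rule laurent_V_mem)

lemma v_central: "1 \<le> i ==> i \<le> d ==> central_elt (v i)"
  unfolding v_def by (intro central_scalars v_R)

lemma centrals_vs: "centrals vs" "length vs = d"
  by (auto simp: centrals_def vs_def v_central)

lemma central_uminus: "central_elt c ==> central_elt (- c)"
  by (simp add: central_elt_def)

lemma Xv_D: "central_elt a ==> \<phi> \<in> D ==> Xv a \<phi> \<in> D"
  by (simp add: Xv_def central_elt)

lemma Pop_D: "centrals L ==> \<phi> \<in> D ==> Pop L \<phi> \<in> D"
  by (induction L) (simp_all add: Pop_simps centrals_simps Xv_D)

lemma Xv_commute:
  assumes "\<And>\<psi>. \<psi> \<in> D ==> f (Xop \<psi>) = Xop (f \<psi>)" "\<And>\<psi> \<psi>'. \<psi> \<in> D ==> \<psi>' \<in> D ==> f (Add \<psi> \<psi>') = Add (f \<psi>) (f \<psi>')"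
    and "\<And>c \<psi>. central_elt c ==> \<psi> \<in> D ==> f (Sop c \<psi>) = Sop c (f \<psi>)"
    and "central_elt a" "\<phi> \<in> D"
  shows "f (Xv a \<phi>) = Xv a (f \<phi>)"
  using assms by (simp add: Xv_def central_uminus central_elt)

lemma Pop_commute:
  assumes "\<And>\<psi>. \<psi> \<in> D ==> f (Xop \<psi>) = Xop (f \<psi>)" "\<And>\<psi> \<psi>'. \<psi> \<in> D ==> \<psi>' \<in> D ==> f (Add \<psi> \<psi>') = Add (f \<psi>) (f \<psi>')"
    and "\<And>c \<psi>. central_elt c ==> \<psi> \<in> D ==> f (Sop c \<psi>) = Sop c (f \<psi>)"
    and "centrals L" "\<phi> \<in> D"
  shows "f (Pop L \<phi>) = Pop L (f \<phi>)"
  using assms(4)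
proof (induction L)
  case (Cons a L)
  have "f (Xv a (Pop L \<phi>)) = Xv a (f (Pop L \<phi>))"
    by (rule Xv_commute[OF assms(1-3)]) (use Cons.prems assms(5) in \<open>auto simp: centrals_simps intro: Pop_D\<close>)
  then show ?case using Cons by (simp add: Pop_simps centrals_simps)
qed (simp add: Pop_simps)

lemma Sop_Sop: "central_elt c ==> central_elt c' ==> \<phi> \<in> D ==> Sop c (Sop c' \<phi>) = Sop c' (Sop c \<phi>)"
  by (intro ext) (simp add: Sop_def mult.assoc[symmetric] central_elt(1)[of c c'] central_elt(2))

lemma Sop_Add: "Sop c (Add \<phi> \<psi>) = Add (Sop c \<phi>) (Sop c \<psi>)"
  by (intro ext) (simp add: Sop_def Add_def distrib_left)

lemma Pop_Add: "Pop L (Add \<phi> \<psi>) = Add (Pop L \<phi>) (Pop L \<psi>)"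
proof (induction L)
  case (Cons a L)
  then show ?case
    by (simp add: Pop_simps Xv_def op_Add) (simp add: Add_def add.assoc add.commute add.left_commute)
qed (simp add: Pop_simps)

lemma Pop_Sop: "centrals L ==> central_elt c ==> \<phi> \<in> D ==> Pop L (Sop c \<phi>) = Sop c (Pop L \<phi>)"
  by (rule Pop_commute[where f = "Sop c", symmetric]) (simp_all add: op_Sop(4)[symmetric] Sop_Add Sop_Sop)

lemma Pop_Zr: "Pop L Zr = Zr"
  by (induction L) (simp_all add: Pop_simps Xv_def)

text \<open>
  At \<open>j = 1\<close> a factor \<open>X\<^sub>1 - a\<close> lowers the degree \<open>k\<close> by one, while at \<open>j \<ge> 2\<close> it preserves it. So the
  lowest entry of an array moves down to degree \<open>K - length L\<close> and is not altered.
\<close>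

lemma Pop_leading_aux:
  assumes z: "\<And>j k. 1 \<le> j ==> j \<le> Suc n ==> k < K ==> \<psi> j k = 0"
  shows "length L \<le> K ==> Pop L \<psi> 1 (K - length L) = \<psi> 1 K \<and> (\<forall>k < K - length L. Pop L \<psi> 1 k = 0) \<and>
    (\<forall>j k. 2 \<le> j \<longrightarrow> j \<le> Suc n \<longrightarrow> k < K \<longrightarrow> Pop L \<psi> j k = 0)"
proof (induction L)
  case Nil
  then show ?case using n z by (auto simp: Pop_simps)
next
  case (Cons a L)
  have len: "length L \<le> K" "K - length L = Suc (K - length (a # L))" using Cons.prems by auto
  have IH1: "Pop L \<psi> 1 (K - length L) = \<psi> 1 K" and IH2: "\<And>k. k < K - length L ==> Pop L \<psi> 1 k = 0"
    and IH3: "\<And>j k. 2 \<le> j ==> j \<le> Suc n ==> k < K ==> Pop L \<psi> j k = 0"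
    using Cons.IH[OF len(1)] by auto
  have val: "Xv a (Pop L \<psi>) 1 k = Pop L \<psi> 1 (Suc k) - a * Pop L \<psi> 1 k" if "k < K" for k
  proof -
    have "(\<Sum>i\<in>tail. \<alpha> i * (x * Pop L \<psi> i k)) = 0"
      by (rule sum.neutral) (use IH3 that in auto)
    then show ?thesis by (simp add: Xv_def Add_def Sop_def Xop_def)
  qed
  have "Pop (a # L) \<psi> 1 (K - length (a # L)) = \<psi> 1 K"
  proof -
    have lt: "K - length (a # L) < K" "K - length (a # L) < K - length L" using Cons.prems by auto
    show ?thesis unfolding Pop_simps val[OF lt(1)] len(2)[symmetric] IH1 IH2[OF lt(2)] by simp
  qed
  moreover have "Pop (a # L) \<psi> 1 k = 0" if "k < K - length (a # L)" for k
  proof -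
    have lt: "k < K" "k < K - length L" "Suc k < K - length L" using that by auto
    show ?thesis unfolding Pop_simps val[OF lt(1)] IH2[OF lt(2)] IH2[OF lt(3)] by simp
  qed
  moreover have "Pop (a # L) \<psi> j k = 0" if "2 \<le> j" "j \<le> Suc n" "k < K" for j k
    using that IH3[OF that] by (simp add: Pop_simps Xv_def Add_def Sop_def Xop_simps)
  ultimately show ?case by blast
qed

lemma Pop_leading:
  assumes z: "\<And>j k. 1 \<le> j ==> j \<le> Suc n ==> k < K ==> \<psi> j k = 0" and "length L \<le> K"
  shows "Pop L \<psi> 1 (K - length L) = \<psi> 1 K"
  using Pop_leading_aux[of K \<psi>, OF z assms(2)] by blast

definition Fop where "Fop = Pop vs"

lemma Fop_D [simp]: "\<phi> \<in> D ==> Fop \<phi> \<in> D" by (simp add: Fop_def Pop_D centrals_vs)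

lemma cl_prod: "set L \<subseteq> {1..d} ==> a \<in> A ==>
    cl (prod_list (map (\<lambda>i. fgen X1 - fscalar (laurent_power (V i) 1)) L)) * a = foldr (\<lambda>i b. x * b - v i * b) L a"
proof (induction L)
  case Nil
  then show ?case by (simp add: cl_one)
next
  case (Cons i L)
  let ?f = "\<lambda>i. fgen X1 - fscalar (laurent_power (V i) 1)"
  have m: "?f j \<in> F" if "j \<in> {1..d}" for j using that by (intro free_diff X1_mem scal_mem v_R) auto
  have "prod_list (map ?f L) \<in> F" using Cons.prems(1) by (intro free_prod_list) (use m in auto)
  then have "cl (prod_list (map ?f (i # L))) * a = cl (?f i) * (cl (prod_list (map ?f L)) * a)"
    using Cons.prems(1) m[of i] by (simp add: cl_mult mult.assoc)
  also have "cl (?f i) = x - v i"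
    using Cons.prems(1) by (subst cl_diff) (auto intro!: scal_mem v_R simp: x_def v_def s_def)
  finally show ?case using Cons by (simp add: left_diff_distrib)
qed

text \<open>
  At these entries the operator is multiplication by the cyclotomic polynomial in \<open>x\<close>, which is zero
  in \<open>A\<close>.
\<close>

lemma Fop_upper: "\<phi> \<in> D ==> 2 \<le> j ==> j \<le> Suc n ==> Fop \<phi> j k = 0"
proof -
  assume \<phi>: "\<phi> \<in> D" and j: "2 \<le> j" "j \<le> Suc n"
  have "Pop (map v L) \<phi> j k = foldr (\<lambda>i b. x * b - v i * b) L (\<phi> j k)" for L
    using j by (induction L) (simp_all add: Pop_simps Xv_def Add_def Sop_def Xop_simps)
  then have "Fop \<phi> j k = cl (cyclotomic_poly d) * \<phi> j k"
    unfolding Fop_def vs_def cyclotomic_poly_def using \<phi> by (subst cl_prod) auto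
  then show ?thesis by (simp add: cl_cyclotomic)
qed

lemma Fop_Zr_iff: "\<phi> \<in> D ==> Fop \<phi> = Zr \<longleftrightarrow> (\<forall>k. Fop \<phi> 1 k = 0)"
proof
  assume \<phi>: "\<phi> \<in> D" and F: "\<forall>k. Fop \<phi> 1 k = 0"
  show "Fop \<phi> = Zr"
  proof (rule D_eqI)
    fix j k assume "1 \<le> j" "j \<le> Suc n"
    then show "Fop \<phi> j k = Zr j k"
      using F Fop_upper[OF \<phi>, of j k] by (cases "j = 1") (simp_all add: Zr_def)
  qed (simp_all add: \<phi>)
qed (simp add: Zr_def)

lemma Fop_Add: "Fop (Add \<phi> \<psi>) = Add (Fop \<phi>) (Fop \<psi>)"
  by (simp add: Fop_def Pop_Add)

lemma Fop_Sop: "central_elt c ==> \<phi> \<in> D ==> Fop (Sop c \<phi>) = Sop c (Fop \<phi>)"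
  by (simp add: Fop_def Pop_Sop centrals_vs)

lemma Fop_Top: "1 \<le> i ==> i \<le> Suc n ==> \<phi> \<in> D ==> Fop (Top i \<phi>) = Top i (Fop \<phi>)"
  unfolding Fop_def
  by (rule Pop_commute[where f = "Top i", symmetric]) (simp_all add: rel_T_X op_Add op_Sop centrals_vs)

lemma Fop_Eop: "1 \<le> i ==> i \<le> n ==> \<phi> \<in> D ==> Fop (Eop i \<phi>) = Eop i (Fop \<phi>)"
  unfolding Fop_def
  by (rule Pop_commute[where f = "Eop i", symmetric]) (simp_all add: rel_E_X op_Add op_Sop centrals_vs)

lemma Fop_Gop: "2 \<le> i ==> i \<le> n ==> \<phi> \<in> D ==> Fop (Gop i \<phi>) = Gop i (Fop \<phi>)"
  unfolding Fop_def
  by (rule Pop_commute[where f = "Gop i", symmetric]) (simp_all add: rel_G_X op_Add op_Sop centrals_vs)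

lemma Fop_Xop: "\<phi> \<in> D ==> Fop (Xop \<phi>) = Xop (Fop \<phi>)"
  unfolding Fop_def
  by (rule Pop_commute[where f = "Xop", symmetric]) (simp_all add: op_Add op_Sop centrals_vs)

lemma Fop_X2: "\<phi> \<in> D ==> Fop (Gop 1 (Xop (Gop 1 \<phi>))) = Gop 1 (Xop (Gop 1 (Fop \<phi>)))"
  unfolding Fop_def
  by (rule Pop_commute[where f = "\<lambda>\<psi>. Gop 1 (Xop (Gop 1 \<psi>))", symmetric])
    (use n rel_X_braid in \<open>simp_all add: op_Add op_Sop centrals_vs\<close>)

subsection \<open>Functionals killed by the cyclotomic ideal\<close>

text \<open>
  Right translation by \<open>g\<^sub>1 \<dots> g\<^sub>j\<^sub>-\<^sub>1\<close>, which moves the entry \<open>j\<close> to 1 since \<open>u\<^sub>1 g\<^sub>1 \<dots> g\<^sub>j\<^sub>-\<^sub>1 = u\<^sub>j\<close>.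
\<close>

definition GG where "GG j \<phi> = foldr Gop [1..<j] \<phi>"

lemma foldr_Gop_D: "set L \<subseteq> {1..n} ==> \<phi> \<in> D ==> foldr Gop L \<phi> \<in> D"
  by (induction L) auto

lemma GG_D [simp]: "j \<le> Suc n ==> \<phi> \<in> D ==> GG j \<phi> \<in> D"
  unfolding GG_def by (rule foldr_Gop_D) auto

lemma GG_Suc: "1 \<le> j ==> GG (Suc j) \<phi> = GG j (Gop j \<phi>)" "GG (Suc 0) \<phi> = \<phi>"
  by (simp_all add: GG_def)

lemma foldr_commute:
  assumes "set L \<subseteq> {1..n}" "\<phi> \<in> D"
    and "\<And>l \<psi>. l \<in> set L ==> \<psi> \<in> D ==> f (Gop l \<psi>) = Gop l (f \<psi>)"
  shows "f (foldr Gop L \<phi>) = foldr Gop L (f \<phi>)"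
  using assms(1,3)
proof (induction L)
  case (Cons a L)
  have "foldr Gop L \<phi> \<in> D" using Cons.prems(1) assms(2) by (intro foldr_Gop_D) auto
  then show ?case using Cons by simp
qed simp

lemma GG_Add: "GG j (Add \<phi> \<psi>) = Add (GG j \<phi>) (GG j \<psi>)"
proof -
  have "foldr Gop L (Add \<phi> \<psi>) = Add (foldr Gop L \<phi>) (foldr Gop L \<psi>)" for L
    by (induction L) (simp_all add: op_Add)
  then show ?thesis by (simp add: GG_def)
qed

lemma GG_Sop: "central_elt c ==> \<phi> \<in> D ==> j \<le> Suc n ==> GG j (Sop c \<phi>) = Sop c (GG j \<phi>)"
  unfolding GG_def by (rule foldr_commute[where f = "Sop c", symmetric]) (auto simp: op_Sop)

lemma GG_first: "1 \<le> j ==> j \<le> Suc n ==> GG j \<phi> 1 k = \<phi> j k"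
proof (induction j arbitrary: \<phi> rule: dec_induct)
  case (step j)
  then show ?case by (simp add: GG_Suc Gop_simps)
qed (simp add: GG_Suc)

lemma GG_degree:
  assumes "\<And>j. \<phi> j k = 0"
  shows "GG j \<phi> l k = 0"
proof -
  have "foldr Gop L \<phi> l k = 0" for L l
    by (induction L arbitrary: l) (simp_all add: assms Gop_def)
  then show ?thesis by (simp add: GG_def)
qed

lemma GG_Top:
  assumes "1 \<le> i" "i \<le> Suc n" "1 \<le> j" "j \<le> Suc n"
  shows "\<exists>i'. 1 \<le> i' \<and> i' \<le> Suc n \<and> (\<forall>\<phi>\<in>D. GG j (Top i \<phi>) = Top i' (GG j \<phi>))"
  using assms(3,4,1,2)
proof (induction j arbitrary: i rule: dec_induct)
  case base
  then show ?case by (auto simp: GG_Suc)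
next
  case (step j)
  have t: "1 \<le> transpose j (Suc j) i" "transpose j (Suc j) i \<le> Suc n"
    using step by (auto simp: transpose_def)
  from step.IH[OF _ t] step.prems obtain i' where i': "1 \<le> i'" "i' \<le> Suc n"
    "\<And>\<phi>. \<phi> \<in> D ==> GG j (Top (transpose j (Suc j) i) \<phi>) = Top i' (GG j \<phi>)" by auto
  then show ?case using step by (intro exI[of _ i']) (auto simp: GG_Suc rel_G_T)
qed

text \<open>
  The functionals that vanish on the cyclotomic ideal. It suffices to test the translates by
  \<open>g\<^sub>1 \<dots> g\<^sub>j\<^sub>-\<^sub>1\<close>, because the set defined in this way is stable under all generators.
\<close>

definition DN where "DN = {\<phi> \<in> D. \<forall>j. 1 \<le> j \<longrightarrow> j \<le> Suc n \<longrightarrow> Fop (GG j \<phi>) = Zr}"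

lemma DN_D: "\<phi> \<in> DN ==> \<phi> \<in> D" by (simp add: DN_def)
lemma DN_F: "\<phi> \<in> DN ==> 1 \<le> j ==> j \<le> Suc n ==> Fop (GG j \<phi>) = Zr" by (simp add: DN_def)

lemma DN_Add: "\<phi> \<in> DN ==> \<psi> \<in> DN ==> Add \<phi> \<psi> \<in> DN"
  by (simp add: DN_def GG_Add Fop_Add)

lemma DN_Sop: "central_elt c ==> \<phi> \<in> DN ==> Sop c \<phi> \<in> DN"
  by (simp add: DN_def GG_Sop Fop_Sop central_elt)

lemma DN_Zr: "Zr \<in> DN"
proof -
  have "foldr Gop L Zr = Zr" for L by (induction L) simp_all
  then show ?thesis by (simp add: DN_def GG_def Fop_def Pop_Zr)
qed

lemma Fop_GG_Top:
  assumes "1 \<le> i" "i \<le> Suc n" "1 \<le> j" "j \<le> Suc n" "\<phi> \<in> D" "Fop (GG j \<phi>) = Zr"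
  shows "Fop (GG j (Top i \<phi>)) = Zr"
proof -
  obtain i' where "1 \<le> i'" "i' \<le> Suc n" "GG j (Top i \<phi>) = Top i' (GG j \<phi>)"
    using GG_Top[OF assms(1-4)] assms(5) by blast
  then show ?thesis using assms by (simp add: Fop_Top)
qed

lemma DN_Top: "1 \<le> i ==> i \<le> Suc n ==> \<phi> \<in> DN ==> Top i \<phi> \<in> DN"
  using Fop_GG_Top by (auto simp: DN_def)

text \<open>
  The operator of \<open>e\<^sub>i\<close> is a combination of monomials in the operators of the \<open>t\<^sub>l\<close>, so it preserves
  every set that these preserve.
\<close>

lemma Eop_closed:
  assumes Y: "\<And>\<phi>. \<phi> \<in> Y ==> \<phi> \<in> D" "Zr \<in> Y" "\<And>\<phi> \<psi>. \<phi> \<in> Y ==> \<psi> \<in> Y ==> Add \<phi> \<psi> \<in> Y"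
      "\<And>\<phi>. \<phi> \<in> Y ==> Sop \<rho> \<phi> \<in> Y" "\<And>\<phi> l. \<phi> \<in> Y ==> 1 \<le> l ==> l \<le> Suc n ==> Top l \<phi> \<in> Y"
    and i: "1 \<le> i" "i \<le> n" and \<phi>: "\<phi> \<in> Y"
  shows "Eop i \<phi> \<in> Y"
proof -
  have pow: "(Top l ^^ m) \<psi> \<in> Y" if "\<psi> \<in> Y" "1 \<le> l" "l \<le> Suc n" for l m \<psi>
    using that by (induction m) (simp_all add: Y(5))
  define S where "S m = (\<lambda>j k. if 1 \<le> j \<and> j \<le> Suc n then (\<Sum>a<m. tj i j ^ a * tj (Suc i) j ^ (r - a)) * \<phi> j k else 0)" for m
  have "S m \<in> Y" for m
  proof (induction m)
    case 0
    have "S 0 = Zr" by (intro ext) (simp add: S_def Zr_def)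
    then show ?case by (simp add: Y(2))
  next
    case (Suc m)
    let ?\<psi> = "(Top i ^^ m) ((Top (Suc i) ^^ (r - m)) \<phi>)"
    have \<psi>: "?\<psi> \<in> Y" using i \<phi> by (intro pow) auto
    have "S (Suc m) = Add (S m) ?\<psi>"
    proof (intro ext)
      fix j k
      show "S (Suc m) j k = Add (S m) ?\<psi> j k"
      proof (cases "1 \<le> j \<and> j \<le> Suc n")
        case True
        then show ?thesis by (simp add: S_def Add_def Top_power distrib_right mult.assoc)
      next
        case False
        have "?\<psi> j k = 0" by (rule D_outside[OF Y(1)[OF \<psi>] False])
        then show ?thesis using False by (auto simp: S_def Add_def)
      qed
    qed
    then show ?case using Suc \<psi> by (simp add: Y(3))
  qed
  then have "Sop \<rho> (S r) \<in> Y" by (rule Y(4))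
  moreover have "Sop \<rho> (S r) = Eop i \<phi>"
    by (intro ext) (auto simp: S_def Sop_def Eop_def cyclic_avg_def mult.assoc)
  ultimately show ?thesis by simp
qed

lemma Fop_GG_Eop:
  assumes i: "1 \<le> i" "i \<le> n" and j: "1 \<le> j" "j \<le> Suc n" and \<phi>: "\<phi> \<in> D" "Fop (GG j \<phi>) = Zr"
  shows "Fop (GG j (Eop i \<phi>)) = Zr"
proof -
  have Z: "Fop (GG j Zr) = Zr" using DN_F[OF DN_Zr j] .
  have "Eop i \<phi> \<in> {\<psi> \<in> D. Fop (GG j \<psi>) = Zr}"
    by (rule Eop_closed)
      (use i j \<phi> Z in \<open>auto simp: GG_Add Fop_Add GG_Sop Fop_Sop central_scalars intro: Fop_GG_Top\<close>)
  then show ?thesis by simp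
qed

text \<open>
  The element \<open>X\<^sub>2 = g\<^sub>1 X\<^sub>1 g\<^sub>1\<close> commutes with the polynomial \<open>F\<close> in \<open>X\<^sub>1\<close>. For the translate \<open>\<chi>\<close> by
  \<open>g\<^sub>2 \<dots> g\<^sub>j\<^sub>-\<^sub>1\<close>, the array \<open>\<omega>\<close> is \<open>g\<^sub>1\<^sup>-\<^sup>1 \<chi>\<close>, so that \<open>g\<^sub>1 X\<^sub>1 \<chi> = X\<^sub>2 \<omega>\<close>, and \<open>F\<close> kills \<open>\<omega>\<close> as it kills \<open>\<chi>\<close> and
  \<open>g\<^sub>1 \<chi>\<close>.
\<close>

lemma DN_Xop:
  assumes \<phi>: "\<phi> \<in> DN"
  shows "Xop \<phi> \<in> DN"
proof -
  have \<phi>D: "\<phi> \<in> D" and F1: "Fop \<phi> = Zr" using DN_D[OF \<phi>] DN_F[OF \<phi>, of 1] by (simp_all add: GG_Suc)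
  have "Fop (GG j (Xop \<phi>)) = Zr" if j: "1 \<le> j" "j \<le> Suc n" for j
  proof (cases "j = 1")
    case True
    then show ?thesis using \<phi>D F1 by (simp add: GG_Suc Fop_Xop)
  next
    case False
    define \<chi> where "\<chi> = foldr Gop [2..<j] \<phi>"
    have two: "Suc 1 = 2" by simp
    have split: "GG j \<psi> = Gop 1 (foldr Gop [2..<j] \<psi>)" for \<psi>
    proof -
      have "[1..<j] = 1 # [Suc 1..<j]" by (rule upt_conv_Cons) (use False j in simp)
      then show ?thesis unfolding GG_def two by simp
    qed
    have \<chi>: "\<chi> \<in> D" unfolding \<chi>_def by (rule foldr_Gop_D) (use j \<phi>D in auto)
    have "Xop \<chi> = foldr Gop [2..<j] (Xop \<phi>)"
      unfolding \<chi>_def by (rule foldr_commute[where f = Xop]) (use j \<phi>D in \<open>auto simp: rel_G_X\<close>)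
    then have GX: "GG j (Xop \<phi>) = Gop 1 (Xop \<chi>)" by (simp add: split)
    have "Fop \<chi> = foldr Gop [2..<j] (Fop \<phi>)"
      unfolding \<chi>_def by (rule foldr_commute[where f = Fop]) (use j \<phi>D in \<open>auto simp: Fop_Gop\<close>)
    also have "\<dots> = Zr"
    proof -
      have "foldr Gop L Zr = Zr" for L by (induction L) simp_all
      then show ?thesis by (simp add: F1)
    qed
    finally have F\<chi>: "Fop \<chi> = Zr" .
    have FG: "Fop (Gop 1 \<chi>) = Zr" using DN_F[OF \<phi> j] by (simp add: split \<chi>_def)
    define \<omega> where "\<omega> = Add (Gop 1 \<chi>) (Sop (- \<kappa>) (Eop 1 \<chi>))"
    have c: "central_elt (- \<kappa>)" by (intro central_uminus central_scalars)
    have ED: "Eop 1 \<chi> \<in> D" "Gop 1 \<chi> \<in> D" using \<chi> n by simp_all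
    have \<omega>: "\<omega> \<in> D" unfolding \<omega>_def using ED c by (simp add: central_elt)
    have "Gop 1 \<omega> = Add (Gop 1 (Gop 1 \<chi>)) (Sop (- \<kappa>) (Gop 1 (Eop 1 \<chi>)))"
      unfolding \<omega>_def op_Add by (subst op_Sop(2)[OF c ED(1)]) (use n in simp_all)
    also have "\<dots> = Add (Add \<chi> (Sop \<kappa> (Eop 1 (Gop 1 \<chi>)))) (Sop (- \<kappa>) (Eop 1 (Gop 1 \<chi>)))"
      using rel_G_quadratic[of 1 \<chi>] rel_E_G[of 1 \<chi>] n \<chi> by simp
    also have "\<dots> = \<chi>" by (intro ext) (simp add: Add_def Sop_def)
    finally have G\<omega>: "Gop 1 \<omega> = \<chi>" .
    have "Fop \<omega> = Add (Fop (Gop 1 \<chi>)) (Sop (- \<kappa>) (Eop 1 (Fop \<chi>)))"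
      unfolding \<omega>_def Fop_Add Fop_Sop[OF c ED(1)] using Fop_Eop[of 1 \<chi>] n \<chi> by simp
    then have "Fop \<omega> = Zr" by (simp add: F\<chi> FG[unfolded One_nat_def])
    then have "Fop (Gop 1 (Xop \<chi>)) = Zr" using Fop_X2[OF \<omega>] by (simp add: G\<omega>[unfolded One_nat_def])
    then show ?thesis by (simp only: GX)
  qed
  then show ?thesis using \<phi>D by (simp add: DN_def)
qed

lemma DN_Gop:
  assumes i: "1 \<le> i" "i \<le> n" and \<phi>: "\<phi> \<in> DN"
  shows "Gop i \<phi> \<in> DN"
proof -
  have \<phi>D: "\<phi> \<in> D" using DN_D[OF \<phi>] .
  have "Fop (GG j (Gop i \<phi>)) = Zr" if j: "1 \<le> j" "j \<le> Suc n" for j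
  proof -
    consider "i = j" | "j < i" | "j = Suc i" | "Suc i < j" by linarith
    then show ?thesis
    proof cases
      case 1
      then have "GG j (Gop i \<phi>) = GG (Suc j) \<phi>" using j by (simp add: GG_Suc)
      then show ?thesis using DN_F[OF \<phi>, of "Suc j"] 1 i by simp
    next
      case 2
      have "Gop i (GG j \<phi>) = GG j (Gop i \<phi>)"
        unfolding GG_def by (rule foldr_commute[where f = "Gop i"]) (use 2 i j \<phi>D in \<open>auto intro!: Gop_far\<close>)
      then have "Fop (GG j (Gop i \<phi>)) = Gop i (Fop (GG j \<phi>))"
        using Fop_Gop[of i "GG j \<phi>"] 2 i j \<phi>D by simp
      then show ?thesis using DN_F[OF \<phi> j] by simp
    next
      case 3
      have "GG j (Gop i \<phi>) = GG i (Gop i (Gop i \<phi>))" using 3 i by (simp add: GG_Suc)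
      also have "\<dots> = Add (GG i \<phi>) (Sop \<kappa> (GG i (Eop i (Gop i \<phi>))))"
        using rel_G_quadratic[OF i \<phi>D] i \<phi>D by (simp add: GG_Add GG_Sop central_scalars)
      finally have eq: "Fop (GG j (Gop i \<phi>)) = Add (Fop (GG i \<phi>)) (Sop \<kappa> (Fop (GG i (Eop i (Gop i \<phi>)))))"
        using i \<phi>D by (simp add: Fop_Add Fop_Sop central_scalars)
      have "Fop (GG i (Gop i \<phi>)) = Zr" using DN_F[OF \<phi>, of "Suc i"] i by (simp add: GG_Suc)
      then have "Fop (GG i (Eop i (Gop i \<phi>))) = Zr" using i \<phi>D by (intro Fop_GG_Eop) auto
      then show ?thesis using eq DN_F[OF \<phi>, of i] i by simp
    next
      case 4
      have list: "[1..<j] = [1..<i] @ i # Suc i # [Suc (Suc i)..<j]"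
      proof -
        have "[1..<j] = [1..<i] @ [i..<j]"
          using upt_add_eq_append[of 1 i "j - i"] i 4 by simp
        also have "[i..<j] = i # Suc i # [Suc (Suc i)..<j]"
          using upt_conv_Cons[of i j] upt_conv_Cons[of "Suc i" j] 4 by simp
        finally show ?thesis .
      qed
      define \<psi> where "\<psi> = foldr Gop [Suc (Suc i)..<j] \<phi>"
      have \<psi>: "\<psi> \<in> D" unfolding \<psi>_def by (rule foldr_Gop_D) (use j \<phi>D in auto)
      have "Gop i \<psi> = foldr Gop [Suc (Suc i)..<j] (Gop i \<phi>)"
        unfolding \<psi>_def by (rule foldr_commute[where f = "Gop i"]) (use 4 i j \<phi>D in \<open>auto intro!: Gop_far\<close>)
      then have "GG j (Gop i \<phi>) = foldr Gop [1..<i] (Gop i (Gop (Suc i) (Gop i \<psi>)))"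
        unfolding GG_def list by simp
      also have "Gop i (Gop (Suc i) (Gop i \<psi>)) = Gop (Suc i) (Gop i (Gop (Suc i) \<psi>))"
        using i 4 j \<psi> by (intro rel_G_braid) auto
      also have "foldr Gop [1..<i] (Gop (Suc i) (Gop i (Gop (Suc i) \<psi>))) = Gop (Suc i) (foldr Gop [1..<i] (Gop i (Gop (Suc i) \<psi>)))"
        by (rule foldr_commute[where f = "Gop (Suc i)", symmetric]) (use 4 i j \<psi> in \<open>auto intro!: Gop_far\<close>)
      also have "foldr Gop [1..<i] (Gop i (Gop (Suc i) \<psi>)) = GG j \<phi>"
        unfolding GG_def list \<psi>_def by simp
      finally show ?thesis
        using Fop_Gop[of "Suc i" "GG j \<phi>"] i 4 j \<phi>D DN_F[OF \<phi> j] by simp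
    qed
  qed
  then show ?thesis using i \<phi>D by (simp add: DN_def)
qed

text \<open>
  In the entry of degree \<open>K - d\<close> at 1 of the polynomial applied to \<open>GG j \<phi>\<close>, the leading term is
  \<open>\<phi> j K\<close>, if all entries of lower degree vanish.
\<close>

lemma DN_unique:
  assumes \<phi>: "\<phi> \<in> DN" and z: "\<And>j k. 1 \<le> j ==> j \<le> Suc n ==> k < d ==> \<phi> j k = 0"
  shows "\<phi> = Zr"
proof -
  have "\<forall>j. \<phi> j k = 0" for k
  proof (induction k rule: less_induct)
    case (less K)
    show ?case
    proof
      fix j
      show "\<phi> j K = 0"
      proof (cases "1 \<le> j \<and> j \<le> Suc n")
        case True
        show ?thesis
        proof (cases "K < d")
          case False
          have "GG j \<phi> l k = 0" if "k < K" for l k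
            using GG_degree[of \<phi> k j l] less.IH[OF that] by simp
          then have "Fop (GG j \<phi>) 1 (K - d) = GG j \<phi> 1 K"
            using Pop_leading(1)[of K "GG j \<phi>" vs] False centrals_vs by (simp add: Fop_def)
          then show ?thesis
            using DN_F[OF \<phi>, of j] True GG_first[of j \<phi> K] by (simp add: Zr_def)
        qed (use z True in simp)
      qed (use D_outside[OF DN_D[OF \<phi>]] in simp)
    qed
  qed
  then show ?thesis by (auto simp: Zr_def)
qed

subsection \<open>Existence of functionals\<close>

text \<open>
  Conversely the entries of degree below \<open>d\<close> can be prescribed. The remaining ones are defined
  degree by degree: in degree \<open>K \<ge> d\<close> the vanishing of the polynomial at degree \<open>K - d\<close> forces their
  values. The prescribed entries single out \<open>X\<^sup>d\<^sup>-\<^sup>1\<close>.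
\<close>

primrec stage :: "nat \<Rightarrow> nat \<Rightarrow> nat \<Rightarrow> 'a" where
  "stage 0 = (\<lambda>j k. 0)"
| "stage (Suc K) = (\<lambda>j k. if k = K \<and> 1 \<le> j \<and> j \<le> Suc n then
     (if K < d then (if j = Suc n \<and> Suc K = d then u else 0) else - Fop (GG j (stage K)) 1 (K - d))
   else stage K j k)"

definition eps where "eps j k = stage (Suc k) j k"

lemma stage_D: "stage K \<in> D"
proof (induction K)
  case 0
  then show ?case using Zr_D by (simp add: Zr_def)
next
  case (Suc K)
  show ?case
  proof (rule D_I)
    fix j k assume j: "1 \<le> j" "j \<le> Suc n"
    then have "Fop (GG j (stage K)) 1 (K - d) \<in> A" using Suc by (intro D_A) simp
    then show "stage (Suc K) j k \<in> A" using Suc j by simp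
  next
    fix j k assume "\<not> (1 \<le> j \<and> j \<le> Suc n)"
    then show "stage (Suc K) j k = 0" using D_outside[OF Suc] by auto
  qed
qed

lemma stage_zero: "K \<le> k ==> stage K j k = 0"
  by (induction K) auto

lemma stage_stable: "k < K ==> stage K j k = eps j k"
proof (induction K)
  case (Suc K)
  then show ?case by (cases "k = K") (auto simp: eps_def)
qed simp

lemma eps_D: "eps \<in> D"
  by (rule D_I) (auto simp: eps_def D_outside[OF stage_D] simp del: stage.simps intro: D_A[OF stage_D])

lemma eps_initial: "1 \<le> j ==> j \<le> Suc n ==> k < d ==> eps j k = (if j = Suc n \<and> Suc k = d then u else 0)"
  by (simp add: eps_def)

lemma eps_DN: "eps \<in> DN"
proof -
  have "Fop (GG j eps) 1 k = 0" if j: "1 \<le> j" "j \<le> Suc n" for j k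
  proof -
    define K where "K = k + d"
    \<comment> \<open>Below degree \<open>K\<close> the two arrays agree, so that their difference contributes by its leading term
      only, and this term is the one that was chosen to cancel the contribution of \<open>stage K\<close>.\<close>
    define \<delta> where "\<delta> = Add eps (Sop (- u) (stage K))"
    have \<delta>: "\<delta> j k = eps j k - stage K j k" for j k
      by (simp add: \<delta>_def Add_def Sop_def D_A[OF stage_D])
    have \<delta>D: "\<delta> \<in> D" unfolding \<delta>_def using eps_D stage_D by simp
    have "eps = Add (stage K) \<delta>" by (intro ext) (simp add: Add_def \<delta>)
    then have "Fop (GG j eps) 1 k = Fop (GG j (stage K)) 1 k + Fop (GG j \<delta>) 1 k"
      by (metis GG_Add Fop_Add Add_def)
    also have "Fop (GG j \<delta>) 1 k = \<delta> j K"
    proof -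
      have "GG j \<delta> l k' = 0" if "k' < K" for l k'
        by (rule GG_degree) (simp add: \<delta> stage_stable that)
      then have "Fop (GG j \<delta>) 1 (K - d) = GG j \<delta> 1 K"
        using Pop_leading[of K "GG j \<delta>" vs] centrals_vs by (simp add: Fop_def K_def)
      then show ?thesis using GG_first[OF j] by (simp add: K_def)
    qed
    also have "\<delta> j K = - Fop (GG j (stage K)) 1 k"
      using j by (simp add: \<delta> stage_zero eps_def K_def)
    finally show ?thesis by simp
  qed
  then show ?thesis using eps_D by (simp add: DN_def Fop_Zr_iff)
qed

definition Rop where "Rop a \<phi> = (\<lambda>j k. \<phi> j k * a)" for a :: 'a and \<phi> :: "nat \<Rightarrow> nat \<Rightarrow> 'a"

lemma Rop_D [simp]: "a \<in> A ==> \<phi> \<in> D ==> Rop a \<phi> \<in> D"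
  by (rule D_I) (simp_all add: Rop_def D_outside)

lemma op_Rop:
  "Top i (Rop a \<phi>) = Rop a (Top i \<phi>)" "Gop i (Rop a \<phi>) = Rop a (Gop i \<phi>)" "Xop (Rop a \<phi>) = Rop a (Xop \<phi>)"
  "Sop c (Rop a \<phi>) = Rop a (Sop c \<phi>)" "Add (Rop a \<phi>) (Rop a \<psi>) = Rop a (Add \<phi> \<psi>)" "Rop a Zr = Zr"
  by (intro ext; simp add: Rop_def Top_def Gop_def Xop_def Sop_def Add_def Zr_def mult.assoc distrib_right
      left_diff_distrib sum_distrib_right)+

lemma DN_Rop: "a \<in> A ==> \<phi> \<in> DN ==> Rop a \<phi> \<in> DN"
proof -
  assume a: "a \<in> A" and \<phi>: "\<phi> \<in> DN"
  have "Pop L (Rop a \<psi>) = Rop a (Pop L \<psi>)" for L \<psi>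
    by (induction L) (simp_all add: Pop_simps Xv_def op_Rop)
  moreover have "foldr Gop L (Rop a \<psi>) = Rop a (foldr Gop L \<psi>)" for L \<psi>
    by (induction L) (simp_all add: op_Rop)
  ultimately show ?thesis using a \<phi> by (simp add: DN_def Fop_def GG_def op_Rop)
qed

lemma central_minus_u: "central_elt (- u)"
  by (simp add: central_elt_def)

lemma DN_eqI:
  assumes "\<phi> \<in> DN" "\<psi> \<in> DN" "\<And>j k. 1 \<le> j ==> j \<le> Suc n ==> k < d ==> \<phi> j k = \<psi> j k"
  shows "\<phi> = \<psi>"
proof -
  have val: "Add \<phi> (Sop (- u) \<psi>) j k = \<phi> j k - \<psi> j k" for j k
    using DN_D[OF assms(2)] by (simp add: Add_def Sop_def)
  have "Add \<phi> (Sop (- u) \<psi>) = Zr"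
    by (rule DN_unique) (simp_all add: DN_Add DN_Sop central_minus_u assms val)
  then have "\<phi> j k - \<psi> j k = 0" for j k using val[of j k] by (simp add: Zr_def)
  then show ?thesis by (intro ext) simp
qed

lemma eps_Top:
  assumes "1 \<le> i" "i \<le> n"
  shows "Top i eps = Rop (t i) eps"
proof (rule DN_eqI)
  fix j k assume "1 \<le> j" "j \<le> Suc n" "k < d"
  then show "Top i eps j k = Rop (t i) eps j k"
    using assms by (auto simp: Top_simps Rop_def eps_initial tj_def)
qed (use assms in \<open>auto intro!: DN_Top DN_Rop eps_DN\<close>)

lemma eps_Gop:
  assumes "1 \<le> i" "i < n"
  shows "Gop i eps = Rop (g i) eps"
proof (rule DN_eqI)
  fix j k assume j: "1 \<le> j" "j \<le> Suc n" "k < d"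
  consider "Suc i < j" | "j = Suc i" | "j = i" | "j < i" by linarith
  then show "Gop i eps j k = Rop (g i) eps j k"
    by cases (use assms j in \<open>auto simp: Gop_simps Rop_def eps_initial\<close>)
qed (use assms in \<open>auto intro!: DN_Gop DN_Rop eps_DN\<close>)

text \<open>
  The value in degree \<open>d\<close> is forced by the polynomial in degree 0, and all factors except the last
  only shift it down. So it is already determined by the single factor \<open>X\<^sub>1 - v\<^sub>d\<close>.
\<close>

lemma eps_boundary: "eps 1 d = \<alpha> (Suc n) * x"
proof -
  define w where "w = v d"
  have vs: "vs = butlast vs @ [w]" using d by (simp add: vs_def w_def)
  have len: "length (butlast vs) = d - 1" using centrals_vs by simp
  let ?\<psi> = "Xv w eps"
  have sum: "(\<Sum>i\<in>tail. \<alpha> i * (x * eps i k)) = (if Suc k = d then \<alpha> (Suc n) * x else 0)" if "k < d" for k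
  proof -
    have "(\<Sum>i\<in>tail. \<alpha> i * (x * eps i k)) = (\<Sum>i\<in>tail. if i = Suc n then (if Suc k = d then \<alpha> (Suc n) * x else 0) else 0)"
      by (rule sum.cong) (use that in \<open>auto simp: eps_initial\<close>)
    then show ?thesis using n by (simp add: tail_def)
  qed
  have "?\<psi> j k = 0" if "1 \<le> j" "j \<le> Suc n" "k < d - 1" for j k
    using that sum[of k] n by (auto simp: Xv_def Add_def Sop_def Xop_def eps_initial)
  then have "Pop (butlast vs) ?\<psi> 1 (d - 1 - length (butlast vs)) = ?\<psi> 1 (d - 1)"
    by (rule Pop_leading) (simp_all add: centrals_vs)
  then have "Fop eps 1 0 = ?\<psi> 1 (d - 1)"
    unfolding len Fop_def by (subst vs) (simp add: Pop_simps)
  also have "\<dots> = eps 1 d - \<alpha> (Suc n) * x"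
    using sum[of "d - 1"] d n by (simp add: Xv_def Add_def Sop_def Xop_def eps_initial)
  finally show ?thesis using DN_F[OF eps_DN, of 1] by (simp add: GG_Suc Zr_def)
qed

text \<open>
  By \<open>DN_eqI\<close> only degrees below \<open>d\<close> matter. In degree \<open>d - 1\<close> the entry at 1 involves \<open>eps 1 d\<close>, which
  \<open>eps_boundary\<close> provides.
\<close>

lemma eps_Xop: "Xop eps = Rop x eps"
proof (rule DN_eqI)
  fix j k assume j: "1 \<le> j" "j \<le> Suc n" "k < d"
  show "Xop eps j k = Rop x eps j k"
  proof (cases "j = 1")
    case True
    have "(\<Sum>i\<in>tail. \<alpha> i * (x * eps i k)) = (\<Sum>i\<in>tail. if i = Suc n then (if Suc k = d then \<alpha> (Suc n) * x else 0) else 0)"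
      by (rule sum.cong) (use j in \<open>auto simp: eps_initial\<close>)
    also have "\<dots> = (if Suc k = d then \<alpha> (Suc n) * x else 0)" using n by (simp add: tail_def)
    finally have sum: "(\<Sum>i\<in>tail. \<alpha> i * (x * eps i k)) = (if Suc k = d then \<alpha> (Suc n) * x else 0)" .
    show ?thesis
    proof (cases "Suc k = d")
      case True
      then show ?thesis using \<open>j = 1\<close> sum eps_boundary j n by (simp add: Xop_def Rop_def eps_initial)
    next
      case False
      then show ?thesis using \<open>j = 1\<close> sum j n by (simp add: Xop_def Rop_def eps_initial)
    qed
  next
    case False
    then show ?thesis using j by (simp add: Xop_simps Rop_def eps_initial)
  qed
qed (auto intro!: DN_Xop DN_Rop eps_DN)

subsection \<open>The inverse of \<open>X\<^sub>1\<close>\<close>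

definition pc where "pc L = foldr (\<lambda>a b. - (a * b)) L u"

lemma pc_simps: "pc [] = u" "pc (a # L) = - (a * pc L)"
  by (simp_all add: pc_def)

text \<open>
  Quotient and remainder of the product of the \<open>X\<^sub>1 - a\<close> by \<open>X\<^sub>1\<close>. The remainder \<open>pc L\<close> is, up to sign,
  the product of the parameters \<open>a\<close>, which is invertible for the \<open>v\<^sub>i\<close>. On arrays killed by the
  polynomial this yields an inverse of \<open>X\<^sub>1\<close>.
\<close>

primrec Qop where
  "Qop [] \<phi> = Zr"
| "Qop (a # L) \<phi> = Add (Xv a (Qop L \<phi>)) (Sop (pc L) \<phi>)"

lemma central_prod: "central_elt a ==> central_elt c ==> central_elt (- (a * c))"
proof -
  assume a: "central_elt a" and c: "central_elt c"
  have "a * c * b = b * (a * c)" if "b \<in> A" for b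
  proof -
    have "a * c * b = a * (b * c)" using central_elt(1)[OF c that] by (simp add: mult.assoc)
    also have "\<dots> = b * (a * c)" using central_elt(1)[OF a that] by (simp add: mult.assoc[symmetric])
    finally show ?thesis .
  qed
  moreover have "a * c \<in> A" using central_elt(2)[OF a] central_elt(2)[OF c] by simp
  ultimately show ?thesis unfolding central_elt_def by (auto simp del: mult_minus_left mult_minus_right simp add: minus_mult_left[symmetric] minus_mult_right[symmetric])
qed

lemma pc_central: "centrals L ==> central_elt (pc L)"
proof (induction L)
  case Nil
  then show ?case by (simp add: central_elt_def pc_simps)
qed (simp add: centrals_simps pc_simps central_prod)

lemma Qop_D: "centrals L ==> \<phi> \<in> D ==> Qop L \<phi> \<in> D"
  by (induction L) (simp_all add: centrals_simps Xv_D central_elt(2) pc_central)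

lemma Pop_Qop: "centrals L ==> \<phi> \<in> D ==> Pop L \<phi> = Add (Xop (Qop L \<phi>)) (Sop (pc L) \<phi>)"
proof (induction L)
  case Nil
  then have "Sop u \<phi> = \<phi>" by (intro ext) (simp add: Sop_def)
  then show ?case by (simp add: Pop_simps pc_simps)
next
  case (Cons a L)
  have a: "central_elt a" and L: "centrals L" using Cons by (simp_all add: centrals_simps)
  have c: "central_elt (pc L)" by (rule pc_central[OF L])
  have Q: "Qop L \<phi> \<in> D" by (rule Qop_D[OF L Cons.prems(2)])
  have 1: "Xop (Xv a (Qop L \<phi>)) = Xv a (Xop (Qop L \<phi>))"
    using a Q by (simp add: Xv_def op_Add op_Sop central_uminus)
  have 2: "Xop (Sop (pc L) \<phi>) = Sop (pc L) (Xop \<phi>)" by (rule op_Sop(4)[OF c Cons.prems(2)])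
  have 3: "Pop (a # L) \<phi> = Xv a (Add (Xop (Qop L \<phi>)) (Sop (pc L) \<phi>))"
    using Cons.IH[OF L Cons.prems(2)] by (simp add: Pop_simps)
  show ?case
    unfolding 3 Qop.simps op_Add 1 unfolding Xv_def op_Add 2 unfolding Add_def Sop_def pc_simps
    by (intro ext) (simp add: algebra_simps)
qed

definition vinv where "vinv i = s (laurent_power (V i) (- 1))"

definition pcinv where "pcinv L = foldr (\<lambda>i b. - (vinv i * b)) L (- u)"

lemma pcinv_simps: "pcinv [] = - u" "pcinv (i # L) = - (vinv i * pcinv L)"
  by (simp_all add: pcinv_def)

definition cinv where "cinv = pcinv [1..<Suc d]"

definition Xinv where "Xinv \<phi> = Sop cinv (Qop vs \<phi>)"

lemma v_vinv: "1 \<le> i ==> i \<le> d ==> vinv i * v i = u"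
  by (simp add: v_def vinv_def s_simps(2)[symmetric] v_R laurent_power_mult laurent_power_zero s_simps(3))

lemma cinv: "central_elt cinv" "cinv * pc vs = - u"
proof -
  have gen: "central_elt (pcinv L) \<and> pcinv L * pc (map v L) = - u" if "set L \<subseteq> {1..d}" for L
    using that
  proof (induction L)
    case Nil
    then show ?case by (simp add: central_minus_u pcinv_simps pc_simps)
  next
    case (Cons i L)
    have c: "central_elt (pcinv L)" "pcinv L * pc (map v L) = - u" using Cons by auto
    have i: "1 \<le> i" "i \<le> d" using Cons.prems by auto
    have vi: "central_elt (vinv i)" unfolding vinv_def by (intro central_scalars v_R i)
    have "pcinv (i # L) * pc (map v (i # L)) = vinv i * ((pcinv L * v i) * pc (map v L))"
      by (simp add: pcinv_simps pc_simps mult.assoc)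
    also have "pcinv L * v i = v i * pcinv L" by (rule central_elt(1)[OF c(1) central_elt(2)[OF v_central[OF i]]])
    also have "vinv i * (v i * pcinv L * pc (map v L)) = (vinv i * v i) * (pcinv L * pc (map v L))" by (simp only: mult.assoc)
    also have "\<dots> = - u" by (simp add: c(2) v_vinv[OF i])
    finally show ?case using vi c by (simp add: pcinv_simps central_prod)
  qed
  show "central_elt cinv" "cinv * pc vs = - u"
    unfolding cinv_def vs_def using gen[of "[1..<Suc d]"] atLeastLessThanSuc_atLeastAtMost[of 1 d]
    by (simp_all only: set_upt order_refl)
qed

lemma Xop_Xinv:
  assumes "\<phi> \<in> DN"
  shows "Xop (Xinv \<phi>) = \<phi>"
proof -
  have \<phi>: "\<phi> \<in> D" by (rule DN_D[OF assms])
  let ?c = "pc vs"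
  have "Fop \<phi> = Zr" using DN_F[OF assms, of 1] by (simp add: GG_Suc)
  then have "Add (Xop (Qop vs \<phi>)) (Sop ?c \<phi>) = Zr"
    using Pop_Qop[OF centrals_vs(1) \<phi>] by (simp add: Fop_def)
  then have eq: "Xop (Qop vs \<phi>) j k = - (?c * \<phi> j k)" for j k
    by (metis (no_types, lifting) Add_def Sop_def Zr_def add_eq_0_iff2)
  have "Xop (Xinv \<phi>) = Sop cinv (Xop (Qop vs \<phi>))"
    unfolding Xinv_def by (rule op_Sop(4)[OF cinv(1) Qop_D[OF centrals_vs(1) \<phi>]])
  then show ?thesis
    using cinv(2) \<phi> by (intro ext) (simp add: Sop_def eq mult.assoc[symmetric])
qed

lemma Qop_Xop: "centrals L ==> \<phi> \<in> D ==> Qop L (Xop \<phi>) = Xop (Qop L \<phi>)"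
  by (induction L)
    (simp_all add: centrals_simps Xv_def op_Add op_Sop central_uminus pc_central Qop_D)

lemma Xinv_Xop: "\<phi> \<in> DN ==> Xinv (Xop \<phi>) = \<phi>"
  using Xop_Xinv[of \<phi>] DN_D[of \<phi>]
  by (simp add: Xinv_def Qop_Xop centrals_vs op_Sop cinv Qop_D)

lemma DN_Xinv: "\<phi> \<in> DN ==> Xinv \<phi> \<in> DN"
proof -
  assume \<phi>: "\<phi> \<in> DN"
  have "centrals L ==> Qop L \<phi> \<in> DN" for L
    by (induction L)
      (simp_all add: DN_Zr centrals_simps Xv_def DN_Add DN_Sop DN_Xop central_uminus pc_central \<phi>)
  then show ?thesis by (simp add: Xinv_def DN_Sop cinv centrals_vs)
qed

lemma Xinv_Add: "Xinv (Add \<phi> \<psi>) = Add (Xinv \<phi>) (Xinv \<psi>)"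
proof -
  have "Qop L (Add \<phi> \<psi>) = Add (Qop L \<phi>) (Qop L \<psi>)" for L
  proof (induction L)
    case (Cons a L)
    then show ?case by (simp add: Xv_def op_Add) (simp add: Add_def add.assoc add.commute add.left_commute)
  qed simp
  then show ?thesis by (simp add: Xinv_def op_Add)
qed

lemma Xinv_Sop: "central_elt c ==> \<phi> \<in> DN ==> Xinv (Sop c \<phi>) = Sop c (Xinv \<phi>)"
proof -
  assume c: "central_elt c" and \<phi>: "\<phi> \<in> DN"
  have "Xinv (Sop c (Xop (Xinv \<phi>))) = Sop c (Xinv \<phi>)"
    using Xinv_Xop[of "Sop c (Xinv \<phi>)"] DN_Sop[OF c DN_Xinv[OF \<phi>]] op_Sop(4)[OF c DN_D[OF DN_Xinv[OF \<phi>]]] by simp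
  then show ?thesis by (simp add: Xop_Xinv[OF \<phi>])
qed

lemma Xinv_Rop: "a \<in> A ==> \<phi> \<in> DN ==> Xinv (Rop a \<phi>) = Rop a (Xinv \<phi>)"
proof -
  assume a: "a \<in> A" and \<phi>: "\<phi> \<in> DN"
  have "Xinv (Xop (Rop a (Xinv \<phi>))) = Rop a (Xinv \<phi>)"
    by (rule Xinv_Xop[OF DN_Rop[OF a DN_Xinv[OF \<phi>]]])
  then show ?thesis by (simp add: op_Rop Xop_Xinv[OF \<phi>])
qed

end

context yh_cyc_coind
begin

section \<open>The action of the free algebra\<close>

abbreviation F' where "F' \<equiv> carrier (free_algebra r d (Suc n))"

definition op where "op a = (case a of T i \<Rightarrow> Top i | G i \<Rightarrow> Gop i | X1 \<Rightarrow> Xop | X1inv \<Rightarrow> Xinv)"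

lemma op_simps [simp]: "op (T i) = Top i" "op (G i) = Gop i" "op X1 = Xop" "op X1inv = Xinv"
  by (simp_all add: op_def)

lemma Xinv_Zr: "Xinv Zr = Zr"
  using Xinv_Xop[OF DN_Zr] by simp

lemma gens_cases:
  assumes "a \<in> yh_gens (Suc n)"
  obtains i where "a = T i" "1 \<le> i" "i \<le> Suc n" | i where "a = G i" "1 \<le> i" "i \<le> n" | "a = X1" | "a = X1inv"
  using assms by (fastforce simp: yh_gens_def)

lemma op_DN: "a \<in> yh_gens (Suc n) ==> \<phi> \<in> DN ==> op a \<phi> \<in> DN"
  by (erule gens_cases) (simp_all add: DN_Top DN_Gop DN_Xop DN_Xinv)

lemma gen_Add: "op a (Add \<phi> \<psi>) = Add (op a \<phi>) (op a \<psi>)"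
  by (cases a) (simp_all add: op_Add Xinv_Add)

lemma gen_Zr: "op a Zr = Zr"
  by (cases a) (simp_all add: Xinv_Zr)

lemma gen_Sop:
  assumes "a \<in> yh_gens (Suc n)" "central_elt c" "\<phi> \<in> DN"
  shows "op a (Sop c \<phi>) = Sop c (op a \<phi>)"
  using assms(1) by (rule gens_cases) (simp_all add: op_Sop[OF assms(2) DN_D[OF assms(3)]] Xinv_Sop assms(2,3))

lemma gen_Rop:
  assumes "a \<in> yh_gens (Suc n)" "c \<in> A" "\<phi> \<in> DN"
  shows "op a (Rop c \<phi>) = Rop c (op a \<phi>)"
  using assms(1) by (rule gens_cases) (simp_all add: op_Rop Xinv_Rop assms(2,3))

definition wact where "wact w \<phi> = foldr op (letters w) \<phi>"

abbreviation words where "words \<equiv> {w. set (letters w) \<subseteq> yh_gens (Suc n)}"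

lemma foldr_op_DN: "set L \<subseteq> yh_gens (Suc n) ==> \<phi> \<in> DN ==> foldr op L \<phi> \<in> DN"
  by (induction L) (simp_all add: op_DN)

lemma wact_DN: "w \<in> words ==> \<phi> \<in> DN ==> wact w \<phi> \<in> DN"
  by (simp add: wact_def foldr_op_DN)

lemma wact_Add: "wact w (Add \<phi> \<psi>) = Add (wact w \<phi>) (wact w \<psi>)"
proof -
  have "foldr op L (Add \<phi> \<psi>) = Add (foldr op L \<phi>) (foldr op L \<psi>)" for L
    by (induction L) (simp_all add: gen_Add)
  then show ?thesis by (simp add: wact_def)
qed

lemma wact_Zr: "wact w Zr = Zr"
proof -
  have "foldr op L Zr = Zr" for L by (induction L) (simp_all add: gen_Zr)
  then show ?thesis by (simp add: wact_def)
qed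

lemma wact_commute:
  assumes f: "\<And>a \<psi>. a \<in> yh_gens (Suc n) ==> \<psi> \<in> DN ==> op a (f \<psi>) = f (op a \<psi>)"
    and w: "w \<in> words" and \<phi>: "\<phi> \<in> DN"
  shows "wact w (f \<phi>) = f (wact w \<phi>)"
proof -
  have "set L \<subseteq> yh_gens (Suc n) ==> foldr op L (f \<phi>) = f (foldr op L \<phi>)" for L
    by (induction L) (simp_all add: f foldr_op_DN \<phi>)
  then show ?thesis using w by (simp add: wact_def)
qed

lemma wact_Sop: "w \<in> words ==> central_elt c ==> \<phi> \<in> DN ==> wact w (Sop c \<phi>) = Sop c (wact w \<phi>)"
  by (rule wact_commute[where f = "Sop c"]) (simp_all add: gen_Sop)

lemma wact_Rop: "w \<in> words ==> c \<in> A ==> \<phi> \<in> DN ==> wact w (Rop c \<phi>) = Rop c (wact w \<phi>)"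
  by (rule wact_commute[where f = "Rop c"]) (simp_all add: gen_Rop)

lemma wact_plus: "wact (w + w') \<phi> = wact w (wact w' \<phi>)"
  by (simp add: wact_def plus_word_def)

definition act where
  "act p \<phi> = (\<lambda>j k. \<Sum>w\<in>Poly_Mapping.keys p. s (Poly_Mapping.lookup p w) * wact w \<phi> j k)"

lemma act_superset:
  assumes "finite K" "Poly_Mapping.keys p \<subseteq> K"
  shows "act p \<phi> j k = (\<Sum>w\<in>K. s (Poly_Mapping.lookup p w) * wact w \<phi> j k)"
  unfolding act_def by (rule sum.mono_neutral_left) (use assms in \<open>auto simp: in_keys_iff s_simps\<close>)

lemma act_zero: "act 0 \<phi> = Zr"
  by (simp add: act_def Zr_def)

lemma act_add:
  assumes "p \<in> F'" "p' \<in> F'"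
  shows "act (p + p') \<phi> = Add (act p \<phi>) (act p' \<phi>)"
proof (intro ext)
  fix j k
  let ?K = "Poly_Mapping.keys p \<union> Poly_Mapping.keys p'"
  have K: "finite ?K" "Poly_Mapping.keys (p + p') \<subseteq> ?K" "Poly_Mapping.keys p \<subseteq> ?K" "Poly_Mapping.keys p' \<subseteq> ?K"
    using keys_add[of p p'] by auto
  have "Poly_Mapping.lookup p w \<in> R" "Poly_Mapping.lookup p' w \<in> R" for w
    using assms by (auto simp: free.mem_iff)
  then show "act (p + p') \<phi> j k = Add (act p \<phi>) (act p' \<phi>) j k"
    unfolding Add_def act_superset[OF K(1,2)] act_superset[OF K(1,3)] act_superset[OF K(1,4)]
    by (simp add: lookup_add s_simps distrib_right sum.distrib)
qed

lemma act_single: "act (Poly_Mapping.single w c) \<phi> = Sop (s c) (wact w \<phi>)"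
proof (cases "c = 0")
  case True
  then show ?thesis by (intro ext) (simp add: act_def Sop_def s_simps)
next
  case False
  then show ?thesis by (intro ext) (simp add: act_def Sop_def)
qed

lemma act_DN: "p \<in> F' ==> \<phi> \<in> DN ==> act p \<phi> \<in> DN"
proof (induction p rule: free.mem_induct)
  case (single w c)
  then show ?case by (simp add: act_single DN_Sop central_scalars wact_DN)
qed (simp_all add: act_zero act_add DN_Zr DN_Add)

lemma act_D: "p \<in> F' ==> \<phi> \<in> DN ==> act p \<phi> \<in> D"
  by (rule DN_D[OF act_DN])

lemma act_Zr: "p \<in> F' ==> act p Zr = Zr"
  by (induction p rule: free.mem_induct) (simp_all add: act_zero act_add act_single wact_Zr)

lemma act_Rop: "p \<in> F' ==> c \<in> A ==> \<phi> \<in> DN ==> act p (Rop c \<phi>) = Rop c (act p \<phi>)"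
  by (induction p rule: free.mem_induct) (simp_all add: act_zero act_add act_single wact_Rop op_Rop)

lemma act_mult: "p \<in> F' ==> p' \<in> F' ==> \<phi> \<in> DN ==> act (p * p') \<phi> = act p (act p' \<phi>)"
proof (induction p rule: free.mem_induct)
  case (single w c)
  have "act (Poly_Mapping.single w c * p') \<phi> = Sop (s c) (wact w (act p' \<phi>))"
    using single(3)
  proof (induction p' rule: free.mem_induct)
    case (single w' c')
    have 1: "wact w (Sop (s c') (wact w' \<phi>)) = Sop (s c') (wact w (wact w' \<phi>))"
      using \<open>w \<in> words\<close> single \<open>\<phi> \<in> DN\<close> by (intro wact_Sop central_scalars wact_DN) auto
    show ?case
      unfolding mult_single act_single 1 wact_plus using \<open>c \<in> R\<close> \<open>c' \<in> R\<close>
      by (intro ext) (simp add: Sop_def s_simps mult.assoc)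
  next
    case (add p q)
    then show ?case
      using \<open>w \<in> words\<close> \<open>c \<in> R\<close>
      by (simp add: distrib_left act_add free.mem_mult free.mem_single wact_Add op_Add)
  qed (simp add: act_zero wact_Zr)
  then show ?case by (simp add: act_single)
next
  case (add p q)
  then show ?case by (simp add: distrib_right act_add free.mem_mult)
qed (simp add: act_zero)

lemma Sop_u: "\<phi> \<in> D ==> Sop u \<phi> = \<phi>"
  by (intro ext) (simp add: Sop_def)

lemma act_fgen: "a \<in> yh_gens (Suc n) ==> \<phi> \<in> DN ==> act (fgen a) \<phi> = op a \<phi>"
  unfolding fgen_def act_single by (simp add: wact_def s_simps Sop_u DN_D op_DN)

lemma act_fscalar: "act (fscalar c) \<phi> = Sop (s c) \<phi>"
  unfolding fscalar_def act_single by (simp add: wact_def zero_word_def)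

lemma act_one: "\<phi> \<in> DN ==> act 1 \<phi> = \<phi>"
  using act_fscalar[of 1 \<phi>] by (simp add: fscalar_simps s_simps Sop_u DN_D)

lemma act_diff:
  assumes "p \<in> F'" "p' \<in> F'" "\<phi> \<in> DN"
  shows "act (p - p') \<phi> j k = act p \<phi> j k - act p' \<phi> j k"
  using act_add[OF free_diff[OF assms(1,2)] assms(2), of \<phi>] by (simp add: Add_def)

lemma act_diff_Zr:
  assumes "p \<in> F'" "p' \<in> F'" "\<phi> \<in> DN" "act p \<phi> = act p' \<phi>"
  shows "act (p - p') \<phi> = Zr"
  by (intro ext) (simp add: act_diff assms Zr_def)

lemma act_sum: "(\<And>i. i \<in> I ==> f i \<in> F') ==> act (sum f I) \<phi> j k = (\<Sum>i\<in>I. act (f i) \<phi> j k)"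
  by (induction I rule: infinite_finite_induct) (simp_all add: act_zero Zr_def act_add free_sum, simp add: Add_def)

lemma gen_F': "1 \<le> i ==> i \<le> Suc n ==> fgen (T i) \<in> F'" "1 \<le> i ==> i \<le> n ==> fgen (G i) \<in> F'"
  "fgen X1 \<in> F'" "fgen X1inv \<in> F'" "c \<in> R ==> fscalar c \<in> F'"
  by (auto intro!: fgen_mem fscalar_mem simp: yh_gens_def)

lemma act_gens:
  assumes "\<phi> \<in> DN"
  shows "1 \<le> i ==> i \<le> Suc n ==> act (fgen (T i)) \<phi> = Top i \<phi>" "1 \<le> i ==> i \<le> n ==> act (fgen (G i)) \<phi> = Gop i \<phi>"
    "act (fgen X1) \<phi> = Xop \<phi>" "act (fgen X1inv) \<phi> = Xinv \<phi>"
  by (subst act_fgen; use assms in \<open>simp add: yh_gens_def\<close>)+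

lemma Top_pow_DN: "1 \<le> i ==> i \<le> Suc n ==> \<phi> \<in> DN ==> (Top i ^^ m) \<phi> \<in> DN"
  by (induction m) (simp_all add: DN_Top)

lemma act_T_power: "1 \<le> i ==> i \<le> Suc n ==> \<phi> \<in> DN ==> act (fgen (T i) ^ m) \<phi> = (Top i ^^ m) \<phi>"
  by (induction m) (simp_all add: act_one act_mult gen_F' free_power act_gens Top_pow_DN)

lemma act_e:
  assumes i: "1 \<le> i" "i \<le> n" and \<phi>: "\<phi> \<in> DN"
  shows "act (e_elt r i) \<phi> = Eop i \<phi>"
proof (rule D_eqI)
  have m: "e_elt r i \<in> F'" by (rule e_elt_mem) (use i in auto)
  show "act (e_elt r i) \<phi> \<in> D" by (rule act_D[OF m \<phi>])
  show "Eop i \<phi> \<in> D" using i \<phi> by (simp add: DN_D)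
  let ?f = "\<lambda>a. fgen (T i) ^ a * fgen (T (Suc i)) ^ (r - a)"
  have f: "?f a \<in> F'" for a using i by (intro free.mem_mult free_power gen_F') auto
  have "act (e_elt r i) \<phi> = Sop \<rho> (act (\<Sum>a<r. ?f a) \<phi>)"
    unfolding e_elt_def by (subst act_mult) (use \<phi> f in \<open>simp_all add: fscalar_const_mem free_sum act_fscalar \<rho>_def\<close>)
  moreover have "act (?f a) \<phi> = (Top i ^^ a) ((Top (Suc i) ^^ (r - a)) \<phi>)" for a
    using i \<phi> by (subst act_mult) (simp_all add: gen_F' free_power act_T_power Top_pow_DN)
  ultimately show "act (e_elt r i) \<phi> j k = Eop i \<phi> j k" if "1 \<le> j" "j \<le> Suc n" for j k
    using that f by (simp add: Sop_def act_sum Top_power Eop_simps cyclic_avg_def mult.assoc sum_distrib_right)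
qed

lemma act_relation:
  assumes "p \<in> yh_relations r (Suc n)" and \<phi>: "\<phi> \<in> DN"
  shows "act p \<phi> = Zr"
  using assms(1)
proof cases
  case (braid_far i j)
  have "Gop i (Gop j \<phi>) = Gop j (Gop i \<phi>)" using braid_far by (intro Gop_far DN_D \<phi>) auto
  then show ?thesis unfolding braid_far(1) using braid_far
    by (intro act_diff_Zr free.mem_mult gen_F' \<phi>) (simp_all add: act_mult gen_F' \<phi> act_gens DN_Gop)
next
  case (braid i)
  then show ?thesis unfolding braid(1)
    by (intro act_diff_Zr free.mem_mult gen_F' \<phi>)
      (simp_all add: act_mult gen_F' free.mem_mult \<phi> act_gens DN_Gop rel_G_braid DN_D)
next
  case (t_comm i j)
  then show ?thesis unfolding t_comm(1)
    by (intro act_diff_Zr free.mem_mult gen_F' \<phi>)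
      (simp_all add: act_mult gen_F' \<phi> act_gens DN_Top rel_T_comm[of i j] DN_D)
next
  case (g_t i j)
  have j': "1 \<le> transpose i (Suc i) j" "transpose i (Suc i) j \<le> Suc n" using g_t by (auto simp: transpose_def)
  show ?thesis unfolding g_t(1)
    by (intro act_diff_Zr free.mem_mult gen_F' \<phi>)
      (use g_t j' in \<open>simp_all add: act_mult gen_F' \<phi> act_gens DN_Top DN_Gop rel_G_T DN_D\<close>)
next
  case (t_order j)
  have "(Top j ^^ r) \<phi> = \<phi>"
    by (rule D_eqI) (use t_order \<phi> in \<open>simp_all add: DN_D Top_pow_DN Top_power tj_order\<close>)
  then show ?thesis unfolding t_order(1)
    by (intro act_diff_Zr free_power free.mem_one gen_F' \<phi>) (use t_order \<phi> in \<open>simp_all add: act_T_power act_one\<close>)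
next
  case (quadratic i)
  let ?c = "laurent_power Q 1 - laurent_power Q (-1)"
  have m: "e_elt r i \<in> F'" "fgen (G i) \<in> F'" "fscalar ?c \<in> F'"
    using quadratic kappa_R by (auto intro!: e_elt_mem gen_F')
  have "act (1 + fscalar ?c * e_elt r i * fgen (G i)) \<phi> = Add \<phi> (Sop \<kappa> (Eop i (Gop i \<phi>)))"
    using quadratic m \<phi>
    by (simp add: act_add free.mem_one free.mem_mult act_one act_mult act_gens act_e DN_Gop act_fscalar \<kappa>_def)
  moreover have "act (fgen (G i) ^ 2) \<phi> = Gop i (Gop i \<phi>)"
    using quadratic m \<phi> by (simp add: power2_eq_square act_mult act_gens DN_Gop)
  ultimately show ?thesis unfolding quadratic(1) using quadratic m \<phi> rel_G_quadratic[of i \<phi>]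
    by (intro act_diff_Zr free.mem_add free.mem_mult free.mem_one free_power) (simp_all add: DN_D)
next
  case X1_X1inv
  then show ?thesis
    by (auto intro!: act_diff_Zr free.mem_mult free.mem_one gen_F' simp: \<phi> act_mult gen_F' act_gens act_one DN_Xinv Xop_Xinv)
next
  case X1inv_X1
  then show ?thesis
    by (auto intro!: act_diff_Zr free.mem_mult free.mem_one gen_F' simp: \<phi> act_mult gen_F' act_gens act_one DN_Xop Xinv_Xop)
next
  case X1_braid
  have one: "(1::nat) \<le> 1" by simp
  have G1: "fgen (G 1) \<in> F'" by (rule gen_F'(2)[OF one n])
  have a: "act (fgen (G 1)) \<psi> = Gop 1 \<psi>" "Gop 1 \<psi> \<in> DN" if "\<psi> \<in> DN" for \<psi>
    by (rule act_gens(2)[OF that one n], rule DN_Gop[OF one n that])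
  show ?thesis unfolding X1_braid(1)
  proof (intro act_diff_Zr free.mem_mult G1 gen_F' \<phi>)
    have "act (fgen (G 1) * fgen X1 * fgen (G 1) * fgen X1) \<phi> = Gop 1 (Xop (Gop 1 (Xop \<phi>)))"
      by (simp only: act_mult G1 gen_F' free.mem_mult \<phi> act_gens(3) a DN_Xop)
    moreover have "act (fgen X1 * fgen (G 1) * fgen X1 * fgen (G 1)) \<phi> = Xop (Gop 1 (Xop (Gop 1 \<phi>)))"
      by (simp only: act_mult G1 gen_F' free.mem_mult \<phi> act_gens(3) a DN_Xop)
    ultimately show "act (fgen (G 1) * fgen X1 * fgen (G 1) * fgen X1) \<phi> = act (fgen X1 * fgen (G 1) * fgen X1 * fgen (G 1)) \<phi>"
      using rel_X_braid[OF DN_D[OF \<phi>]] by simp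
  qed
next
  case (g_X1 i)
  then show ?thesis unfolding g_X1(1)
    by (intro act_diff_Zr free.mem_mult gen_F' \<phi>)
      (simp_all add: act_mult gen_F' \<phi> act_gens DN_Gop DN_Xop rel_G_X DN_D)
next
  case (t_X1 j)
  then show ?thesis unfolding t_X1(1)
    by (intro act_diff_Zr free.mem_mult gen_F' \<phi>)
      (simp_all add: act_mult gen_F' \<phi> act_gens DN_Top DN_Xop rel_T_X DN_D)
qed

lemma act_cyclotomic:
  assumes \<phi>: "\<phi> \<in> DN"
  shows "act (cyclotomic_poly d) \<phi> = Zr"
proof -
  let ?f = "\<lambda>i. fgen X1 - fscalar (laurent_power (V i) 1)"
  have m: "?f i \<in> F'" if "i \<in> {1..d}" for i using that by (intro free_diff gen_F' v_R) auto
  have "set L \<subseteq> {1..d} ==> act (prod_list (map ?f L)) \<phi> = Pop (map v L) \<phi> \<and> prod_list (map ?f L) \<in> F'" for L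
  proof (induction L)
    case Nil
    then show ?case by (simp add: act_one \<phi> Pop_simps free.mem_one)
  next
    case (Cons i L)
    have IH: "act (prod_list (map ?f L)) \<phi> = Pop (map v L) \<phi>" "prod_list (map ?f L) \<in> F'" using Cons by auto
    have i: "i \<in> {1..d}" using Cons.prems by auto
    have P: "Pop (map v L) \<phi> \<in> DN" using act_DN[OF IH(2) \<phi>] by (simp add: IH(1))
    have "act (?f i) (Pop (map v L) \<phi>) = Xv (v i) (Pop (map v L) \<phi>)"
      by (intro ext, subst act_diff)
        (use i P in \<open>simp_all add: gen_F' v_R act_gens act_fscalar Xv_def Add_def Sop_def v_def\<close>)
    then show ?case using m[OF i] IH \<phi> by (simp add: act_mult Pop_simps free.mem_mult)
  qed
  from this[of "[1..<Suc d]"] have "act (cyclotomic_poly d) \<phi> = Fop \<phi>"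
    unfolding cyclotomic_poly_def Fop_def vs_def using atLeastLessThanSuc_atLeastAtMost[of 1 d] by (simp only: set_upt order_refl)
  also have "\<dots> = Zr" using DN_F[OF \<phi>, of 1] by (simp add: GG_Suc)
  finally show ?thesis .
qed

text \<open>
  The elements that act as zero on \<open>DN\<close> form an ideal which contains all defining relations, by the
  computations with operators above.
\<close>

lemma act_class_zero:
  assumes p: "p \<in> F'" "YH_class r d (Suc n) p = \<zero>\<^bsub>cyclotomic_YH r d (Suc n)\<^esub>" and \<phi>: "\<phi> \<in> DN"
  shows "act p \<phi> = Zr"
proof -
  let ?J = "{p \<in> F'. \<forall>\<phi>\<in>DN. act p \<phi> = Zr}"
  have um: "act (- p) \<phi> = Zr" if "p \<in> F'" "\<phi> \<in> DN" "act p \<phi> = Zr" for p \<phi>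
    using act_add[OF free.mem_uminus[OF that(1)] that(1), of \<phi>] that by (simp add: act_zero)
  have "ideal ?J (free_algebra r d (Suc n))"
  proof (rule idealI[OF ring_free])
    interpret FA: ring "free_algebra r d (Suc n)" by (rule ring_free)
    show "subgroup ?J (add_monoid (free_algebra r d (Suc n)))"
    proof (rule FA.add.subgroupI)
      show "?J \<noteq> {}" using free.mem_zero[of r d "Suc n"] act_zero by auto
    next
      fix a assume "a \<in> ?J"
      then show "\<ominus>\<^bsub>free_algebra r d (Suc n)\<^esub> a \<in> ?J" by (auto simp: free_minus um free.mem_uminus)
    qed (auto simp: act_add free.mem_add)
  qed (auto simp: act_mult act_Zr act_DN free.mem_mult)
  then have "p \<in> ?J"
    by (rule YH_class_zero_least)
      (use p in \<open>auto simp: act_relation act_cyclotomic yh_relations_mem cyclotomic_poly_mem\<close>)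
  then show ?thesis using \<phi> by blast
qed

subsection \<open>Values at the identity\<close>

lemma F_sub: "p \<in> F ==> p \<in> F'"
  by (fastforce simp: free.mem_iff yh_gens_def)

text \<open>
  At \<open>u\<^sub>n\<^sub>+\<^sub>1 = 1\<close> and its multiples by \<open>X\<^sup>k\<close>, translation by an element of \<open>A\<close> is left multiplication.
\<close>

lemma act_left:
  assumes p: "p \<in> F" and \<phi>: "\<phi> \<in> DN"
  shows "act p \<phi> (Suc n) k = cl p * \<phi> (Suc n) k"
  using p \<phi>
proof (induction p arbitrary: \<phi> k rule: free_induct)
  case (scalar c)
  then show ?case by (simp add: act_fscalar Sop_def s_def)
next
  case (gen a)
  have inv: "Xinv \<phi> (Suc n) k = xinv * \<phi> (Suc n) k"
  proof -
    have "\<phi> (Suc n) k = x * Xinv \<phi> (Suc n) k"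
      using n arg_cong[OF Xop_Xinv[OF gen(2)], of "\<lambda>f. f (Suc n) k"] by (simp add: Xop_simps)
    then show ?thesis using x_inverse(2) DN_D[OF DN_Xinv[OF gen(2)]] by (simp add: mult.assoc[symmetric])
  qed
  show ?case
    using gen n inv
    by (auto simp: yh_gens_def act_gens Top_simps tj_def Gop_simps Xop_simps t_def g_def x_def xinv_def)
next
  case (add p q)
  then show ?case using F_sub by (simp add: act_add Add_def cl_add distrib_right)
next
  case (mult p q)
  then show ?case using F_sub by (simp add: act_mult act_DN cl_mult mult.assoc)
qed

lemma Rop_Rop: "Rop a (Rop b \<phi>) = Rop (b * a) \<phi>"
  by (simp add: Rop_def mult.assoc)

lemma Rop_u: "\<phi> \<in> D ==> Rop u \<phi> = \<phi>"
  by (intro ext) (simp add: Rop_def)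

lemma eps_Xinv: "Xinv eps = Rop xinv eps"
proof -
  have "eps = Rop x (Xinv eps)" using Xinv_Xop[OF eps_DN] eps_Xop Xinv_Rop[of x eps] eps_DN by simp
  then have "Rop xinv eps = Rop xinv (Rop x (Xinv eps))" by (rule arg_cong)
  also have "\<dots> = Xinv eps" by (simp add: Rop_Rop x_inverse Rop_u DN_D DN_Xinv eps_DN)
  finally show ?thesis by simp
qed

text \<open>
  On \<open>eps\<close> the translations by \<open>A\<close> agree with right multiplication of the values. For the
  generators this was shown by uniqueness, and multiplicativity uses that the operators commute with
  right multiplications.
\<close>

lemma act_right:
  assumes p: "p \<in> F"
  shows "act p eps = Rop (cl p) eps"
  using p
proof (induction p rule: free_induct)
  case (scalar c)
  then show ?case
    by (intro ext) (simp add: act_fscalar Sop_def Rop_def s_def[symmetric] central eps_D)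
next
  case (gen a)
  then show ?case
    using n
    by (auto simp: yh_gens_def act_gens eps_DN eps_Top eps_Gop eps_Xop eps_Xinv t_def g_def x_def xinv_def)
next
  case (add p q)
  then show ?case using F_sub by (simp add: act_add cl_add) (intro ext, simp add: Add_def Rop_def distrib_left)
next
  case (mult p q)
  then show ?case using F_sub by (simp add: act_mult eps_DN cl_mult act_Rop A_I Rop_Rop)
qed

definition theta where "theta p = act p eps (Suc n) 0"

lemma theta_A: "p \<in> F' ==> theta p \<in> A"
  unfolding theta_def by (rule D_A[OF act_D[OF _ eps_DN]])

lemma theta_add: "p \<in> F' ==> p' \<in> F' ==> theta (p + p') = theta p + theta p'"
  by (simp add: theta_def act_add Add_def)

lemma theta_class_zero: "p \<in> F' ==> YH_class r d (Suc n) p = \<zero>\<^bsub>cyclotomic_YH r d (Suc n)\<^esub> ==> theta p = 0"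
  by (simp add: theta_def act_class_zero eps_DN Zr_def)

lemma theta_left: "p \<in> F ==> p' \<in> F' ==> theta (p * p') = cl p * theta p'"
  by (simp add: theta_def act_mult F_sub eps_DN act_left act_DN)

lemma theta_right: "p \<in> F ==> p' \<in> F' ==> theta (p' * p) = theta p' * cl p"
  by (simp add: theta_def act_mult F_sub eps_DN act_right act_Rop A_I) (simp add: Rop_def)

end

subsection \<open>Lifts of the distinguished elements to the free algebra\<close>

text \<open>
  Lifts of \<open>g\<^sub>i\<^sup>-\<^sup>1 = g\<^sub>i - (q - q\<^sup>-\<^sup>1) e\<^sub>i\<close>, of \<open>u\<^sub>j\<close> and of \<open>X\<^sub>n\<^sub>+\<^sub>1\<close> to the free algebra.
\<close>

definition free_inv where
  "free_inv r i = fgen (G i) - fscalar (laurent_power Q 1 - laurent_power Q (-1)) * e_elt r i"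

definition free_u where "free_u r n j = prod_list (map (free_inv r) (rev [j..<Suc n]))"

definition free_X where
  "free_X n = prod_list (map (\<lambda>i. fgen (G i)) (rev [1..<Suc n])) * fgen X1 * prod_list (map (\<lambda>i. fgen (G i)) [1..<Suc n])"

context yh_cyc_coind
begin

lemma free_inv_mem: "1 \<le> i ==> i \<le> n ==> free_inv r i \<in> F'"
  unfolding free_inv_def using kappa_R by (intro free_diff free.mem_mult gen_F' e_elt_mem) auto

lemma act_free_inv:
  assumes i: "1 \<le> i" "i \<le> n" and \<phi>: "\<phi> \<in> DN"
  shows "act (free_inv r i) \<phi> (Suc i) k = \<phi> i k"
proof -
  have m: "e_elt r i \<in> F'" "fgen (G i) \<in> F'" "fscalar (laurent_power Q 1 - laurent_power Q (-1)) \<in> F'"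
    using i kappa_R by (auto intro!: e_elt_mem gen_F')
  have "tj i (Suc i) = t i" "tj (Suc i) (Suc i) = t0" by (simp_all add: tj_def)
  then show ?thesis
    unfolding free_inv_def using i \<phi> m
    by (subst act_diff)
      (simp_all add: free.mem_mult act_mult act_gens act_e act_fscalar Sop_def Gop_simps Eop_simps \<kappa>_def)
qed

lemma act_free_u:
  assumes j: "1 \<le> j" "j \<le> Suc n" and \<phi>: "\<phi> \<in> DN"
  shows "free_u r n j \<in> F' \<and> act (free_u r n j) \<phi> (Suc n) k = \<phi> j k"
proof -
  have "m \<le> Suc n ==> prod_list (map (free_inv r) (rev [j..<m])) \<in> F' \<and>
      act (prod_list (map (free_inv r) (rev [j..<m]))) \<phi> m k = \<phi> j k" if "j \<le> m" for m
    using that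
  proof (induction m rule: dec_induct)
    case base
    then show ?case by (simp add: act_one \<phi> free.mem_one)
  next
    case (step m)
    then show ?case
      using j \<phi> by (simp add: act_mult free_inv_mem act_free_inv act_DN free.mem_mult)
  qed
  from this[of "Suc n"] j show ?thesis by (simp add: free_u_def)
qed

lemma free_G_prod: "set L \<subseteq> {1..n} ==> prod_list (map (\<lambda>i. fgen (G i)) L) \<in> F'"
  by (induction L) (simp_all add: free.mem_one free.mem_mult gen_F')

lemma foldr_Gop_DN: "set L \<subseteq> {1..n} ==> \<phi> \<in> DN ==> foldr Gop L \<phi> \<in> DN"
  by (induction L) (simp_all add: DN_Gop)

lemma act_G_prod: "set L \<subseteq> {1..n} ==> \<phi> \<in> DN ==> act (prod_list (map (\<lambda>i. fgen (G i)) L)) \<phi> = foldr Gop L \<phi>"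
  by (induction L) (simp_all add: act_one act_mult free_G_prod gen_F' act_gens foldr_Gop_DN)

text \<open>
  Translation by \<open>g\<^sub>1 \<dots> g\<^sub>n\<close> moves the entry \<open>n + 1\<close> to 1, and \<open>down_Xop\<close> brings it back with its degree
  raised by one.
\<close>

lemma act_free_X: "\<phi> \<in> DN ==> free_X n \<in> F' \<and> act (free_X n) \<phi> (Suc n) k = \<phi> (Suc n) (Suc k)"
proof -
  assume \<phi>: "\<phi> \<in> DN"
  let ?up = "prod_list (map (\<lambda>i. fgen (G i)) [1..<Suc n])" and ?dn = "prod_list (map (\<lambda>i. fgen (G i)) (rev [1..<Suc n]))"
  have sub: "set [1..<Suc n] \<subseteq> {1..n}" "set (rev [1..<Suc n]) \<subseteq> {1..n}" by auto
  have m: "?up \<in> F'" "?dn \<in> F'" by (rule free_G_prod[OF sub(1)], rule free_G_prod[OF sub(2)])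
  have up: "act ?up \<phi> = GG (Suc n) \<phi>" unfolding GG_def by (rule act_G_prod[OF sub(1) \<phi>])
  have GD: "GG (Suc n) \<phi> \<in> DN" using act_DN[OF m(1) \<phi>] by (simp only: up)
  have "act (free_X n) \<phi> = act ?dn (act (fgen X1) (act ?up \<phi>))"
    unfolding free_X_def by (simp only: act_mult free.mem_mult m gen_F' \<phi> up GD act_gens(3) DN_Xop)
  also have "\<dots> = down 1 (Xop (GG (Suc n) \<phi>))"
    unfolding up act_gens(3)[OF GD] act_G_prod[OF sub(2) DN_Xop[OF GD]] down_def foldr_conv_fold rev_rev_ident ..
  finally have "act (free_X n) \<phi> (Suc n) k = GG (Suc n) \<phi> 1 (Suc k)" by (simp only: down_Xop)
  also have "\<dots> = \<phi> (Suc n) (Suc k)" by (rule GG_first) auto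
  finally show ?thesis unfolding free_X_def using m by (simp only: free.mem_mult gen_F' simp_thms)
qed

lemma act_free_X_power: "\<phi> \<in> DN ==> act (free_X n ^ k) \<phi> (Suc n) l = \<phi> (Suc n) (k + l)"
proof (induction k arbitrary: l)
  case (Suc k)
  have m: "free_X n \<in> F'" using act_free_X[OF Suc.prems] by blast
  then have "act (free_X n ^ Suc k) \<phi> (Suc n) l = act (free_X n ^ k) \<phi> (Suc n) (Suc l)"
    using act_free_X[OF act_DN[OF free_power[OF m] Suc.prems]] Suc.prems by (simp add: act_mult free_power)
  then show ?case using Suc by simp
qed (simp add: act_one)

lemma theta_basis:
  assumes "1 \<le> j" "j \<le> Suc n"
  shows "theta (free_X n ^ k * fgen (T (Suc n)) ^ l * free_u r n j) = t0 ^ l * eps j k"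
proof -
  have m: "free_X n \<in> F'" "free_u r n j \<in> F'" "fgen (T (Suc n)) \<in> F'"
    using act_free_X[OF eps_DN] act_free_u[OF assms eps_DN] gen_F'(1)[of "Suc n"] by auto
  have t: "tj (Suc n) (Suc n) = t0" by (simp add: tj_def)
  have u: "act (free_u r n j) eps \<in> DN" by (rule act_DN[OF m(2) eps_DN])
  have T: "(Top (Suc n) ^^ l) (act (free_u r n j) eps) \<in> DN" by (rule Top_pow_DN[OF _ _ u]) auto
  have "theta (free_X n ^ k * fgen (T (Suc n)) ^ l * free_u r n j)
      = act (free_X n ^ k) ((Top (Suc n) ^^ l) (act (free_u r n j) eps)) (Suc n) 0"
    unfolding theta_def using m u by (simp add: act_mult free.mem_mult free_power eps_DN act_T_power)
  also have "\<dots> = t0 ^ l * act (free_u r n j) eps (Suc n) k"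
    unfolding act_free_X_power[OF T] by (subst Top_power) (simp_all add: t)
  finally show ?thesis using act_free_u[OF assms eps_DN] by simp
qed

end

section \<open>The Frobenius homomorphism\<close>

locale yh_cyc = yh_rep r d n cl for r d n and cl :: "yh_free \<Rightarrow> 'a::{ring,monoid_mult}" +
  assumes n: "1 \<le> n" and d: "1 \<le> d" and cl_cyclotomic: "cl (cyclotomic_poly d) = 0"
begin

definition \<zeta> :: complex where "\<zeta> = exp (2 * of_real pi * \<i> / of_nat r)"

lemma zeta_ring: "\<zeta> ^ k \<in> coeff_ring r"
  by (induction k) (simp_all add: coeff_ring \<zeta>_def)

lemma zeta_power: "\<zeta> ^ m = cis (2 * pi * real m / real r)"
proof -
  have "\<zeta> = cis (2 * pi / real r)"
    by (simp add: \<zeta>_def cis_conv_exp field_simps)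
  then show ?thesis by (simp add: Complex.DeMoivre mult.commute)
qed

lemma zeta_eq_1: "\<zeta> ^ m = 1 \<longleftrightarrow> r dvd m"
proof
  assume "\<zeta> ^ m = 1"
  then have "cos (2 * pi * real m / real r) = 1" unfolding zeta_power by (metis cis.sel(1) one_complex.sel(1))
  then obtain k :: int where "2 * pi * real m / real r = of_int k * 2 * pi" by (auto simp: cos_one_2pi_int)
  then have "real m = of_int k * real r" using r by (simp add: field_simps)
  then have "int m = k * int r" by (metis of_int_eq_iff of_int_mult of_int_of_nat_eq)
  then have "int r dvd int m" by simp
  then show "r dvd m" by simp
next
  assume "r dvd m"
  then obtain k where "m = r * k" by auto
  then have "2 * pi * real m / real r = 2 * pi * real k" using r by simp
  then show "\<zeta> ^ m = 1" unfolding zeta_power by (simp add: complex_eq_iff)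
qed

lemma zeta_sum: "(\<Sum>l<r. \<zeta> ^ (l * m)) = (if r dvd m then of_nat r else 0)"
proof (cases "r dvd m")
  case True
  have "\<zeta> ^ (l * m) = 1" for l using True by (simp add: zeta_eq_1)
  then show ?thesis using True by simp
next
  case False
  have "(\<Sum>l<r. \<zeta> ^ (l * m)) = (\<Sum>l<r. (\<zeta> ^ m) ^ l)"
    by (simp add: power_mult[symmetric] mult.commute)
  also have "\<dots> = 0"
  proof -
    have "(\<zeta> ^ m) ^ r = 1" by (simp add: power_mult[symmetric] zeta_eq_1)
    then show ?thesis using False by (simp add: geometric_sum zeta_eq_1)
  qed
  finally show ?thesis using False by simp
qed

abbreviation sc where "sc c \<equiv> s (laurent_const c)"

lemma sc_power: "sc (\<zeta> ^ l) ^ m * u = sc (\<zeta> ^ (l * m))"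
proof (induction m)
  case 0
  then show ?case by (simp add: laurent_const_def s_simps)
next
  case (Suc m)
  have "sc (\<zeta> ^ l) ^ Suc m * u = sc (\<zeta> ^ l) * sc (\<zeta> ^ (l * m))" by (simp add: mult.assoc Suc)
  also have "\<dots> = sc (\<zeta> ^ l * \<zeta> ^ (l * m))"
    by (simp only: s_simps(2)[OF laurent_const_mem[OF zeta_ring] laurent_const_mem[OF zeta_ring], symmetric] laurent_const_mult)
  finally show ?case by (simp add: power_add)
qed

definition t0 where "t0 l = sc (\<zeta> ^ l)"

lemma t0_A: "t0 l \<in> A"
  unfolding t0_def by (intro gens_A laurent_const_mem zeta_ring)

lemma instance_zeta: "yh_cyc_coind r d n cl (t0 l)"
proof -
  have "t0 l ^ r = u"
  proof -
    have "t0 l ^ r \<in> A" using r t0_A by (rule power_A)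
    then have "t0 l ^ r = t0 l ^ r * u" by simp
    also have "\<dots> = sc (\<zeta> ^ (l * r))" unfolding t0_def by (rule sc_power)
    also have "\<zeta> ^ (l * r) = 1" by (simp add: zeta_eq_1)
    finally show ?thesis by (simp add: laurent_const_def s_simps)
  qed
  then show ?thesis
    by unfold_locales
      (use n d cl_cyclotomic t0_A in \<open>auto simp: t0_def intro: central laurent_const_mem zeta_ring\<close>)
qed

abbreviation F1 where "F1 \<equiv> carrier (free_algebra r d (Suc n))"

text \<open>
  On the monomials, the map for the root of unity \<open>\<zeta>\<^sup>m\<close> has a factor \<open>\<zeta>\<^sup>m\<^sup>l\<close> from \<open>t\<^sub>n\<^sub>+\<^sub>1\<^sup>l\<close>. The average removes
  all of them except \<open>l = 0\<close> modulo \<open>r\<close>.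
\<close>

definition functional where "functional p = \<rho> * (\<Sum>l<r. yh_cyc_coind.theta r d n cl (t0 l) p)"

lemmas theta_facts = yh_cyc_coind.theta_A[OF instance_zeta] yh_cyc_coind.theta_add[OF instance_zeta]
  yh_cyc_coind.theta_class_zero[OF instance_zeta] yh_cyc_coind.theta_left[OF instance_zeta] yh_cyc_coind.theta_right[OF instance_zeta]

lemma functional_A: "p \<in> F1 ==> functional p \<in> A"
  unfolding functional_def by (intro A_closed(6)[OF gens_A(6) A_sum] theta_facts(1))

lemma functional_add: "p \<in> F1 ==> p' \<in> F1 ==> functional (p + p') = functional p + functional p'"
  by (simp add: functional_def theta_facts(2) sum.distrib distrib_left)

lemma functional_class_zero:
  "p \<in> F1 ==> YH_class r d (Suc n) p = \<zero>\<^bsub>cyclotomic_YH r d (Suc n)\<^esub> ==> functional p = 0"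
  by (simp add: functional_def theta_facts(3))

lemma functional_left: "p \<in> F ==> p' \<in> F1 ==> functional (p * p') = cl p * functional p'"
proof -
  assume p: "p \<in> F" "p' \<in> F1"
  have "cl p * functional p' = (cl p * \<rho>) * (\<Sum>l<r. yh_cyc_coind.theta r d n cl (t0 l) p')"
    by (simp add: functional_def mult.assoc)
  also have "cl p * \<rho> = \<rho> * cl p" using p by (intro rho_central[symmetric] A_I)
  finally show ?thesis using p by (simp add: functional_def theta_facts(4) mult.assoc sum_distrib_left)
qed

lemma functional_right: "p \<in> F ==> p' \<in> F1 ==> functional (p' * p) = functional p' * cl p"
  by (simp add: functional_def theta_facts(5) mult.assoc sum_distrib_right)

lemma functional_basis:
  assumes j: "1 \<le> j" "j \<le> Suc n" and k: "k < d"
  shows "functional (free_X n ^ k * fgen (T (Suc n)) ^ l * free_u r n j) =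
    (if j = Suc n \<and> Suc k = d \<and> r dvd l then u else 0)"
proof -
  have eps: "yh_cyc_coind.eps r d n cl (t0 m) j k = (if j = Suc n \<and> Suc k = d then u else 0)" for m
    by (rule yh_cyc_coind.eps_initial[OF instance_zeta j k])
  have sum: "(\<Sum>m\<in>M. t0 m ^ l * u) = sc (\<Sum>m\<in>M. \<zeta> ^ (m * l)) \<and> (\<Sum>m\<in>M. \<zeta> ^ (m * l)) \<in> coeff_ring r"
    if "finite M" for M
    using that
  proof (induction M rule: finite_induct)
    case empty
    then show ?case by (simp add: laurent_const_def s_simps coeff_ring)
  next
    case (insert a M)
    have "sc (\<zeta> ^ (a * l) + (\<Sum>m\<in>M. \<zeta> ^ (m * l))) = sc (\<zeta> ^ (a * l)) + sc (\<Sum>m\<in>M. \<zeta> ^ (m * l))"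
      using insert by (simp add: laurent_const_def single_add)
        (intro s_simps(1) laurent_const_mem[unfolded laurent_const_def] zeta_ring, simp)
    then show ?case using insert by (simp add: sc_power t0_def coeff_ring zeta_ring)
  qed
  show ?thesis
  proof (cases "j = Suc n \<and> Suc k = d")
    case True
    have "functional (free_X n ^ k * fgen (T (Suc n)) ^ l * free_u r n j) = \<rho> * (\<Sum>m<r. t0 m ^ l * u)"
      unfolding functional_def yh_cyc_coind.theta_basis[OF instance_zeta j] eps using True by simp
    also have "\<dots> = sc (1 / of_nat r) * sc (if r dvd l then of_nat r else 0)"
      using sum[of "{..<r}"] by (simp add: zeta_sum \<rho>_def)
    also have "\<dots> = sc (1 / of_nat r * (if r dvd l then of_nat r else 0))"
      using sum[of "{..<r}"] unfolding laurent_const_mult[symmetric]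
      by (intro s_simps(2)[symmetric] laurent_const_mem coeff_ring) (simp add: zeta_sum)
    also have "\<dots> = (if r dvd l then u else 0)"
      using r by (simp add: laurent_const_def s_simps)
    finally show ?thesis using True by auto
  next
    case False
    then show ?thesis unfolding functional_def yh_cyc_coind.theta_basis[OF instance_zeta j] eps by auto
  qed
qed

end

section \<open>The larger algebra as a module over the smaller one\<close>

locale yh_top = yh_rep r d "Suc n" cl for r d n and cl :: "yh_free \<Rightarrow> 'a::{ring,monoid_mult}" +
  assumes n: "1 \<le> n" and d: "1 \<le> d" and cl_cyclotomic: "cl (cyclotomic_poly d) = 0"
begin

abbreviation F0 where "F0 \<equiv> carrier (free_algebra r d n)"

definition C where "C = cl ` F0"

lemma F0_F: "p \<in> F0 ==> p \<in> F"
  by (fastforce simp: free.mem_iff yh_gens_def)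

lemma C_I: "p \<in> F0 ==> cl p \<in> C" by (simp add: C_def)

lemma C_A: "c \<in> C ==> c \<in> A" by (auto simp: C_def intro: A_I F0_F)

lemma C_closed:
  "u \<in> C" "0 \<in> C" "a \<in> C ==> b \<in> C ==> a + b \<in> C" "a \<in> C ==> - a \<in> C" "a \<in> C ==> b \<in> C ==> a * b \<in> C"
proof -
  show "u \<in> C" unfolding u_def by (intro C_I) simp
  show "0 \<in> C" using C_I[of 0] by (simp add: cl_zero)
  assume "a \<in> C"
  then obtain p where p: "p \<in> F0" "a = cl p" by (auto simp: C_def)
  show "- a \<in> C" using C_I[of "- p"] p by (simp add: cl_uminus F0_F)
  assume "b \<in> C"
  then obtain p' where p': "p' \<in> F0" "b = cl p'" by (auto simp: C_def)
  show "a + b \<in> C" using C_I[of "p + p'"] p p' by (simp add: cl_add F0_F)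
  show "a * b \<in> C" using C_I[of "p * p'"] p p' by (simp add: cl_mult F0_F)
qed

lemma C_gens:
  "c \<in> R ==> s c \<in> C" "1 \<le> i ==> i \<le> n ==> t i \<in> C" "1 \<le> i ==> i < n ==> g i \<in> C" "x \<in> C" "xinv \<in> C" "\<kappa> \<in> C" "\<rho> \<in> C"
  unfolding s_def t_def g_def x_def xinv_def \<rho>_def \<kappa>_def
  by (intro C_I fscalar_mem fgen_mem gens_mem kappa_R rho_R; assumption)+

lemma left_comm: "a * b = b * a ==> a * (b * z) = b * (a * z)" for a b z :: 'a
  by (simp add: mult.assoc[symmetric])

lemma C_commute:
  assumes z: "z \<in> A" "\<And>i. 1 \<le> i ==> i \<le> n ==> z * t i = t i * z" "\<And>i. 1 \<le> i ==> i < n ==> z * g i = g i * z" "z * x = x * z"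
    and c: "c \<in> C"
  shows "z * c = c * z"
proof -
  obtain p where p: "p \<in> F0" "c = cl p" using c by (auto simp: C_def)
  have xi: "z * xinv = xinv * z"
  proof -
    have "z * xinv = (xinv * x) * (z * xinv)" using z(1) by (simp add: x_inverse)
    also have "\<dots> = xinv * ((x * z) * xinv)" by (simp only: mult.assoc)
    also have "\<dots> = xinv * (z * (x * xinv))" by (simp only: z(4)[symmetric] mult.assoc)
    finally show ?thesis using z(1) by (simp add: x_inverse)
  qed
  from p(1) have "z * cl p = cl p * z"
  proof (induction p rule: free_induct)
    case (scalar c)
    then show ?case using z(1) by (simp add: central s_def[symmetric])
  next
    case (gen a)
    then show ?case using z xi by (auto simp: yh_gens_def t_def g_def x_def xinv_def)
  next
    case (add p q)
    then show ?case by (simp add: cl_add F0_F distrib_left distrib_right)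
  next
    case (mult p q)
    have "z * (cl p * cl q) = cl p * (z * cl q)" by (rule left_comm[OF mult(3)])
    then show ?case using mult by (simp add: cl_mult F0_F mult.assoc)
  qed
  then show ?thesis by (simp add: p)
qed

definition ee where "ee i = \<kappa> * e (t i) (t (Suc i))"
definition h where "h i = g i - ee i"

lemma ee_A [simp]: "1 \<le> i ==> i \<le> n ==> ee i \<in> A"
  unfolding ee_def by (intro A_closed e_A gens_A) auto

lemma h_A [simp]: "1 \<le> i ==> i \<le> n ==> h i \<in> A"
  by (simp add: h_def)

lemma ee_mem: "1 \<le> i ==> i < n ==> ee i \<in> C"
proof -
  assume i: "1 \<le> i" "i < n"
  have "ee i = cl (fscalar (laurent_power Q 1 - laurent_power Q (-1)) * e_elt r i)"
    using i e_elt_mem[of i "Suc n" r d] kappa_R by (simp add: cl_mult e_cl ee_def \<kappa>_def s_def)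
  then show ?thesis using i by (simp only:) (intro C_I free.mem_mult fscalar_mem kappa_R e_elt_mem; simp)
qed

lemma h_C: "1 \<le> i ==> i < n ==> h i \<in> C"
  using C_closed(3)[OF C_gens(3) C_closed(4)[OF ee_mem]] by (simp add: h_def)

lemma h_cl: "1 \<le> i ==> i \<le> n ==> cl (free_inv r i) = h i \<and> free_inv r i \<in> F"
proof -
  assume i: "1 \<le> i" "i \<le> n"
  have m: "e_elt r i \<in> F" using i by (intro e_elt_mem) auto
  show ?thesis using i m kappa_R
    by (simp add: free_inv_def cl_diff cl_mult e_cl h_def ee_def g_def \<kappa>_def s_def)
qed

lemma gh: "1 \<le> i ==> i \<le> n ==> g i * h i = u" "1 \<le> i ==> i \<le> n ==> h i * g i = u"
proof -
  assume i: "1 \<le> i" "i \<le> n"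
  have q: "g i * g i = u + ee i * g i" using g_quadratic[of i] i by (simp add: ee_def mult.assoc)
  have "g i * ee i = \<kappa> * (g i * e (t i) (t (Suc i)))"
    unfolding ee_def by (rule left_comm) (use i in \<open>simp add: kappa_central\<close>)
  also have "\<dots> = ee i * g i" using g_e_comm[of i] i by (simp add: ee_def mult.assoc)
  finally have ge: "g i * ee i = ee i * g i" .
  show "h i * g i = u" by (simp add: h_def left_diff_distrib q)
  show "g i * h i = u" by (simp add: h_def right_diff_distrib q ge)
qed

text \<open>
  Multiply by \<open>h\<close> on both sides: a relation of this kind for \<open>g\<close> also holds for the inverse \<open>h\<close>.
\<close>

lemma transfer:
  assumes "a \<in> A" "1 \<le> i" "i \<le> n" "1 \<le> j" "j \<le> n" "a * g i = g j * a"
  shows "a * h i = h j * a"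
proof -
  have "a * h i = (h j * g j) * (a * h i)" using assms by (simp add: gh)
  also have "\<dots> = h j * ((g j * a) * h i)" by (simp only: mult.assoc)
  also have "\<dots> = h j * (a * (g i * h i))" by (simp only: assms(6)[symmetric] mult.assoc)
  finally show ?thesis using assms by (simp add: gh)
qed

lemma h_t: "1 \<le> i ==> i \<le> n ==> 1 \<le> j ==> j \<le> Suc n ==> h i * t j = t (transpose i (Suc i) j) * h i"
proof -
  assume i: "1 \<le> i" "i \<le> n" "1 \<le> j" "j \<le> Suc n"
  let ?j = "transpose i (Suc i) j"
  have j': "1 \<le> ?j" "?j \<le> Suc n" using i by (auto simp: transpose_def)
  have gt: "g i * t ?j = t j * g i" using g_t[of i ?j] i j' by simp
  have "h i * t j = h i * (t j * (g i * h i))" using i by (simp add: gh)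
  also have "\<dots> = h i * ((g i * t ?j) * h i)" by (simp only: gt mult.assoc)
  also have "\<dots> = (h i * g i) * (t ?j * h i)" by (simp only: mult.assoc)
  finally show ?thesis using i j' by (simp add: gh)
qed

lemma h_x: "2 \<le> i ==> i \<le> n ==> x * h i = h i * x"
  by (rule transfer) (simp_all add: g_x)

lemma g_h_far: "1 \<le> i ==> i \<le> n ==> 1 \<le> j ==> j \<le> n ==> i + 2 \<le> j \<or> j + 2 \<le> i ==> g i * h j = h j * g i"
  by (rule transfer) (auto intro!: g_far)

text \<open>
  Products of elements of \<open>A\<close>, where the empty product has to be the unit \<open>u\<close> of \<open>A\<close>.
\<close>

definition pr where "pr L = foldr (*) L u"

lemma pr_simps [simp]: "pr [] = u" "pr (a # L) = a * pr L" by (simp_all add: pr_def)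

lemma pr_A [simp]: "set L \<subseteq> A ==> pr L \<in> A"
  by (induction L) simp_all

lemma pr_C: "set L \<subseteq> C ==> pr L \<in> C"
  by (induction L) (simp_all add: C_closed)

lemma pr_append: "set L' \<subseteq> A ==> pr (L @ L') = pr L * pr L'"
  by (induction L) (simp_all add: mult.assoc)

lemma pr_shift: "z \<in> A ==> (\<And>l. l \<in> set L ==> z * f l = f' l * z) ==> z * pr (map f L) = pr (map f' L) * z"
proof (induction L)
  case (Cons l L)
  have IH: "z * pr (map f L) = pr (map f' L) * z" by (rule Cons.IH) (use Cons.prems in auto)
  have "z * (f l * pr (map f L)) = (z * f l) * pr (map f L)" by (simp only: mult.assoc)
  also have "\<dots> = f' l * (z * pr (map f L))" using Cons.prems(2)[of l] by (simp add: mult.assoc)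
  finally show ?case by (simp add: IH mult.assoc)
qed simp

lemma pr_shift2: "z \<in> A ==> (\<And>l. l \<in> set L ==> f l * z = z * f' l) ==> pr (map f L) * z = z * pr (map f' L)"
proof (induction L)
  case (Cons l L)
  have IH: "pr (map f L) * z = z * pr (map f' L)" by (rule Cons.IH) (use Cons.prems in auto)
  have "f l * pr (map f L) * z = (f l * z) * pr (map f' L)" by (simp only: IH mult.assoc)
  also have "\<dots> = z * (f' l * pr (map f' L))" using Cons.prems(2)[of l] by (simp add: mult.assoc)
  finally show ?case by simp
qed simp

lemma cl_prod_list: "(\<And>l. l \<in> set L ==> f l \<in> F) ==> cl (prod_list (map f L)) = pr (map (\<lambda>l. cl (f l)) L)"
proof (induction L)
  case (Cons a L)
  have "prod_list (map f L) \<in> F" by (rule free_prod_list) (use Cons.prems in auto)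
  then show ?case using Cons by (simp add: cl_mult)
qed (simp add: cl_one)

definition U where "U j = pr (map h (rev [j..<Suc n]))"
definition W where "W j = pr (map g [j..<Suc n])"

lemma hs_A: "1 \<le> j ==> m \<le> Suc n ==> set (map h (rev [j..<m])) \<subseteq> A" by auto
lemma gs_A: "1 \<le> j ==> m \<le> Suc n ==> set (map g [j..<m]) \<subseteq> A" by auto
lemma gsr_A: "1 \<le> j ==> m \<le> Suc n ==> set (map g (rev [j..<m])) \<subseteq> A" by auto

lemma U_A [simp]: "1 \<le> j ==> U j \<in> A" unfolding U_def by (rule pr_A[OF hs_A]) auto
lemma W_A [simp]: "1 \<le> j ==> W j \<in> A" unfolding W_def by (rule pr_A[OF gs_A]) auto

lemma U_last: "U (Suc n) = u" "W (Suc n) = u" by (simp_all add: U_def W_def)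

lemma U_cl: "1 \<le> j ==> cl (free_u r n j) = U j \<and> free_u r n j \<in> F"
proof -
  assume j: "1 \<le> j"
  have m: "free_inv r l \<in> F" "cl (free_inv r l) = h l" if "l \<in> set (rev [j..<Suc n])" for l
    using h_cl[of l] that j by auto
  have "cl (free_u r n j) = pr (map (\<lambda>l. cl (free_inv r l)) (rev [j..<Suc n]))"
    unfolding free_u_def by (rule cl_prod_list) (rule m)
  also have "map (\<lambda>l. cl (free_inv r l)) (rev [j..<Suc n]) = map h (rev [j..<Suc n])"
    by (rule map_cong[OF refl]) (rule m)
  finally have "cl (free_u r n j) = U j" unfolding U_def .
  moreover have "free_u r n j \<in> F" unfolding free_u_def by (rule free_prod_list) (use m(1) in auto)
  ultimately show ?thesis ..
qed

lemma U_W: "1 \<le> j ==> j \<le> Suc n ==> U j * W j = u" "1 \<le> j ==> j \<le> Suc n ==> W j * U j = u"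
proof -
  assume j: "1 \<le> j" "j \<le> Suc n"
  have "pr (map h (rev [j..<m])) * pr (map g [j..<m]) = u \<and> pr (map g [j..<m]) * pr (map h (rev [j..<m])) = u"
    if "j \<le> m" "m \<le> Suc n" for m
    using that
  proof (induction m rule: dec_induct)
    case base
    then show ?case by simp
  next
    case (step m)
    let ?H = "pr (map h (rev [j..<m]))" and ?G = "pr (map g [j..<m])"
    have IH: "?H * ?G = u" "?G * ?H = u" using step by auto
    have A: "?H \<in> A" "?G \<in> A" "h m \<in> A" "g m \<in> A"
      using step j by (auto intro!: pr_A[OF hs_A] pr_A[OF gs_A])
    have m: "1 \<le> m" "m \<le> n" using step j by auto
    have e: "pr (map h (rev [j..<Suc m])) = h m * ?H" "pr (map g [j..<Suc m]) = ?G * g m"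
      using step A by (simp_all add: pr_append)
    have "h m * ?H * (?G * g m) = h m * ((?H * ?G) * g m)" by (simp only: mult.assoc)
    moreover have "?G * g m * (h m * ?H) = ?G * ((g m * h m) * ?H)" by (simp only: mult.assoc)
    ultimately show ?case unfolding e using A by (simp add: IH gh[OF m])
  qed
  from this[of "Suc n"] j show "U j * W j = u" "W j * U j = u" by (auto simp: U_def W_def)
qed

lemma U_step: "1 \<le> j ==> j \<le> n ==> U j = U (Suc j) * h j"
proof -
  assume j: "1 \<le> j" "j \<le> n"
  have "[j..<Suc n] = j # [Suc j..<Suc n]" by (rule upt_conv_Cons) (use j in simp)
  then have "U j = pr (map h (rev [Suc j..<Suc n]) @ [h j])" unfolding U_def by simp
  also have "\<dots> = U (Suc j) * pr [h j]" unfolding U_def by (rule pr_append) (use j in simp)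
  finally show ?thesis using j by simp
qed

lemma U_g_eq: "1 \<le> j ==> j \<le> n ==> U j * g j = U (Suc j)"
  by (simp add: U_step[of j] mult.assoc gh)

lemma U_g_lt: "1 \<le> i ==> i + 2 \<le> j ==> j \<le> Suc n ==> U j * g i = g i * U j"
  unfolding U_def by (rule pr_shift[symmetric]) (auto intro!: g_h_far)

lemma U_x: "2 \<le> j ==> U j * x = x * U j"
  unfolding U_def by (rule pr_shift[symmetric]) (auto intro!: h_x)

text \<open>
  The inverse of \<open>z = g\<^sub>m g\<^sub>m\<^sub>+\<^sub>1\<close> is \<open>h\<^sub>m\<^sub>+\<^sub>1 h\<^sub>m\<close>, and the braid relation is \<open>g\<^sub>m\<^sub>+\<^sub>1 z = z g\<^sub>m\<close>.
\<close>

lemma h_h_g: "1 \<le> m ==> m < n ==> h (Suc m) * (h m * g (Suc m)) = g m * (h (Suc m) * h m)"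
proof -
  assume m: "1 \<le> m" "m < n"
  define z where "z = g m * g (Suc m)"
  define y where "y = h (Suc m) * h m"
  have A: "z \<in> A" "y \<in> A" "g m \<in> A" "g (Suc m) \<in> A" using m by (simp_all add: z_def y_def)
  have yz: "y * z = u"
  proof -
    have "y * z = h (Suc m) * ((h m * g m) * g (Suc m))" by (simp only: y_def z_def mult.assoc)
    then show ?thesis using m by (simp add: gh)
  qed
  have zy: "z * y = u"
  proof -
    have "z * y = g m * ((g (Suc m) * h (Suc m)) * h m)" by (simp only: y_def z_def mult.assoc)
    then show ?thesis using m by (simp add: gh)
  qed
  have b: "g (Suc m) * z = z * g m" using g_braid[of m] m by (simp add: z_def mult.assoc)
  have "y * g (Suc m) = y * (g (Suc m) * (z * y))" using A by (simp add: zy)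
  also have "\<dots> = y * ((g (Suc m) * z) * y)" by (simp only: mult.assoc)
  also have "\<dots> = (y * z) * (g m * y)" by (simp only: b mult.assoc)
  also have "\<dots> = g m * y" using A by (simp add: yz)
  finally show ?thesis by (simp add: y_def mult.assoc)
qed

lemma U_g_gt:
  assumes "1 \<le> j" "j < i" "i \<le> n"
  shows "U j * g i = g (i - 1) * U j"
proof -
  obtain m where i: "i = Suc m" using assms by (cases i) auto
  have m: "1 \<le> m" "j \<le> m" "m < n" using assms i by auto
  let ?P = "pr (map h (rev [Suc (Suc m)..<Suc n]))" and ?Q = "pr (map h (rev [j..<m]))"
  have list: "[j..<Suc n] = [j..<m] @ m # Suc m # [Suc (Suc m)..<Suc n]"
  proof -
    have "[j..<Suc n] = [j..<m] @ [m..<Suc n]" using upt_add_eq_append[of j m "Suc n - m"] m by simp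
    also have "[m..<Suc n] = m # Suc m # [Suc (Suc m)..<Suc n]"
      using upt_conv_Cons[of m "Suc n"] upt_conv_Cons[of "Suc m" "Suc n"] m by (simp del: upt_Suc)
    finally show ?thesis .
  qed
  have A: "?Q \<in> A" using m assms(1) by (auto intro!: pr_A)
  have U: "U j = ?P * (h (Suc m) * (h m * ?Q))"
    unfolding U_def list using assms m by (simp add: pr_append image_subset_iff mult.assoc del: upt_Suc)
  have 1: "?Q * g (Suc m) = g (Suc m) * ?Q"
  proof (rule pr_shift[symmetric])
    fix l assume "l \<in> set (rev [j..<m])"
    then show "g (Suc m) * h l = h l * g (Suc m)" using m assms(1) by (intro g_h_far) auto
  qed (use m in simp)
  have 2: "?P * g m = g m * ?P"
  proof (rule pr_shift[symmetric])
    fix l assume "l \<in> set (rev [Suc (Suc m)..<Suc n])"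
    then show "g m * h l = h l * g m" using m by (intro g_h_far) auto
  qed (use m in simp)
  have "U j * g (Suc m) = ?P * (h (Suc m) * (h m * (?Q * g (Suc m))))" by (simp only: U mult.assoc)
  also have "\<dots> = ?P * ((h (Suc m) * (h m * g (Suc m))) * ?Q)" by (simp only: 1 mult.assoc)
  also have "\<dots> = (?P * g m) * (h (Suc m) * (h m * ?Q))" using m by (simp only: h_h_g mult.assoc)
  also have "\<dots> = g m * U j" by (simp only: 2 U mult.assoc)
  finally show ?thesis by (simp add: i)
qed

lemma U_t: "1 \<le> j ==> 1 \<le> i ==> i \<le> Suc n ==> \<exists>i'. 1 \<le> i' \<and> i' \<le> Suc n \<and> U j * t i = t i' * U j"
proof -
  assume j: "1 \<le> j" and i: "1 \<le> i" "i \<le> Suc n"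
  have "\<exists>i'. 1 \<le> i' \<and> i' \<le> Suc n \<and> pr (map h L) * t i = t i' * pr (map h L)" if "set L \<subseteq> {1..n}" for L
    using that
  proof (induction L)
    case Nil
    then show ?case using i by auto
  next
    case (Cons l L)
    then obtain i' where i': "1 \<le> i'" "i' \<le> Suc n" "pr (map h L) * t i = t i' * pr (map h L)" by auto
    have l: "1 \<le> l" "l \<le> n" using Cons.prems by auto
    let ?i = "transpose l (Suc l) i'"
    have "1 \<le> ?i" "?i \<le> Suc n" using l i' by (auto simp: transpose_def)
    moreover have "h l * pr (map h L) * t i = t ?i * (h l * pr (map h L))"
    proof -
      have "h l * pr (map h L) * t i = h l * (t i' * pr (map h L))" by (simp only: mult.assoc i'(3))
      also have "\<dots> = (h l * t i') * pr (map h L)" by (simp only: mult.assoc)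
      also have "\<dots> = t ?i * (h l * pr (map h L))" by (simp only: h_t[OF l i'(1,2)] mult.assoc)
      finally show ?thesis .
    qed
    ultimately show ?case by auto
  qed
  moreover have "set (rev [j..<Suc n]) \<subseteq> {1..n}" using j by auto
  ultimately show ?thesis unfolding U_def by blast
qed

subsection \<open>The Jucys--Murphy element \<open>X\<^sub>n\<^sub>+\<^sub>1\<close>\<close>

definition XX where "XX m = cl (free_X m)"

lemma free_X_mem: "m < l ==> free_X m \<in> carrier (free_algebra r d l)"
  unfolding free_X_def by (intro free.mem_mult free_prod_list) (auto intro!: fgen_mem simp: yh_gens_def)

lemma XX_A [simp]: "m \<le> n ==> XX m \<in> A"
  unfolding XX_def by (intro A_I free_X_mem) auto

lemma XX_C: "m < n ==> XX m \<in> C"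
  unfolding XX_def by (intro C_I free_X_mem) auto

lemma XX_0: "XX 0 = x" by (simp add: XX_def free_X_def x_def)

lemma XX_Suc: "m < n ==> XX (Suc m) = g (Suc m) * (XX m * g (Suc m))"
proof -
  assume m: "m < n"
  have "free_X (Suc m) = fgen (G (Suc m)) * free_X m * fgen (G (Suc m))"
    by (simp add: free_X_def mult.assoc)
  then show ?thesis using m free_X_mem[of m "Suc n"] by (simp add: XX_def cl_mult g_def mult.assoc)
qed

lemma XX_t: "m \<le> n ==> 1 \<le> i ==> i \<le> Suc n ==> XX m * t i = t i * XX m"
proof (induction m arbitrary: i)
  case 0
  then show ?case by (simp add: XX_0 t_x)
next
  case (Suc m)
  let ?g = "g (Suc m)" and ?i = "transpose (Suc m) (Suc (Suc m)) i"
  have i': "1 \<le> ?i" "?i \<le> Suc n" using Suc.prems by (auto simp: transpose_def)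
  have gt: "?g * t i = t ?i * ?g" "?g * t ?i = t i * ?g"
    using g_t[of "Suc m" i] g_t[of "Suc m" ?i] Suc.prems i' by simp_all
  have "?g * (XX m * ?g) * t i = ?g * (XX m * (?g * t i))" by (simp only: mult.assoc)
  also have "\<dots> = ?g * ((XX m * t ?i) * ?g)" by (simp only: gt mult.assoc)
  also have "XX m * t ?i = t ?i * XX m" using Suc i' by simp
  also have "?g * (t ?i * XX m * ?g) = (?g * t ?i) * (XX m * ?g)" by (simp only: mult.assoc)
  also have "\<dots> = t i * (?g * (XX m * ?g))" by (simp only: gt mult.assoc)
  finally show ?case using Suc.prems by (simp add: XX_Suc)
qed

lemma XX_g_gt: "m \<le> n ==> m + 2 \<le> i ==> i \<le> n ==> XX m * g i = g i * XX m"
proof (induction m)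
  case 0
  then show ?case by (simp add: XX_0 g_x)
next
  case (Suc m)
  let ?g = "g (Suc m)"
  have gg: "?g * g i = g i * ?g" using Suc.prems by (intro g_far) auto
  have IH: "XX m * g i = g i * XX m" using Suc by simp
  have "?g * (XX m * ?g) * g i = ?g * ((XX m * g i) * ?g)" by (simp only: gg mult.assoc)
  also have "\<dots> = (?g * g i) * (XX m * ?g)" by (simp only: IH mult.assoc)
  also have "\<dots> = g i * (?g * (XX m * ?g))" by (simp only: gg mult.assoc)
  finally show ?case using Suc.prems by (simp add: XX_Suc)
qed

text \<open>
  By induction only \<open>i = m\<close> is left. There \<open>X\<^sub>m\<^sub>+\<^sub>2 = g\<^sub>m\<^sub>+\<^sub>1 g\<^sub>m Y g\<^sub>m g\<^sub>m\<^sub>+\<^sub>1\<close> with an element \<open>Y\<close> that commutes with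
  \<open>g\<^sub>m\<^sub>+\<^sub>1\<close>, and the braid relation is applied on both sides of \<open>Y\<close>.
\<close>

lemma XX_g_lt: "m \<le> n ==> 1 \<le> i ==> i < m ==> XX m * g i = g i * XX m"
proof (induction m)
  case (Suc m)
  let ?g = "g (Suc m)"
  have XS: "XX (Suc m) = ?g * (XX m * ?g)" using Suc.prems by (simp add: XX_Suc)
  show ?case
  proof (cases "i = m")
    case False
    have gg: "?g * g i = g i * ?g" using Suc.prems False by (intro g_far) auto
    have IH: "XX m * g i = g i * XX m" using Suc False by simp
    have "?g * (XX m * ?g) * g i = ?g * ((XX m * g i) * ?g)" by (simp only: gg mult.assoc)
    also have "\<dots> = (?g * g i) * (XX m * ?g)" by (simp only: IH mult.assoc)
    also have "\<dots> = g i * (?g * (XX m * ?g))" by (simp only: gg mult.assoc)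
    finally show ?thesis unfolding XS .
  next
    case True
    then obtain l where l: "m = Suc l" using Suc.prems by (cases m) auto
    let ?Y = "XX l" and ?a = "g m"
    have Xm: "XX m = ?a * (?Y * ?a)" using Suc.prems by (simp add: l XX_Suc)
    have Yg: "?Y * ?g = ?g * ?Y" using Suc.prems by (intro XX_g_gt) (auto simp: l)
    have br: "?a * (?g * ?a) = ?g * (?a * ?g)" using Suc.prems True by (intro g_braid) auto
    have "?g * (XX m * ?g) * ?a = ?g * (?a * (?Y * (?a * (?g * ?a))))" by (simp only: Xm mult.assoc)
    also have "\<dots> = ?g * (?a * ((?Y * ?g) * (?a * ?g)))" by (simp only: br mult.assoc)
    also have "\<dots> = (?g * (?a * ?g)) * (?Y * (?a * ?g))" by (simp only: Yg mult.assoc)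
    also have "\<dots> = ?a * (?g * (XX m * ?g))" by (simp only: br[symmetric] Xm mult.assoc)
    finally show ?thesis unfolding XS True .
  qed
qed simp

lemma XX_x: "m \<le> n ==> XX m * x = x * XX m"
proof (induction m)
  case 0
  then show ?case by (simp add: XX_0)
next
  case (Suc m)
  show ?case
  proof (cases "m = 0")
    case True
    have X1: "XX (Suc m) = g 1 * (x * g 1)" using Suc.prems by (simp add: XX_Suc True XX_0)
    have "g 1 * (x * (g 1 * x)) = x * (g 1 * (x * g 1))" using Suc.prems by (intro x_braid) auto
    then show ?thesis unfolding X1 by (simp only: mult.assoc)
  next
    case False
    let ?g = "g (Suc m)"
    have gx: "?g * x = x * ?g" using Suc.prems False by (intro g_x) auto
    have "?g * (XX m * ?g) * x = ?g * ((XX m * x) * ?g)" by (simp only: gx mult.assoc)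
    also have "XX m * x = x * XX m" using Suc by simp
    also have "?g * (x * XX m * ?g) = (?g * x) * (XX m * ?g)" by (simp only: mult.assoc)
    also have "\<dots> = x * (?g * (XX m * ?g))" by (simp only: gx mult.assoc)
    finally show ?thesis using Suc.prems by (simp add: XX_Suc)
  qed
qed

abbreviation XN where "XN \<equiv> XX n"
abbreviation tn where "tn \<equiv> t (Suc n)"

lemma X_C: "c \<in> C ==> XN * c = c * XN"
  by (rule C_commute) (simp_all add: XX_t XX_g_lt XX_x)

lemma tn_C: "c \<in> C ==> tn * c = c * tn"
  by (rule C_commute) (simp_all add: t_comm g_t_simps t_x)

lemma X_tn: "XN * tn = tn * XN" by (simp add: XX_t)

lemma pow_comm: "z * c = c * z ==> z ^ k * c = c * z ^ k" for z c :: 'a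
  using power_commute_gen[of c z z k] by simp

lemma pow_A: "z \<in> A ==> a \<in> A ==> z ^ k * a \<in> A"
  by (induction k) (simp_all add: mult.assoc)

subsection \<open>Spanning sets\<close>

definition bas where "bas k l j = XN ^ k * (tn ^ l * U j)"

lemma bas_A [simp]: "1 \<le> j ==> bas k l j \<in> A"
  unfolding bas_def by (intro pow_A) simp_all

lemma bas_C: "c \<in> C ==> XN ^ k * (tn ^ l * (c * a)) = c * (XN ^ k * (tn ^ l * a))"
proof -
  assume c: "c \<in> C"
  have 1: "tn ^ l * c = c * tn ^ l" by (rule pow_comm[OF tn_C[OF c]])
  have 2: "XN ^ k * c = c * XN ^ k" by (rule pow_comm[OF X_C[OF c]])
  have "XN ^ k * (tn ^ l * (c * a)) = XN ^ k * ((tn ^ l * c) * a)" by (simp only: mult.assoc)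
  also have "\<dots> = (XN ^ k * c) * (tn ^ l * a)" by (simp only: 1 mult.assoc)
  finally show ?thesis by (simp only: 2 mult.assoc)
qed

text \<open>
  The left \<open>C\<close>-span of the monomials \<open>bas k l j\<close> with \<open>(k, j) \<in> P\<close>. The exponent \<open>l\<close> is not bounded, since
  it matters only modulo \<open>r\<close>.
\<close>

inductive_set Sp for P where
  zero: "0 \<in> Sp P"
| add: "y \<in> Sp P ==> y' \<in> Sp P ==> y + y' \<in> Sp P"
| gen: "c \<in> C ==> (k, j) \<in> P ==> 1 \<le> j ==> j \<le> Suc n ==> c * bas k l j \<in> Sp P"

lemma Sp_A: "y \<in> Sp P ==> y \<in> A"
  by (induction rule: Sp.induct) (simp_all add: C_A)

lemma Sp_mono: "y \<in> Sp P ==> P \<subseteq> P' ==> y \<in> Sp P'"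
  by (induction rule: Sp.induct) (auto intro: Sp.intros)

lemma Sp_C: "y \<in> Sp P ==> c \<in> C ==> c * y \<in> Sp P"
proof (induction rule: Sp.induct)
  case (gen c' k j l)
  have "(c * c') * bas k l j \<in> Sp P" using gen by (intro Sp.gen C_closed)
  then show ?case by (simp add: mult.assoc)
qed (simp_all add: distrib_left Sp.zero Sp.add)

lemma Sp_uminus: "y \<in> Sp P ==> - y \<in> Sp P"
  using Sp_C[OF _ C_closed(4)[OF C_closed(1)]] by (simp add: Sp_A)

lemma Sp_diff: "y \<in> Sp P ==> y' \<in> Sp P ==> y - y' \<in> Sp P"
  using Sp.add[OF _ Sp_uminus, of y P y'] by simp

lemma Sp_bas: "(k, j) \<in> P ==> 1 \<le> j ==> j \<le> Suc n ==> bas k l j \<in> Sp P"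
  using Sp.gen[OF C_closed(1), of k j P l] by simp

lemma Sp_tn: "y \<in> Sp P ==> tn * y \<in> Sp P"
proof (induction rule: Sp.induct)
  case (gen c k j l)
  have "tn * (c * bas k l j) = (tn * c) * bas k l j" by (simp only: mult.assoc)
  also have "\<dots> = c * (tn * bas k l j)" by (simp only: tn_C[OF gen(1)] mult.assoc)
  also have "tn * bas k l j = (tn * XN ^ k) * (tn ^ l * U j)" by (simp only: bas_def mult.assoc)
  also have "tn * XN ^ k = XN ^ k * tn" by (rule pow_comm[OF X_tn, symmetric])
  also have "XN ^ k * tn * (tn ^ l * U j) = bas k (Suc l) j" by (simp only: bas_def power_Suc mult.assoc)
  finally show ?case using gen by (simp only: Sp.gen)
qed (simp_all add: distrib_left Sp.zero Sp.add)

lemma Sp_X: "y \<in> Sp P ==> (\<And>k j. (k, j) \<in> P ==> (Suc k, j) \<in> P') ==> XN * y \<in> Sp P'"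
proof (induction rule: Sp.induct)
  case (gen c k j l)
  have "XN * (c * bas k l j) = (XN * c) * bas k l j" by (simp only: mult.assoc)
  also have "\<dots> = c * bas (Suc k) l j" by (simp only: X_C[OF gen(1)] bas_def power_Suc mult.assoc)
  finally show ?case using gen by (simp only: Sp.gen)
qed (simp_all add: distrib_left Sp.zero Sp.add)

lemma Sp_t_left: "y \<in> Sp P ==> 1 \<le> i ==> i \<le> Suc n ==> t i * y \<in> Sp P"
  by (cases "i = Suc n") (simp_all add: Sp_tn Sp_C C_gens)

text \<open>
  The elements whose right multiplication preserves the span. They are closed under sums and
  products, so generators can be treated one by one.
\<close>

definition Rc where "Rc P = {b \<in> A. \<forall>y\<in>Sp P. y * b \<in> Sp P}"

lemma Rc_I:
  assumes "b \<in> A" "\<And>k l j. (k, j) \<in> P ==> 1 \<le> j ==> j \<le> Suc n ==> bas k l j * b \<in> Sp P"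
  shows "b \<in> Rc P"
proof -
  have "y * b \<in> Sp P" if "y \<in> Sp P" for y
    using that
  proof (induction rule: Sp.induct)
    case (gen c k j l)
    then show ?case using Sp_C[OF assms(2)] by (simp add: mult.assoc)
  qed (simp_all add: distrib_right Sp.zero Sp.add)
  then show ?thesis using assms(1) by (simp add: Rc_def)
qed

lemma Rc_D: "b \<in> Rc P ==> y \<in> Sp P ==> y * b \<in> Sp P" by (simp add: Rc_def)

lemma Rc_closed:
  "0 \<in> Rc P" "u \<in> Rc P" "a \<in> Rc P ==> b \<in> Rc P ==> a + b \<in> Rc P" "a \<in> Rc P ==> b \<in> Rc P ==> a * b \<in> Rc P"
  "a \<in> Rc P ==> - a \<in> Rc P" "a \<in> Rc P ==> b \<in> Rc P ==> a - b \<in> Rc P"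
  by (auto simp: Rc_def Sp.zero Sp_A Sp.add distrib_left right_diff_distrib Sp_uminus Sp_diff mult.assoc[symmetric])

lemma Rc_scalar: "c \<in> R ==> s c \<in> Rc P"
  using Sp_C[OF _ C_gens(1)] by (simp add: Rc_def) (metis central Sp_A)

lemma Rc_sum: "(\<And>i. i \<in> I ==> f i \<in> Rc P) ==> sum f I \<in> Rc P"
  by (induction I rule: infinite_finite_induct) (simp_all add: Rc_closed)

lemma Rc_power: "1 \<le> k ==> a \<in> Rc P ==> a ^ k \<in> Rc P"
  by (induction k rule: nat_induct_at_least) (simp_all add: Rc_closed)

lemma Rc_pr: "set L \<subseteq> Rc P ==> pr L \<in> Rc P"
  by (induction L) (simp_all add: Rc_closed)

lemma Rc_C: "c \<in> C ==> (\<And>k j. (k, j) \<in> P ==> 1 \<le> j ==> j \<le> Suc n ==> \<exists>c'\<in>C. U j * c = c' * U j) ==> c \<in> Rc P"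
proof (rule Rc_I)
  fix k l j
  assume c: "\<And>k j. (k, j) \<in> P ==> 1 \<le> j ==> j \<le> Suc n ==> \<exists>c'\<in>C. U j * c = c' * U j"
    and kj: "(k, j) \<in> P" "1 \<le> j" "j \<le> Suc n"
  from c[OF kj] obtain c' where c': "c' \<in> C" "U j * c = c' * U j" by blast
  have "bas k l j * c = c' * bas k l j" unfolding bas_def by (simp only: mult.assoc c'(2) bas_C[OF c'(1)])
  then show "bas k l j * c \<in> Sp P" using Sp_C[OF Sp_bas[OF kj] c'(1)] by simp
qed (rule C_A)

lemma Rc_t: "1 \<le> i ==> i \<le> Suc n ==> t i \<in> Rc P"
proof (rule Rc_I)
  fix k l j
  assume i: "1 \<le> i" "i \<le> Suc n" and kj: "(k, j) \<in> P" "1 \<le> j" "j \<le> Suc n"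
  obtain i' where i': "1 \<le> i'" "i' \<le> Suc n" "U j * t i = t i' * U j" using U_t[OF kj(2) i] by blast
  have "t i' * tn = tn * t i'" using i' by (simp add: t_comm)
  then have 1: "tn ^ l * t i' = t i' * tn ^ l" by (intro pow_comm) simp
  have 2: "XN ^ k * t i' = t i' * XN ^ k" by (rule pow_comm) (use i' in \<open>simp add: XX_t\<close>)
  have "bas k l j * t i = XN ^ k * ((tn ^ l * t i') * U j)" unfolding bas_def by (simp only: mult.assoc i'(3))
  also have "\<dots> = (XN ^ k * t i') * (tn ^ l * U j)" by (simp only: 1 mult.assoc)
  also have "\<dots> = t i' * bas k l j" by (simp only: 2 bas_def mult.assoc)
  finally show "bas k l j * t i \<in> Sp P" using Sp_t_left[OF Sp_bas[OF kj] i'(1,2)] by simp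
qed simp

lemma Rc_ee: "1 \<le> i ==> i \<le> n ==> ee i \<in> Rc P"
proof -
  assume i: "1 \<le> i" "i \<le> n"
  have "t i ^ a * t (Suc i) ^ (r - a) \<in> Rc P" if "a < r" for a
  proof (cases "a = 0")
    case True
    then show ?thesis using i r by (simp add: Rc_power Rc_t)
  next
    case False
    then show ?thesis using i that by (intro Rc_closed(4) Rc_power Rc_t) auto
  qed
  then have "(\<Sum>a<r. t i ^ a * t (Suc i) ^ (r - a)) \<in> Rc P" by (intro Rc_sum) auto
  then show ?thesis
    unfolding ee_def cyclic_avg_def \<kappa>_def \<rho>_def
    by (intro Rc_closed(4)[OF Rc_scalar[OF kappa_R] Rc_closed(4)[OF Rc_scalar[OF rho_R]]])
qed

abbreviation PP where "PP K \<equiv> K \<times> {1..Suc n}"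

text \<open>
  Either \<open>u\<^sub>j g\<^sub>i\<close> is a left multiple of some \<open>u\<^sub>l\<close> by an element of \<open>C\<close>, or \<open>u\<^sub>j g\<^sub>i\<^sup>-\<^sup>1\<close> is. The two differ by
  \<open>\<kappa> u\<^sub>j e\<^sub>i\<close>, which is in the span by \<open>Rc_ee\<close>.
\<close>

lemma Rc_g: "1 \<le> i ==> i \<le> n ==> g i \<in> Rc (PP K)"
proof (rule Rc_I)
  fix k l j
  assume i: "1 \<le> i" "i \<le> n" and kj: "(k, j) \<in> PP K" "1 \<le> j" "j \<le> Suc n"
  have assoc: "bas k l j * b = XN ^ k * (tn ^ l * (U j * b))" for b by (simp only: bas_def mult.assoc)
  consider "i + 2 \<le> j" | "j = Suc i" | "j = i" | "j < i" by linarith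
  then show "bas k l j * g i \<in> Sp (PP K)"
  proof cases
    case 1
    have c: "g i \<in> C" using 1 i kj by (intro C_gens) auto
    show ?thesis unfolding assoc U_g_lt[OF i(1) 1 kj(3)] bas_C[OF c] bas_def[symmetric]
      by (intro Sp.gen c kj)
  next
    case 2
    have "bas k l j * h i = bas k l i" unfolding assoc unfolding 2 by (simp only: U_step[OF i, symmetric] bas_def)
    then have "bas k l j * h i \<in> Sp (PP K)" using Sp_bas[of k i "PP K" l] i kj by simp
    moreover have "bas k l j * ee i \<in> Sp (PP K)" by (rule Rc_D[OF Rc_ee[OF i] Sp_bas[OF kj]])
    ultimately have "bas k l j * h i + bas k l j * ee i \<in> Sp (PP K)" by (rule Sp.add)
    then show ?thesis by (simp add: h_def right_diff_distrib)
  next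
    case 3
    have "bas k l j * g i = bas k l (Suc j)" unfolding assoc unfolding 3 by (simp only: U_g_eq[OF i] bas_def)
    then show ?thesis using Sp_bas[of k "Suc j" "PP K" l] 3 i kj by simp
  next
    case 4
    have c: "g (i - 1) \<in> C" using 4 i kj by (intro C_gens) auto
    show ?thesis unfolding assoc U_g_gt[OF kj(2) 4 i(2)] bas_C[OF c] bas_def[symmetric]
      by (intro Sp.gen c kj)
  qed
qed simp

lemma Rc_x2: "P \<subseteq> UNIV \<times> {2..} ==> x \<in> Rc P"
  by (rule Rc_C[OF C_gens(4)]) (use U_x C_gens(4) in auto)

definition Gd where "Gd = pr (map g (rev [1..<Suc n]))"

lemma X_Gd: "XN = Gd * (x * W 1)"
proof -
  have 1: "fgen (G l) \<in> F" if "l \<in> set [1..<Suc n]" for l using that by auto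
  have 2: "fgen (G l) \<in> F" if "l \<in> set (rev [1..<Suc n])" for l using that by auto
  let ?a = "prod_list (map (\<lambda>i. fgen (G i)) (rev [1..<Suc n]))" and ?b = "prod_list (map (\<lambda>i. fgen (G i)) [1..<Suc n])"
  have m: "?a \<in> F" "?b \<in> F" using 1 2 by (auto intro!: free_prod_list simp del: upt_Suc)
  have "XN = cl ?a * (x * cl ?b)" unfolding XX_def free_X_def x_def using m by (simp only: cl_mult free.mem_mult X1_mem mult.assoc)
  then show ?thesis
    by (simp only: cl_prod_list[of "[1..<Suc n]" "\<lambda>i. fgen (G i)", OF 1]
        cl_prod_list[of "rev [1..<Suc n]" "\<lambda>i. fgen (G i)", OF 2] Gd_def W_def g_def[abs_def])
qed

text \<open>
  Replacing the factors of \<open>g\<^sub>n \<dots> g\<^sub>1\<close> by their inverses from the left, each step changes the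
  product by \<open>u\<^sub>j\<^sub>+\<^sub>1 \<kappa> e\<^sub>j g\<^sub>j\<^sub>-\<^sub>1 \<dots> g\<^sub>1\<close>, and the factors \<open>g\<^sub>i\<close> on the right commute with \<open>u\<^sub>j\<^sub>+\<^sub>1\<close>.
\<close>

lemma Gd_diff: "Gd - U 1 \<in> Sp ({0} \<times> {2..Suc n})"
proof -
  let ?G = "\<lambda>j. pr (map g (rev [1..<j]))"
  have "j \<le> Suc n \<longrightarrow> U j * ?G j - U 1 \<in> Sp ({0} \<times> {2..Suc n})" if "1 \<le> j" for j
    using that
  proof (induction j rule: nat_induct_at_least)
    case base
    then show ?case by (simp add: Sp.zero)
  next
    case (Suc j)
    show ?case
    proof
      assume "Suc j \<le> Suc n"
      then have j: "1 \<le> j" "j \<le> n" using Suc by auto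
      have G: "?G (Suc j) = g j * ?G j" using j by simp
      have "U (Suc j) * ee j \<in> Sp {(0, Suc j)}"
        using Rc_D[OF Rc_ee[OF j] Sp_bas[of 0 "Suc j" "{(0, Suc j)}" 0]] j by (simp add: bas_def)
      moreover have "?G j \<in> Rc {(0, Suc j)}"
      proof (rule Rc_pr)
        have "g i \<in> Rc {(0, Suc j)}" if "1 \<le> i" "i < j" for i
          by (rule Rc_C[OF C_gens(3)]) (use that j U_g_lt[of i "Suc j"] C_gens(3)[of i] in auto)
        then show "set (map g (rev [1..<j])) \<subseteq> Rc {(0, Suc j)}" by auto
      qed
      ultimately have "U (Suc j) * ee j * ?G j \<in> Sp {(0, Suc j)}" by (rule Rc_D[rotated])
      then have "U (Suc j) * ee j * ?G j \<in> Sp ({0} \<times> {2..Suc n})" by (rule Sp_mono) (use j in auto)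
      moreover have "U j * ?G j - U 1 \<in> Sp ({0} \<times> {2..Suc n})" using Suc j by simp
      ultimately have "U (Suc j) * ee j * ?G j + (U j * ?G j - U 1) \<in> Sp ({0} \<times> {2..Suc n})" by (rule Sp.add)
      moreover have "U (Suc j) * ee j * ?G j + U j * ?G j = U (Suc j) * ?G (Suc j)"
        unfolding U_step[OF j] G h_def by (simp add: right_diff_distrib left_diff_distrib mult.assoc)
      ultimately show "U (Suc j) * ?G (Suc j) - U 1 \<in> Sp ({0} \<times> {2..Suc n})"
        by (simp only: add_diff_eq)
    qed
  qed
  moreover have "Gd \<in> A" unfolding Gd_def by (rule pr_A[OF gsr_A]) auto
  ultimately show ?thesis unfolding Gd_def[symmetric] using U_last by (metis Gd_def le_refl le_add1 plus_1_eq_Suc unit(1))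
qed

abbreviation P2 where "P2 \<equiv> {0} \<times> {2..Suc n}"

text \<open>
  Since \<open>X u\<^sub>1 = g\<^sub>n \<dots> g\<^sub>1 X\<^sub>1\<close>, this follows from \<open>Gd_diff\<close>.
\<close>

lemma U1_x: "\<exists>y\<in>Sp P2. U 1 * x = XN * U 1 - y"
proof -
  have "XN * U 1 = Gd * (x * (W 1 * U 1))" by (simp only: X_Gd mult.assoc)
  also have "\<dots> = Gd * x" using U_W(2)[of 1] n by simp
  finally have "U 1 * x = XN * U 1 - (Gd - U 1) * x" by (simp add: left_diff_distrib)
  moreover have "(Gd - U 1) * x \<in> Sp P2" by (rule Rc_D[OF Rc_x2 Gd_diff]) auto
  ultimately show ?thesis by blast
qed

definition fac where "fac i = fgen X1 - fscalar (laurent_power (V i) 1)"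

lemma fac: "1 \<le> i ==> i \<le> d ==> fac i \<in> F \<and> cl (fac i) = x - s (laurent_power (V i) 1)"
  unfolding fac_def by (simp add: laurent_V_mem cl_diff x_def s_def)

lemma fac_prod: "set L \<subseteq> {1..d} ==> prod_list (map fac L) \<in> F"
  by (rule free_prod_list) (use fac in auto)

text \<open>
  Each factor \<open>X\<^sub>1 - v\<^sub>i\<close> to the right of \<open>u\<^sub>1\<close> can be replaced by \<open>X\<close> to its left, up to terms of lower
  degree.
\<close>

lemma U1_fac:
  assumes "set L \<subseteq> {1..d}"
  shows "U 1 * cl (prod_list (map fac L)) - XN ^ length L * U 1 \<in> Sp (PP {..<length L})"
  using assms
proof (induction L)
  case Nil
  then show ?case by (simp add: cl_one Sp.zero)
next
  case (Cons i L)
  let ?z = "cl (prod_list (map fac L))" and ?v = "s (laurent_power (V i) 1)" and ?m = "length L"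
  have i: "1 \<le> i" "i \<le> d" and L: "set L \<subseteq> {1..d}" using Cons.prems by auto
  have v: "?v \<in> C" "laurent_power (V i) 1 \<in> R" using laurent_V_mem[OF i] by (auto intro: C_gens)
  have zA: "?z \<in> A" by (rule A_I[OF fac_prod[OF L]])
  have z2: "?z \<in> Rc P2"
    using L
  proof (induction L)
    case Nil
    then show ?case by (simp add: cl_one Rc_closed)
  next
    case (Cons a L)
    then have "cl (prod_list (map fac (a # L))) = (x - s (laurent_power (V a) 1)) * cl (prod_list (map fac L))"
      using fac[of a] fac_prod[of L] by (simp add: cl_mult)
    moreover have "x - s (laurent_power (V a) 1) \<in> Rc P2"
      by (intro Rc_closed(6) Rc_x2 Rc_scalar laurent_V_mem) (use Cons.prems in auto)
    ultimately show ?case using Cons by (simp add: Rc_closed)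
  qed
  obtain y where y: "y \<in> Sp P2" "U 1 * x = XN * U 1 - y" using U1_x by blast
  have IH: "U 1 * ?z - XN ^ ?m * U 1 \<in> Sp (PP {..<?m})" using Cons.IH L by simp
  have 1: "XN * (U 1 * ?z - XN ^ ?m * U 1) \<in> Sp (PP {..<Suc ?m})" by (rule Sp_X[OF IH]) auto
  have 2: "y * ?z \<in> Sp (PP {..<Suc ?m})" by (rule Sp_mono[OF Rc_D[OF z2 y(1)]]) auto
  have 3: "?v * (U 1 * ?z - XN ^ ?m * U 1) \<in> Sp (PP {..<Suc ?m})"
    by (rule Sp_mono[OF Sp_C[OF IH v(1)]]) auto
  have "bas ?m 0 1 \<in> Sp (PP {..<Suc ?m})" by (rule Sp_bas) (use n in auto)
  then have 4: "?v * (XN ^ ?m * U 1) \<in> Sp (PP {..<Suc ?m})" using Sp_C[OF _ v(1)] by (simp add: bas_def)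
  have "cl (prod_list (map fac (i # L))) = (x - ?v) * ?z"
    using fac[OF i] fac_prod[OF L] by (simp add: cl_mult)
  then have "U 1 * cl (prod_list (map fac (i # L))) = (U 1 * x) * ?z - (U 1 * ?v) * ?z"
    by (simp only: left_diff_distrib right_diff_distrib mult.assoc)
  also have "U 1 * ?v = ?v * U 1" using v(2) by (simp add: central)
  finally have "U 1 * cl (prod_list (map fac (i # L))) - XN ^ Suc ?m * U 1 =
      XN * (U 1 * ?z - XN ^ ?m * U 1) - y * ?z - ?v * (U 1 * ?z - XN ^ ?m * U 1) - ?v * (XN ^ ?m * U 1)"
    by (simp only: y(2) left_diff_distrib right_diff_distrib mult.assoc power_Suc) (simp add: algebra_simps)
  then show ?case using Sp_diff[OF Sp_diff[OF Sp_diff[OF 1 2] 3] 4] by simp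
qed

abbreviation S where "S \<equiv> Sp (PP {..<d})"

lemma fac_cyclotomic: "cl (prod_list (map fac [1..<Suc d])) = 0"
  using cl_cyclotomic by (simp add: cyclotomic_poly_def fac_def[abs_def])

lemma set_fac: "set [1..<Suc d] \<subseteq> {1..d}" by auto

text \<open>
  The cyclotomic polynomial in \<open>X\<^sub>1\<close> is zero, so \<open>U1_fac\<close> expresses \<open>X\<^sup>d u\<^sub>1\<close> by lower powers of \<open>X\<close>.
\<close>

lemma X_d: "XN ^ d * U 1 \<in> S"
proof -
  have "U 1 * cl (prod_list (map fac [1..<Suc d])) - XN ^ d * U 1 \<in> S"
    using U1_fac[OF set_fac] by (simp only: length_upt diff_Suc_1)
  then have "- (XN ^ d * U 1) \<in> S" unfolding fac_cyclotomic by simp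
  then show ?thesis using Sp_uminus by fastforce
qed

lemma Sp_tn_pow: "y \<in> Sp P ==> tn ^ l * y \<in> Sp P"
  by (induction l) (simp_all add: Sp_tn mult.assoc)

lemma Sp_X_pow: "y \<in> Sp ({0} \<times> J) ==> XN ^ k * y \<in> Sp ({k} \<times> J)"
proof (induction k)
  case (Suc k)
  then show ?case using Sp_X[of "XN ^ k * y" "{k} \<times> J" "{Suc k} \<times> J"] by (auto simp: mult.assoc)
qed simp

lemma Rc_x: "x \<in> Rc (PP {..<d})"
proof (rule Rc_I)
  fix k l j
  assume kj: "(k, j) \<in> PP {..<d}" "1 \<le> j" "j \<le> Suc n"
  have assoc: "bas k l j * b = XN ^ k * (tn ^ l * (U j * b))" for b by (simp only: bas_def mult.assoc)
  show "bas k l j * x \<in> S"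
  proof (cases "j = 1")
    case False
    then have "U j * x = x * U j" using kj by (intro U_x) auto
    then have "bas k l j * x = x * bas k l j" unfolding assoc by (simp only: bas_C[OF C_gens(4)] bas_def)
    then show ?thesis using Sp_C[OF Sp_bas[OF kj] C_gens(4)] by simp
  next
    case True
    obtain y where y: "y \<in> Sp P2" "U 1 * x = XN * U 1 - y" using U1_x by blast
    have "tn ^ l * XN = XN * tn ^ l" by (rule pow_comm[OF X_tn[symmetric]])
    then have "tn ^ l * (XN * U 1) = XN * (tn ^ l * U 1)" by (rule left_comm)
    then have "bas k l j * x = XN ^ k * (XN * (tn ^ l * U 1)) - XN ^ k * (tn ^ l * y)"
      unfolding assoc unfolding True y(2) right_diff_distrib by (simp only:)
    also have "XN ^ k * (XN * (tn ^ l * U 1)) = bas (Suc k) l 1" by (simp only: bas_def power_Suc2 mult.assoc)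
    finally have eq: "bas k l j * x = bas (Suc k) l 1 - XN ^ k * (tn ^ l * y)" .
    have 1: "XN ^ k * (tn ^ l * y) \<in> S"
      by (rule Sp_mono[OF Sp_X_pow[OF Sp_tn_pow[OF y(1)]]]) (use kj in auto)
    have "bas (Suc k) l 1 \<in> S"
    proof (cases "Suc k = d")
      case True
      have "XN ^ d * tn ^ l = tn ^ l * XN ^ d"
        by (rule pow_comm) (rule pow_comm[OF X_tn[symmetric], symmetric])
      then have "bas (Suc k) l 1 = tn ^ l * (XN ^ d * U 1)" by (simp add: bas_def True mult.assoc[symmetric])
      then show ?thesis using Sp_tn_pow[OF X_d] by simp
    next
      case False
      then show ?thesis using kj n by (intro Sp_bas) auto
    qed
    then show ?thesis unfolding eq by (rule Sp_diff[OF _ 1])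
  qed
qed simp

text \<open>
  The product is a polynomial in \<open>x\<close> whose constant term is a product of the \<open>- v\<^sub>i\<close>, hence invertible.
  This makes \<open>xinv\<close> a polynomial in \<open>x\<close>.
\<close>

lemma fac_decomp:
  "set L \<subseteq> {1..d} ==> \<exists>q\<in>Rc (PP {..<d}). \<exists>c\<in>R. \<exists>c'\<in>R. c' * c = 1 \<and> cl (prod_list (map fac L)) = q * x + s c"
proof (induction L)
  case Nil
  then show ?case
    by (intro bexI[of _ 0] bexI[of _ 1]) (simp_all add: Rc_closed ground.mem_one cl_one s_simps)
next
  case (Cons i L)
  let ?v = "laurent_power (V i) 1" and ?w = "laurent_power (V i) (- 1)"
  obtain q c c' where q: "q \<in> Rc (PP {..<d})" "c \<in> R" "c' \<in> R" "c' * c = 1" "cl (prod_list (map fac L)) = q * x + s c"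
    using Cons by auto
  have i: "1 \<le> i" "i \<le> d" and L: "set L \<subseteq> {1..d}" using Cons.prems by auto
  have v: "?v \<in> R" "?w \<in> R" by (rule laurent_V_mem[OF i])+
  have vw: "?w * ?v = 1" by (simp add: laurent_power_mult laurent_power_zero)
  have "cl (prod_list (map fac (i # L))) = (x - s ?v) * (q * x + s c)"
    using fac[OF i] fac_prod[OF L] q(5) by (simp add: cl_mult)
  also have "\<dots> = ((x - s ?v) * q + s c) * x + s (- (?v * c))"
  proof -
    have "s (- (?v * c)) = - (s ?v * s c)"
      using s_simps(1)[of "- (?v * c)" "?v * c"] v q
      by (simp add: ground.mem_mult ground.mem_uminus s_simps(2)[symmetric] s_simps(4) eq_neg_iff_add_eq_0)
    moreover have "x * s c = s c * x" using q by (simp add: central)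
    ultimately show ?thesis by (simp add: algebra_simps)
  qed
  finally have eq: "cl (prod_list (map fac (i # L))) = ((x - s ?v) * q + s c) * x + s (- (?v * c))" .
  have "(- (?w * c')) * (- (?v * c)) = (?w * ?v) * (c' * c)" by (simp add: mult.assoc mult.left_commute)
  then have one: "(- (?w * c')) * (- (?v * c)) = 1" unfolding vw q(4) by simp
  have "(x - s ?v) * q + s c \<in> Rc (PP {..<d})"
    by (intro Rc_closed(3,4,6) Rc_x Rc_scalar v q)
  moreover have "- (?v * c) \<in> R" "- (?w * c') \<in> R" by (intro ground.mem_uminus ground.mem_mult v q)+
  ultimately show ?case using eq one by blast
qed

lemma Rc_xinv: "xinv \<in> Rc (PP {..<d})"
proof -
  obtain q c c' where q: "q \<in> Rc (PP {..<d})" "c \<in> R" "c' \<in> R" "c' * c = 1" "q * x + s c = 0"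
    using fac_decomp[OF set_fac] unfolding fac_cyclotomic by metis
  have qA: "q \<in> A" using q by (simp add: Rc_def)
  have "(q * x + s c) * xinv = q + s c * xinv" using qA by (simp add: distrib_right mult.assoc x_inverse)
  then have sq: "s c * xinv = - q" using q(5) by (simp add: add_eq_0_iff2)
  have "xinv = s (c' * c) * xinv" unfolding q(4) by (simp add: s_simps)
  also have "\<dots> = s c' * (s c * xinv)" by (simp only: s_simps(2)[OF q(3,2)] mult.assoc)
  finally have "xinv = s c' * (- q)" unfolding sq .
  then show ?thesis using Rc_closed(4)[OF Rc_scalar[OF q(3), of "PP {..<d}"] Rc_closed(5)[OF q(1)]] by simp
qed

lemma bas_cl: "1 \<le> j ==> cl (free_X n ^ k * fgen (T (Suc n)) ^ l * free_u r n j) = bas k l j"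
proof -
  assume j: "1 \<le> j"
  have pow: "q \<in> F ==> q' \<in> F ==> cl (q ^ m * q') = cl q ^ m * cl q'" for q q' m
    by (induction m) (simp_all add: cl_mult mult.assoc)
  have m: "free_X n \<in> F" "fgen (T (Suc n)) \<in> F" "free_u r n j \<in> F" using U_cl[OF j] by (auto intro: free_X_mem)
  then show ?thesis using U_cl[OF j] by (simp add: bas_def mult.assoc pow XX_def t_def)
qed

theorem spanning: "b \<in> A ==> b \<in> S"
proof -
  assume "b \<in> A"
  then obtain p where p: "p \<in> F" "b = cl p" by (auto simp: A_def)
  from p(1) have "cl p \<in> Rc (PP {..<d})"
  proof (induction p rule: free_induct)
    case (scalar c)
    then show ?case using Rc_scalar by (simp add: s_def)
  next
    case (gen a)
    then show ?case
      using Rc_t Rc_g Rc_x Rc_xinv by (auto simp: yh_gens_def t_def g_def x_def xinv_def)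
  qed (simp_all add: cl_add cl_mult Rc_closed)
  moreover have "bas 0 0 (Suc n) \<in> S" by (rule Sp_bas) (use d in auto)
  ultimately show ?thesis using Rc_D[of b "PP {..<d}" u] p A_I[OF p(1)] by (simp add: bas_def U_last)
qed

end

section \<open>Dual bases\<close>

context yh_top
begin

lemma W_g:
  assumes "1 \<le> j" "j \<le> m" "m < n"
  shows "W j * g m = g (Suc m) * W j"
proof -
  let ?P = "pr (map g [j..<m])" and ?Q = "pr (map g [Suc (Suc m)..<Suc n])"
  have list: "[j..<Suc n] = [j..<m] @ m # Suc m # [Suc (Suc m)..<Suc n]"
  proof -
    have "[j..<Suc n] = [j..<m] @ [m..<Suc n]" using upt_add_eq_append[of j m "Suc n - m"] assms by simp
    also have "[m..<Suc n] = m # Suc m # [Suc (Suc m)..<Suc n]"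
      using upt_conv_Cons[of m "Suc n"] upt_conv_Cons[of "Suc m" "Suc n"] assms by (simp del: upt_Suc)
    finally show ?thesis .
  qed
  have "set (map g (m # Suc m # [Suc (Suc m)..<Suc n])) \<subseteq> A" using assms by auto
  then have W: "W j = ?P * (g m * (g (Suc m) * ?Q))"
    unfolding W_def list map_append by (subst pr_append) (simp_all del: upt_Suc)
  have 1: "?Q * g m = g m * ?Q"
  proof (rule pr_shift[symmetric])
    fix l assume "l \<in> set [Suc (Suc m)..<Suc n]"
    then show "g m * g l = g l * g m" using assms by (intro g_far) auto
  qed (use assms in simp)
  have 2: "?P * g (Suc m) = g (Suc m) * ?P"
  proof (rule pr_shift[symmetric])
    fix l assume "l \<in> set [j..<m]"
    then show "g (Suc m) * g l = g l * g (Suc m)" using assms by (intro g_far) auto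
  qed (use assms in simp)
  have br: "g m * (g (Suc m) * g m) = g (Suc m) * (g m * g (Suc m))" using assms by (intro g_braid) auto
  have "W j * g m = ?P * (g m * (g (Suc m) * (?Q * g m)))" by (simp only: W mult.assoc)
  also have "\<dots> = ?P * ((g m * (g (Suc m) * g m)) * ?Q)" by (simp only: 1 mult.assoc)
  also have "\<dots> = (?P * g (Suc m)) * (g m * (g (Suc m) * ?Q))" by (simp only: br mult.assoc)
  finally show ?thesis by (simp only: 2 W mult.assoc)
qed

lemma W_h: "1 \<le> j ==> j < l ==> l \<le> n ==> h l * W j = W j * h (l - 1)"
  by (rule transfer[symmetric]) (use W_g[of j "l - 1"] in auto)

lemma U_W_less:
  assumes "1 \<le> i" "i < j" "j \<le> Suc n"
  shows "\<exists>c\<in>C. \<exists>c'\<in>C. U i * W j = c * (h n * c')"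
proof -
  let ?c = "pr (map (\<lambda>l. g (l - 1)) [j..<Suc n])" and ?c' = "pr (map h (rev [i..<n]))"
  have "U i * W j = ?c * U i"
    unfolding W_def by (rule pr_shift) (use assms U_g_gt in auto)
  moreover have "U i = h n * ?c'" using assms by (simp add: U_def)
  moreover have "?c \<in> C" by (rule pr_C) (use assms in \<open>auto intro!: C_gens\<close>)
  moreover have "?c' \<in> C" by (rule pr_C) (use assms in \<open>auto intro!: h_C\<close>)
  ultimately show ?thesis by metis
qed

lemma U_W_greater:
  assumes "1 \<le> j" "j < i" "i \<le> Suc n"
  shows "\<exists>c\<in>C. \<exists>c'\<in>C. U i * W j = c * (g n * c')"
proof -
  let ?c = "pr (map g [j..<n])" and ?c' = "pr (map (\<lambda>l. h (l - 1)) (rev [i..<Suc n]))"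
  have 1: "U i * W j = W j * ?c'"
    unfolding U_def
  proof (rule pr_shift2)
    fix l assume "l \<in> set (rev [i..<Suc n])"
    then show "h l * W j = W j * h (l - 1)" using assms by (intro W_h) auto
  qed (use assms in simp)
  have "pr (map g [j..<n] @ [g n]) = ?c * pr [g n]" by (rule pr_append) (use assms in simp)
  then have 2: "W j = ?c * g n" using assms by (simp add: W_def)
  have "?c \<in> C" by (rule pr_C) (use assms in \<open>auto intro!: C_gens\<close>)
  moreover have "?c' \<in> C" by (rule pr_C) (use assms in \<open>auto intro!: h_C\<close>)
  moreover have "U i * W j = ?c * (g n * ?c')" unfolding 1 unfolding 2 mult.assoc ..
  ultimately show ?thesis by blast
qed

lemma bas_reduce: "1 \<le> j ==> bas k l j = bas k (l mod r) j"
proof -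
  assume j: "1 \<le> j"
  have u: "tn ^ (r * m) * U j = U j" for m
    by (induction m) (simp_all add: power_add mult.assoc t_order unit(1)[OF U_A[OF j]])
  have "tn ^ l * U j = tn ^ (l mod r + r * (l div r)) * U j" by simp
  also have "\<dots> = tn ^ (l mod r) * U j" unfolding power_add mult.assoc u ..
  finally show ?thesis by (simp add: bas_def)
qed

text \<open>
  Products of this form, for \<open>z = g\<^sub>n\<close> and \<open>z = g\<^sub>n\<^sup>-\<^sup>1\<close>, are all that is needed for the products of
  \<open>X\<^sup>k t\<^sub>n\<^sub>+\<^sub>1\<^sup>l u\<^sub>i\<close> with the dual family: by \<open>U_W_less\<close> and \<open>U_W_greater\<close> every other factor is in \<open>C\<close> and
  commutes with \<open>X\<close> and \<open>t\<^sub>n\<^sub>+\<^sub>1\<close>.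
\<close>

definition mid where "mid z k l k' l' = XN ^ k * (tn ^ l * (z * (XN ^ k' * (tn ^ l' * u))))"

lemma mid_A: "z \<in> A ==> mid z k l k' l' \<in> A"
  unfolding mid_def by (intro pow_A A_closed(6)[of z]) auto

lemma mid_add: "mid (z + z') k l k' l' = mid z k l k' l' + mid z' k l k' l'"
  by (simp add: mid_def distrib_left distrib_right)

lemma mid_left: "c \<in> C ==> mid (c * z) k l k' l' = c * mid z k l k' l'"
  unfolding mid_def by (simp only: mult.assoc bas_C)

lemma mid_right: "c \<in> C ==> mid (z * c) k l k' l' = mid z k l k' l' * c"
proof -
  assume c: "c \<in> C"
  have "c * (XN ^ k' * (tn ^ l' * u)) = XN ^ k' * (tn ^ l' * (c * u))" by (rule bas_C[OF c, symmetric])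
  also have "c * u = u * c" using C_A[OF c] by simp
  finally show ?thesis unfolding mid_def by (simp only: mult.assoc)
qed

lemma tn_XN_pow: "tn ^ l * XN ^ k = XN ^ k * tn ^ l"
  by (rule pow_comm) (rule pow_comm[OF X_tn, symmetric])

lemma mid_u: "mid (tn ^ m * u) k l k' l' = bas (k + k') (l + m + l') (Suc n)"
proof -
  have "u * (XN ^ k' * (tn ^ l' * u)) = XN ^ k' * (tn ^ l' * u)" by (simp add: pow_A)
  then have "mid (tn ^ m * u) k l k' l' = XN ^ k * ((tn ^ l * tn ^ m) * XN ^ k') * (tn ^ l' * u)"
    unfolding mid_def by (simp only: mult.assoc)
  also have "\<dots> = XN ^ k * (XN ^ k' * tn ^ (l + m)) * (tn ^ l' * u)"
    by (simp only: power_add[symmetric] tn_XN_pow)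
  finally show ?thesis by (simp add: bas_def U_last power_add mult.assoc)
qed

lemma h_XN: "h n * XN = XX (n - 1) * (h n + ee n)"
proof -
  have "XN = g n * (XX (n - 1) * g n)" using XX_Suc[of "n - 1"] n by simp
  then have "h n * XN = (h n * g n) * (XX (n - 1) * g n)" by (simp only: mult.assoc)
  also have "\<dots> = XX (n - 1) * g n" using n by (simp add: gh)
  finally show ?thesis by (simp add: h_def)
qed

lemma U_n: "U n = h n"
  using U_step[of n] n by (simp add: U_last)

end

text \<open>
  The two algebras, with the inclusion \<open>\<phi>\<close> and the Frobenius homomorphism \<open>\<theta>\<close>.
\<close>

locale yh_pair = L: yh_rep r d n cl0 + yh_top r d n cl
  for r d n and cl0 :: "yh_free \<Rightarrow> 'b::{ring,monoid_mult}" and cl :: "yh_free \<Rightarrow> 'a::{ring,monoid_mult}" +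
  fixes \<phi> :: "'b \<Rightarrow> 'a" and \<theta> :: "'a \<Rightarrow> 'b"
  assumes phi_cl: "p \<in> F0 ==> \<phi> (cl0 p) = cl p"
    and theta_A: "b \<in> A ==> \<theta> b \<in> L.A"
    and theta_add: "b \<in> A ==> b' \<in> A ==> \<theta> (b + b') = \<theta> b + \<theta> b'"
    and theta_left: "p \<in> F0 ==> b \<in> A ==> \<theta> (cl p * b) = cl0 p * \<theta> b"
    and theta_right: "p \<in> F0 ==> b \<in> A ==> \<theta> (b * cl p) = \<theta> b * cl0 p"
    and theta_bas: "1 \<le> j ==> j \<le> Suc n ==> k < d ==>
      \<theta> (bas k l j) = (if j = Suc n \<and> Suc k = d \<and> r dvd l then L.u else 0)"
begin

lemma C_phi: "c \<in> C ==> \<exists>a\<in>L.A. c = \<phi> a"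
  by (auto simp: C_def L.A_def phi_cl)

lemma phi_C: "a \<in> L.A ==> \<phi> a \<in> C"
  by (auto simp: C_def L.A_def phi_cl)

lemma phi_A [simp]: "a \<in> L.A ==> \<phi> a \<in> A" by (rule C_A[OF phi_C])

lemma theta_phi: "a \<in> L.A ==> b \<in> A ==> \<theta> (\<phi> a * b) = a * \<theta> b" "a \<in> L.A ==> b \<in> A ==> \<theta> (b * \<phi> a) = \<theta> b * a"
  by (auto simp: L.A_def phi_cl theta_left theta_right)

lemma phi_hom:
  "a \<in> L.A ==> b \<in> L.A ==> \<phi> (a + b) = \<phi> a + \<phi> b" "a \<in> L.A ==> b \<in> L.A ==> \<phi> (a * b) = \<phi> a * \<phi> b"
  "\<phi> L.u = u" "\<phi> 0 = 0"
proof -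
  show "\<phi> L.u = u" unfolding L.u_def u_def by (rule phi_cl) simp
  show "\<phi> 0 = 0" using phi_cl[of 0] by (simp add: L.cl_zero cl_zero)
  assume "a \<in> L.A" "b \<in> L.A"
  then obtain p q where "p \<in> F0" "a = cl0 p" "q \<in> F0" "b = cl0 q" by (auto simp: L.A_def)
  then show "\<phi> (a + b) = \<phi> a + \<phi> b" "\<phi> (a * b) = \<phi> a * \<phi> b"
    using phi_cl[of "p + q"] phi_cl[of "p * q"]
    by (simp_all add: phi_cl L.cl_add[symmetric] L.cl_mult[symmetric] cl_add cl_mult F0_F)
qed

lemma theta_zero: "\<theta> 0 = 0"
  using theta_add[of 0 0] by simp

lemma theta_diff: "b \<in> A ==> b' \<in> A ==> \<theta> (b - b') = \<theta> b - \<theta> b'"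
  using theta_add[of "b - b'" b'] by (simp add: algebra_simps)

lemma theta_sum: "(\<And>i. i \<in> I ==> f i \<in> A) ==> \<theta> (sum f I) = (\<Sum>i\<in>I. \<theta> (f i))"
  by (induction I rule: infinite_finite_induct) (simp_all add: theta_zero theta_add)

lemma theta_C_zero: "c \<in> C ==> b \<in> A ==> \<theta> b = 0 ==> \<theta> (c * b) = 0 \<and> \<theta> (b * c) = 0"
  by (auto simp: C_def theta_left theta_right)

lemma theta_mid_C:
  assumes "c \<in> C" "c' \<in> C" "z \<in> A" "\<theta> (mid z k l k' l') = 0"
  shows "\<theta> (mid (c * (z * c')) k l k' l') = 0"
  unfolding mid_left[OF assms(1)] mid_right[OF assms(2)]
  using theta_C_zero[OF assms(1)] theta_C_zero[OF assms(2) mid_A[OF assms(3)] assms(4)] mid_A[OF assms(3)] C_A[OF assms(2)]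
  by simp

lemma theta_mid_ee:
  assumes "Suc (k + k') < d"
  shows "\<theta> (mid (ee n) k l k' l') = 0"
proof -
  have 1: "\<theta> (mid (t n ^ a * (tn ^ b * u)) k l k' l') = 0 \<and> t n ^ a * (tn ^ b * u) \<in> A" for a b
  proof (induction a)
    case 0
    then show ?case using assms by (simp add: mid_u theta_bas pow_A)
  next
    case (Suc a)
    let ?z = "t n ^ a * (tn ^ b * u)"
    have c: "t n \<in> C" using n by (intro C_gens) auto
    have z: "t n ^ Suc a * (tn ^ b * u) = t n * ?z" by (simp add: mult.assoc)
    show ?case unfolding z mid_left[OF c]
      using theta_C_zero[OF c mid_A[OF conjunct2[OF Suc]] conjunct1[OF Suc]] Suc n by simp
  qed
  have sum: "\<theta> (mid (\<Sum>a\<in>M. t n ^ a * (tn ^ (r - a) * u)) k l k' l') = 0 \<and>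
      (\<Sum>a\<in>M. t n ^ a * (tn ^ (r - a) * u)) \<in> A" for M
  proof (induction M rule: infinite_finite_induct)
    case (insert a M)
    then show ?case using 1[of a "r - a"] by (simp add: mid_add theta_add mid_A)
  qed (simp_all add: mid_def theta_zero)
  have "(\<Sum>a<r. t n ^ a * t (Suc n) ^ (r - a)) = (\<Sum>a<r. t n ^ a * (tn ^ (r - a) * u))"
  proof (rule sum.cong)
    fix a assume "a \<in> {..<r}"
    then have "tn ^ (r - a) \<in> A" by (intro power_A) auto
    then show "t n ^ a * t (Suc n) ^ (r - a) = t n ^ a * (tn ^ (r - a) * u)" by simp
  qed simp
  then have ee: "ee n = \<kappa> * (\<rho> * (\<Sum>a<r. t n ^ a * (tn ^ (r - a) * u)))" by (simp add: ee_def cyclic_avg_def)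
  show ?thesis
    unfolding ee mid_left[OF C_gens(6)] mid_left[OF C_gens(7)]
    using theta_C_zero[OF C_gens(7) mid_A[OF conjunct2[OF sum]] conjunct1[OF sum]]
      theta_C_zero[OF C_gens(6), of "\<rho> * mid (\<Sum>a<r. t n ^ a * (tn ^ (r - a) * u)) k l k' l'"]
      mid_A[OF conjunct2[OF sum[of "{..<r}"]]] by simp
qed

text \<open>
  Moving \<open>X\<close> to the left of \<open>g\<^sub>n\<^sup>-\<^sup>1\<close> by \<open>g\<^sub>n\<^sup>-\<^sup>1 X = X\<^sub>n (g\<^sub>n\<^sup>-\<^sup>1 + \<kappa> e\<^sub>n)\<close> loses a power of \<open>X\<close> in the correction term,
  which is therefore killed by \<open>\<theta>\<close>; the other term ends up as a multiple of \<open>u\<^sub>n\<close>.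
\<close>

lemma theta_mid_h: "k + k' < d ==> \<theta> (mid (h n) k l k' l') = 0"
proof (induction k')
  case 0
  have nn: "1 \<le> n" "n \<le> n" using n by auto
  have "h n * tn = t n * h n" using h_t[OF nn, of "Suc n"] by (simp add: transpose_def)
  then have "h n * tn ^ l' = t n ^ l' * h n" by (rule power_commute_gen)
  then have "mid (h n) k l 0 l' = XN ^ k * (tn ^ l * (t n ^ l' * h n * u))"
    by (simp add: mid_def mult.assoc[symmetric])
  also have "t n ^ l' * h n * u = t n ^ l' * U n" using n by (simp add: mult.assoc U_n)
  also have "XN ^ k * (tn ^ l * (t n ^ l' * U n)) = t n ^ l' * bas k l n"
  proof (induction l')
    case (Suc l')
    have c: "t n \<in> C" using n by (intro C_gens) auto
    show ?case using Suc by (simp add: mult.assoc bas_C[OF c])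
  qed (simp add: bas_def)
  also have "\<theta> (t n ^ l' * bas k l n) = 0"
  proof (induction l')
    case 0
    then show ?case using n \<open>k + 0 < d\<close> by (simp add: theta_bas)
  next
    case (Suc l')
    have c: "t n \<in> C" using n by (intro C_gens) auto
    have "t n ^ l' * bas k l n \<in> A" using n by (intro pow_A) auto
    then show ?case using theta_C_zero[OF c _ Suc] by (simp add: mult.assoc)
  qed
  finally show ?case .
next
  case (Suc k')
  let ?Y = "XX (n - 1)"
  have Y: "?Y \<in> C" using n by (intro XX_C) auto
  have "h n * (XN * z) = ?Y * ((h n + ee n) * z)" for z
    by (simp only: mult.assoc[symmetric] h_XN)
  then have "mid (h n) k l (Suc k') l' = mid (?Y * (h n + ee n)) k l k' l'"
    by (simp add: mid_def mult.assoc)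
  also have "\<dots> = ?Y * (mid (h n) k l k' l' + mid (ee n) k l k' l')"
    by (simp only: mid_left[OF Y] mid_add)
  finally have eq: "mid (h n) k l (Suc k') l' = ?Y * (mid (h n) k l k' l' + mid (ee n) k l k' l')" .
  have "\<theta> (mid (h n) k l k' l' + mid (ee n) k l k' l') = 0"
    using Suc theta_mid_ee n by (simp add: theta_add mid_A)
  then show ?case unfolding eq using theta_C_zero[OF Y] n by (simp add: mid_A)
qed

lemma theta_mid_g: "Suc (k + k') < d ==> \<theta> (mid (g n) k l k' l') = 0"
proof -
  assume k: "Suc (k + k') < d"
  have "g n = h n + ee n" by (simp add: h_def)
  then have "\<theta> (mid (g n) k l k' l') = \<theta> (mid (h n) k l k' l') + \<theta> (mid (ee n) k l k' l')"
    using n by (simp only: mid_add) (simp add: theta_add mid_A)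
  then show ?thesis using theta_mid_ee[OF k] theta_mid_h[of k k'] k by simp
qed

definition idx where "idx = {..<d} \<times> {1..Suc n} \<times> {..<r}"
text \<open>
  The order in which the Gram matrix is triangular: first by the degree in \<open>X\<close>, then by the index of
  \<open>u\<^sub>i\<close>. Different exponents \<open>l\<close> have the same rank, as \<open>\<theta>\<close> already separates them.
\<close>

fun rk where "rk (k, i, l) = k * (n + 2) + i" for l :: nat
fun cvec where "cvec (k, i, l) = bas k l i"
fun bvec where "bvec (k, i, l) = W i * (XN ^ (d - 1 - k) * (tn ^ (r - l) * u))"

lemma finite_idx: "finite idx" by (simp add: idx_def)

lemma cvec_A: "p \<in> idx ==> cvec p \<in> A" and bvec_A: "p \<in> idx ==> bvec p \<in> A"
  by (auto simp: idx_def pow_A)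

text \<open>
  For a lower degree of \<open>p\<close>, the total degree in \<open>X\<close> is less than \<open>d - 1\<close>. In equal degrees the products
  \<open>u\<^sub>i g\<^sub>j \<dots> g\<^sub>n\<close> with \<open>i < j\<close> involve \<open>g\<^sub>n\<^sup>-\<^sup>1\<close> and not \<open>g\<^sub>n\<close>, and \<open>theta_mid_h\<close> applies in degree \<open>d - 1\<close>, too.
\<close>

lemma gram:
  assumes "p \<in> idx" "q \<in> idx" "rk p \<le> rk q"
  shows "\<theta> (cvec p * bvec q) = (if p = q then L.u else 0)"
proof -
  obtain k i l k' j l' where p: "p = (k, i, l)" and q: "q = (k', j, l')" by (metis prod_cases3)
  have b: "k < d" "1 \<le> i" "i \<le> Suc n" "l < r" "k' < d" "1 \<le> j" "j \<le> Suc n" "l' < r"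
    using assms by (auto simp: idx_def p q)
  have le: "k \<le> k'"
  proof (rule ccontr)
    assume "\<not> k \<le> k'"
    then have "Suc k' * (n + 2) \<le> k * (n + 2)" by (intro mult_le_mono1) simp
    then show False using assms(3) b by (simp add: p q)
  qed
  have ij: "i \<le> j" if "k = k'" using assms(3) that by (simp add: p q)
  let ?K = "d - 1 - k'" and ?L = "r - l'"
  have eq: "cvec p * bvec q = mid (U i * W j) k l ?K ?L"
    by (simp add: p q bas_def mid_def mult.assoc)
  show ?thesis
  proof (cases "i = j")
    case True
    have "mid u k l ?K ?L = bas (k + ?K) (l + ?L) (Suc n)" using mid_u[of 0 k l ?K ?L] by simp
    moreover have "U i * W j = u" using True b U_W(1)[of j] by simp
    ultimately have 1: "\<theta> (cvec p * bvec q) = (if Suc (k + ?K) = d \<and> r dvd l + ?L then L.u else 0)"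
      unfolding eq using b le by (simp add: theta_bas)
    have "r dvd l + ?L \<longleftrightarrow> l = l'"
    proof
      assume "r dvd l + ?L"
      then obtain c where c: "l + ?L = r * c" by auto
      have "c < 2" using c b by (metis add_less_mono diff_le_self le_less_trans less_le_not_le mult_2 mult.commute mult_less_cancel1 nat_less_le not_le add_less_le_mono)
      moreover have "c \<noteq> 0" using c b by (cases c) auto
      ultimately have "c = 1" by simp
      then show "l = l'" using c b by simp
    qed (use b in simp)
    moreover have "Suc (k + ?K) = d \<longleftrightarrow> k = k'" using b le by auto
    ultimately show ?thesis unfolding 1 using True by (auto simp: p q)
  next
    case False
    then have pq: "p \<noteq> q" by (simp add: p q)
    have "\<theta> (mid (U i * W j) k l ?K ?L) = 0"
    proof (cases "i < j")
      case True
      obtain c c' where c: "c \<in> C" "c' \<in> C" "U i * W j = c * (h n * c')" using U_W_less[of i j] b True by blast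
      have "\<theta> (mid (h n) k l ?K ?L) = 0" by (rule theta_mid_h) (use b le in simp)
      then show ?thesis unfolding c(3) using n by (intro theta_mid_C c) auto
    next
      case ge: False
      then have "k < k'" using ij le False by (metis le_neq_implies_less)
      obtain c c' where c: "c \<in> C" "c' \<in> C" "U i * W j = c * (g n * c')" using U_W_greater[of j i] b ge False by force
      have "\<theta> (mid (g n) k l ?K ?L) = 0" by (rule theta_mid_g) (use b \<open>k < k'\<close> in simp)
      then show ?thesis unfolding c(3) using n by (intro theta_mid_C c) auto
    qed
    then show ?thesis using pq by (simp add: eq)
  qed
qed

text \<open>
  Gram--Schmidt orthogonalisation of \<open>cvec\<close> with respect to \<open>bvec\<close>.
\<close>

function cdual where
  "cdual p = cvec p - (\<Sum>q\<in>{q \<in> idx. rk q < rk p}. \<phi> (\<theta> (cvec p * bvec q)) * cdual q)"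
  by auto
termination by (relation "measure rk") auto

declare cdual.simps [simp del]

lemma cb_A: "p \<in> idx ==> q \<in> idx ==> \<theta> (cvec p * bvec q) \<in> L.A"
  by (intro theta_A A_closed cvec_A bvec_A)

lemma cdual:
  "p \<in> idx ==> cdual p \<in> A \<and> (\<forall>q\<in>idx. \<theta> (cdual p * bvec q) = (if p = q then L.u else 0))"
proof (induction p rule: measure_induct_rule[of rk])
  case (less p)
  let ?Q = "{q \<in> idx. rk q < rk p}"
  have fin: "finite ?Q" using finite_idx by simp
  have IH: "cdual q \<in> A" "\<And>q'. q' \<in> idx ==> \<theta> (cdual q * bvec q') = (if q = q' then L.u else 0)" if "q \<in> ?Q" for q
    using less.IH[of q] that by auto
  have A: "\<phi> (\<theta> (cvec p * bvec q)) * cdual q \<in> A" if "q \<in> ?Q" for q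
    using IH(1)[OF that] cb_A[OF less.prems, of q] that by simp
  have "cdual p \<in> A" unfolding cdual.simps[of p] by (intro A_closed(4) A_sum A cvec_A less.prems)
  moreover have "\<theta> (cdual p * bvec s) = (if p = s then L.u else 0)" if s: "s \<in> idx" for s
  proof -
    have t1: "\<theta> (\<phi> (\<theta> (cvec p * bvec q)) * cdual q * bvec s) = (if q = s then \<theta> (cvec p * bvec s) else 0)" if q: "q \<in> ?Q" for q
    proof -
      have "\<theta> (\<phi> (\<theta> (cvec p * bvec q)) * (cdual q * bvec s)) = \<theta> (cvec p * bvec q) * \<theta> (cdual q * bvec s)"
        using q IH(1)[OF q] bvec_A[OF s] cb_A[OF less.prems, of q] by (intro theta_phi) auto
      then show ?thesis using IH(2)[OF q s] cb_A[OF less.prems s] by (simp add: mult.assoc)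
    qed
    have "cdual p * bvec s = cvec p * bvec s - (\<Sum>q\<in>?Q. \<phi> (\<theta> (cvec p * bvec q)) * cdual q * bvec s)"
      unfolding cdual.simps[of p] by (simp only: left_diff_distrib sum_distrib_right)
    then have "\<theta> (cdual p * bvec s) = \<theta> (cvec p * bvec s) - (\<Sum>q\<in>?Q. \<theta> (\<phi> (\<theta> (cvec p * bvec q)) * cdual q * bvec s))"
      using A_closed(6)[OF A bvec_A[OF s]] A_closed(6)[OF cvec_A[OF less.prems] bvec_A[OF s]]
      by (simp only: theta_diff A_sum theta_sum)
    also have "(\<Sum>q\<in>?Q. \<theta> (\<phi> (\<theta> (cvec p * bvec q)) * cdual q * bvec s)) = (\<Sum>q\<in>?Q. if q = s then \<theta> (cvec p * bvec s) else 0)"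
      by (rule sum.cong[OF refl t1])
    also have "\<dots> = (if s \<in> ?Q then \<theta> (cvec p * bvec s) else 0)" using fin by simp
    finally show ?thesis
      using gram[OF less.prems s] s by (cases "rk s < rk p") auto
  qed
  ultimately show ?case by blast
qed

text \<open>
  On the family \<open>cvec\<close> this is the definition of \<open>cdual\<close>, and \<open>cvec\<close> spans by \<open>spanning\<close>.
\<close>

lemma expand_right:
  assumes "b \<in> A"
  shows "(\<Sum>q\<in>idx. \<phi> (\<theta> (b * bvec q)) * cdual q) = b"
  using spanning[OF assms]
proof (induction rule: Sp.induct)
  case zero
  then show ?case by (simp add: theta_zero phi_hom)
next
  case (add y y')
  have "\<phi> (\<theta> ((y + y') * bvec q)) = \<phi> (\<theta> (y * bvec q)) + \<phi> (\<theta> (y' * bvec q))" if "q \<in> idx" for q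
    using add bvec_A[OF that] by (simp add: distrib_right theta_add theta_A phi_hom Sp_A)
  then show ?case using add by (simp add: distrib_right sum.distrib)
next
  case (gen c k j l)
  let ?p = "(k, j, l mod r)"
  have p: "?p \<in> idx" using gen r by (simp add: idx_def)
  have bas: "bas k l j = cvec ?p" using bas_reduce[OF gen(3)] by simp
  obtain a where a: "a \<in> L.A" "c = \<phi> a" using C_phi[OF gen(1)] by blast
  have "\<phi> (\<theta> (c * cvec ?p * bvec q)) = c * \<phi> (\<theta> (cvec ?p * bvec q))" if "q \<in> idx" for q
    unfolding a(2) mult.assoc theta_phi(1)[OF a(1) A_closed(6)[OF cvec_A[OF p] bvec_A[OF that]]]
    by (rule phi_hom(2)[OF a(1) cb_A[OF p that]])
  then have "(\<Sum>q\<in>idx. \<phi> (\<theta> (c * cvec ?p * bvec q)) * cdual q) = c * (\<Sum>q\<in>idx. \<phi> (\<theta> (cvec ?p * bvec q)) * cdual q)"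
    by (simp add: sum_distrib_left mult.assoc)
  also have "(\<Sum>q\<in>idx. \<phi> (\<theta> (cvec ?p * bvec q)) * cdual q) = cvec ?p"
  proof -
    let ?f = "\<lambda>q. \<phi> (\<theta> (cvec ?p * bvec q)) * cdual q"
    let ?Q = "{q \<in> idx. rk q < rk ?p}"
    have "sum ?f idx = sum ?f (insert ?p ?Q)"
    proof (rule sum.mono_neutral_right)
      show "\<forall>q\<in>idx - insert ?p ?Q. ?f q = 0"
      proof
        fix q assume "q \<in> idx - insert ?p ?Q"
        then have "q \<in> idx" "rk ?p \<le> rk q" "?p \<noteq> q" by auto
        then show "?f q = 0" using gram[OF p, of q] by (simp only: if_False phi_hom(4)) simp
      qed
    qed (use finite_idx p in auto)
    also have "\<dots> = ?f ?p + sum ?f ?Q" using finite_idx by (subst sum.insert) auto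
    also have "?f ?p = cdual ?p"
    proof -
      have g1: "\<theta> (cvec ?p * bvec ?p) = L.u" using gram[OF p p order_refl] by (simp only: if_True simp_thms)
      show ?thesis unfolding g1 phi_hom(3) using cdual[OF p] by simp
    qed
    also have "\<dots> = cvec ?p - sum ?f ?Q" by (rule cdual.simps)
    finally show ?thesis by simp
  qed
  finally show ?case unfolding bas .
qed

end

locale yh_pair_involution = yh_pair r d n cl0 cl \<phi> \<theta>
  for r d n and cl0 :: "yh_free \<Rightarrow> 'b::{ring,monoid_mult}" and cl :: "yh_free \<Rightarrow> 'a::{ring,monoid_mult}" and \<phi> \<theta> +
  fixes \<tau>0 :: "'b \<Rightarrow> 'b" and \<tau> :: "'a \<Rightarrow> 'a"
  assumes tau0_A: "a \<in> L.A ==> \<tau>0 a \<in> L.A"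
    and tau0_add: "a \<in> L.A ==> a' \<in> L.A ==> \<tau>0 (a + a') = \<tau>0 a + \<tau>0 a'"
    and tau0_mult: "a \<in> L.A ==> a' \<in> L.A ==> \<tau>0 (a * a') = \<tau>0 a' * \<tau>0 a"
    and tau0_u: "\<tau>0 L.u = L.u"
    and tau_A: "b \<in> A ==> \<tau> b \<in> A"
    and tau_add: "b \<in> A ==> b' \<in> A ==> \<tau> (b + b') = \<tau> b + \<tau> b'"
    and tau_mult: "b \<in> A ==> b' \<in> A ==> \<tau> (b * b') = \<tau> b' * \<tau> b"
    and tau_u: "\<tau> u = u"
    and tau_tau: "b \<in> A ==> \<tau> (\<tau> b) = b"
    and tau_gens: "1 \<le> i ==> i \<le> n ==> \<tau> (g i) = g i" "\<tau> tn = tn" "\<tau> x = x"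
    and tau_phi: "a \<in> L.A ==> \<tau> (\<phi> a) = \<phi> (\<tau>0 a)"
begin

lemma tau_zero: "\<tau> 0 = 0" "\<tau>0 0 = 0"
  using tau_add[of 0 0] tau0_add[of 0 0] by simp_all

text \<open>
  The element \<open>h i\<close> is the inverse of \<open>g i\<close>, which \<open>\<tau>\<close> fixes.
\<close>

lemma tau_h: "1 \<le> i ==> i \<le> n ==> \<tau> (h i) = h i"
proof -
  assume i: "1 \<le> i" "i \<le> n"
  have "\<tau> (h i) * g i = u" using tau_mult[of "g i" "h i"] i by (simp add: gh tau_u tau_gens)
  then have "\<tau> (h i) * (g i * h i) = h i" using i by (simp add: mult.assoc[symmetric])
  then show ?thesis using i by (simp add: gh tau_A)
qed

lemma tau_XX: "m \<le> n ==> \<tau> (XX m) = XX m"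
proof (induction m)
  case 0
  then show ?case by (simp add: XX_0 tau_gens)
next
  case (Suc m)
  then show ?case by (simp add: XX_Suc tau_mult tau_gens mult.assoc)
qed

lemma tau_pow: "z \<in> A ==> a \<in> A ==> \<tau> z = z ==> \<tau> (z ^ k * a) = \<tau> a * z ^ k"
proof (induction k)
  case (Suc k)
  then have "\<tau> (z ^ Suc k * a) = \<tau> a * (z ^ k * z)" by (simp add: mult.assoc tau_mult pow_A)
  then show ?case by (simp add: power_Suc2 del: power_Suc)
qed simp

lemma tau_pr: "set L \<subseteq> {1..n} ==> \<tau> (pr (map h L)) = pr (map h (rev L))"
proof (induction L)
  case (Cons l L)
  have A: "set (map h L) \<subseteq> A" "h l \<in> A" using Cons.prems by auto
  have "pr (map h (rev L) @ [h l]) = pr (map h (rev L)) * pr [h l]" by (rule pr_append) (use A in simp)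
  then show ?case using Cons A by (simp add: tau_mult tau_h)
qed (simp add: tau_u)

lemma theta_tau_bas:
  assumes "1 \<le> j" "j \<le> Suc n" "k < d"
  shows "\<theta> (\<tau> (bas k l j)) = \<theta> (bas k l j)"
proof -
  have t: "\<tau> (bas k l j) = \<tau> (U j) * (XN ^ k * tn ^ l)"
    unfolding bas_def using assms
    by (simp add: tau_pow tau_XX tau_gens pow_A mult.assoc tn_XN_pow)
  show ?thesis
  proof (cases "j = Suc n")
    case True
    have "u * (XN ^ k * tn ^ l) = (u * XN ^ k) * tn ^ l" by (simp only: mult.assoc)
    also have "u * XN ^ k = XN ^ k * u" by (rule pow_comm[symmetric]) simp
    also have "XN ^ k * u * tn ^ l = XN ^ k * (u * tn ^ l)" by (simp only: mult.assoc)
    also have "u * tn ^ l = tn ^ l * u" by (rule pow_comm[symmetric]) simp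
    finally show ?thesis unfolding t by (simp add: True U_last tau_u bas_def)
  next
    case False
    then have j: "j \<le> n" using assms by simp
    let ?c = "pr (map h [j..<n])"
    have c: "?c \<in> C" by (rule pr_C) (use assms in \<open>auto intro!: h_C\<close>)
    have "\<tau> (U j) = pr (map h [j..<Suc n])"
    proof -
      have "set (rev [j..<Suc n]) \<subseteq> {1..n}" using assms by auto
      from tau_pr[OF this] show ?thesis unfolding U_def rev_rev_ident .
    qed
    also have "\<dots> = pr (map h [j..<n] @ [h n])" using j by simp
    also have "\<dots> = ?c * pr [h n]" by (rule pr_append) (use n in simp)
    finally have tU: "\<tau> (U j) = ?c * (h n * u)" by simp
    have uX: "u * (XN ^ k * tn ^ l) = XN ^ k * (tn ^ l * u)"
    proof -
      have "u * XN ^ k = XN ^ k * u" by (rule pow_comm[symmetric]) simp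
      moreover have "u * tn ^ l = tn ^ l * u" by (rule pow_comm[symmetric]) simp
      ultimately show ?thesis by (metis mult.assoc)
    qed
    have "\<tau> (bas k l j) = ?c * (h n * (XN ^ k * (tn ^ l * u)))" unfolding t tU by (simp only: mult.assoc uX)
    also have "\<dots> = ?c * mid (h n) 0 0 k l" by (simp add: mid_def)
    finally have "\<theta> (\<tau> (bas k l j)) = 0"
      using theta_C_zero[OF c mid_A theta_mid_h[of 0 k 0 l]] assms n by simp
    then show ?thesis using assms False by (simp add: theta_bas)
  qed
qed

text \<open>
  By bilinearity it is enough to consider the monomials \<open>bas k l j\<close>. For \<open>j \<le> n\<close> the image under \<open>\<tau>\<close>
  contains \<open>g\<^sub>n\<^sup>-\<^sup>1\<close> to the left of \<open>X\<^sup>k\<close>, and \<open>\<theta>\<close> vanishes on both; for \<open>j = n + 1\<close> it is the monomial itself.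
\<close>

lemma theta_tau: "b \<in> A ==> \<theta> (\<tau> b) = \<tau>0 (\<theta> b)"
proof -
  assume "b \<in> A"
  from spanning[OF this] show ?thesis
  proof (induction rule: Sp.induct)
    case zero
    then show ?case by (simp add: tau_zero theta_zero)
  next
    case (add y y')
    then show ?case by (simp add: Sp_A tau_add theta_add tau_A tau0_add theta_A)
  next
    case (gen c k j l)
    obtain a where a: "a \<in> L.A" "c = \<phi> a" using C_phi[OF gen(1)] by blast
    have k: "k < d" using gen by simp
    have "\<theta> (\<tau> (c * bas k l j)) = \<theta> (\<tau> (bas k l j)) * \<tau>0 a"
      using a gen by (simp add: tau_mult tau_phi theta_phi tau_A tau0_A)
    also have "\<dots> = \<tau>0 (\<theta> (bas k l j)) * \<tau>0 a"
      unfolding theta_tau_bas[OF gen(3,4) k] using gen by (simp add: theta_bas tau0_u tau_zero)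
    also have "\<dots> = \<tau>0 (\<theta> (c * bas k l j))"
      using a gen by (simp add: theta_phi tau0_mult theta_A)
    finally show ?case .
  qed
qed

text \<open>
  The difference \<open>y\<close> of both sides satisfies \<open>\<theta> (z * y) = 0\<close> for all \<open>z\<close>. Applying \<open>\<tau>\<close> gives
  \<open>\<theta> (\<tau> y * z) = 0\<close> for all \<open>z\<close>, and then \<open>expand_right\<close> shows \<open>\<tau> y = 0\<close>.
\<close>

lemma expand_left:
  assumes b: "b \<in> A"
  shows "(\<Sum>q\<in>idx. bvec q * \<phi> (\<theta> (cdual q * b))) = b"
proof -
  define y where "y = (\<Sum>q\<in>idx. bvec q * \<phi> (\<theta> (cdual q * b))) - b"
  have cA: "cdual q \<in> A" if "q \<in> idx" for q using cdual[OF that] by blast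
  have tA: "\<theta> (cdual q * b) \<in> L.A" if "q \<in> idx" for q using cA[OF that] b by (intro theta_A) simp
  have sA: "bvec q * \<phi> (\<theta> (cdual q * b)) \<in> A" if "q \<in> idx" for q
    using bvec_A[OF that] tA[OF that] by simp
  have y: "y \<in> A" unfolding y_def using sA b by simp
  have z1: "\<theta> (cdual p * y) = 0" if p: "p \<in> idx" for p
  proof -
    have "cdual p * y = (\<Sum>q\<in>idx. cdual p * bvec q * \<phi> (\<theta> (cdual q * b))) - cdual p * b"
      by (simp add: y_def right_diff_distrib sum_distrib_left mult.assoc)
    then have "\<theta> (cdual p * y) = (\<Sum>q\<in>idx. \<theta> (cdual p * bvec q * \<phi> (\<theta> (cdual q * b)))) - \<theta> (cdual p * b)"
      using cA[OF p] b bvec_A tA by (simp add: theta_diff theta_sum)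
    also have "(\<Sum>q\<in>idx. \<theta> (cdual p * bvec q * \<phi> (\<theta> (cdual q * b)))) = (\<Sum>q\<in>idx. if p = q then \<theta> (cdual p * b) else 0)"
    proof (rule sum.cong[OF refl])
      fix q assume q: "q \<in> idx"
      have "\<theta> (cdual p * bvec q * \<phi> (\<theta> (cdual q * b))) = \<theta> (cdual p * bvec q) * \<theta> (cdual q * b)"
        using cA[OF p] bvec_A[OF q] tA[OF q] by (intro theta_phi) auto
      then show "\<theta> (cdual p * bvec q * \<phi> (\<theta> (cdual q * b))) = (if p = q then \<theta> (cdual p * b) else 0)"
        using cdual[OF p] q tA[OF q] by auto
    qed
    finally show ?thesis using p finite_idx by simp
  qed
  have z2: "\<theta> (z * y) = 0" if z: "z \<in> A" for z
  proof -
    have zA: "\<theta> (z * bvec q) \<in> L.A" if "q \<in> idx" for q using z bvec_A[OF that] by (intro theta_A) simp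
    have "z * y = (\<Sum>q\<in>idx. \<phi> (\<theta> (z * bvec q)) * (cdual q * y))"
      by (subst expand_right[OF z, symmetric]) (simp only: sum_distrib_right mult.assoc)
    then have "\<theta> (z * y) = (\<Sum>q\<in>idx. \<theta> (\<phi> (\<theta> (z * bvec q)) * (cdual q * y)))"
      using zA cA y by (simp add: theta_sum)
    also have "\<dots> = 0"
      by (rule sum.neutral) (use zA cA y z1 in \<open>auto simp: theta_phi\<close>)
    finally show ?thesis .
  qed
  have "\<theta> (\<tau> y * z) = 0" if z: "z \<in> A" for z
  proof -
    have "\<tau> y * z = \<tau> (\<tau> z * y)" using y z by (simp add: tau_mult tau_A tau_tau)
    then show ?thesis using theta_tau[of "\<tau> z * y"] z2[of "\<tau> z"] y z by (simp add: tau_A tau_zero)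
  qed
  then have "\<tau> y = 0"
    using expand_right[OF tau_A[OF y]] bvec_A by (simp add: phi_hom)
  then have "y = 0" using tau_tau[OF y] by (simp add: tau_zero)
  then show ?thesis by (simp add: y_def)
qed

end

section \<open>The inclusion and the anti-automorphism\<close>

lemma frev_add: "frev (p + q) = frev p + frev q"
  by (rule poly_mapping_eqI) (simp add: lookup_frev lookup_add)

lemma frev_zero: "frev 0 = 0"
  by (rule poly_mapping_eqI) (simp add: lookup_frev)

lemma frev_diff: "frev (p - q) = frev p - frev q"
  by (rule poly_mapping_eqI) (simp add: lookup_frev lookup_minus)

lemma frev_single: "frev (Poly_Mapping.single w c) = Poly_Mapping.single (Word (rev (letters w))) c"
proof -
  have "w = Word (rev (letters v)) \<longleftrightarrow> Word (rev (letters w)) = v" for v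
    by (metis rev_rev_ident word.collapse word.sel)
  then show ?thesis
    by (intro poly_mapping_eqI) (simp add: lookup_frev lookup_single when_def)
qed

lemma frev_mult: "frev (p * q) = frev q * frev p"
proof -
  interpret U: subalgebra_data "UNIV :: laurent set" "UNIV :: yh_gen word set" by standard auto
  have all: "p \<in> U.S" for p :: yh_free by (simp add: monoid_subalgebra_def)
  have s: "frev (Poly_Mapping.single w c * q) = frev q * frev (Poly_Mapping.single w c)" for w c q
    using all[of q]
    by (induction q rule: U.mem_induct)
      (simp_all add: frev_zero frev_add frev_single mult_single plus_word_def mult.commute distrib_left distrib_right)
  show ?thesis
    using all[of p]
    by (induction p rule: U.mem_induct) (simp_all add: frev_zero s frev_add distrib_left distrib_right)
qed

lemma frev_fscalar: "frev (fscalar c) = fscalar c"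
  by (simp add: fscalar_def frev_single zero_word_def)

lemma frev_basic: "frev (fgen a) = fgen a" "frev (fscalar c) = fscalar c" "frev 1 = 1"
  using frev_fscalar[of 1] by (simp_all add: fgen_def frev_single frev_fscalar fscalar_simps)

lemma frev_power: "frev (p ^ k) = frev p ^ k"
  by (induction k) (simp_all add: frev_basic frev_mult power_commutes)

lemma frev_sum: "frev (sum f I) = (\<Sum>i\<in>I. frev (f i))"
  by (induction I rule: infinite_finite_induct) (simp_all add: frev_zero frev_add)

lemma frev_mem: "p \<in> carrier (free_algebra r d n) ==> frev p \<in> carrier (free_algebra r d n)"
  by (induction p rule: free_induct)
    (simp_all add: frev_basic frev_add frev_mult fscalar_mem fgen_mem free.mem_add free.mem_mult)

lemma frev_frev: "frev (frev p) = p"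
  by (rule poly_mapping_eqI) (simp add: lookup_frev)

lemma frev_cyclotomic: "frev (cyclotomic_poly d) = cyclotomic_poly d"
proof -
  let ?f = "\<lambda>i. fgen X1 - fscalar (laurent_power (V i) 1)"
  have f: "frev (?f i) = ?f i" for i by (simp add: frev_diff frev_basic)
  have c: "?f i * ?f j = ?f j * ?f i" for i j
    by (simp only: left_diff_distrib right_diff_distrib fscalar_central[of "laurent_power (V i) 1" "fgen X1"]
        fscalar_central[of "laurent_power (V j) 1" "fgen X1"]
        fscalar_central[of "laurent_power (V i) 1" "fscalar (laurent_power (V j) 1)"]) (simp add: algebra_simps)
  have com: "?f i * prod_list (map ?f L) = prod_list (map ?f L) * ?f i" for i L
  proof (induction L)
    case (Cons j L)
    have "?f i * (?f j * prod_list (map ?f L)) = ?f j * (?f i * prod_list (map ?f L))"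
      by (simp only: mult.assoc[symmetric] c[of i j])
    then show ?case using Cons by (simp only: list.map prod_list.Cons mult.assoc)
  qed simp
  have "frev (prod_list (map ?f L)) = prod_list (map ?f L)" for L
  proof (induction L)
    case (Cons i L)
    then show ?case by (simp only: list.map prod_list.Cons frev_mult f com)
  qed (simp add: frev_basic)
  then show ?thesis unfolding cyclotomic_poly_def .
qed

context yh_rep
begin

lemma cl_frev_e:
  assumes "1 \<le> i" "Suc i \<le> n"
  shows "cl (frev (e_elt r i)) = e (t i) (t (Suc i)) \<and> frev (e_elt r i) \<in> F"
proof -
  let ?c = "fscalar (laurent_const (1 / of_nat r))"
  have c: "t (Suc i) ^ m * t i ^ k = t i ^ k * t (Suc i) ^ m" for m k
  proof -
    have "t (Suc i) * t i ^ k = t i ^ k * t (Suc i)"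
      by (rule power_commute_gen) (use assms in \<open>simp add: t_comm\<close>)
    then show ?thesis by (rule power_commute_gen[of "t i ^ k" "t (Suc i)" "t (Suc i)" m, OF sym, symmetric])
  qed
  have eq: "frev (e_elt r i) = (\<Sum>a<r. fgen (T (Suc i)) ^ (r - a) * fgen (T i) ^ a) * ?c"
    by (simp add: e_elt_def frev_mult frev_sum frev_power frev_basic)
  have cl1: "cl (fgen (T (Suc i)) ^ (r - a) * fgen (T i) ^ a) = t i ^ a * t (Suc i) ^ (r - a)" if "a < r" for a
  proof (cases "a = 0")
    case True
    then show ?thesis using assms r by (simp add: cl_power t_def)
  next
    case False
    then show ?thesis using assms that by (simp add: cl_mult cl_power t_def[symmetric] c)
  qed
  have "cl (frev (e_elt r i)) = cl (\<Sum>a<r. fgen (T (Suc i)) ^ (r - a) * fgen (T i) ^ a) * \<rho>"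
    unfolding eq using assms by (subst cl_mult) (simp_all add: free_sum rho_R \<rho>_def s_def)
  also have "cl (\<Sum>a<r. fgen (T (Suc i)) ^ (r - a) * fgen (T i) ^ a) = (\<Sum>a<r. t i ^ a * t (Suc i) ^ (r - a))"
    using assms cl1 by (subst cl_sum) simp_all
  also have "\<dots> * \<rho> = e (t i) (t (Suc i))"
  proof -
    have "t i ^ k * t (Suc i) ^ (r - k) \<in> A" if "k < r" for k
      using assms that by (cases k) (simp_all add: power_A del: power_Suc)
    then show ?thesis unfolding cyclic_avg_def by (intro rho_central[symmetric] A_sum) auto
  qed
  finally show ?thesis using frev_mem[OF e_elt_mem[OF assms]] by simp
qed

text \<open>
  The reversed relations hold as well. Most of them are symmetric; the quadratic one uses that \<open>g\<^sub>i\<close>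
  commutes with \<open>e\<^sub>i\<close>.
\<close>

lemma cl_frev_relation:
  assumes p: "p \<in> yh_relations r n" shows "cl (frev p) = 0"
proof -
  note tc = t_comm and gt = g_t and tord = t_order
  from p show ?thesis
  proof (induction p rule: yh_relations.induct)
    case (braid_far i j)
    then show ?case using g_far[of i j] by (simp add: frev_diff frev_mult frev_basic cl_diff cl_mult g_def[symmetric])
  next
    case (braid i)
    then show ?case using g_braid[of i] by (simp add: frev_diff frev_mult frev_basic cl_diff cl_mult g_def[symmetric] mult.assoc)
  next
    case (t_comm i j)
    then show ?case using tc[of i j] by (simp add: frev_diff frev_mult frev_basic cl_diff cl_mult t_def[symmetric])
  next
    case (g_t i j)
    have j': "1 \<le> transpose i (Suc i) j" "transpose i (Suc i) j \<le> n" using transpose_range[of i n j] g_t by auto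
    have "g i * t (transpose i (Suc i) j) = t j * g i" using gt[of i "transpose i (Suc i) j"] g_t j' by simp
    then show ?case using g_t j' by (simp add: frev_diff frev_mult frev_basic cl_diff cl_mult t_def[symmetric] g_def[symmetric])
  next
    case (t_order j)
    then show ?case using tord[of j] r
      by (simp add: frev_diff frev_power frev_basic cl_diff cl_power t_def[symmetric] cl_one)
  next
    case (quadratic i)
    let ?e = "frev (e_elt r i)"
    have e: "cl ?e = e (t i) (t (Suc i))" "?e \<in> F" using cl_frev_e[of i] quadratic by auto
    have "cl (frev (fgen (G i) ^ 2 - (1 + fscalar (laurent_power Q 1 - laurent_power Q (-1)) * e_elt r i * fgen (G i)))) =
        g i * g i - (u + g i * (e (t i) (t (Suc i)) * \<kappa>))"
      using quadratic e kappa_R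
      by (simp add: frev_diff frev_add frev_mult frev_basic power2_eq_square cl_diff cl_add cl_mult cl_one g_def \<kappa>_def s_def)
    also have "g i * (e (t i) (t (Suc i)) * \<kappa>) = (g i * e (t i) (t (Suc i))) * \<kappa>" by (simp only: mult.assoc)
    also have "\<dots> = \<kappa> * (e (t i) (t (Suc i)) * g i)"
      using quadratic g_e_comm[of i] by (simp add: kappa_central e_A)
    finally show ?case using g_quadratic[of i] quadratic by simp
  next
    case X1_X1inv
    then show ?case using x_inverse by (simp add: frev_diff frev_mult frev_basic cl_diff cl_mult cl_one x_def xinv_def)
  next
    case X1inv_X1
    then show ?case using x_inverse by (simp add: frev_diff frev_mult frev_basic cl_diff cl_mult cl_one x_def xinv_def)
  next
    case X1_braid
    have m: "fgen (G 1) \<in> F" using X1_braid by simp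
    have "cl (frev (fgen (G 1) * fgen X1 * fgen (G 1) * fgen X1 - fgen X1 * fgen (G 1) * fgen X1 * fgen (G 1)))
        = x * (g 1 * (x * g 1)) - g 1 * (x * (g 1 * x))"
      using m by (simp only: frev_diff frev_mult frev_basic cl_diff cl_mult free.mem_mult X1_mem g_def x_def)
    then show ?case using x_braid[OF X1_braid] by simp
  next
    case (g_X1 i)
    then show ?case using g_x[of i] by (simp add: frev_diff frev_mult frev_basic cl_diff cl_mult g_def[symmetric] x_def[symmetric])
  next
    case (t_X1 j)
    then show ?case using t_x[of j] by (simp add: frev_diff frev_mult frev_basic cl_diff cl_mult t_def[symmetric] x_def[symmetric])
  qed
qed

end

lemma free_mono: "p \<in> carrier (free_algebra r d n) ==> p \<in> carrier (free_algebra r d (Suc n))"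
  by (fastforce simp: free.mem_iff yh_gens_def)

lemma relations_mono: "p \<in> yh_relations r n ==> p \<in> yh_relations r (Suc n)"
  by (induction rule: yh_relations.induct) (rule yh_relations.intros; simp)+

lemma quot_map_coset:
  assumes R: "ideal I R" and S: "ideal J S"
    and f: "\<And>x. x \<in> carrier S ==> f x \<in> carrier R"
    and add: "\<And>x y. x \<in> carrier S ==> y \<in> carrier S ==> f (x \<oplus>\<^bsub>S\<^esub> y) = f x \<oplus>\<^bsub>R\<^esub> f y"
    and J: "\<And>x. x \<in> J ==> f x \<in> I" and x: "x \<in> carrier S"
  shows "quot_map R I f (J +>\<^bsub>S\<^esub> x) = I +>\<^bsub>R\<^esub> f x"
proof -
  interpret I: ideal I R by fact
  interpret J: ideal J S by fact
  have Jc: "h \<in> carrier S" if "h \<in> J" for h using that J.a_subset by blast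
  have Ic: "h \<in> carrier R" if "h \<in> I" for h using that I.a_subset by blast
  show ?thesis
  proof (intro equalityI subsetI)
    fix y assume "y \<in> quot_map R I f (J +>\<^bsub>S\<^esub> x)"
    then obtain i h where ih: "i \<in> I" "h \<in> J" "y = i \<oplus>\<^bsub>R\<^esub> f (h \<oplus>\<^bsub>S\<^esub> x)"
      by (auto simp: quot_map_def set_add_def' a_r_coset_def')
    have "y = (i \<oplus>\<^bsub>R\<^esub> f h) \<oplus>\<^bsub>R\<^esub> f x"
      using ih x Ic[OF ih(1)] Jc[OF ih(2)] f by (simp add: add I.a_assoc)
    moreover have "i \<oplus>\<^bsub>R\<^esub> f h \<in> I" by (rule additive_subgroup.a_closed[OF ideal.axioms(1)[OF R] ih(1) J[OF ih(2)]])
    ultimately show "y \<in> I +>\<^bsub>R\<^esub> f x" by (auto simp: a_r_coset_def')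
  next
    fix y assume "y \<in> I +>\<^bsub>R\<^esub> f x"
    then obtain i where i: "i \<in> I" "y = i \<oplus>\<^bsub>R\<^esub> f x" by (auto simp: a_r_coset_def')
    have x0: "x = \<zero>\<^bsub>S\<^esub> \<oplus>\<^bsub>S\<^esub> x" using x by simp
    have "x \<in> J +>\<^bsub>S\<^esub> x" using x0 J.zero_closed by (auto simp: a_r_coset_def')
    then show "y \<in> quot_map R I f (J +>\<^bsub>S\<^esub> x)" using i by (auto simp: quot_map_def set_add_def')
  qed
qed

lemma affine_ideal_ideal: "ideal (affine_ideal r d n) (free_algebra r d n)"
  unfolding affine_ideal_def using yh_relations_mem by (intro ring.genideal_ideal ring_free) blast

lemma cyclotomic_ideal_ideal: "ideal (cyclotomic_ideal r d n) (affine_YH r d n)"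
  unfolding cyclotomic_ideal_def
  by (intro ring.genideal_ideal ring_affine) (simp add: affine_class_surj cyclotomic_poly_mem)

lemma zero_set_ideal:
  assumes S: "ring S" and h: "h \<in> ring_hom (free_algebra r d m) S"
    and f: "\<And>p. p \<in> carrier (free_algebra r d n) ==> f p \<in> carrier (free_algebra r d m)"
    and add: "\<And>p q. f (p + q) = f p + f q"
    and mult: "\<And>p q. f (p * q) = f p * f q \<or> f (p * q) = f q * f p"
  shows "ideal {p \<in> carrier (free_algebra r d n). h (f p) = \<zero>\<^bsub>S\<^esub>} (free_algebra r d n)"
proof (rule idealI[OF ring_free])
  interpret S: ring S by fact
  interpret FA: ring "free_algebra r d n" by (rule ring_free)
  note hom = ring_hom_add[OF h, simplified] ring_hom_mult[OF h, simplified] ring_hom_closed[OF h]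
  have f0: "f 0 = 0" using add[of 0 0] by simp
  have fm: "f (- p) = - f p" for p using add[of "- p" p] by (simp add: f0 eq_neg_iff_add_eq_0)
  have h0: "h 0 = \<zero>\<^bsub>S\<^esub>" using ring_hom_zero[OF h ring_free S] by simp
  have hm: "h (- p) = \<zero>\<^bsub>S\<^esub>" if "p \<in> carrier (free_algebra r d m)" "h p = \<zero>\<^bsub>S\<^esub>" for p
    using hom(1)[OF free.mem_uminus[OF that(1)] that(1)] that hom(3)[OF free.mem_uminus[OF that(1)]] by (simp add: h0)
  show "subgroup {p \<in> carrier (free_algebra r d n). h (f p) = \<zero>\<^bsub>S\<^esub>} (add_monoid (free_algebra r d n))"
  proof (rule FA.add.subgroupI)
    show "{p \<in> carrier (free_algebra r d n). h (f p) = \<zero>\<^bsub>S\<^esub>} \<noteq> {}"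
      using free.mem_zero[of r d n] by (auto simp: f0 h0)
  qed (auto simp: free_minus fm hm f add hom free.mem_uminus free.mem_add)
  fix a x assume a: "a \<in> {p \<in> carrier (free_algebra r d n). h (f p) = \<zero>\<^bsub>S\<^esub>}" and x: "x \<in> carrier (free_algebra r d n)"
  have "h (f (x * a)) = \<zero>\<^bsub>S\<^esub>" "h (f (a * x)) = \<zero>\<^bsub>S\<^esub>"
    using mult[of x a] mult[of a x] a x f by (auto simp: hom)
  then show "x \<otimes>\<^bsub>free_algebra r d n\<^esub> a \<in> {p \<in> carrier (free_algebra r d n). h (f p) = \<zero>\<^bsub>S\<^esub>}"
    "a \<otimes>\<^bsub>free_algebra r d n\<^esub> x \<in> {p \<in> carrier (free_algebra r d n). h (f p) = \<zero>\<^bsub>S\<^esub>}"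
    using a x by (auto simp: free.mem_mult)
qed

text \<open>
  The alternative in the assumption on products covers the inclusion and the anti-automorphism at
  once: in both cases the elements that are sent to zero form an ideal.
\<close>

lemma quot_quot_map:
  assumes f: "\<And>p. p \<in> carrier (free_algebra r d n) ==> f p \<in> carrier (free_algebra r d m)"
    and add: "\<And>p q. f (p + q) = f p + f q"
    and mult: "\<And>p q. f (p * q) = f p * f q \<or> f (p * q) = f q * f p"
    and rel: "\<And>p. p \<in> yh_relations r n ==> affine_class r d m (f p) = \<zero>\<^bsub>affine_YH r d m\<^esub>"
    and cyc: "f (cyclotomic_poly d) = cyclotomic_poly d"
    and p: "p \<in> carrier (free_algebra r d n)"
  shows "quot_map (affine_YH r d m) (cyclotomic_ideal r d m)
      (quot_map (free_algebra r d m) (affine_ideal r d m) f) (YH_class r d n p) = YH_class r d m (f p)"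
proof -
  let ?f = "quot_map (free_algebra r d m) (affine_ideal r d m) f"
  have aff: "f p \<in> affine_ideal r d m" if "p \<in> affine_ideal r d n" for p
  proof -
    have pm: "p \<in> carrier (free_algebra r d n)" using that ideal.Icarr[OF affine_ideal_ideal] by blast
    have "p \<in> {p \<in> carrier (free_algebra r d n). affine_class r d m (f p) = \<zero>\<^bsub>affine_YH r d m\<^esub>}"
    proof (rule affine_class_zero_least[OF zero_set_ideal[OF ring_affine affine_class_hom f add mult] _ pm])
      show "yh_relations r n \<subseteq> {p \<in> carrier (free_algebra r d n). affine_class r d m (f p) = \<zero>\<^bsub>affine_YH r d m\<^esub>}"
        using rel yh_relations_mem by blast
      show "affine_class r d n p = \<zero>\<^bsub>affine_YH r d n\<^esub>"
        by (rule iffD2[OF affine_class_eq_zero_iff[OF pm] that])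
    qed
    then have "affine_class r d m (f p) = \<zero>\<^bsub>affine_YH r d m\<^esub>" by blast
    then show ?thesis by (rule iffD1[OF affine_class_eq_zero_iff[OF f[OF pm]]])
  qed
  have f1: "?f (affine_class r d n p) = affine_class r d m (f p)" if "p \<in> carrier (free_algebra r d n)" for p
    unfolding affine_class_def
    by (rule quot_map_coset[OF affine_ideal_ideal affine_ideal_ideal]) (use f add aff that in \<open>simp_all only: free_sel\<close>)
  have cl0: "YH_class r d m (f p) = \<zero>\<^bsub>cyclotomic_YH r d m\<^esub>"
    if "p \<in> carrier (free_algebra r d n)" "YH_class r d n p = \<zero>\<^bsub>cyclotomic_YH r d n\<^esub>" for p
  proof -
    have z: "YH_class r d m (f p) = \<zero>\<^bsub>cyclotomic_YH r d m\<^esub>" if "p \<in> yh_relations r n" for p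
      unfolding YH_class_eq_zero_iff[OF f[OF yh_relations_mem[OF that]]] rel[OF that]
      by (rule additive_subgroup.zero_closed[OF ideal.axioms(1)[OF cyclotomic_ideal_ideal]])
    have "p \<in> {p \<in> carrier (free_algebra r d n). YH_class r d m (f p) = \<zero>\<^bsub>cyclotomic_YH r d m\<^esub>}"
    proof (rule YH_class_zero_least[OF zero_set_ideal[OF ring_cyclotomic YH_class_hom f add mult] _ _ that])
      show "yh_relations r n \<subseteq> {p \<in> carrier (free_algebra r d n). YH_class r d m (f p) = \<zero>\<^bsub>cyclotomic_YH r d m\<^esub>}"
        using z yh_relations_mem by blast
      show "cyclotomic_poly d \<in> {p \<in> carrier (free_algebra r d n). YH_class r d m (f p) = \<zero>\<^bsub>cyclotomic_YH r d m\<^esub>}"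
        using cyc YH_class_cyclotomic cyclotomic_poly_mem by (simp only: mem_Collect_eq simp_thms)
    qed
    then show ?thesis by blast
  qed
  have "quot_map (affine_YH r d m) (cyclotomic_ideal r d m) ?f
      (cyclotomic_ideal r d n +>\<^bsub>affine_YH r d n\<^esub> affine_class r d n p)
    = cyclotomic_ideal r d m +>\<^bsub>affine_YH r d m\<^esub> ?f (affine_class r d n p)"
  proof (rule quot_map_coset[OF cyclotomic_ideal_ideal cyclotomic_ideal_ideal])
    show "?f x \<in> carrier (affine_YH r d m)" if "x \<in> carrier (affine_YH r d n)" for x
    proof -
      obtain p where p: "p \<in> carrier (free_algebra r d n)" "x = affine_class r d n p"
        using \<open>x \<in> carrier (affine_YH r d n)\<close> unfolding affine_class_surj by blast
      show ?thesis unfolding p(2) f1[OF p(1)] using f[OF p(1)] by (rule ring_hom_closed[OF affine_class_hom])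
    qed
    show "?f (x \<oplus>\<^bsub>affine_YH r d n\<^esub> y) = ?f x \<oplus>\<^bsub>affine_YH r d m\<^esub> ?f y"
      if xy: "x \<in> carrier (affine_YH r d n)" "y \<in> carrier (affine_YH r d n)" for x y
    proof -
      obtain p q where pq: "p \<in> carrier (free_algebra r d n)" "x = affine_class r d n p"
        "q \<in> carrier (free_algebra r d n)" "y = affine_class r d n q"
        using xy unfolding affine_class_surj by blast
      have "x \<oplus>\<^bsub>affine_YH r d n\<^esub> y = affine_class r d n (p + q)"
        unfolding pq using ring_hom_add[OF affine_class_hom pq(1,3)] by (simp only: free_sel)
      moreover have "affine_class r d m (f p + f q) = affine_class r d m (f p) \<oplus>\<^bsub>affine_YH r d m\<^esub> affine_class r d m (f q)"
        using ring_hom_add[OF affine_class_hom f[OF pq(1)] f[OF pq(3)]] by (simp only: free_sel)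
      ultimately show ?thesis
        by (simp only: pq(2,4) f1[OF pq(1)] f1[OF pq(3)] f1[OF free.mem_add[OF pq(1,3)]] add)
    qed
    show "?f x \<in> cyclotomic_ideal r d m" if "x \<in> cyclotomic_ideal r d n" for x
    proof -
      have "x \<in> carrier (affine_YH r d n)" using that ideal.Icarr[OF cyclotomic_ideal_ideal] by blast
      then obtain p where q: "p \<in> carrier (free_algebra r d n)" "x = affine_class r d n p"
        unfolding affine_class_surj by blast
      have "YH_class r d n p = \<zero>\<^bsub>cyclotomic_YH r d n\<^esub>"
        unfolding YH_class_eq_zero_iff[OF q(1)] using that q(2) by simp
      from cl0[OF q(1) this] show ?thesis
        unfolding q(2) f1[OF q(1)] YH_class_eq_zero_iff[OF f[OF q(1)]] .
    qed
    show "affine_class r d n p \<in> carrier (affine_YH r d n)" by (rule ring_hom_closed[OF affine_class_hom p])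
  qed
  then show ?thesis unfolding YH_class_def f1[OF p] .
qed

lemma YH_incl_class: "p \<in> carrier (free_algebra r d n) ==> YH_incl r d n (YH_class r d n p) = YH_class r d (Suc n) p"
  unfolding YH_incl_def
  by (rule quot_quot_map[where f = "\<lambda>p. p"]) (simp_all add: free_mono affine_class_relation relations_mono)

lemma affine_rep:
  assumes "1 \<le> r" shows "yh_rep r d n (\<lambda>p. ring_embed (affine_YH r d n) (affine_class r d n p))"
proof
  interpret R: ring "affine_YH r d n" by (rule ring_affine)
  note e = ring_embed[OF ring_affine]
  note c = ring_hom_closed[OF affine_class_hom]
  have z: "ring_embed (affine_YH r d n) \<zero>\<^bsub>affine_YH r d n\<^esub> = 0"
    using ring_embed(1)[OF ring_affine R.zero_closed R.zero_closed] by simp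
  fix p p'
  show "p \<in> yh_relations r n ==> ring_embed (affine_YH r d n) (affine_class r d n p) = 0"
    by (simp add: affine_class_relation z)
  assume "p \<in> carrier (free_algebra r d n)" "p' \<in> carrier (free_algebra r d n)"
  then show "ring_embed (affine_YH r d n) (affine_class r d n (p + p')) =
      ring_embed (affine_YH r d n) (affine_class r d n p) + ring_embed (affine_YH r d n) (affine_class r d n p')"
    "ring_embed (affine_YH r d n) (affine_class r d n (p * p')) =
      ring_embed (affine_YH r d n) (affine_class r d n p) * ring_embed (affine_YH r d n) (affine_class r d n p')"
    using ring_hom_add[OF affine_class_hom, of p r d n p'] ring_hom_mult[OF affine_class_hom, of p r d n p']
    by (simp_all add: e c)
qed (rule assms)

lemma YH_tau_class:
  assumes r: "1 \<le> r" and p: "p \<in> carrier (free_algebra r d n)"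
  shows "YH_tau r d n (YH_class r d n p) = YH_class r d n (frev p)"
  unfolding YH_tau_def
proof (rule quot_quot_map[where f = frev])
  interpret yh_rep r d n "\<lambda>p. ring_embed (affine_YH r d n) (affine_class r d n p)" by (rule affine_rep[OF r])
  fix p assume "p \<in> yh_relations r n"
  then have "ring_embed (affine_YH r d n) (affine_class r d n (frev p)) = ring_embed (affine_YH r d n) (affine_class r d n 0)"
    by (simp add: cl_frev_relation cl_zero)
  then have "affine_class r d n (frev p) = affine_class r d n 0"
    using ring_embed(3)[OF ring_affine] ring_hom_closed[OF affine_class_hom]
      frev_mem[OF yh_relations_mem[OF \<open>p \<in> yh_relations r n\<close>]] free.mem_zero by metis
  then show "affine_class r d n (frev p) = \<zero>\<^bsub>affine_YH r d n\<^esub>"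
    using ring_hom_zero[OF affine_class_hom ring_free ring_affine] by simp
qed (use p in \<open>simp_all add: frev_mem frev_add frev_mult frev_cyclotomic\<close>)

section \<open>The Frobenius extension of cyclotomic Yokonuma--Hecke algebras\<close>

definition emb :: "nat \<Rightarrow> nat \<Rightarrow> nat \<Rightarrow> yh_free \<Rightarrow> yh_elt ring_family" where
  "emb r d n p = ring_embed (cyclotomic_YH r d n) (YH_class r d n p)"

definition unembed :: "nat \<Rightarrow> nat \<Rightarrow> nat \<Rightarrow> yh_elt ring_family \<Rightarrow> yh_elt" where
  "unembed r d n = the_inv_into (carrier (cyclotomic_YH r d n)) (ring_embed (cyclotomic_YH r d n))"

lemma emb_zero: "ring_embed (cyclotomic_YH r d n) \<zero>\<^bsub>cyclotomic_YH r d n\<^esub> = 0"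
proof -
  interpret R: ring "cyclotomic_YH r d n" by (rule ring_cyclotomic)
  show ?thesis using ring_embed(1)[OF ring_cyclotomic R.zero_closed R.zero_closed] by simp
qed

lemma class_closed: "p \<in> carrier (free_algebra r d n) ==> YH_class r d n p \<in> carrier (cyclotomic_YH r d n)"
  by (rule ring_hom_closed[OF YH_class_hom])

lemma class_hom:
  assumes "p \<in> carrier (free_algebra r d n)" "p' \<in> carrier (free_algebra r d n)"
  shows "YH_class r d n (p + p') = YH_class r d n p \<oplus>\<^bsub>cyclotomic_YH r d n\<^esub> YH_class r d n p'"
    "YH_class r d n (p * p') = YH_class r d n p \<otimes>\<^bsub>cyclotomic_YH r d n\<^esub> YH_class r d n p'"
    "YH_class r d n 1 = \<one>\<^bsub>cyclotomic_YH r d n\<^esub>"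
  using ring_hom_add[OF YH_class_hom assms] ring_hom_mult[OF YH_class_hom assms] ring_hom_one[OF YH_class_hom] by simp_all

lemma emb_rep: "1 \<le> r ==> yh_rep r d n (emb r d n)"
  by unfold_locales
    (simp_all add: emb_def class_hom ring_embed[OF ring_cyclotomic] class_closed YH_class_relation emb_zero)

lemma emb_cyclotomic: "emb r d n (cyclotomic_poly d) = 0"
  by (simp add: emb_def YH_class_cyclotomic emb_zero)

lemma emb_eq_iff:
  "p \<in> carrier (free_algebra r d n) ==> p' \<in> carrier (free_algebra r d n) ==>
    emb r d n p = emb r d n p' \<longleftrightarrow> YH_class r d n p = YH_class r d n p'"
  unfolding emb_def by (rule ring_embed(3)[OF ring_cyclotomic]) (rule class_closed, assumption)+

lemma unembed: "x \<in> carrier (cyclotomic_YH r d n) ==> unembed r d n (ring_embed (cyclotomic_YH r d n) x) = x"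
  unfolding unembed_def
  by (rule the_inv_into_f_f) (auto simp: inj_on_def ring_embed(3)[OF ring_cyclotomic])

lemma unembed_emb: "p \<in> carrier (free_algebra r d n) ==> unembed r d n (emb r d n p) = YH_class r d n p"
  unfolding emb_def by (rule unembed) (rule class_closed)

lemma embed_finsum:
  assumes "ring S" "finite I" "\<And>i. i \<in> I ==> f i \<in> carrier S"
  shows "ring_embed S (finsum S f I) = (\<Sum>i\<in>I. ring_embed S (f i))"
proof -
  interpret ring S by fact
  have z: "ring_embed S \<zero>\<^bsub>S\<^esub> = 0" using ring_embed(1)[OF assms(1) zero_closed zero_closed] by simp
  show ?thesis
    using assms(2,3)
  proof (induction I rule: finite_induct)
    case (insert a I)
    then have "finsum S f (insert a I) = f a \<oplus>\<^bsub>S\<^esub> finsum S f I" by (intro finsum_insert) auto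
    then show ?case using insert by (simp add: ring_embed(1)[OF assms(1)] Pi_def)
  qed (simp add: z)
qed

locale yokonuma_hecke =
  fixes r d n :: nat
  assumes r: "1 \<le> r" and d: "1 \<le> d" and n: "1 \<le> n"
begin

abbreviation AA where "AA \<equiv> cyclotomic_YH r d n"
abbreviation BB where "BB \<equiv> cyclotomic_YH r d (Suc n)"
abbreviation FA where "FA \<equiv> carrier (free_algebra r d n)"
abbreviation FB where "FB \<equiv> carrier (free_algebra r d (Suc n))"
abbreviation eA where "eA \<equiv> emb r d n"
abbreviation eB where "eB \<equiv> emb r d (Suc n)"

text \<open>
  A representative in the free algebra. The maps below are defined on representatives, and each of
  them is shown to depend on the class only.
\<close>

definition lift where "lift m y = (SOME p. p \<in> carrier (free_algebra r d m) \<and> emb r d m p = y)" for m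

lemma lift: "p \<in> carrier (free_algebra r d m) ==>
    lift m (emb r d m p) \<in> carrier (free_algebra r d m) \<and> emb r d m (lift m (emb r d m p)) = emb r d m p"
  unfolding lift_def by (rule someI[of _ p]) simp

lemma lift_class: "p \<in> carrier (free_algebra r d m) ==>
    YH_class r d m (lift m (emb r d m p)) = YH_class r d m p"
  using lift emb_eq_iff by blast

definition theta0 where "theta0 y = yh_cyc.functional r d n eA (lift (Suc n) y)"
definition phi0 where "phi0 y = eB (lift n y)"
definition tau0 where "tau0 m y = emb r d m (frev (lift m y))" for m

lemma cyc: "yh_cyc r d n eA"
  by (intro yh_cyc.intro emb_rep r yh_cyc_axioms.intro n d emb_cyclotomic)

lemma top: "yh_top r d n eB"
  by (intro yh_top.intro emb_rep r yh_top_axioms.intro n d emb_cyclotomic)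

lemma theta0_eB: "p \<in> FB ==> theta0 (eB p) = yh_cyc.functional r d n eA p"
proof -
  interpret yh_cyc r d n eA by (rule cyc)
  interpret B: ring BB by (rule ring_cyclotomic)
  assume p: "p \<in> FB"
  let ?l = "lift (Suc n) (eB p)"
  have l: "?l \<in> FB" using lift[OF p] by blast
  have dm: "?l - p \<in> FB" by (rule free_diff[OF l p])
  have "YH_class r d (Suc n) ?l = YH_class r d (Suc n) (?l - p) \<oplus>\<^bsub>BB\<^esub> YH_class r d (Suc n) p"
    using class_hom(1)[OF dm p] by simp
  then have "YH_class r d (Suc n) (?l - p) = \<zero>\<^bsub>BB\<^esub>"
    using lift_class[OF p] class_closed[OF dm] class_closed[OF p] B.add.l_cancel_one' by (metis B.add.r_cancel_one' B.a_comm)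
  then have "functional (?l - p) = 0" by (rule functional_class_zero[OF dm])
  then show ?thesis using functional_add[OF dm p] by (simp add: theta0_def)
qed

lemma phi0_eA: "p \<in> FA ==> phi0 (eA p) = eB p"
proof -
  assume p: "p \<in> FA"
  have l: "lift n (eA p) \<in> FA" using lift[OF p] by blast
  have "YH_class r d (Suc n) (lift n (eA p)) = YH_class r d (Suc n) p"
    using lift_class[OF p] by (simp add: YH_incl_class[OF l, symmetric] YH_incl_class[OF p, symmetric])
  then show ?thesis by (simp add: phi0_def emb_def)
qed

lemma tau0_emb: "p \<in> carrier (free_algebra r d m) ==> tau0 m (emb r d m p) = emb r d m (frev p)"
proof -
  assume p: "p \<in> carrier (free_algebra r d m)"
  have l: "lift m (emb r d m p) \<in> carrier (free_algebra r d m)" using lift[OF p] by blast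
  have "YH_class r d m (frev (lift m (emb r d m p))) = YH_class r d m (frev p)"
    using lift_class[OF p] by (simp add: YH_tau_class[OF r l, symmetric] YH_tau_class[OF r p, symmetric])
  then show ?thesis by (simp add: tau0_def emb_def)
qed

lemma pair: "yh_pair r d n eA eB phi0 theta0"
proof -
  interpret L: yh_cyc r d n eA by (rule cyc)
  interpret yh_top r d n eB by (rule top)
  have eB: "\<exists>p\<in>FB. b = eB p" if "b \<in> A" for b using that by (auto simp: A_def)
  show ?thesis
  proof (intro yh_pair.intro emb_rep r top yh_pair_axioms.intro)
    fix p assume "p \<in> FA" then show "phi0 (eA p) = eB p" by (rule phi0_eA)
  next
    fix b assume "b \<in> A"
    then show "theta0 b \<in> L.A" using eB theta0_eB L.functional_A by metis
  next
    fix b b' assume "b \<in> A" "b' \<in> A"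
    then obtain p p' where p: "p \<in> FB" "b = eB p" "p' \<in> FB" "b' = eB p'" using eB by blast
    then show "theta0 (b + b') = theta0 b + theta0 b'"
      by (simp add: cl_add[symmetric] theta0_eB free.mem_add L.functional_add)
  next
    fix p b assume p: "p \<in> FA" and "b \<in> A"
    then obtain p' where p': "p' \<in> FB" "b = eB p'" using eB by blast
    have pB: "p \<in> FB" by (rule free_mono[OF p])
    show "theta0 (eB p * b) = eA p * theta0 b" "theta0 (b * eB p) = theta0 b * eA p"
      using p p' pB
      by (simp_all add: cl_mult[symmetric] theta0_eB free.mem_mult L.functional_left L.functional_right)
  next
    fix j k l assume j: "1 \<le> j" "j \<le> Suc n" and k: "k < d"
    have m: "free_X n ^ k * fgen (T (Suc n)) ^ l * free_u r n j \<in> FB"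
      using U_cl[OF j(1)] by (intro free.mem_mult free_power free_X_mem) (auto intro!: fgen_mem simp: yh_gens_def)
    show "theta0 (bas k l j) = (if j = Suc n \<and> Suc k = d \<and> r dvd l then L.u else 0)"
      using theta0_eB[OF m] unfolding bas_cl[OF j(1)] L.functional_basis[OF j k] .
  qed
qed

lemma involution: "yh_pair_involution r d n eA eB phi0 theta0 (tau0 n) (tau0 (Suc n))"
proof -
  interpret yh_pair r d n eA eB phi0 theta0 by (rule pair)
  have eB: "\<exists>p\<in>FB. b = eB p" if "b \<in> A" for b using that by (auto simp: A_def)
  have eA: "\<exists>p\<in>FA. a = eA p" if "a \<in> L.A" for a using that by (auto simp: L.A_def)
  show ?thesis
  proof (intro yh_pair_involution.intro pair yh_pair_involution_axioms.intro)
    fix a assume "a \<in> L.A"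
    then obtain p where p: "p \<in> FA" "a = eA p" using eA by blast
    show "tau0 n a \<in> L.A" using p by (simp add: tau0_emb L.A_I frev_mem)
    have pB: "p \<in> FB" by (rule free_mono[OF p(1)])
    show "tau0 (Suc n) (phi0 a) = phi0 (tau0 n a)" using p pB by (simp add: phi0_eA tau0_emb frev_mem)
    fix a' assume "a' \<in> L.A"
    then obtain p' where p': "p' \<in> FA" "a' = eA p'" using eA by blast
    show "tau0 n (a + a') = tau0 n a + tau0 n a'" "tau0 n (a * a') = tau0 n a' * tau0 n a"
      using p p' by (simp_all add: L.cl_add[symmetric] L.cl_mult[symmetric] tau0_emb frev_add frev_mult frev_mem)
  next
    fix b assume "b \<in> A"
    then obtain p where p: "p \<in> FB" "b = eB p" using eB by blast
    show "tau0 (Suc n) b \<in> A" using p by (simp add: tau0_emb A_I frev_mem)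
    show "tau0 (Suc n) (tau0 (Suc n) b) = b" using p by (simp add: tau0_emb frev_mem frev_frev)
    fix b' assume "b' \<in> A"
    then obtain p' where p': "p' \<in> FB" "b' = eB p'" using eB by blast
    show "tau0 (Suc n) (b + b') = tau0 (Suc n) b + tau0 (Suc n) b'" "tau0 (Suc n) (b * b') = tau0 (Suc n) b' * tau0 (Suc n) b"
      using p p' by (simp_all add: cl_add[symmetric] cl_mult[symmetric] tau0_emb frev_add frev_mult frev_mem)
  next
    show "tau0 n L.u = L.u" unfolding L.u_def by (simp add: tau0_emb frev_basic)
    show "tau0 (Suc n) u = u" unfolding u_def by (simp add: tau0_emb frev_basic)
    show "tau0 (Suc n) (g i) = g i" if "1 \<le> i" "i \<le> n" for i
      using that unfolding g_def by (simp add: tau0_emb frev_basic)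
    show "tau0 (Suc n) tn = tn" unfolding t_def by (simp add: tau0_emb frev_basic)
    show "tau0 (Suc n) x = x" unfolding x_def by (simp add: tau0_emb frev_basic)
  qed
qed

definition Theta where "Theta b = unembed r d n (theta0 (ring_embed BB b))"
definition index where "index = yh_pair.idx r d n"
definition ldual where "ldual i = unembed r d (Suc n) (yh_pair.bvec r d n eB i)"
definition rdual where "rdual i = unembed r d (Suc n) (yh_pair.cdual r d n eB phi0 theta0 i)"

lemma BB_cases:
  assumes "b \<in> carrier BB"
  obtains p where "p \<in> FB" "b = YH_class r d (Suc n) p" "ring_embed BB b = eB p"
  using assms by (auto simp: YH_class_surj emb_def)

lemma AA_cases:
  assumes "a \<in> carrier AA"
  obtains p where "p \<in> FA" "a = YH_class r d n p" "ring_embed AA a = eA p"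
  using assms by (auto simp: YH_class_surj emb_def)

lemma Theta_class: "p \<in> FB ==> Theta (YH_class r d (Suc n) p) \<in> carrier AA \<and> ring_embed AA (Theta (YH_class r d (Suc n) p)) = theta0 (eB p)"
proof -
  interpret yh_pair r d n eA eB phi0 theta0 by (rule pair)
  assume p: "p \<in> FB"
  have "theta0 (eB p) \<in> L.A" by (rule theta_A[OF A_I[OF p]])
  then obtain p' where p': "p' \<in> FA" "theta0 (eB p) = eA p'" by (auto simp: L.A_def)
  have "Theta (YH_class r d (Suc n) p) = YH_class r d n p'"
    unfolding Theta_def emb_def[symmetric] p'(2) by (rule unembed_emb[OF p'(1)])
  then show ?thesis using p' by (simp add: class_closed emb_def)
qed

lemma incl_hom: "YH_incl r d n \<in> ring_hom AA BB"
proof (rule ring_hom_memI)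
  fix a assume "a \<in> carrier AA"
  then obtain p where p: "p \<in> FA" "a = YH_class r d n p" by (rule AA_cases)
  show "YH_incl r d n a \<in> carrier BB" using p by (simp add: YH_incl_class class_closed free_mono)
  fix a' assume "a' \<in> carrier AA"
  then obtain p' where p': "p' \<in> FA" "a' = YH_class r d n p'" by (rule AA_cases)
  show "YH_incl r d n (a \<otimes>\<^bsub>AA\<^esub> a') = YH_incl r d n a \<otimes>\<^bsub>BB\<^esub> YH_incl r d n a'"
    "YH_incl r d n (a \<oplus>\<^bsub>AA\<^esub> a') = YH_incl r d n a \<oplus>\<^bsub>BB\<^esub> YH_incl r d n a'"
    using p p' by (simp_all add: class_hom[symmetric] YH_incl_class free_mono free.mem_add free.mem_mult)
next
  show "YH_incl r d n \<one>\<^bsub>AA\<^esub> = \<one>\<^bsub>BB\<^esub>"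
    using YH_incl_class[OF free.mem_one, of r d n] ring_hom_one[OF YH_class_hom, of r d] by simp
qed

lemma embed_incl: "a \<in> carrier AA ==> ring_embed BB (YH_incl r d n a) = phi0 (ring_embed AA a)"
  by (erule AA_cases) (simp add: YH_incl_class phi0_eA emb_def[symmetric])

lemma involution_algebra:
  "algebra_involution (cyclotomic_YH r d m) (ground_ring r d) (YH_scalar r d m) (YH_tau r d m)"
proof -
  interpret M: ring "cyclotomic_YH r d m" by (rule ring_cyclotomic)
  interpret R: cring "ground_ring r d" by (rule cring_ground)
  show ?thesis
  proof unfold_locales
    show "YH_scalar r d m \<in> ring_hom (ground_ring r d) (cyclotomic_YH r d m)"
    proof (rule ring_hom_memI)
      fix a assume a: "a \<in> carrier (ground_ring r d)"
      show "YH_scalar r d m a \<in> carrier (cyclotomic_YH r d m)"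
        unfolding YH_scalar_def by (intro class_closed fscalar_mem a)
      fix b assume "b \<in> carrier (ground_ring r d)"
      then show "YH_scalar r d m (a \<otimes>\<^bsub>ground_ring r d\<^esub> b) = YH_scalar r d m a \<otimes>\<^bsub>cyclotomic_YH r d m\<^esub> YH_scalar r d m b"
        "YH_scalar r d m (a \<oplus>\<^bsub>ground_ring r d\<^esub> b) = YH_scalar r d m a \<oplus>\<^bsub>cyclotomic_YH r d m\<^esub> YH_scalar r d m b"
        using a by (simp_all add: YH_scalar_def fscalar_simps class_hom fscalar_mem)
    next
      show "YH_scalar r d m \<one>\<^bsub>ground_ring r d\<^esub> = \<one>\<^bsub>cyclotomic_YH r d m\<^esub>"
        using ring_hom_one[OF YH_class_hom, of r d m] by (simp add: YH_scalar_def fscalar_simps)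
    qed
  next
    fix c z assume "c \<in> carrier (ground_ring r d)" "z \<in> carrier (cyclotomic_YH r d m)"
    then show "YH_scalar r d m c \<otimes>\<^bsub>cyclotomic_YH r d m\<^esub> z = z \<otimes>\<^bsub>cyclotomic_YH r d m\<^esub> YH_scalar r d m c"
      unfolding YH_class_surj
      by (auto simp: YH_scalar_def class_hom(2)[symmetric] fscalar_mem fscalar_central)
  next
    fix z assume "z \<in> carrier (cyclotomic_YH r d m)"
    then obtain p where p: "p \<in> carrier (free_algebra r d m)" "z = YH_class r d m p" unfolding YH_class_surj by blast
    show "YH_tau r d m z \<in> carrier (cyclotomic_YH r d m)" "YH_tau r d m (YH_tau r d m z) = z"
      using p by (simp_all add: YH_tau_class[OF r] frev_mem frev_frev class_closed)
    fix z' assume "z' \<in> carrier (cyclotomic_YH r d m)"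
    then obtain p' where p': "p' \<in> carrier (free_algebra r d m)" "z' = YH_class r d m p'" unfolding YH_class_surj by blast
    show "YH_tau r d m (z \<oplus>\<^bsub>cyclotomic_YH r d m\<^esub> z') = YH_tau r d m z \<oplus>\<^bsub>cyclotomic_YH r d m\<^esub> YH_tau r d m z'"
      "YH_tau r d m (z \<otimes>\<^bsub>cyclotomic_YH r d m\<^esub> z') = YH_tau r d m z' \<otimes>\<^bsub>cyclotomic_YH r d m\<^esub> YH_tau r d m z"
      using p p'
      by (simp_all add: class_hom[symmetric] YH_tau_class[OF r] frev_mem frev_add frev_mult free.mem_add free.mem_mult)
  next
    show "YH_tau r d m \<one>\<^bsub>cyclotomic_YH r d m\<^esub> = \<one>\<^bsub>cyclotomic_YH r d m\<^esub>"
      using YH_tau_class[OF r free.mem_one, of d m] ring_hom_one[OF YH_class_hom, of r d m] by (simp add: frev_basic)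
  qed
qed

lemma frobenius:
  "frobenius_duality AA BB (YH_incl r d n) Theta index ldual rdual
     (ground_ring r d) (YH_scalar r d n) (YH_tau r d n) (YH_scalar r d (Suc n)) (YH_tau r d (Suc n))"
proof -
  interpret P: yh_pair_involution r d n eA eB phi0 theta0 "tau0 n" "tau0 (Suc n)" by (rule involution)
  interpret A: ring AA by (rule ring_cyclotomic)
  interpret B: ring BB by (rule ring_cyclotomic)
  note eA = ring_embed[OF ring_cyclotomic, of _ r d n] and eB = ring_embed[OF ring_cyclotomic, of _ r d "Suc n"]
  have cl: "Theta b \<in> carrier AA" "ring_embed AA (Theta b) = theta0 (ring_embed BB b)" "ring_embed BB b \<in> P.A"
    if b: "b \<in> carrier BB" for b
  proof -
    obtain p where p: "p \<in> FB" "b = YH_class r d (Suc n) p" "ring_embed BB b = eB p" by (rule BB_cases[OF b])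
    show "Theta b \<in> carrier AA" "ring_embed AA (Theta b) = theta0 (ring_embed BB b)" "ring_embed BB b \<in> P.A"
      using Theta_class[OF p(1)] P.A_I[OF p(1)] unfolding p(3) unfolding p(2) by auto
  qed
  have clA: "ring_embed AA a \<in> P.L.A" if "a \<in> carrier AA" for a
    using that by (auto elim!: AA_cases intro: P.L.A_I)
  have incl: "YH_incl r d n a \<in> carrier BB" if "a \<in> carrier AA" for a
    by (rule ring_hom_closed[OF incl_hom that])
  have un: "unembed r d (Suc n) y \<in> carrier BB \<and> ring_embed BB (unembed r d (Suc n) y) = y" if y: "y \<in> P.A" for y
  proof -
    obtain p where "p \<in> FB" "y = eB p" using y unfolding P.A_def by blast
    then show ?thesis by (simp add: unembed_emb class_closed) (simp add: emb_def)
  qed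
  have b: "ldual i \<in> carrier BB" "ring_embed BB (ldual i) = P.bvec i" if "i \<in> index" for i
    using un[OF P.bvec_A, of i] that by (simp_all add: ldual_def index_def)
  have c: "rdual i \<in> carrier BB" "ring_embed BB (rdual i) = P.cdual i" if "i \<in> index" for i
    using un[of "P.cdual i"] P.cdual[of i] that by (simp_all add: rdual_def index_def)
  have fin: "finite index" by (simp add: index_def P.finite_idx)
  have "frobenius_extension AA BB (YH_incl r d n) Theta index ldual rdual"
  proof unfold_locales
    show "YH_incl r d n \<in> ring_hom AA BB" by (rule incl_hom)
    show "Theta x \<in> carrier AA" if "x \<in> carrier BB" for x by (rule cl(1)[OF that])
    show "Theta (x \<oplus>\<^bsub>BB\<^esub> y) = Theta x \<oplus>\<^bsub>AA\<^esub> Theta y" if "x \<in> carrier BB" "y \<in> carrier BB" for x y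
      by (rule iffD1[OF eA(3)]) (use that in \<open>simp_all add: cl eA(1) eB(1) P.theta_add\<close>)
    show "Theta (YH_incl r d n a \<otimes>\<^bsub>BB\<^esub> x) = a \<otimes>\<^bsub>AA\<^esub> Theta x" if "a \<in> carrier AA" "x \<in> carrier BB" for a x
      by (rule iffD1[OF eA(3)]) (use that in \<open>simp_all add: cl incl eA(2) eB(2) embed_incl clA P.theta_phi\<close>)
    show "Theta (x \<otimes>\<^bsub>BB\<^esub> YH_incl r d n a) = Theta x \<otimes>\<^bsub>AA\<^esub> a" if "a \<in> carrier AA" "x \<in> carrier BB" for a x
      by (rule iffD1[OF eA(3)]) (use that in \<open>simp_all add: cl incl eA(2) eB(2) embed_incl clA P.theta_phi\<close>)
    show "finite index" by (rule fin)
    show "ldual i \<in> carrier BB" "rdual i \<in> carrier BB" if "i \<in> index" for i using b c that by blast+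
    fix x assume x: "x \<in> carrier BB"
    have t: "ldual i \<otimes>\<^bsub>BB\<^esub> YH_incl r d n (Theta (rdual i \<otimes>\<^bsub>BB\<^esub> x)) \<in> carrier BB"
      "YH_incl r d n (Theta (x \<otimes>\<^bsub>BB\<^esub> ldual i)) \<otimes>\<^bsub>BB\<^esub> rdual i \<in> carrier BB" if "i \<in> index" for i
      using that x by (simp_all add: b c cl incl)
    show "(\<Oplus>\<^bsub>BB\<^esub>i\<in>index. ldual i \<otimes>\<^bsub>BB\<^esub> YH_incl r d n (Theta (rdual i \<otimes>\<^bsub>BB\<^esub> x))) = x"
    proof (rule iffD1[OF eB(3)])
      have "ring_embed BB (\<Oplus>\<^bsub>BB\<^esub>i\<in>index. ldual i \<otimes>\<^bsub>BB\<^esub> YH_incl r d n (Theta (rdual i \<otimes>\<^bsub>BB\<^esub> x)))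
          = (\<Sum>i\<in>index. P.bvec i * phi0 (theta0 (P.cdual i * ring_embed BB x)))"
        using t x by (subst embed_finsum[OF ring_cyclotomic fin]) (simp_all add: b c cl incl eB(2) embed_incl)
      then show "ring_embed BB (\<Oplus>\<^bsub>BB\<^esub>i\<in>index. ldual i \<otimes>\<^bsub>BB\<^esub> YH_incl r d n (Theta (rdual i \<otimes>\<^bsub>BB\<^esub> x))) = ring_embed BB x"
        using P.expand_left[OF cl(3)[OF x]] by (simp only: index_def)
    qed (use t x in \<open>auto intro!: B.finsum_closed\<close>)
    show "(\<Oplus>\<^bsub>BB\<^esub>i\<in>index. YH_incl r d n (Theta (x \<otimes>\<^bsub>BB\<^esub> ldual i)) \<otimes>\<^bsub>BB\<^esub> rdual i) = x"
    proof (rule iffD1[OF eB(3)])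
      have "ring_embed BB (\<Oplus>\<^bsub>BB\<^esub>i\<in>index. YH_incl r d n (Theta (x \<otimes>\<^bsub>BB\<^esub> ldual i)) \<otimes>\<^bsub>BB\<^esub> rdual i)
          = (\<Sum>i\<in>index. phi0 (theta0 (ring_embed BB x * P.bvec i)) * P.cdual i)"
        using t x by (subst embed_finsum[OF ring_cyclotomic fin]) (simp_all add: b c cl incl eB(2) embed_incl)
      then show "ring_embed BB (\<Oplus>\<^bsub>BB\<^esub>i\<in>index. YH_incl r d n (Theta (x \<otimes>\<^bsub>BB\<^esub> ldual i)) \<otimes>\<^bsub>BB\<^esub> rdual i) = ring_embed BB x"
        using P.expand_right[OF cl(3)[OF x]] by (simp only: index_def)
    qed (use t x in \<open>auto intro!: B.finsum_closed\<close>)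
  qed
  moreover have "frobenius_duality_axioms AA (YH_incl r d n) (ground_ring r d) (YH_scalar r d n) (YH_tau r d n)
      (YH_scalar r d (Suc n)) (YH_tau r d (Suc n))"
  proof
    show "YH_incl r d n (YH_scalar r d n s) = YH_scalar r d (Suc n) s" if "s \<in> carrier (ground_ring r d)" for s
      unfolding YH_scalar_def by (rule YH_incl_class) (rule fscalar_mem[OF that])
    show "YH_tau r d (Suc n) (YH_incl r d n a) = YH_incl r d n (YH_tau r d n a)" if "a \<in> carrier AA" for a
      using that by (auto elim!: AA_cases simp: YH_incl_class YH_tau_class[OF r] free_mono frev_mem)
  qed
  ultimately show ?thesis by (intro frobenius_duality.intro involution_algebra)
qed

end

theorem corollary4p6:
  fixes r d n :: nat
  assumes "r \<ge> 1" and "d \<ge> 1" and "n \<ge> 1"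
  shows "(exact_lmod_functor (cyclotomic_YH r d n) (cyclotomic_YH r d (Suc n))
           (Ind r d n :: (yh_elt, 'm) module \<Rightarrow> _) (Ind_map r d n)) \<and>
         (adjoint_lmod_functors (cyclotomic_YH r d n) (cyclotomic_YH r d (Suc n))
           (Ind r d n :: (yh_elt, 'm) module \<Rightarrow> _) (Ind_map r d n)
           (Res r d n :: (yh_elt, 'n) module \<Rightarrow> _) Res_map) \<and>
         (adjoint_lmod_functors (cyclotomic_YH r d (Suc n)) (cyclotomic_YH r d n)
           (Res r d n :: (yh_elt, 'n) module \<Rightarrow> _) Res_map
           (Ind r d n :: (yh_elt, 'm) module \<Rightarrow> _) (Ind_map r d n)) \<and>
         (\<exists>\<Phi>.
          (\<forall>M :: (yh_elt, 'm) module.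
             left_module (cyclotomic_YH r d n) M \<and> finite_dimensional r d n M \<longrightarrow>
             \<Phi> M \<in> lmod_iso (cyclotomic_YH r d (Suc n))
                      (Ind r d n (tau_dual r d n M)) (tau_dual r d (Suc n) (Ind r d n M))) \<and>
          (\<forall>(M :: (yh_elt, 'm) module) (N :: (yh_elt, 'm) module) f.
             left_module (cyclotomic_YH r d n) M \<and> finite_dimensional r d n M \<and>
             left_module (cyclotomic_YH r d n) N \<and> finite_dimensional r d n N \<and>
             f \<in> lmod_hom (cyclotomic_YH r d n) M N \<longrightarrow>
             compose (carrier (Ind r d n (tau_dual r d n N)))
               (\<Phi> M)
               (Ind_map r d n (tau_dual r d n N) (tau_dual r d n M) (tau_dual_map r d n M N f)) =
             compose (carrier (Ind r d n (tau_dual r d n N)))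
               (tau_dual_map r d (Suc n) (Ind r d n M) (Ind r d n N) (Ind_map r d n M N f))
               (\<Phi> N)))"
proof -
  interpret yokonuma_hecke r d n by standard (use assms in auto)
  interpret frobenius_duality AA BB "YH_incl r d n" Theta index ldual rdual
    "ground_ring r d" "YH_scalar r d n" "YH_tau r d n" "YH_scalar r d (Suc n)" "YH_tau r d (Suc n)"
    by (rule frobenius)
  have Res: "(Res_map :: (yh_elt, 'n) module \<Rightarrow> (yh_elt, 'n) module \<Rightarrow> _) = (\<lambda>_ _ f. f)"
    by (intro ext) (simp add: Res_map_def)
  show ?thesis
    unfolding Ind_def Ind_map_def Res_def Res tau_dual_def tau_dual_map_def
    by (intro conjI exI[of _ dual_comparison] allI impI ext_exact ext_left_adjoint ext_right_adjoint
        dual_comparison_iso dual_comparison_natural) auto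
qed

end
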